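(* Consider the bipartite configuration model $\mathrm{BCM}(\boldsymbol d^{\ell},\boldsymbol d^{r})$ under Assumptions (A), (B), (C1), (D) listed in the context, and further assume $p_2+q_2<2$. Let $\eta_{\ell}\in[0,1]$ be the smallest solution in $[0,1]$ of $\eta_{\ell}=G_{\widetilde D^{r}}(G_{\widetilde D^{\ell}}(\eta_{\ell}))$, and let $\xi_{\ell}:=1-G_{D^{\ell}}(\eta_{\ell})$, $\eta_{r}:=G_{\widetilde D^{\ell}}(\eta_{\ell})$. Let $\mathscr C_{1,b}$ and $\mathscr C_{2,b}$ denote the largest and second largest connected components of the BCM (by total number of vertices in both partitions, ties broken arbitrarily). If $\mathbb E[\widetilde D^{\ell}]\,\mathbb E[\widetilde D^{r}]>1$, then $\xi_{\ell}>0$, $\eta_{\ell}<1$, $\eta_{r}<1$, and, as $n\to\infty$, $$\frac{|\mathscr C_{1,b}\cap\mathscr V^{\ell}|}{N_n}\xrightarrow{\ \mathbb P\ }\xi_{\ell},\qquad \frac{|\mathscr C_{1,b}\cap\mathscr V^{\ell}_k|}{N_n}\xrightarrow{\ \mathbb P\ }p_k\bigl(1-\eta_{\ell}^k\bigr)\ \ (k\in\mathbb Z^+),\qquad \frac{|\mathscr E(\mathscr C_{1,b})|}{N_n}\xrightarrow{\ \mathbb P\ }\mathbb E[D^{\ell}]\bigl(1-\eta_{\ell}\eta_{r}\bigr),$$ where $\mathscr V^{\ell}=[N_n]$ is the left partition, $\mathscr V_k^{\ell}$ is the set of left vertices of degree $k$, and $\mathscr E(\mathscr C_{1,b})$ is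 the set of edges (with multiplicity) of $\mathscr C_{1,b}$. In this case $\mathscr C_{1,b}$ is unique in the sense that $|\mathscr C_{2,b}|/(N_n+M_n)\xrightarrow{\ \mathbb P\ }0$. If $\mathbb E[\widetilde D^{\ell}]\,\mathbb E[\widetilde D^{r}]\le1$, then $|\mathscr C_{1,b}|/(N_n+M_n)\xrightarrow{\ \mathbb P\ }0$.
   Context: Notation: $\mathbb Z^+=\{1,2,\dots\}$, $\mathbb N=\{0,1,2,\dots\}$. For an $\mathbb N$-valued random variable $X$ with $0<\mathbb E[X]<\infty$, the size-biased variable $X^\star$ has $\mathbb P(X^\star=k)=k\,\mathbb P(X=k)/\mathbb E[X]$, and $\widetilde X:=X^\star-1$. $G_X(z)=\mathbb E[z^X]$ for $z\in[0,1]$. $\mathbb E[\widetilde D^{\ell}],\mathbb E[\widetilde D^{r}]$ may be $+\infty$ (convention $0\cdot\infty=0$). Bipartite configuration model. For each $n$ (dependence often suppressed) let $N_n,M_n\to\infty$ and let $\boldsymbol d^{\ell}=(d_v^{\ell})_{v\in[N_n]}$, $\boldsymbol d^{r}=(d_a^{r})_{a\in[M_n]}$ be sequences of positive integers with $\mathscr h_n:=\sum_v d_v^{\ell}=\sum_a d_a^{r}$. The left partition is $\mathscr V^{\ell}=[N_n]$ and the right partition is $\mathscr V^{r}=[M_n]$ (treated as disjoint). Attach $d_v^{\ell}$ half-edges to each left vertex $v$ and $d_a^{r}$ half-edges to each right vertex $a$, and match left half-edges to right half-edges by a uniformly random bijection; each matched pair of half-edges becomes an edge. The resulting bipartite multigraph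 is $\mathrm{BCM}(\boldsymbol d^{\ell},\boldsymbol d^{r})$. Assumptions. Let $D_n^{\ell}=d^{\ell}_{V}$ with $V$ uniform on $[N_n]$ and $D_n^{r}=d^{r}_{W}$ with $W$ uniform on $[M_n]$. (A) $D_n^{\ell}\to D^{\ell}$ in distribution, where $D^{\ell}$ has pmf $\boldsymbol p=(p_k)_{k\in\mathbb Z^+}$. (B) $\mathbb E[D^{\ell}]<\infty$ and $\mathbb E[D_n^{\ell}]\to\mathbb E[D^{\ell}]$. (C1) $D_n^{r}\to D^{r}$ in distribution, where $D^{r}$ has pmf $\boldsymbol q=(q_k)_{k\in\mathbb Z^+}$. (D) $\mathbb E[D^{r}]<\infty$ and $\mathbb E[D_n^{r}]\to\mathbb E[D^{r}]$. *)

theory Defs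
  imports "HOL-Probability.Probability" "Graph_Theory.Digraph_Component"
begin

section \<open>Size-biasing and generating functions\<close>

abbreviation pmf_mean :: "nat pmf \<Rightarrow> real" where
  "pmf_mean X \<equiv> measure_pmf.expectation X real"

text \<open>Meaningful only if the mean of X is finite and nonzero; see \<open>pmf_size_biased\<close>.\<close>

definition size_biased :: "nat pmf \<Rightarrow> nat pmf" where
  "size_biased X = embed_pmf (\<lambda>k. real k * pmf X k / pmf_mean X)"

text \<open>The law of \<open>X\<^sup>\<star> - 1\<close>. Truncated subtraction is harmless: \<open>X\<^sup>\<star>\<close> never takes the value 0.\<close>

definition size_biased_minus_one :: "nat pmf \<Rightarrow> nat pmf" where
  "size_biased_minus_one X = map_pmf (\<lambda>k. k - 1) (size_biased X)"

definition ennreal_mean :: "nat pmf \<Rightarrow> ennreal" where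
  "ennreal_mean X = (\<integral>\<^sup>+ k. ennreal (real k) \<partial>measure_pmf X)"

definition pgf :: "nat pmf \<Rightarrow> real \<Rightarrow> real" where
  "pgf X z = measure_pmf.expectation X (\<lambda>k. z ^ k)"

lemma pmf_size_biased:
  assumes "integrable (measure_pmf X) real" "pmf_mean X > 0"
  shows "pmf (size_biased X) k = real k * pmf X k / pmf_mean X"
  unfolding size_biased_def
proof (rule pmf_embed_pmf)
  show "0 \<le> real k * pmf X k / pmf_mean X" for k
    using assms(2) by simp
  have "(\<integral>\<^sup>+ k. ennreal (real k * pmf X k / pmf_mean X) \<partial>count_space UNIV)
      = (\<integral>\<^sup>+ k. ennreal (pmf X k) * ennreal (real k / pmf_mean X) \<partial>count_space UNIV)"
    using assms(2) by (intro nn_integral_cong) (simp flip: ennreal_mult add: mult_ac)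
  also have "\<dots> = (\<integral>\<^sup>+ k. ennreal (real k / pmf_mean X) \<partial>measure_pmf X)"
    by (simp add: nn_integral_measure_pmf)
  also have "\<dots> = ennreal (measure_pmf.expectation X (\<lambda>k. real k / pmf_mean X))"
    using assms by (intro nn_integral_eq_integral) auto
  also have "measure_pmf.expectation X (\<lambda>k. real k / pmf_mean X) = 1"
    using assms(2) by simp
  finally show "(\<integral>\<^sup>+ k. ennreal (real k * pmf X k / pmf_mean X) \<partial>count_space UNIV) = 1"
    by simp
qed

section \<open>Modes of convergence\<close>

definition real_law :: "nat pmf \<Rightarrow> real measure" where
  "real_law X = distr (measure_pmf X) borel real"

text \<open>
  Convergence in probability to a constant; the random variables may live on a different
  (discrete) probability space for each n.
\<close>

definition tendsto_in_prob :: "(nat \<Rightarrow> 'a pmf) \<Rightarrow> (nat \<Rightarrow> 'a \<Rightarrow> real) \<Rightarrow> real \<Rightarrow> bool" where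
  "tendsto_in_prob P X c \<longleftrightarrow>
     (\<forall>\<epsilon>>0. (\<lambda>n. measure_pmf.prob (P n) {\<omega>. \<bar>X n \<omega> - c\<bar> > \<epsilon>}) \<longlonglongrightarrow> 0)"

section \<open>The bipartite configuration model\<close>

text \<open>The law of the degree of a uniformly chosen vertex.\<close>

definition degree_law :: "nat \<Rightarrow> (nat \<Rightarrow> nat) \<Rightarrow> nat pmf" where
  "degree_law N d = map_pmf d (pmf_of_set {1..N})"

definition half_edges :: "nat \<Rightarrow> (nat \<Rightarrow> nat) \<Rightarrow> (nat \<times> nat) set" where
  "half_edges N d = (SIGMA v:{1..N}. {1..d v})"

text \<open>The bijections between two sets, made \<open>undefined\<close> outside A so that there are finitely many.\<close>

definition matchings :: "'a set \<Rightarrow> 'b set \<Rightarrow> ('a \<Rightarrow> 'b) set" where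
  "matchings A B = {f \<in> A \<rightarrow>\<^sub>E B. bij_betw f A B}"

text \<open>
  A bipartite multigraph is a \<open>pre_digraph\<close> with left vertices \<open>Inl v\<close> and right vertices \<open>Inr a\<close>.
  Its edges are indexed by the left half-edges, which keeps track of multiplicities. They are
  stored oriented from left to right, but connectivity below disregards the orientation.
\<close>

type_synonym bip_multigraph = "(nat + nat, nat \<times> nat) pre_digraph"

definition bcm_graph ::
  "nat \<Rightarrow> nat \<Rightarrow> (nat \<Rightarrow> nat) \<Rightarrow> (nat \<times> nat \<Rightarrow> nat \<times> nat) \<Rightarrow> bip_multigraph" where
  "bcm_graph N M dl f =
     \<lparr> verts = Inl ` {1..N} \<union> Inr ` {1..M}, arcs = half_edges N dl,
       tail = (\<lambda>h. Inl (fst h)), head = (\<lambda>h. Inr (fst (f h))) \<rparr>"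

definition BCM :: "nat \<Rightarrow> nat \<Rightarrow> (nat \<Rightarrow> nat) \<Rightarrow> (nat \<Rightarrow> nat) \<Rightarrow> bip_multigraph pmf" where
  "BCM N M dl dr =
     map_pmf (bcm_graph N M dl) (pmf_of_set (matchings (half_edges N dl) (half_edges M dr)))"

lemma finite_matchings:
  "finite (matchings (half_edges N dl) (half_edges M dr))"
proof -
  have "finite (half_edges N dl \<rightarrow>\<^sub>E half_edges M dr)"
    unfolding half_edges_def by (intro finite_PiE finite_SigmaI) simp_all
  then show ?thesis
    unfolding matchings_def by (rule rev_finite_subset) blast
qed

lemma matchings_nonempty:
  assumes "(\<Sum>v\<in>{1..N}. dl v) = (\<Sum>a\<in>{1..M}. dr a)"
  shows "matchings (half_edges N dl) (half_edges M dr) \<noteq> {}"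
proof -
  have "card (half_edges N dl) = card (half_edges M dr)"
    using assms by (simp add: half_edges_def)
  moreover have "finite (half_edges N dl)" "finite (half_edges M dr)"
    by (auto simp: half_edges_def)
  ultimately obtain f where f: "bij_betw f (half_edges N dl) (half_edges M dr)"
    using finite_same_card_bij by blast
  then have "restrict f (half_edges N dl) \<in> matchings (half_edges N dl) (half_edges M dr)"
    by (auto simp: matchings_def bij_betw_apply cong: bij_betw_cong)
  then show ?thesis by blast
qed

section \<open>Connected components\<close>

text \<open>
  The vertex sets of the connected components of the underlying undirected graph: as for
  \<^const>\<open>connected\<close>, one passes to strong connectivity of the symmetrised graph.
\<close>

definition components :: "('v, 'e) pre_digraph \<Rightarrow> 'v set set" where
  "components G = pre_digraph.sccs_verts (with_proj (mk_symmetric G))"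

definition largest_component :: "('v, 'e) pre_digraph \<Rightarrow> 'v set \<Rightarrow> bool" where
  "largest_component G C \<longleftrightarrow> C \<in> components G \<and> (\<forall>C'\<in>components G. card C' \<le> card C)"

text \<open>C2 is a second largest component once C1 was chosen as the largest; it is empty if there is
  no component other than C1.\<close>

definition second_largest_component :: "('v, 'e) pre_digraph \<Rightarrow> 'v set \<Rightarrow> 'v set \<Rightarrow> bool" where
  "second_largest_component G C1 C2 \<longleftrightarrow>
     (if components G - {C1} = {} then C2 = {}
      else C2 \<in> components G - {C1} \<and> (\<forall>C'\<in>components G - {C1}. card C' \<le> card C2))"

definition left_part :: "nat \<Rightarrow> (nat + nat) set" where
  "left_part N = Inl ` {1..N}"

definition left_part_deg :: "nat \<Rightarrow> (nat \<Rightarrow> nat) \<Rightarrow> nat \<Rightarrow> (nat + nat) set" where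
  "left_part_deg N d k = Inl ` {v \<in> {1..N}. d v = k}"

definition component_edges :: "('v, 'e) pre_digraph \<Rightarrow> 'v set \<Rightarrow> 'e set" where
  "component_edges G C = arcs (G \<restriction> C)"

section \<open>The limiting quantities\<close>

definition eta_left :: "nat pmf \<Rightarrow> nat pmf \<Rightarrow> real" where
  "eta_left p q = (LEAST x. 0 \<le> x \<and> x \<le> 1 \<and>
     x = pgf (size_biased_minus_one q) (pgf (size_biased_minus_one p) x))"

definition eta_right :: "nat pmf \<Rightarrow> nat pmf \<Rightarrow> real" where
  "eta_right p q = pgf (size_biased_minus_one p) (eta_left p q)"

definition xi_left :: "nat pmf \<Rightarrow> nat pmf \<Rightarrow> real" where
  "xi_left p q = 1 - pgf p (eta_left p q)"

end

theory Submission
  imports Defs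
begin

text \<open>An edge of the multigraph is its left half-edge, and the random matching f tells at
  which right vertex it ends. Two edges are linked if they share a vertex. The components of the
  multigraph are the classes of the equivalence relation that this generates on the left half-edges,
  so the theorem is about the classes of a uniformly random bijection f.

  The partner of a half-edge is a uniformly random half-edge of the other side, which belongs to a
  vertex of degree k with probability close to the size-biased degree law. Following the edges out
  of an active half-edge therefore resembles a branching process with two alternating types, whose
  offspring laws are the size-biased degree laws minus one, and whose extinction probability \<rho>
  is \<open>eta_left\<close>. Accordingly, a vertex of degree k lies in a component of bounded size
  with probability close to \<open>\<rho> ^ k\<close>. For the upper bound, every \<theta> that the
  composed generating function maps strictly below itself gives a bound by induction on the number
  of edges explored (\<open>explored_small_le\<close>); if the product of the means exceeds 1,
  convexity provides such \<theta> arbitrarily close to \<rho>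
  (\<open>ext_prob_supercritical\<close>). For the lower bound, the iterates of the generating
  functions started at 0 are probabilities of dying out within finitely many rounds
  (\<open>stops_ext_prob\<close>). The upper bound also holds for two vertices at once and then
  yields covariances that are almost nonpositive, so the number of half-edges in small components is
  concentrated (\<open>small_weight_tendsto\<close>). If \<rho> = 1, almost all edges lie in small
  components and nothing else is left to prove (\<open>no_giant\<close>).

  Suppose next that the product of the means exceeds 1. It has to be excluded that the edges outside
  small components are spread over several large components. To this end one cuts off the first
  half-edge of each of \<epsilon> h vertices, h being the number of edges. Given the matching of all
  other half-edges, the cut ones are matched uniformly at random with the right half-edges that
  remain. The matching of the others divides the right half-edges into classes, of which at most h /
  K have K elements or more. Every division of these big classes into two groups, both of which meet
  of the order of \<epsilon> h cut half-edges, is bridged by a cut half-edge up to a probability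
  \<open>exp (- c * \<epsilon> * h)\<close>. For large K this beats the number
  \<open>2 ^ (h div K)\<close> of divisions (\<open>separated_unlikely\<close>), so almost all cut
  half-edges that meet a big class are in one component (\<open>giant_of_not_separated\<close>).
  Those that meet none although their component is not small are rare, because the probabilities of
  the two events, to meet no big class and to lie in a small component, are estimated by the same
  power of \<rho>. Since vertices of the same degree are exchangeable, two arbitrary vertices of
  given degrees are unlikely to lie in different components that are not small
  (\<open>apart_unlikely\<close>). Summing over all pairs of half-edges shows that a single
  component contains almost all edges outside small components (\<open>giant_exists\<close>).

  This component is the largest one (\<open>good_largest\<close>). The number of its edges is read
  off directly from the proportion of half-edges in small components, and the number of its left
  vertices by counting a half-edge at a vertex of degree k with weight 1 / k.\<close>

section \<open>Uniform random matchings\<close>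

text \<open>The probability of P under the uniform distribution on S, as a quotient of
  cardinalities, so that the combinatorial arguments are counting arguments. It is 0 if S is empty
  or infinite.\<close>

definition uprob :: "'a set \<Rightarrow> ('a \<Rightarrow> bool) \<Rightarrow> real" where
  "uprob S P = real (card {x \<in> S. P x}) / real (card S)"

lemma uprob_nonneg [simp]: "0 \<le> uprob S P"
  by (simp add: uprob_def)

lemma uprob_le_1 [simp]: "uprob S P \<le> 1"
proof (cases "finite S")
  case True
  then have "card {x \<in> S. P x} \<le> card S" by (intro card_mono) auto
  then show ?thesis by (auto simp: uprob_def divide_le_eq_1)
next
  case False then show ?thesis by (simp add: uprob_def)
qed

lemma uprob_mono:
  assumes "finite S" "\<And>x. x \<in> S \<Longrightarrow> P x \<Longrightarrow> Q x"
  shows "uprob S P \<le> uprob S Q"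
proof -
  have "card {x \<in> S. P x} \<le> card {x \<in> S. Q x}"
    using assms by (intro card_mono) auto
  then show ?thesis by (simp add: uprob_def divide_right_mono)
qed

lemma uprob_cong:
  assumes "\<And>x. x \<in> S \<Longrightarrow> P x = Q x"
  shows "uprob S P = uprob S Q"
proof -
  have "{x \<in> S. P x} = {x \<in> S. Q x}" using assms by auto
  then show ?thesis by (simp add: uprob_def)
qed

lemma uprob_disj_le:
  assumes "finite S"
  shows "uprob S (\<lambda>x. P x \<or> Q x) \<le> uprob S P + uprob S Q"
proof -
  have "{x \<in> S. P x \<or> Q x} = {x \<in> S. P x} \<union> {x \<in> S. Q x}" by auto
  then have "card {x \<in> S. P x \<or> Q x} \<le> card {x \<in> S. P x} + card {x \<in> S. Q x}"
    by (simp add: card_Un_le)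
  then show ?thesis
    unfolding uprob_def add_divide_distrib[symmetric] by (intro divide_right_mono) linarith+
qed

lemma uprob_Bex_le:
  assumes "finite S" "finite I"
  shows "uprob S (\<lambda>x. \<exists>i\<in>I. P i x) \<le> (\<Sum>i\<in>I. uprob S (P i))"
  using assms(2)
proof induction
  case empty then show ?case by (simp add: uprob_def)
next
  case (insert i I)
  have "uprob S (\<lambda>x. \<exists>i\<in>insert i I. P i x) \<le> uprob S (P i) + uprob S (\<lambda>x. \<exists>i\<in>I. P i x)"
    using uprob_disj_le[OF assms(1), of "P i" "\<lambda>x. \<exists>i\<in>I. P i x"] by simp
  then show ?case using insert by simp
qed

lemma uprob_const_True: "finite S \<Longrightarrow> S \<noteq> {} \<Longrightarrow> (\<And>x. x \<in> S \<Longrightarrow> P x) \<Longrightarrow> uprob S P = 1"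
proof -
  assume a: "finite S" "S \<noteq> {}" "\<And>x. x \<in> S \<Longrightarrow> P x"
  then have "{x \<in> S. P x} = S" by auto
  then show ?thesis using a by (simp add: uprob_def)
qed

lemma uprob_const_False: "(\<And>x. x \<in> S \<Longrightarrow> \<not> P x) \<Longrightarrow> uprob S P = 0"
proof -
  assume "\<And>x. x \<in> S \<Longrightarrow> \<not> P x"
  then have "{x \<in> S. P x} = {}" by auto
  then show ?thesis unfolding uprob_def by (simp only: card.empty of_nat_0 div_0)
qed

lemma uprob_not:
  assumes "finite S" "S \<noteq> {}"
  shows "uprob S (\<lambda>x. \<not> P x) = 1 - uprob S P"
proof -
  have "S = {x \<in> S. P x} \<union> {x \<in> S. \<not> P x}" by auto
  then have "card S = card {x \<in> S. P x} + card {x \<in> S. \<not> P x}"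
    by (subst card_Un_disjoint[symmetric]) (use assms in auto)
  then have "real (card {x \<in> S. \<not> P x}) = real (card S) - real (card {x \<in> S. P x})" by linarith
  moreover have "card S > 0" using assms by (simp add: card_gt_0_iff)
  ultimately show ?thesis by (simp add: uprob_def diff_divide_distrib)
qed

lemma uprob_eq_avg:
  assumes "finite S"
  shows "uprob S P = (\<Sum>x\<in>S. of_bool (P x)) / real (card S)"
proof -
  have "(\<Sum>x\<in>S. of_bool (P x)) = real (card {x \<in> S. P x})"
    using assms by (simp add: of_bool_def sum.If_cases Int_def)
  then show ?thesis by (simp add: uprob_def)
qed

definition avg :: "'a set \<Rightarrow> ('a \<Rightarrow> real) \<Rightarrow> real" where
  "avg S \<phi> = (\<Sum>x\<in>S. \<phi> x) / real (card S)"

lemma avg_mono: "(\<And>x. x \<in> S \<Longrightarrow> \<phi> x \<le> \<psi> x) \<Longrightarrow> avg S \<phi> \<le> avg S \<psi>"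
  unfolding avg_def by (intro divide_right_mono sum_mono) auto

lemma avg_nonneg: "(\<And>x. x \<in> S \<Longrightarrow> 0 \<le> \<phi> x) \<Longrightarrow> 0 \<le> avg S \<phi>"
  unfolding avg_def by (intro divide_nonneg_nonneg sum_nonneg) auto

lemma avg_add: "avg S (\<lambda>x. \<phi> x + \<psi> x) = avg S \<phi> + avg S \<psi>"
  by (simp add: avg_def sum.distrib add_divide_distrib)

lemma avg_diff: "avg S (\<lambda>x. \<phi> x - \<psi> x) = avg S \<phi> - avg S \<psi>"
  by (simp add: avg_def sum_subtractf diff_divide_distrib)

lemma avg_cmult: "avg S (\<lambda>x. c * \<phi> x) = c * avg S \<phi>"
  by (simp add: avg_def sum_distrib_left)

lemma avg_const: "finite S \<Longrightarrow> S \<noteq> {} \<Longrightarrow> avg S (\<lambda>x. c) = c"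
  by (simp add: avg_def)

lemma avg_sum: "avg S (\<lambda>x. \<Sum>i\<in>I. \<phi> i x) = (\<Sum>i\<in>I. avg S (\<phi> i))"
  by (simp add: avg_def sum_divide_distrib) (rule sum.swap)

lemma avg_of_bool: "finite S \<Longrightarrow> avg S (\<lambda>x. of_bool (P x)) = uprob S P"
  by (simp add: uprob_eq_avg avg_def)

lemma avg_card:
  assumes "finite S" "finite I"
  shows "avg S (\<lambda>x. real (card {i \<in> I. Q i x})) = (\<Sum>i\<in>I. uprob S (Q i))"
proof -
  have "(\<lambda>x. real (card {i \<in> I. Q i x})) = (\<lambda>x. \<Sum>i\<in>I. of_bool (Q i x))"
    using assms(2) by (simp add: of_bool_def sum.If_cases Int_def)
  then show ?thesis using assms(1) by (simp only: avg_sum avg_of_bool)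
qed

lemma uprob_markov:
  assumes "finite S" "c > 0" "\<And>x. x \<in> S \<Longrightarrow> 0 \<le> \<phi> x"
  shows "uprob S (\<lambda>x. \<phi> x \<ge> c) \<le> avg S \<phi> / c"
proof -
  have "avg S (\<lambda>x. c * of_bool (\<phi> x \<ge> c)) \<le> avg S \<phi>"
    using assms by (intro avg_mono) (auto simp: of_bool_def)
  then show ?thesis using assms by (simp add: avg_cmult avg_of_bool field_simps)
qed

lemma finite_matchings_of_finite:
  assumes "finite A" "finite B"
  shows "finite (matchings A B)"
proof -
  have "finite (A \<rightarrow>\<^sub>E B)" using assms by (intro finite_PiE) auto
  then show ?thesis unfolding matchings_def by (rule rev_finite_subset) blast
qed

lemma matchings_bij: "f \<in> matchings A B \<Longrightarrow> bij_betw f A B"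
  by (simp add: matchings_def)

lemma matchings_inj: "f \<in> matchings A B \<Longrightarrow> inj_on f A"
  by (simp add: matchings_def bij_betw_def)

lemma matchings_image: "f \<in> matchings A B \<Longrightarrow> f ` A = B"
  by (simp add: matchings_def bij_betw_def)

lemma matchings_mem: "f \<in> matchings A B \<Longrightarrow> x \<in> A \<Longrightarrow> f x \<in> B"
  by (auto simp: matchings_def)

lemma matchings_update:
  assumes "x \<in> A" "y \<in> B" "f \<in> matchings (A - {x}) (B - {y})"
  shows "f(x := y) \<in> matchings A B"
proof -
  have bij: "bij_betw f (A - {x}) (B - {y})" using assms(3) by (rule matchings_bij)
  have "bij_betw (f(x := y)) (insert x (A - {x})) (insert y (B - {y}))"
    using bij unfolding bij_betw_def by (auto simp: inj_on_def)
  then have "bij_betw (f(x := y)) A B" using assms by (simp add: insert_absorb)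
  moreover have "f(x := y) \<in> A \<rightarrow>\<^sub>E B"
    using assms by (auto simp: matchings_def PiE_def extensional_def Pi_def)
  ultimately show ?thesis by (simp add: matchings_def)
qed

lemma matchings_remove:
  assumes "x \<in> A" "f \<in> matchings A B"
  shows "f(x := undefined) \<in> matchings (A - {x}) (B - {f x})"
proof -
  have "bij_betw f (A - {x}) (B - {f x})"
    using assms matchings_bij[OF assms(2)] by (auto simp: bij_betw_def inj_on_def)
  then have "bij_betw (f(x := undefined)) (A - {x}) (B - {f x})"
    by (rule bij_betw_cong[THEN iffD1, rotated]) auto
  moreover have "f(x := undefined) \<in> (A - {x}) \<rightarrow>\<^sub>E (B - {f x})"
    using assms \<open>bij_betw f (A - {x}) (B - {f x})\<close>
    by (auto simp: matchings_def PiE_def extensional_def bij_betw_def)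
  ultimately show ?thesis by (simp add: matchings_def)
qed

lemma matchings_nonundef:
  assumes "f \<in> matchings (A - {x}) B"
  shows "f x = undefined"
  using assms by (auto simp: matchings_def PiE_def extensional_def)

lemma bij_betw_matchings_left:
  assumes "x \<in> A"
  shows "bij_betw (\<lambda>(y, f). f(x := y)) (SIGMA y:B. matchings (A - {x}) (B - {y})) (matchings A B)"
proof (rule bij_betw_byWitness[where f' = "\<lambda>f. (f x, f(x := undefined))"])
  show "\<forall>a\<in>SIGMA y:B. matchings (A - {x}) (B - {y}).
      (\<lambda>f. (f x, f(x := undefined))) ((\<lambda>(y, f). f(x := y)) a) = a"
    using matchings_nonundef by fastforce
  show "(\<lambda>(y, f). f(x := y)) ` (SIGMA y:B. matchings (A - {x}) (B - {y})) \<subseteq> matchings A B"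
    using matchings_update[OF assms] by auto
  show "(\<lambda>f. (f x, f(x := undefined))) ` matchings A B \<subseteq> (SIGMA y:B. matchings (A - {x}) (B - {y}))"
    using matchings_remove[OF assms] matchings_mem[OF _ assms] by auto
qed auto

lemma bij_betw_matchings_right:
  assumes "y \<in> B"
  shows "bij_betw (\<lambda>(x, f). f(x := y)) (SIGMA x:A. matchings (A - {x}) (B - {y})) (matchings A B)"
proof (rule bij_betw_byWitness[where f' = "\<lambda>f. let x = inv_into A f y in (x, f(x := undefined))"])
  show "\<forall>a\<in>SIGMA x:A. matchings (A - {x}) (B - {y}).
      (\<lambda>f. let x = inv_into A f y in (x, f(x := undefined))) ((\<lambda>(x, f). f(x := y)) a) = a"
  proof safe
    fix x f assume x: "x \<in> A" and f: "f \<in> matchings (A - {x}) (B - {y})"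
    have "inj_on (f(x := y)) A" using matchings_inj[OF matchings_update[OF x assms f]] .
    then have "inv_into A (f(x := y)) y = x"
      using x by (metis fun_upd_same inv_into_f_f)
    then show "(let x' = inv_into A (f(x := y)) y in (x', (f(x := y))(x' := undefined))) = (x, f)"
      using matchings_nonundef[OF f] by (auto simp: Let_def)
  qed
  show "(\<lambda>(x, f). f(x := y)) ` (SIGMA x:A. matchings (A - {x}) (B - {y})) \<subseteq> matchings A B"
    using matchings_update[OF _ assms] by auto
  have inv: "inv_into A f y \<in> A" "f (inv_into A f y) = y" if "f \<in> matchings A B" for f
    using matchings_image[OF that] assms by (auto intro: inv_into_into f_inv_into_f)
  show "(\<lambda>f. let x = inv_into A f y in (x, f(x := undefined))) ` matchings A B
      \<subseteq> (SIGMA x:A. matchings (A - {x}) (B - {y}))"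
    using matchings_remove[OF inv(1)] inv by (fastforce simp: Let_def)
  show "\<forall>f\<in>matchings A B. (\<lambda>(x, f). f(x := y)) (let x = inv_into A f y in (x, f(x := undefined))) = f"
    using inv(2) by (auto simp: Let_def fun_eq_iff) metis
qed

lemma card_matchings:
  assumes "finite A" "finite B" "card A = card B"
  shows "card (matchings A B) = fact (card A)"
  using assms
proof (induction A arbitrary: B rule: finite_induct)
  case empty
  then have "matchings ({} :: 'a set) B = {\<lambda>x. undefined}" by (auto simp: matchings_def bij_betw_def)
  then show ?case by simp
next
  case (insert x A)
  have "card (matchings (insert x A) B) = card (SIGMA y:B. matchings A (B - {y}))"
    using bij_betw_same_card[OF bij_betw_matchings_left[of x "insert x A" B]] insert by simp
  also have "\<dots> = (\<Sum>y\<in>B. card (matchings A (B - {y})))"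
    using insert by (intro card_SigmaI) (auto intro: finite_matchings_of_finite)
  also have "\<dots> = (\<Sum>y\<in>B. fact (card A))"
  proof (rule sum.cong)
    fix y assume "y \<in> B"
    then have "card A = card (B - {y})" using insert.prems insert.hyps(1,2) by simp
    then show "card (matchings A (B - {y})) = fact (card A)" using insert.IH[of "B - {y}"] insert.prems(1) by blast
  qed simp
  finally have "card (matchings (insert x A) B) = card B * fact (card A)" by simp
  moreover have "card B = Suc (card A)" "card (insert x A) = Suc (card A)"
    using insert.prems insert.hyps(1,2) by simp_all
  ultimately show ?case by (simp only: fact_Suc of_nat_id)
qed

lemma matchings_ne:
  assumes "finite A" "finite B" "card A = card B"
  shows "matchings A B \<noteq> {}"
  using card_matchings[OF assms] by auto

lemma card_Collect_bij:
  assumes "bij_betw g S T"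
  shows "card {t \<in> T. P t} = card {s \<in> S. P (g s)}"
proof -
  have "bij_betw g {s \<in> S. P (g s)} {t \<in> T. P t}"
    using assms by (auto simp: bij_betw_def inj_on_def)
  then show ?thesis by (metis bij_betw_same_card)
qed

text \<open>The reason why a random matching can be revealed edge by edge: the partner of x is
  uniform and, given the partner, what remains is a uniform matching of what is left. The next lemma
  reveals the partner of a right half-edge instead.\<close>

lemma uprob_matchings_left:
  assumes "finite A" "finite B" "card A = card B" "x \<in> A"
  shows "uprob (matchings A B) P =
    (\<Sum>y\<in>B. uprob (matchings (A - {x}) (B - {y})) (\<lambda>f. P (f(x := y)))) / real (card B)"
proof -
  have fin: "finite (matchings (A - {x}) (B - {y}))" for y
    using assms by (intro finite_matchings_of_finite) auto
  have "card {f \<in> matchings A B. P f}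
      = card {(y, f). (y, f) \<in> (SIGMA y:B. matchings (A - {x}) (B - {y})) \<and> P (f(x := y))}"
    by (subst card_Collect_bij[OF bij_betw_matchings_left[OF assms(4)]])
       (rule arg_cong[where f = card], auto)
  also have "\<dots> = card (SIGMA y:B. {f \<in> matchings (A - {x}) (B - {y}). P (f(x := y))})"
    by (rule arg_cong[where f = card]) auto
  also have "\<dots> = (\<Sum>y\<in>B. card {f \<in> matchings (A - {x}) (B - {y}). P (f(x := y))})"
    using assms fin by (intro card_SigmaI) auto
  finally have *: "card {f \<in> matchings A B. P f}
      = (\<Sum>y\<in>B. card {f \<in> matchings (A - {x}) (B - {y}). P (f(x := y))})" .
  have c: "card (matchings (A - {x}) (B - {y})) = fact (card B - 1)" if "y \<in> B" for y
    using assms that by (subst card_matchings) auto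
  have pos: "card B > 0" using assms by (metis card_gt_0_iff empty_iff)
  have c2: "card (matchings A B) = card B * fact (card B - 1)"
    using assms pos by (simp add: card_matchings fact_reduce)
  show ?thesis
    unfolding uprob_def * c2 using c
    by (simp add: sum_divide_distrib[symmetric] field_simps)
qed

lemma uprob_matchings_right:
  assumes "finite A" "finite B" "card A = card B" "y \<in> B"
  shows "uprob (matchings A B) P =
    (\<Sum>x\<in>A. uprob (matchings (A - {x}) (B - {y})) (\<lambda>f. P (f(x := y)))) / real (card A)"
proof -
  have fin: "finite (matchings (A - {x}) (B - {y}))" for x
    using assms by (intro finite_matchings_of_finite) auto
  have "card {f \<in> matchings A B. P f}
      = card {(x, f). (x, f) \<in> (SIGMA x:A. matchings (A - {x}) (B - {y})) \<and> P (f(x := y))}"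
    by (subst card_Collect_bij[OF bij_betw_matchings_right[OF assms(4)]])
       (rule arg_cong[where f = card], auto)
  also have "\<dots> = card (SIGMA x:A. {f \<in> matchings (A - {x}) (B - {y}). P (f(x := y))})"
    by (rule arg_cong[where f = card]) auto
  also have "\<dots> = (\<Sum>x\<in>A. card {f \<in> matchings (A - {x}) (B - {y}). P (f(x := y))})"
    using assms fin by (intro card_SigmaI) auto
  finally have *: "card {f \<in> matchings A B. P f}
      = (\<Sum>x\<in>A. card {f \<in> matchings (A - {x}) (B - {y}). P (f(x := y))})" .
  have c: "card (matchings (A - {x}) (B - {y})) = fact (card A - 1)" if "x \<in> A" for x
    using assms that by (subst card_matchings) auto
  have pos: "card A > 0" using assms by (metis card_gt_0_iff empty_iff)
  have c2: "card (matchings A B) = card A * fact (card A - 1)"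
    using assms pos by (simp add: card_matchings fact_reduce)
  show ?thesis
    unfolding uprob_def * c2 using c
    by (simp add: sum_divide_distrib[symmetric] field_simps)
qed

text \<open>Reveal the values on D one by one; averaging preserves the bound. In the sprinkling
  argument D consists of the half-edges that are not cut.\<close>

lemma uprob_matchings_conditional:
  assumes "finite A" "finite B" "card A = card B" "D \<subseteq> A"
    and "\<And>f0. f0 \<in> matchings A B \<Longrightarrow>
      uprob (matchings (A - D) (B - f0 ` D)) (\<lambda>g. P (\<lambda>x. if x \<in> D then f0 x else g x)) \<le> c"
  shows "uprob (matchings A B) P \<le> c"
proof -
  have "finite D" using assms(1,4) finite_subset by blast
  then show ?thesis using assms
  proof (induction D arbitrary: A B P rule: finite_induct)
    case empty
    obtain f0 where "f0 \<in> matchings A B" using matchings_ne[OF empty(1-3)] by blast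
    from empty(5)[OF this] show ?case by simp
  next
    case (insert z D)
    have z: "z \<in> A" using insert by auto
    have "uprob (matchings (A - {z}) (B - {y})) (\<lambda>f. P (f(z := y))) \<le> c" if y: "y \<in> B" for y
    proof (rule insert.IH)
      show "card (A - {z}) = card (B - {y})" using insert z y by simp
      show "D \<subseteq> A - {z}" using insert by auto
      fix f0 assume f0: "f0 \<in> matchings (A - {z}) (B - {y})"
      have "f0(z := y) \<in> matchings A B" by (rule matchings_update[OF z y f0])
      from insert.prems(5)[OF this]
      have "uprob (matchings (A - insert z D) (B - (f0(z := y)) ` insert z D))
        (\<lambda>g. P (\<lambda>x. if x \<in> insert z D then (f0(z := y)) x else g x)) \<le> c" .
      moreover have "(f0(z := y)) ` insert z D = insert y (f0 ` D)" using insert(2) by auto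
      moreover have "A - insert z D = A - {z} - D" "B - insert y (f0 ` D) = B - {y} - f0 ` D" by auto
      moreover have "(\<lambda>x. if x \<in> insert z D then (f0(z := y)) x else g x)
        = (\<lambda>x. if x \<in> D then f0 x else g x)(z := y)" for g using insert(2) by auto
      ultimately show "uprob (matchings (A - {z} - D) (B - {y} - f0 ` D))
         (\<lambda>g. P ((\<lambda>x. if x \<in> D then f0 x else g x)(z := y))) \<le> c" by simp
    qed (use insert in auto)
    then have "(\<Sum>y\<in>B. uprob (matchings (A - {z}) (B - {y})) (\<lambda>f. P (f(z := y)))) \<le> (\<Sum>y\<in>B. c)"
      by (rule sum_mono)
    moreover have "real (card B) > 0" using insert z by (metis card_gt_0_iff empty_iff of_nat_0_less_iff)
    ultimately show ?case
      by (subst uprob_matchings_left[OF insert.prems(1-3) z]) (simp add: field_simps)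
  qed
qed

lemma matchings_precompose:
  assumes "bij_betw \<sigma> A A" "f \<in> matchings A B"
  shows "restrict (f \<circ> \<sigma>) A \<in> matchings A B"
proof -
  have "bij_betw (f \<circ> \<sigma>) A B" using assms matchings_bij bij_betw_trans by blast
  then have "bij_betw (restrict (f \<circ> \<sigma>) A) A B" by (simp cong: bij_betw_cong)
  then show ?thesis using bij_betw_apply[OF \<open>bij_betw (f \<circ> \<sigma>) A B\<close>] by (auto simp: matchings_def)
qed

text \<open>Exchangeability: relabelling the left half-edges preserves the uniform law, since
  precomposition with \<sigma> is injective on matchings.\<close>

lemma uprob_matchings_precompose:
  assumes "finite A" "finite B" "bij_betw \<sigma> A A"
  shows "uprob (matchings A B) P \<le> uprob (matchings A B) (\<lambda>f. P (restrict (f \<circ> inv_into A \<sigma>) A))"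
proof -
  let ?g = "\<lambda>f. restrict (f \<circ> \<sigma>) A" and ?h = "\<lambda>f. restrict (f \<circ> inv_into A \<sigma>) A"
  have inv: "bij_betw (inv_into A \<sigma>) A A" using assms(3) by (rule bij_betw_inv_into)
  have gh: "?h (?g f) = f" if "f \<in> matchings A B" for f
    using that inv assms(3)
    by (auto simp: fun_eq_iff restrict_def matchings_def PiE_def extensional_def bij_betw_apply
        bij_betw_inv_into_right)
  have "card {f \<in> matchings A B. P f} \<le> card {f \<in> matchings A B. P (?h f)}"
  proof (rule card_inj_on_le[where f = ?g])
    show "inj_on ?g {f \<in> matchings A B. P f}"
      by (rule inj_on_inverseI[where g = ?h]) (simp add: gh)
    show "?g ` {f \<in> matchings A B. P f} \<subseteq> {f \<in> matchings A B. P (?h f)}"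
      using gh matchings_precompose[OF assms(3)] by auto
    show "finite {f \<in> matchings A B. P (?h f)}"
      using finite_matchings_of_finite[OF assms(1,2)] by auto
  qed
  then show ?thesis by (simp add: uprob_def divide_right_mono)
qed

text \<open>Reveal the partners of S one by one. As long as T has not been hit, all of it is
  available among at most \<open>card F\<close> candidates, so T is missed again with probability at
  most \<open>1 - card T / card F\<close>.\<close>

lemma uprob_matchings_avoid:
  assumes "finite F" "finite G" "card F = card G" "S \<subseteq> F" "T \<subseteq> G"
  shows "uprob (matchings F G) (\<lambda>f. f ` S \<inter> T = {}) \<le> exp (- real (card S) * real (card T) / real (card F))"
proof -
  have "finite S" using assms(1,4) finite_subset by blast
  then show ?thesis using assms
  proof (induction S arbitrary: F G rule: finite_induct)
    case empty then show ?case by simp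
  next
    case (insert x S)
    have x: "x \<in> F" using insert by auto
    define t m s where "t = card T" and "m = card F" and "s = card S"
    have m0: "m > 0" using x insert(4) by (auto simp: m_def card_gt_0_iff)
    have finT: "finite T" using insert.prems(2,5) by (rule rev_finite_subset)
    have tm: "t \<le> m" unfolding t_def m_def using insert by (metis card_mono)
    have eq: "uprob (matchings (F - {x}) (G - {y})) (\<lambda>f. (f(x := y)) ` insert x S \<inter> T = {}) =
       (if y \<in> T then 0 else uprob (matchings (F - {x}) (G - {y})) (\<lambda>f. f ` S \<inter> T = {}))" for y
    proof -
      have *: "(f(x := y)) ` insert x S = insert y (f ` S)" for f :: "'a \<Rightarrow> 'b" using insert(2) by auto
      show ?thesis unfolding * by (auto intro!: uprob_const_False)
    qed
    have le: "uprob (matchings (F - {x}) (G - {y})) (\<lambda>f. f ` S \<inter> T = {}) \<le> exp (- real s * real t / real m)"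
      if y: "y \<in> G - T" for y
    proof -
      have "uprob (matchings (F - {x}) (G - {y})) (\<lambda>f. f ` S \<inter> T = {})
        \<le> exp (- real (card S) * real (card T) / real (card (F - {x})))"
        using insert y x by (intro insert.IH) auto
      also have "\<dots> \<le> exp (- real s * real t / real m)"
      proof (cases "m = 1")
        case True
        then have "card F = 1" by (simp add: m_def)
        then have "F = {x}" using x by (metis card_1_singletonE singletonD)
        then have "S = {}" using insert by auto
        then show ?thesis by (simp add: s_def)
      next
        case False
        have "card (F - {x}) = m - 1" using x insert(4) by (simp add: m_def)
        then show ?thesis using False m0 by (simp add: s_def t_def frac_le)
      qed
      finally show ?thesis .
    qed
    have "uprob (matchings F G) (\<lambda>f. f ` insert x S \<inter> T = {}) =
       (\<Sum>y\<in>G. if y \<in> T then 0 else uprob (matchings (F - {x}) (G - {y})) (\<lambda>f. f ` S \<inter> T = {})) / real (card G)"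
      by (subst uprob_matchings_left[OF insert(4-6) x]) (simp only: eq)
    also have "(\<Sum>y\<in>G. if y \<in> T then 0 else uprob (matchings (F - {x}) (G - {y})) (\<lambda>f. f ` S \<inter> T = {}))
      \<le> (\<Sum>y\<in>G. if y \<in> T then 0 else exp (- real s * real t / real m))"
      using le by (intro sum_mono) auto
    also have "\<dots> = real (m - t) * exp (- real s * real t / real m)"
    proof -
      have "card (G - T) = m - t" using insert finT by (simp add: m_def t_def card_Diff_subset)
      moreover have "G \<inter> - T = G - T" by auto
      ultimately show ?thesis using insert(5) by (simp add: sum.If_cases)
    qed
    finally have "uprob (matchings F G) (\<lambda>f. f ` insert x S \<inter> T = {})
      \<le> (1 - real t / real m) * exp (- real s * real t / real m)"
      using insert(6) m0 tm by (simp add: m_def divide_right_mono of_nat_diff field_simps)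
    also have "\<dots> \<le> exp (- real t / real m) * exp (- real s * real t / real m)"
      using exp_ge_add_one_self[of "- real t / real m"] by (intro mult_right_mono) auto
    also have "\<dots> = exp (- real (card (insert x S)) * real (card T) / real (card F))"
    proof -
      have "real (card (insert x S)) = real s + 1" using insert by (simp add: s_def)
      then show ?thesis
        by (simp add: t_def m_def flip: exp_add) (simp add: algebra_simps diff_divide_distrib)
    qed
    finally show ?case .
  qed
qed

section \<open>Exploring a random matching\<close>

text \<open>Edges are represented by left half-edges; \<alpha> and \<beta> are the vertices of left
  and right half-edges. Two edges are linked if they share a vertex.\<close>

definition linked :: "'a set \<Rightarrow> ('a \<Rightarrow> 'v) \<Rightarrow> ('b \<Rightarrow> 'w) \<Rightarrow> ('a \<Rightarrow> 'b) \<Rightarrow> ('a \<times> 'a) set" where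
  "linked A \<alpha> \<beta> f = {(x, x'). x \<in> A \<and> x' \<in> A \<and> (\<alpha> x = \<alpha> x' \<or> \<beta> (f x) = \<beta> (f x'))}"

text \<open>The edges that are reached from a set L of active left and a set R of active right
  half-edges. Both kinds are needed for a recursion that reveals a single partner at a time.\<close>

definition explored ::
  "'a set \<Rightarrow> ('a \<Rightarrow> 'v) \<Rightarrow> ('b \<Rightarrow> 'w) \<Rightarrow> ('a \<Rightarrow> 'b) \<Rightarrow> 'a set \<Rightarrow> 'b set \<Rightarrow> 'a set" where
  "explored A \<alpha> \<beta> f L R = (linked A \<alpha> \<beta> f)\<^sup>* `` (L \<union> {x \<in> A. f x \<in> R})"

definition fib :: "'a set \<Rightarrow> ('a \<Rightarrow> 'v) \<Rightarrow> 'a \<Rightarrow> 'a set" where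
  "fib S \<alpha> x = {x' \<in> S. \<alpha> x' = \<alpha> x}"

lemma explored_start: "L \<subseteq> explored A \<alpha> \<beta> f L R" "x \<in> A \<Longrightarrow> f x \<in> R \<Longrightarrow> x \<in> explored A \<alpha> \<beta> f L R"
  by (auto simp: explored_def)

lemma explored_link:
  assumes "x \<in> explored A \<alpha> \<beta> f L R" "x \<in> A" "x' \<in> A" "\<alpha> x = \<alpha> x' \<or> \<beta> (f x) = \<beta> (f x')"
  shows "x' \<in> explored A \<alpha> \<beta> f L R"
proof -
  obtain z where "z \<in> L \<union> {x \<in> A. f x \<in> R}" "(z, x) \<in> (linked A \<alpha> \<beta> f)\<^sup>*"
    using assms(1) by (auto simp: explored_def)
  moreover have "(x, x') \<in> linked A \<alpha> \<beta> f" using assms by (auto simp: linked_def)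
  ultimately show ?thesis unfolding explored_def by (meson ImageI rtrancl.rtrancl_into_rtrancl)
qed

lemma explored_least:
  assumes "L \<subseteq> E" "\<And>x. x \<in> A \<Longrightarrow> f x \<in> R \<Longrightarrow> x \<in> E"
    and "\<And>x x'. x \<in> E \<Longrightarrow> x \<in> A \<Longrightarrow> x' \<in> A \<Longrightarrow> \<alpha> x = \<alpha> x' \<or> \<beta> (f x) = \<beta> (f x') \<Longrightarrow> x' \<in> E"
  shows "explored A \<alpha> \<beta> f L R \<subseteq> E"
proof
  fix x assume "x \<in> explored A \<alpha> \<beta> f L R"
  then obtain z where z: "z \<in> L \<union> {x \<in> A. f x \<in> R}" and "(z, x) \<in> (linked A \<alpha> \<beta> f)\<^sup>*"
    by (auto simp: explored_def)
  from this(2) show "x \<in> E"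
    by (induction rule: rtrancl_induct) (use z assms in \<open>auto simp: linked_def\<close>)
qed

lemma explored_subset: "L \<subseteq> A \<Longrightarrow> explored A \<alpha> \<beta> f L R \<subseteq> A"
  by (rule explored_least) auto

lemma finite_explored: "finite A \<Longrightarrow> L \<subseteq> A \<Longrightarrow> finite (explored A \<alpha> \<beta> f L R)"
  using explored_subset finite_subset by metis

lemma explored_mono: "L \<subseteq> L' \<Longrightarrow> explored A \<alpha> \<beta> f L R \<subseteq> explored A \<alpha> \<beta> f L' R"
  by (auto simp: explored_def)

lemma explored_Union: "explored A \<alpha> \<beta> f (\<Union>i\<in>I. L i) {} = (\<Union>i\<in>I. explored A \<alpha> \<beta> f (L i) {})"
  by (auto simp: explored_def)

text \<open>Reveal the partner y of an active x. In a lower bound for what is reached, any part of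
  the other half-edges at the vertices of x and y may be declared active.\<close>

lemma explored_step_supset:
  assumes "L \<subseteq> A" "x \<in> A" "x \<in> L \<or> y \<in> R" "f \<in> matchings (A - {x}) (B - {y})"
    and that: "LL \<subseteq> fib A \<alpha> x" "RR \<subseteq> fib B \<beta> y"
  shows "insert x (explored (A - {x}) \<alpha> \<beta> f ((L \<union> LL) - {x}) ((R \<union> RR) - {y}))
    \<subseteq> explored A \<alpha> \<beta> (f(x := y)) L R"
proof -
  let ?E = "explored A \<alpha> \<beta> (f(x := y)) L R"
  have x: "x \<in> ?E"
    using assms(2,3) explored_start(1)[of L A \<alpha> \<beta> "f(x := y)" R]
      explored_start(2)[of x A "f(x := y)" R \<alpha> \<beta> L] by auto
  have "explored (A - {x}) \<alpha> \<beta> f ((L \<union> LL) - {x}) ((R \<union> RR) - {y}) \<subseteq> ?E"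
  proof (rule explored_least)
    have "LL \<subseteq> ?E" using that(1) x explored_link[OF x assms(2)] by (auto simp: fib_def)
    then show "L \<union> LL - {x} \<subseteq> ?E" using explored_start(1)[of L A \<alpha> \<beta> "f(x := y)" R] by blast
  next
    fix z assume z: "z \<in> A - {x}" "f z \<in> R \<union> RR - {y}"
    show "z \<in> ?E"
    proof (cases "f z \<in> R")
      case True then show ?thesis using z explored_start(2)[of z A "f(x := y)" R] by auto
    next
      case False
      then have "\<beta> ((f(x := y)) x) = \<beta> ((f(x := y)) z)" using z that(2) by (auto simp: fib_def)
      then show ?thesis using explored_link[OF x assms(2)] z by blast
    qed
  next
    fix z z' assume "z \<in> ?E" "z \<in> A - {x}" "z' \<in> A - {x}" "\<alpha> z = \<alpha> z' \<or> \<beta> (f z) = \<beta> (f z')"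
    then show "z' \<in> ?E" using explored_link[of z A \<alpha> \<beta> "f(x := y)" L R z'] by auto
  qed
  then show ?thesis using x by blast
qed

lemma card_explored_step:
  assumes "finite A" "L \<subseteq> A" "x \<in> A" "x \<in> L \<or> y \<in> R" "f \<in> matchings (A - {x}) (B - {y})"
    "LL \<subseteq> fib A \<alpha> x" "RR \<subseteq> fib B \<beta> y"
  shows "card (explored A \<alpha> \<beta> (f(x := y)) L R)
    \<ge> Suc (card (explored (A - {x}) \<alpha> \<beta> f ((L \<union> LL) - {x}) ((R \<union> RR) - {y})))"
proof -
  let ?D = "explored (A - {x}) \<alpha> \<beta> f ((L \<union> LL) - {x}) ((R \<union> RR) - {y})"
  have sub: "?D \<subseteq> A - {x}" using assms by (intro explored_subset) (auto simp: fib_def)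
  then have "Suc (card ?D) = card (insert x ?D)" using assms(1) finite_subset
    by (subst card_insert_disjoint) auto
  also have "\<dots> \<le> card (explored A \<alpha> \<beta> (f(x := y)) L R)"
    using assms by (intro card_mono finite_explored explored_step_supset) auto
  finally show ?thesis .
qed

text \<open>Nothing else is reached if all the other half-edges at the vertices of x and y become
  active.\<close>

lemma explored_step_subset:
  assumes "L \<subseteq> A" "R \<subseteq> B" "x \<in> A" "y \<in> B" "f \<in> matchings (A - {x}) (B - {y})"
    and "fib A \<alpha> x \<subseteq> L'" "fib B \<beta> y \<subseteq> R'" "L \<subseteq> L'" "R \<subseteq> R'"
  shows "explored A \<alpha> \<beta> (f(x := y)) L R \<subseteq> insert x (explored (A - {x}) \<alpha> \<beta> f (L' - {x}) (R' - {y}))"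
    (is "_ \<subseteq> insert x ?D")
proof (rule explored_least)
  have noty: "f z \<noteq> y" if "z \<in> A - {x}" for z using matchings_mem[OF assms(5) that] by auto
  show "L \<subseteq> insert x ?D" using explored_start(1)[of "L' - {x}"] assms by blast
  show "z \<in> insert x ?D" if "z \<in> A" "(f(x := y)) z \<in> R" for z
  proof (cases "z = x")
    case False
    then have "f z \<in> R' - {y}" "z \<in> A - {x}" using that assms(9) noty[of z] by auto
    then show ?thesis using explored_start(2)[of z "A - {x}" f "R' - {y}"] by blast
  qed simp
  fix z z' assume z: "z \<in> insert x ?D" "z \<in> A" "z' \<in> A"
    and zz: "\<alpha> z = \<alpha> z' \<or> \<beta> ((f(x := y)) z) = \<beta> ((f(x := y)) z')"
  show "z' \<in> insert x ?D"
  proof (cases "z' = x")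
    case False
    show ?thesis
    proof (cases "z = x")
      case True
      have "z' \<in> L' - {x} \<or> f z' \<in> R' - {y}"
        using zz True False assms(6,7) z noty[of z'] matchings_mem[OF assms(5), of z'] by (auto simp: fib_def)
      then show ?thesis using explored_start(1)[of "L' - {x}"] False z
          explored_start(2)[of z' "A - {x}" f "R' - {y}"] by blast
    next
      case zx: False
      then show ?thesis using explored_link[of z "A - {x}" \<alpha> \<beta> f "L' - {x}" "R' - {y}" z'] z zz False by auto
    qed
  qed simp
qed

lemma card_explored_step_le:
  assumes "finite A" "L \<subseteq> A" "R \<subseteq> B" "x \<in> A" "y \<in> B" "f \<in> matchings (A - {x}) (B - {y})"
    and "fib A \<alpha> x \<subseteq> L'" "fib B \<beta> y \<subseteq> R'" "L \<subseteq> L'" "R \<subseteq> R'" "L' \<subseteq> A"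
  shows "card (explored A \<alpha> \<beta> (f(x := y)) L R) \<le> Suc (card (explored (A - {x}) \<alpha> \<beta> f (L' - {x}) (R' - {y})))"
proof -
  let ?D = "explored (A - {x}) \<alpha> \<beta> f (L' - {x}) (R' - {y})"
  have fin: "finite ?D" using assms by (intro finite_explored) auto
  have "card (explored A \<alpha> \<beta> (f(x := y)) L R) \<le> card (insert x ?D)"
    using assms fin by (intro card_mono explored_step_subset) auto
  then show ?thesis using fin by (simp add: card_insert_if split: if_splits)
qed

text \<open>The invariant of an exploration: among the half-edges S' that have not been used, those
  that are not active form complete vertices. Hence an encounter with such a vertex of degree k adds
  exactly k - 1 active half-edges, as \<open>card_discover\<close> states, no matter what has been
  removed before.\<close>

definition explorable :: "'a set \<Rightarrow> ('a \<Rightarrow> 'v) \<Rightarrow> 'a set \<Rightarrow> 'a set \<Rightarrow> bool" where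
  "explorable S \<alpha> S' L \<longleftrightarrow> L \<subseteq> S' \<and> S' \<subseteq> S \<and> (\<forall>x\<in>S' - L. fib S \<alpha> x \<subseteq> S' - L)"

lemma explorable_self:
  assumes "L \<subseteq> S" "\<And>x. x \<in> L \<Longrightarrow> fib S \<alpha> x \<subseteq> L"
  shows "explorable S \<alpha> S L"
proof -
  have "x' \<notin> L" if "x \<in> S - L" "x' \<in> fib S \<alpha> x" for x x'
  proof
    assume "x' \<in> L"
    moreover have "x \<in> fib S \<alpha> x'" using that by (auto simp: fib_def)
    ultimately show False using assms(2)[of x'] that(1) by blast
  qed
  then show ?thesis using assms(1) unfolding explorable_def by (auto simp: fib_def)
qed

lemma explorable_remove: "explorable S \<alpha> S' L \<Longrightarrow> x \<in> L \<Longrightarrow> explorable S \<alpha> (S' - {x}) (L - {x})"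
  unfolding explorable_def by (auto simp: fib_def)

lemma explorable_fib_active:
  assumes "explorable S \<alpha> S' L" "x \<in> L"
  shows "fib S' \<alpha> x \<subseteq> L"
proof
  fix x' assume x': "x' \<in> fib S' \<alpha> x"
  show "x' \<in> L"
  proof (rule ccontr)
    assume "x' \<notin> L"
    then have "x' \<in> S' - L" using x' by (auto simp: fib_def)
    then have "fib S \<alpha> x' \<subseteq> S' - L" using assms(1) by (auto simp: explorable_def)
    moreover have "x \<in> fib S \<alpha> x'" using x' assms by (auto simp: explorable_def fib_def)
    ultimately show False using assms(2) by blast
  qed
qed

lemma explorable_fib_fresh: "explorable S \<alpha> S' L \<Longrightarrow> x \<in> S' - L \<Longrightarrow> fib S' \<alpha> x = fib S \<alpha> x \<and> fib S \<alpha> x \<inter> L = {}"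
  unfolding explorable_def fib_def by blast

lemma explorable_discover:
  assumes "explorable S \<alpha> S' L" "x \<in> S' - L"
  shows "explorable S \<alpha> (S' - {x}) (L \<union> fib S' \<alpha> x - {x})"
proof -
  have "fib S \<alpha> z \<subseteq> (S' - {x}) - (L \<union> fib S' \<alpha> x - {x})"
    if z: "z \<in> (S' - {x}) - (L \<union> fib S' \<alpha> x - {x})" for z
  proof -
    have "fib S \<alpha> z \<subseteq> S' - L" using z assms(1) by (auto simp: explorable_def)
    moreover have "\<alpha> z \<noteq> \<alpha> x" using z by (auto simp: fib_def)
    ultimately show ?thesis by (auto simp: fib_def)
  qed
  then show ?thesis using assms unfolding explorable_def by (auto simp: fib_def)
qed

lemma card_discover:
  assumes "finite S" "explorable S \<alpha> S' L" "x \<in> S' - L"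
  shows "card (L \<union> fib S' \<alpha> x - {x}) = card L + (card (fib S \<alpha> x) - 1)"
proof -
  have e: "fib S' \<alpha> x = fib S \<alpha> x" "fib S \<alpha> x \<inter> L = {}" using explorable_fib_fresh[OF assms(2,3)] by auto
  have x: "x \<in> fib S \<alpha> x" using assms(2,3) by (auto simp: fib_def explorable_def)
  have fin: "finite L" "finite (fib S \<alpha> x)"
    using assms finite_subset[of L S] by (auto simp: fib_def explorable_def)
  have "L \<union> fib S' \<alpha> x - {x} = L \<union> (fib S \<alpha> x - {x})" using e assms(3) by auto
  moreover have "card (L \<union> (fib S \<alpha> x - {x})) = card L + card (fib S \<alpha> x - {x})"
    using e fin by (intro card_Un_disjoint) auto
  ultimately show ?thesis using fin x by simp
qed

lemma card_le_explored:
  assumes "finite A" "L \<subseteq> A" "f \<in> matchings A B" "R \<subseteq> B"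
  shows "card L \<le> card (explored A \<alpha> \<beta> f L R)" "card R \<le> card (explored A \<alpha> \<beta> f L R)"
proof -
  have fin: "finite (explored A \<alpha> \<beta> f L R)" using assms by (intro finite_explored)
  show "card L \<le> card (explored A \<alpha> \<beta> f L R)"
    using fin explored_start(1) by (rule card_mono)
  have "R \<subseteq> f ` explored A \<alpha> \<beta> f L R"
  proof
    fix y assume "y \<in> R"
    then have "y \<in> f ` A" using matchings_image[OF assms(3)] assms(4) by auto
    then obtain x where "x \<in> A" "y = f x" by auto
    then show "y \<in> f ` explored A \<alpha> \<beta> f L R"
      using \<open>y \<in> R\<close> explored_start(2)[of x A f R] by blast
  qed
  then have "card R \<le> card (f ` explored A \<alpha> \<beta> f L R)" using fin by (intro card_mono) auto
  also have "\<dots> \<le> card (explored A \<alpha> \<beta> f L R)" using fin by (rule card_image_le)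
  finally show "card R \<le> card (explored A \<alpha> \<beta> f L R)" .
qed

text \<open>One step of the induction below, averaged over the partner y. A partner in R is a
  collision, which has probability at most K0 / h1 and is estimated trivially; the average of the
  powers of \<theta> is controlled by the supersolution property.\<close>

lemma avg_supersolution:
  fixes \<phi> :: "'b \<Rightarrow> real"
  assumes "finite B0" "B \<subseteq> B0" "R \<subseteq> B" "card R \<le> K0" "h1 \<le> card B" "h1 > 0"
    and "0 \<le> \<theta>" "0 \<le> c" "0 \<le> e" "0 \<le> t"
    and super: "(\<Sum>y\<in>B0. \<theta> ^ d y) \<le> t * real h1"
    and le: "\<And>y. y \<in> B \<Longrightarrow> \<phi> y \<le> (if y \<in> R then 1 else c * \<theta> ^ d y + e)"
  shows "(\<Sum>y\<in>B. \<phi> y) / real (card B) \<le> c * t + e + real K0 / real h1"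
proof -
  have fin: "finite B" using assms finite_subset by blast
  have pos: "real (card B) > 0" using assms by simp
  have "(\<Sum>y\<in>B. \<phi> y) \<le> (\<Sum>y\<in>B. of_bool (y \<in> R) + (c * \<theta> ^ d y + e))"
  proof (rule sum_mono)
    fix y assume "y \<in> B"
    from le[OF this] show "\<phi> y \<le> of_bool (y \<in> R) + (c * \<theta> ^ d y + e)"
    proof (cases "y \<in> R")
      case True
      have "0 \<le> c * \<theta> ^ d y + e" using assms by simp
      then show ?thesis using True \<open>\<phi> y \<le> _\<close> by simp
    qed (use \<open>\<phi> y \<le> _\<close> in simp)
  qed
  also have "\<dots> = real (card R) + c * (\<Sum>y\<in>B. \<theta> ^ d y) + real (card B) * e"
    using fin assms(3) by (simp add: sum.distrib sum_distrib_left sum.If_cases of_bool_def Int_absorb1 Int_commute)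
  also have "\<dots> \<le> real K0 + c * (t * real h1) + real (card B) * e"
  proof -
    have "(\<Sum>y\<in>B. \<theta> ^ d y) \<le> (\<Sum>y\<in>B0. \<theta> ^ d y)"
      using assms by (intro sum_mono2) auto
    then have "(\<Sum>y\<in>B. \<theta> ^ d y) \<le> t * real h1" using super by simp
    then have "c * (\<Sum>y\<in>B. \<theta> ^ d y) \<le> c * (t * real h1)" using assms by (intro mult_left_mono) auto
    then show ?thesis using assms by simp
  qed
  finally have "(\<Sum>y\<in>B. \<phi> y) / real (card B) \<le> (real K0 + c * (t * real h1) + real (card B) * e) / real (card B)"
    using pos by (intro divide_right_mono) auto
  also have "\<dots> = real K0 / real (card B) + c * t * (real h1 / real (card B)) + e"
    using pos by (simp add: field_simps)
  also have "\<dots> \<le> real K0 / real h1 + c * t * 1 + e"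
  proof -
    have "real K0 / real (card B) \<le> real K0 / real h1"
      using assms by (intro divide_left_mono) auto
    moreover have "c * t * (real h1 / real (card B)) \<le> c * t * 1"
      using assms pos by (intro mult_left_mono) (auto simp: divide_le_eq)
    ultimately show ?thesis by simp
  qed
  finally show ?thesis by simp
qed

text \<open>Up to collisions, each active half-edge starts an independent branching process, and the
  pair \<open>(\<theta>l, \<theta>r)\<close> is a supersolution of the equations for the extinction
  probabilities. Therefore \<open>\<theta>l ^ card L * \<theta>r ^ card R\<close> is a
  supermartingale. The averages in SB and SA are taken with respect to h1, a lower bound for the
  number of half-edges that remain, which makes them robust against the removal of those that have
  been used. The bound does not refer to limits, so it also applies to modified vertex
  labels.\<close>

lemma explored_small_le:
  fixes \<theta>l \<theta>r :: real
  assumes fin: "finite A0" "finite B0" and th: "0 \<le> \<theta>l" "\<theta>l \<le> 1" "0 \<le> \<theta>r" "\<theta>r \<le> 1" and h1: "h1 > 0"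
    and SB: "(\<Sum>y\<in>B0. \<theta>r ^ (card (fib B0 \<beta> y) - 1)) \<le> \<theta>l * real h1"
    and SA: "(\<Sum>x\<in>A0. \<theta>l ^ (card (fib A0 \<alpha> x) - 1)) \<le> \<theta>r * real h1"
    and "explorable A0 \<alpha> A L" "explorable B0 \<beta> B R" "card A = card B" "K \<le> K0" "h1 + K \<le> card A"
  shows "uprob (matchings A B) (\<lambda>f. card (explored A \<alpha> \<beta> f L R) \<le> K)
    \<le> \<theta>l ^ card L * \<theta>r ^ card R + real K * real K0 / real h1"
  using assms(10-)
proof (induction K arbitrary: A B L R)
  case 0
  have finA: "finite A" "finite B" "L \<subseteq> A" "R \<subseteq> B" using 0 fin finite_subset by (auto simp: explorable_def)
  then have finL: "finite L" "finite R" using finite_subset by auto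
  show ?case
  proof (cases "L = {} \<and> R = {}")
    case False
    have "uprob (matchings A B) (\<lambda>f. card (explored A \<alpha> \<beta> f L R) \<le> 0) = 0"
    proof (rule uprob_const_False)
      fix f assume "f \<in> matchings A B"
      from card_le_explored[OF finA(1,3) this finA(4), of \<alpha> \<beta>]
      show "\<not> card (explored A \<alpha> \<beta> f L R) \<le> 0" using False finL by auto
    qed
    then show ?thesis using th by simp
  qed simp
next
  case (Suc K)
  have sub: "A \<subseteq> A0" "B \<subseteq> B0" "L \<subseteq> A" "R \<subseteq> B" using Suc.prems by (auto simp: explorable_def)
  have finA: "finite A" "finite B" using finite_subset[OF sub(1) fin(1)] finite_subset[OF sub(2) fin(2)] by auto
  have finL: "finite L" "finite R"
    using finite_subset[OF sub(3) finA(1)] finite_subset[OF sub(4) finA(2)] by auto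
  let ?P = "\<lambda>A B L R K. uprob (matchings A B) (\<lambda>f. card (explored A \<alpha> \<beta> f L R) \<le> K)"
  define e where "e = real K * real K0 / real h1"
  have e0: "0 \<le> e" by (simp add: e_def)
  have goal_e: "real (Suc K) * real K0 / real h1 = e + real K0 / real h1"
    by (simp add: e_def add_divide_distrib algebra_simps)
  have hc: "h1 \<le> card B" "h1 \<le> card A" using Suc.prems by auto
  \<comment> \<open>With more than \<open>Suc K\<close> active half-edges on the right the
    exploration cannot stay small. This case is split off since the collision estimate needs a bound
    on R. Left half-edges are used up first, so that there are no collisions when a right one is
    revealed.\<close>
  consider "card R > Suc K" | "L = {}" "R = {}" | "L \<noteq> {}" "card R \<le> Suc K" | "L = {}" "R \<noteq> {}" by linarith
  then show ?case
  proof cases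
    case 1
    have "?P A B L R (Suc K) = 0"
    proof (rule uprob_const_False)
      fix f assume "f \<in> matchings A B"
      from card_le_explored(2)[OF finA(1) sub(3) this sub(4), of \<alpha> \<beta>]
      show "\<not> card (explored A \<alpha> \<beta> f L R) \<le> Suc K" using 1 by linarith
    qed
    then show ?thesis using th by simp
  next
    case 2
    have "?P A B L R (Suc K) \<le> 1" by simp
    also have "1 \<le> 1 + real (Suc K) * real K0 / real h1" by simp
    finally show ?thesis using 2 by simp
  next
    case 3
    then obtain x where x: "x \<in> L" by auto
    then have xA: "x \<in> A" using sub by auto
    have cL: "card L = Suc (card (L - {x}))" using x finL by (metis card_Suc_Diff1)
    define \<phi> where "\<phi> y = uprob (matchings (A - {x}) (B - {y})) (\<lambda>f. card (explored A \<alpha> \<beta> (f(x := y)) L R) \<le> Suc K)" for y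
    have "?P A B L R (Suc K) = (\<Sum>y\<in>B. \<phi> y) / real (card B)"
      unfolding \<phi>_def by (rule uprob_matchings_left) (use finA Suc.prems xA in auto)
    also have "\<dots> \<le> (\<theta>l ^ card (L - {x}) * \<theta>r ^ card R) * \<theta>l + e + real K0 / real h1"
    proof (rule avg_supersolution[OF fin(2) sub(2,4) _ hc(1) h1 th(3) _ e0 th(1) SB])
      show "card R \<le> K0" using 3 Suc.prems by linarith
      show "0 \<le> \<theta>l ^ card (L - {x}) * \<theta>r ^ card R" using th by simp
      fix y assume y: "y \<in> B"
      show "\<phi> y \<le> (if y \<in> R then 1 else \<theta>l ^ card (L - {x}) * \<theta>r ^ card R * \<theta>r ^ (card (fib B0 \<beta> y) - 1) + e)"
      proof (cases "y \<in> R")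
        case True then show ?thesis by (simp add: \<phi>_def)
      next
        case False
        then have y': "y \<in> B - R" using y by auto
        let ?R = "R \<union> fib B \<beta> y - {y}"
        have "\<phi> y \<le> ?P (A - {x}) (B - {y}) (L - {x}) ?R K"
          unfolding \<phi>_def
        proof (rule uprob_mono)
          show "finite (matchings (A - {x}) (B - {y}))" using finA by (intro finite_matchings_of_finite) auto
          fix f assume "f \<in> matchings (A - {x}) (B - {y})" "card (explored A \<alpha> \<beta> (f(x := y)) L R) \<le> Suc K"
          then show "card (explored (A - {x}) \<alpha> \<beta> f (L - {x}) ?R) \<le> K"
            using card_explored_step[OF finA(1) sub(3) xA, of y R f B "{}" \<alpha> "fib B \<beta> y" \<beta>] x by simp
        qed
        also have "\<dots> \<le> \<theta>l ^ card (L - {x}) * \<theta>r ^ card ?R + e"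
          unfolding e_def
          by (rule Suc.IH) (use Suc.prems explorable_remove[OF Suc.prems(1) x]
              explorable_discover[OF Suc.prems(2) y'] xA y finA in auto)
        also have "card ?R = card R + (card (fib B0 \<beta> y) - 1)"
          by (rule card_discover[OF fin(2) Suc.prems(2) y'])
        finally show ?thesis using False by (simp add: power_add mult.assoc)
      qed
    qed
    finally show ?thesis unfolding goal_e by (simp add: cL algebra_simps)
  next
    case 4
    then obtain y where y: "y \<in> R" by auto
    then have yB: "y \<in> B" using sub by auto
    have cR: "card R = Suc (card (R - {y}))" using y finL by (metis card_Suc_Diff1)
    define \<phi> where "\<phi> x = uprob (matchings (A - {x}) (B - {y})) (\<lambda>f. card (explored A \<alpha> \<beta> (f(x := y)) L R) \<le> Suc K)" for x
    have "?P A B L R (Suc K) = (\<Sum>x\<in>A. \<phi> x) / real (card A)"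
      unfolding \<phi>_def by (rule uprob_matchings_right) (use finA Suc.prems yB in auto)
    also have "\<dots> \<le> \<theta>r ^ card (R - {y}) * \<theta>r + e + real K0 / real h1"
    proof (rule avg_supersolution[OF fin(1) sub(1) _ _ hc(2) h1 th(1) _ e0 th(3) SA, where R = "{}"])
      show "0 \<le> \<theta>r ^ card (R - {y})" using th by simp
      fix x assume x: "x \<in> A"
      then have x': "x \<in> A - L" using 4 by auto
      let ?L = "L \<union> fib A \<alpha> x - {x}"
      have "\<phi> x \<le> ?P (A - {x}) (B - {y}) ?L (R - {y}) K"
        unfolding \<phi>_def
      proof (rule uprob_mono)
        show "finite (matchings (A - {x}) (B - {y}))" using finA by (intro finite_matchings_of_finite) auto
        fix f assume "f \<in> matchings (A - {x}) (B - {y})" "card (explored A \<alpha> \<beta> (f(x := y)) L R) \<le> Suc K"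
        then show "card (explored (A - {x}) \<alpha> \<beta> f ?L (R - {y})) \<le> K"
          using card_explored_step[OF finA(1) sub(3) x, of y R f B "fib A \<alpha> x" \<alpha> "{}" \<beta>] y by simp
      qed
      also have "\<dots> \<le> \<theta>l ^ card ?L * \<theta>r ^ card (R - {y}) + e"
        unfolding e_def
        by (rule Suc.IH) (use Suc.prems explorable_remove[OF Suc.prems(2) y]
            explorable_discover[OF Suc.prems(1) x'] x yB finA in auto)
      also have "card ?L = card L + (card (fib A0 \<alpha> x) - 1)"
        by (rule card_discover[OF fin(1) Suc.prems(1) x'])
      finally show "\<phi> x \<le> (if x \<in> {} then 1 else \<theta>r ^ card (R - {y}) * \<theta>l ^ (card (fib A0 \<alpha> x) - 1) + e)"
        using 4 by (simp add: mult.commute)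
    qed auto
    finally show ?thesis unfolding goal_e using 4 by (simp add: cR algebra_simps)
  qed
qed

text \<open>In a lower bound the collisions are simply dropped from the sum over the
  partners.\<close>

lemma explored_small_step_left:
  assumes fin: "finite A0" "finite B0" and ex: "explorable A0 \<alpha> A L" "explorable B0 \<beta> B R"
    and c: "card A = card B" and x: "x \<in> L"
  shows "(\<Sum>y\<in>B - R. uprob (matchings (A - {x}) (B - {y}))
      (\<lambda>f. card (explored (A - {x}) \<alpha> \<beta> f (L - {x}) (R \<union> fib B \<beta> y - {y})) \<le> K)) / real (card B)
    \<le> uprob (matchings A B) (\<lambda>f. card (explored A \<alpha> \<beta> f L R) \<le> Suc K)"
proof -
  have sub: "A \<subseteq> A0" "B \<subseteq> B0" "L \<subseteq> A" "R \<subseteq> B" using ex by (auto simp: explorable_def)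
  have finA: "finite A" "finite B" using finite_subset[OF sub(1) fin(1)] finite_subset[OF sub(2) fin(2)] by auto
  have xA: "x \<in> A" using sub x by auto
  let ?Q = "\<lambda>y. uprob (matchings (A - {x}) (B - {y})) (\<lambda>f. card (explored A \<alpha> \<beta> (f(x := y)) L R) \<le> Suc K)"
  have "(\<Sum>y\<in>B - R. uprob (matchings (A - {x}) (B - {y}))
      (\<lambda>f. card (explored (A - {x}) \<alpha> \<beta> f (L - {x}) (R \<union> fib B \<beta> y - {y})) \<le> K)) \<le> (\<Sum>y\<in>B - R. ?Q y)"
  proof (rule sum_mono, rule uprob_mono)
    fix y f assume y: "y \<in> B - R" and f: "f \<in> matchings (A - {x}) (B - {y})"
      and le: "card (explored (A - {x}) \<alpha> \<beta> f (L - {x}) (R \<union> fib B \<beta> y - {y})) \<le> K"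
    have "card (explored A \<alpha> \<beta> (f(x := y)) L R)
        \<le> Suc (card (explored (A - {x}) \<alpha> \<beta> f (L - {x}) (R \<union> fib B \<beta> y - {y})))"
      by (rule card_explored_step_le[OF finA(1) sub(3,4) xA _ f])
         (use y sub explorable_fib_active[OF ex(1) x] in auto)
    then show "card (explored A \<alpha> \<beta> (f(x := y)) L R) \<le> Suc K" using le by linarith
  qed (use finA in \<open>auto intro: finite_matchings_of_finite\<close>)
  also have "\<dots> \<le> (\<Sum>y\<in>B. ?Q y)" using finA by (intro sum_mono2) auto
  finally show ?thesis
    by (subst uprob_matchings_left[OF finA c xA]) (rule divide_right_mono, auto)
qed

lemma explored_small_step_right:
  assumes fin: "finite A0" "finite B0" and ex: "explorable A0 \<alpha> A L" "explorable B0 \<beta> B R"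
    and c: "card A = card B" and y: "y \<in> R"
  shows "(\<Sum>x\<in>A - L. uprob (matchings (A - {x}) (B - {y}))
      (\<lambda>f. card (explored (A - {x}) \<alpha> \<beta> f (L \<union> fib A \<alpha> x - {x}) (R - {y})) \<le> K)) / real (card A)
    \<le> uprob (matchings A B) (\<lambda>f. card (explored A \<alpha> \<beta> f L R) \<le> Suc K)"
proof -
  have sub: "A \<subseteq> A0" "B \<subseteq> B0" "L \<subseteq> A" "R \<subseteq> B" using ex by (auto simp: explorable_def)
  have finA: "finite A" "finite B" using finite_subset[OF sub(1) fin(1)] finite_subset[OF sub(2) fin(2)] by auto
  have yB: "y \<in> B" using sub y by auto
  let ?Q = "\<lambda>x. uprob (matchings (A - {x}) (B - {y})) (\<lambda>f. card (explored A \<alpha> \<beta> (f(x := y)) L R) \<le> Suc K)"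
  have "(\<Sum>x\<in>A - L. uprob (matchings (A - {x}) (B - {y}))
      (\<lambda>f. card (explored (A - {x}) \<alpha> \<beta> f (L \<union> fib A \<alpha> x - {x}) (R - {y})) \<le> K)) \<le> (\<Sum>x\<in>A - L. ?Q x)"
  proof (rule sum_mono, rule uprob_mono)
    fix x f assume x: "x \<in> A - L" and f: "f \<in> matchings (A - {x}) (B - {y})"
      and le: "card (explored (A - {x}) \<alpha> \<beta> f (L \<union> fib A \<alpha> x - {x}) (R - {y})) \<le> K"
    have "card (explored A \<alpha> \<beta> (f(x := y)) L R)
        \<le> Suc (card (explored (A - {x}) \<alpha> \<beta> f (L \<union> fib A \<alpha> x - {x}) (R - {y})))"
      by (rule card_explored_step_le[OF finA(1) sub(3,4) _ yB f])
         (use x sub explorable_fib_active[OF ex(2) y] in \<open>auto simp: fib_def\<close>)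
    then show "card (explored A \<alpha> \<beta> (f(x := y)) L R) \<le> Suc K" using le by linarith
  qed (use finA in \<open>auto intro: finite_matchings_of_finite\<close>)
  also have "\<dots> \<le> (\<Sum>x\<in>A. ?Q x)" using finA by (intro sum_mono2) auto
  finally show ?thesis
    by (subst uprob_matchings_right[OF finA c yB]) (rule divide_right_mono, auto)
qed

section \<open>Generating functions and extinction probabilities\<close>

definition is_law :: "(nat \<Rightarrow> real) \<Rightarrow> bool" where
  "is_law w \<longleftrightarrow> (\<forall>k. 0 \<le> w k) \<and> w sums 1"

text \<open>The generating function of X - 1 for X of law w. It is used for size-biased laws, which
  do not charge 0, so the truncated subtraction does no harm.\<close>

definition gen :: "(nat \<Rightarrow> real) \<Rightarrow> real \<Rightarrow> real" where
  "gen w z = (\<Sum>k. w k * z ^ (k - 1))"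

lemma is_law_nonneg: "is_law w \<Longrightarrow> 0 \<le> w k"
  and is_law_summable: "is_law w \<Longrightarrow> summable w"
  and is_law_suminf: "is_law w \<Longrightarrow> suminf w = 1"
  by (auto simp: is_law_def sums_iff)

lemma is_law_le_1: "is_law w \<Longrightarrow> w k \<le> 1"
  using sum_le_suminf[OF is_law_summable, of w "{k}"] is_law_nonneg is_law_suminf by fastforce

lemma is_law_summable_mult:
  assumes "is_law w" "\<And>k. 0 \<le> b k" "\<And>k. b k \<le> 1"
  shows "summable (\<lambda>k. w k * b k)"
proof (rule summable_comparison_test[OF _ is_law_summable[OF assms(1)]], intro exI allI impI)
  fix k show "norm (w k * b k) \<le> w k"
    using assms is_law_nonneg[OF assms(1), of k] by (simp add: mult_left_le)
qed

lemma gen_summable: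
  assumes "is_law w" "0 \<le> z" "z \<le> 1"
  shows "summable (\<lambda>k. w k * z ^ (k - 1))"
  by (rule is_law_summable_mult) (use assms in \<open>auto intro: power_le_one\<close>)

lemma gen_1: "is_law w \<Longrightarrow> gen w 1 = 1"
  by (simp add: gen_def is_law_suminf)

lemma gen_nonneg: "is_law w \<Longrightarrow> 0 \<le> z \<Longrightarrow> z \<le> 1 \<Longrightarrow> 0 \<le> gen w z"
  unfolding gen_def by (rule suminf_nonneg[OF gen_summable]) (auto simp: is_law_nonneg)

lemma gen_mono:
  assumes "is_law w" "0 \<le> x" "x \<le> y" "y \<le> 1"
  shows "gen w x \<le> gen w y"
  unfolding gen_def
proof (rule suminf_le)
  show "summable (\<lambda>k. w k * x ^ (k - 1))" "summable (\<lambda>k. w k * y ^ (k - 1))"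
    using assms by (auto intro!: gen_summable simp del: One_nat_def)
qed (use assms in \<open>auto intro!: mult_left_mono power_mono simp: is_law_nonneg\<close>)

lemma gen_le_1: "is_law w \<Longrightarrow> 0 \<le> z \<Longrightarrow> z \<le> 1 \<Longrightarrow> gen w z \<le> 1"
  using gen_mono[of w z 1] gen_1 by simp

lemma power_convex_combination:
  fixes a b s :: real
  assumes "0 \<le> a" "0 \<le> b" "0 \<le> s" "s \<le> 1"
  shows "((1 - s) * a + s * b) ^ n \<le> (1 - s) * a ^ n + s * b ^ n"
proof (induction n)
  case (Suc n)
  have "((1 - s) * a + s * b) ^ Suc n \<le> ((1 - s) * a + s * b) * ((1 - s) * a ^ n + s * b ^ n)"
    using Suc assms by (auto intro!: mult_left_mono)
  also have "\<dots> = (1 - s) * a ^ Suc n + s * b ^ Suc n - s * (1 - s) * ((a - b) * (a ^ n - b ^ n))"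
    by (simp add: algebra_simps)
  also have "\<dots> \<le> (1 - s) * a ^ Suc n + s * b ^ Suc n"
  proof -
    have "0 \<le> (a - b) * (a ^ n - b ^ n)"
      using power_mono[of a b n] power_mono[of b a n] assms
      by (cases "a \<le> b") (auto intro: mult_nonneg_nonneg mult_nonpos_nonpos)
    then have "0 \<le> s * (1 - s) * ((a - b) * (a ^ n - b ^ n))" using assms by simp
    then show ?thesis by linarith
  qed
  finally show ?case .
qed simp

lemma gen_convex:
  assumes w: "is_law w" and "0 \<le> a" "a \<le> 1" "0 \<le> b" "b \<le> 1" "0 \<le> s" "s \<le> 1"
  shows "gen w ((1 - s) * a + s * b) \<le> (1 - s) * gen w a + s * gen w b"
proof -
  have le: "(1 - s) * a + s * b \<le> 1" using assms convex_bound_le[of a 1 b "1 - s" s] by auto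
  have sums: "(\<lambda>k. (1 - s) * (w k * a ^ (k - 1)) + s * (w k * b ^ (k - 1))) sums
      ((1 - s) * gen w a + s * gen w b)"
    unfolding gen_def using assms by (intro sums_add sums_mult summable_sums gen_summable) auto
  have "gen w ((1 - s) * a + s * b) \<le> (\<Sum>k. (1 - s) * (w k * a ^ (k - 1)) + s * (w k * b ^ (k - 1)))"
    unfolding gen_def
  proof (rule suminf_le)
    fix k
    have "w k * ((1 - s) * a + s * b) ^ (k - 1) \<le> w k * ((1 - s) * a ^ (k - 1) + s * b ^ (k - 1))"
      using assms by (intro mult_left_mono power_convex_combination) (auto simp: is_law_nonneg)
    then show "w k * ((1 - s) * a + s * b) ^ (k - 1)
        \<le> (1 - s) * (w k * a ^ (k - 1)) + s * (w k * b ^ (k - 1))" by (simp add: algebra_simps)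
  next
    show "summable (\<lambda>k. w k * ((1 - s) * a + s * b) ^ (k - 1))"
      using assms le by (intro gen_summable) auto
  qed (use sums in \<open>auto simp: sums_iff\<close>)
  then show ?thesis using sums by (simp add: sums_iff)
qed

lemma gen_cont:
  assumes "is_law w"
  shows "continuous_on {0..1} (gen w)"
proof -
  have "uniform_limit {0..1} (\<lambda>n z. \<Sum>k<n. w k * z ^ (k - 1)) (\<lambda>z. \<Sum>k. w k * z ^ (k - 1)) sequentially"
    by (rule Weierstrass_m_test[OF _ is_law_summable[OF assms]])
       (auto simp: abs_mult is_law_nonneg[OF assms] power_abs intro!: mult_left_le power_le_one)
  then have "continuous_on {0..1} (\<lambda>z. \<Sum>k. w k * z ^ (k - 1))"
    by (rule uniform_limit_theorem[rotated]) (auto intro!: always_eventually continuous_intros)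
  then show ?thesis by (simp add: gen_def[abs_def])
qed

fun ext_iter :: "(nat \<Rightarrow> real) \<Rightarrow> (nat \<Rightarrow> real) \<Rightarrow> nat \<Rightarrow> real" where
  "ext_iter u v 0 = 0"
| "ext_iter u v (Suc t) = gen v (gen u (ext_iter u v t))"

text \<open>The extinction probability of the branching process that starts with one left half-edge.
  As the limit of the probabilities to die out within t rounds it is approached from below, which
  the lower bounds rely on.\<close>

definition ext_prob :: "(nat \<Rightarrow> real) \<Rightarrow> (nat \<Rightarrow> real) \<Rightarrow> real" where
  "ext_prob u v = lim (ext_iter u v)"

context
  fixes u v :: "nat \<Rightarrow> real"
  assumes laws: "is_law u" "is_law v"
begin

lemma gen_comp_bounds:
  assumes "0 \<le> x" "x \<le> 1"
  shows "0 \<le> gen v (gen u x)" "gen v (gen u x) \<le> 1"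
  using assms laws by (auto intro!: gen_nonneg gen_le_1)

lemma gen_comp_mono:
  assumes "0 \<le> x" "x \<le> y" "y \<le> 1"
  shows "gen v (gen u x) \<le> gen v (gen u y)"
  using assms laws by (intro gen_mono) (auto intro!: gen_nonneg gen_le_1)

lemma ext_iter_bounds: "0 \<le> ext_iter u v t" "ext_iter u v t \<le> 1"
  by (induction t) (use gen_comp_bounds in auto)

lemma ext_iter_le:
  assumes "0 \<le> x" "x \<le> 1" "gen v (gen u x) \<le> x"
  shows "ext_iter u v t \<le> x"
proof (induction t)
  case (Suc t)
  then show ?case using gen_comp_mono[of "ext_iter u v t" x] ext_iter_bounds[of t] assms by simp
qed (use assms in simp)

lemma ext_iter_incseq: "incseq (ext_iter u v)"
proof (rule incseq_SucI)
  fix t show "ext_iter u v t \<le> ext_iter u v (Suc t)"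
  proof (induction t)
    case 0 then show ?case using ext_iter_bounds[of 1] by simp
  next
    case (Suc t)
    have "gen v (gen u (ext_iter u v t)) \<le> gen v (gen u (ext_iter u v (Suc t)))"
      by (rule gen_comp_mono[OF ext_iter_bounds(1) Suc ext_iter_bounds(2)])
    then show ?case by simp
  qed
qed

lemma ext_iter_tendsto: "ext_iter u v \<longlonglongrightarrow> ext_prob u v"
proof -
  obtain L where "ext_iter u v \<longlonglongrightarrow> L"
    using incseq_convergent[OF ext_iter_incseq] ext_iter_bounds by metis
  then show ?thesis by (simp add: ext_prob_def limI)
qed

lemma ext_prob_bounds: "0 \<le> ext_prob u v" "ext_prob u v \<le> 1"
  using LIMSEQ_le_const[OF ext_iter_tendsto, of 0] LIMSEQ_le_const2[OF ext_iter_tendsto, of 1]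
    ext_iter_bounds by auto

lemma ext_prob_least: "0 \<le> x \<Longrightarrow> x \<le> 1 \<Longrightarrow> gen v (gen u x) \<le> x \<Longrightarrow> ext_prob u v \<le> x"
  using LIMSEQ_le_const2[OF ext_iter_tendsto, of x] ext_iter_le by auto

lemma gen_comp_cont: "continuous_on {0..1} (\<lambda>x. gen v (gen u x))"
  by (rule continuous_on_compose2[OF gen_cont[OF laws(2)] gen_cont[OF laws(1)]])
     (auto intro!: gen_nonneg gen_le_1 laws)

lemma ext_prob_fix: "gen v (gen u (ext_prob u v)) = ext_prob u v"
proof -
  have "(\<lambda>t. gen v (gen u (ext_iter u v t))) \<longlonglongrightarrow> gen v (gen u (ext_prob u v))"
    by (rule continuous_on_tendsto_compose[OF gen_comp_cont ext_iter_tendsto])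
       (use ext_prob_bounds ext_iter_bounds in auto)
  moreover have "(\<lambda>t. ext_iter u v (Suc t)) \<longlonglongrightarrow> ext_prob u v"
    using ext_iter_tendsto by (rule LIMSEQ_Suc)
  ultimately show ?thesis using LIMSEQ_unique by fastforce
qed

lemma ext_prob_eq_Least: "ext_prob u v = (LEAST x. 0 \<le> x \<and> x \<le> 1 \<and> x = gen v (gen u x))"
  by (rule sym, rule Least_equality) (use ext_prob_bounds ext_prob_fix ext_prob_least in auto)

lemma gen_comp_convex:
  assumes "0 \<le> a" "a \<le> 1" "0 \<le> b" "b \<le> 1" "0 \<le> s" "s \<le> 1"
  shows "gen v (gen u ((1 - s) * a + s * b)) \<le> (1 - s) * gen v (gen u a) + s * gen v (gen u b)"
proof -
  have le: "(1 - s) * a + s * b \<le> 1" using assms convex_bound_le[of a 1 b "1 - s" s] by auto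
  have le2: "(1 - s) * gen u a + s * gen u b \<le> 1"
    using assms convex_bound_le[of "gen u a" 1 "gen u b" "1 - s" s] gen_le_1[OF laws(1)] by auto
  have "gen v (gen u ((1 - s) * a + s * b)) \<le> gen v ((1 - s) * gen u a + s * gen u b)"
    using assms le le2 gen_convex[OF laws(1)] by (intro gen_mono laws gen_nonneg) auto
  also have "\<dots> \<le> (1 - s) * gen v (gen u a) + s * gen v (gen u b)"
    using assms gen_nonneg[OF laws(1)] gen_le_1[OF laws(1)] by (intro gen_convex laws) auto
  finally show ?thesis .
qed

end

lemma one_minus_power_bounds:
  fixes x :: real
  assumes "0 \<le> x" "x \<le> 1"
  shows "1 - x ^ j \<le> real j * (1 - x)" "real j * x ^ j * (1 - x) \<le> 1 - x ^ j"
proof -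
  have eq: "1 - x ^ j = (1 - x) * (\<Sum>i<j. x ^ i)"
    by (simp add: one_diff_power_eq)
  have "(\<Sum>i<j. x ^ i) \<le> (\<Sum>i<j. 1)" using assms by (intro sum_mono) (auto intro: power_le_one)
  then have "(1 - x) * (\<Sum>i<j. x ^ i) \<le> (1 - x) * real j" using assms by (intro mult_left_mono) auto
  then show "1 - x ^ j \<le> real j * (1 - x)" using eq by (simp add: mult.commute)
  have "(\<Sum>i<j. x ^ j) \<le> (\<Sum>i<j. x ^ i)" using assms by (intro sum_mono power_decreasing) auto
  then have "(1 - x) * (real j * x ^ j) \<le> (1 - x) * (\<Sum>i<j. x ^ i)" using assms by (intro mult_left_mono) auto
  then show "real j * x ^ j * (1 - x) \<le> 1 - x ^ j" using eq by (simp add: mult_ac)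
qed

lemma one_minus_power_less:
  fixes x :: real
  assumes "0 \<le> x" "x < 1" "j \<ge> 2"
  shows "1 - x ^ j < real j * (1 - x)"
proof -
  obtain i where j: "j = Suc i" "i \<ge> 1" using assms by (cases j) auto
  have "x ^ i < 1" using power_strict_mono[of x 1 i] assms j by simp
  then have "x ^ i * (1 - x) < 1 * (1 - x)" using assms by (intro mult_strict_right_mono) auto
  moreover have "1 - x ^ j = (1 - x ^ i) + x ^ i * (1 - x)" using j by (simp add: algebra_simps)
  ultimately show ?thesis using one_minus_power_bounds(1)[of x i] assms j by (simp add: algebra_simps)
qed

lemma one_minus_gen:
  assumes "is_law w" "0 \<le> x" "x \<le> 1"
  shows "(\<lambda>k. w k * (1 - x ^ (k - 1))) sums (1 - gen w x)"
proof -
  have "(\<lambda>k. w k - w k * x ^ (k - 1)) sums (1 - gen w x)"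
    unfolding gen_def using assms by (intro sums_diff summable_sums gen_summable) (auto simp: is_law_def)
  then show ?thesis by (simp add: algebra_simps)
qed

lemma sum_le_of_sums:
  fixes f :: "nat \<Rightarrow> real"
  assumes "f sums s" "finite I" "\<And>k. 0 \<le> f k"
  shows "sum f I \<le> s"
  using sum_le_suminf[of f I] assms by (simp add: sums_iff)

text \<open>Near 1 the slope of the generating function is at least the truncated mean, up to the
  factor \<open>x ^ n\<close>, which tends to 1. Truncation makes this meaningful when the mean is
  infinite.\<close>

lemma one_minus_gen_ge:
  assumes "is_law w" "0 \<le> x" "x \<le> 1"
  shows "(\<Sum>k<n. w k * real (k - 1)) * x ^ n * (1 - x) \<le> 1 - gen w x"
proof -
  have "(\<Sum>k<n. w k * real (k - 1)) * x ^ n * (1 - x) = (\<Sum>k<n. w k * (real (k - 1) * x ^ n * (1 - x)))"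
    by (simp add: sum_distrib_left sum_distrib_right mult_ac)
  also have "\<dots> \<le> (\<Sum>k<n. w k * (1 - x ^ (k - 1)))"
  proof (intro sum_mono mult_left_mono)
    fix k assume "k \<in> {..<n}"
    then have "x ^ n \<le> x ^ (k - 1)" using assms by (intro power_decreasing) auto
    then have "real (k - 1) * x ^ n * (1 - x) \<le> real (k - 1) * x ^ (k - 1) * (1 - x)"
      using assms by (intro mult_right_mono mult_left_mono) auto
    also have "\<dots> \<le> 1 - x ^ (k - 1)" by (rule one_minus_power_bounds(2)[OF assms(2,3)])
    finally show "real (k - 1) * x ^ n * (1 - x) \<le> 1 - x ^ (k - 1)" .
  qed (use assms is_law_nonneg in auto)
  also have "\<dots> \<le> 1 - gen w x"
    using assms is_law_nonneg[OF assms(1)]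
    by (intro sum_le_of_sums[OF one_minus_gen[OF assms]]) (auto intro!: mult_nonneg_nonneg power_le_one)
  finally show ?thesis .
qed

text \<open>The mean of X - 1 for X of law w, possibly infinite.\<close>

definition excess :: "(nat \<Rightarrow> real) \<Rightarrow> ennreal" where
  "excess w = (\<Sum>k. ennreal (w k * real (k - 1)))"

lemma excess_sums:
  assumes "is_law w" "excess w \<noteq> \<top>"
  shows "(\<lambda>k. w k * real (k - 1)) sums enn2real (excess w)"
proof -
  have "summable (\<lambda>k. w k * real (k - 1))"
    using assms by (intro summable_suminf_not_top) (auto simp: excess_def is_law_nonneg)
  moreover from this have "excess w = ennreal (\<Sum>k. w k * real (k - 1))"
    unfolding excess_def using assms by (intro suminf_ennreal2) (auto simp: is_law_nonneg)
  ultimately show ?thesis using assms by (auto simp: sums_iff suminf_nonneg is_law_nonneg)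
qed

lemma excess_eq_0:
  assumes "is_law w" "excess w = 0" "k \<ge> 2"
  shows "w k = 0"
proof -
  have "ennreal (w k * real (k - 1)) \<le> excess w"
    unfolding excess_def using sum_le_suminf[of "\<lambda>k. ennreal (w k * real (k - 1))" "{k}"] by auto
  then have "ennreal (w k * real (k - 1)) \<le> ennreal 0" using assms(2) by simp
  then have "w k * real (k - 1) \<le> 0" by (subst (asm) ennreal_le_iff) auto
  then show ?thesis using assms is_law_nonneg[OF assms(1), of k] by (auto simp: mult_le_0_iff)
qed

lemma gen_eq_1_of_excess_0:
  assumes "is_law w" "excess w = 0"
  shows "gen w z = 1"
proof -
  have "(\<lambda>k. w k * z ^ (k - 1)) = w"
  proof
    fix k show "w k * z ^ (k - 1) = w k"
      using excess_eq_0[OF assms, of k] by (cases "k \<ge> 2") (auto simp: not_le numeral_2_eq_2 less_Suc_eq)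
  qed
  then show ?thesis using is_law_suminf[OF assms(1)] by (simp add: gen_def)
qed

lemma one_minus_gen_le:
  assumes "is_law w" "excess w \<noteq> \<top>" "0 \<le> x" "x \<le> 1"
  shows "1 - gen w x \<le> enn2real (excess w) * (1 - x)"
  using one_minus_power_bounds(1)[OF assms(3,4)] is_law_nonneg[OF assms(1)]
  by (intro sums_le[OF _ one_minus_gen sums_mult2[OF excess_sums]])
     (use assms in \<open>auto simp: mult.assoc intro!: mult_left_mono\<close>)

text \<open>The generating function lies strictly above its tangent at 1 unless it is
  affine.\<close>

lemma one_minus_gen_eq:
  assumes w: "is_law w" "excess w \<noteq> \<top>" and x: "0 \<le> x" "x < 1"
    and eq: "1 - gen w x = enn2real (excess w) * (1 - x)" and k: "k \<ge> 3"
  shows "w k = 0"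
proof (rule ccontr)
  assume "w k \<noteq> 0"
  then have wk: "w k > 0" using is_law_nonneg[OF w(1), of k] by linarith
  let ?d = "\<lambda>k. w k * real (k - 1) * (1 - x) - w k * (1 - x ^ (k - 1))"
  have sums: "?d sums 0"
    using sums_diff[OF sums_mult2[OF excess_sums[OF w], of "1 - x"] one_minus_gen[OF w(1), of x]] x eq by simp
  have "?d k > 0" using one_minus_power_less[of x "k - 1"] x k wk by (simp add: mult.assoc)
  moreover have "(\<Sum>i\<in>{k}. ?d i) \<le> 0"
    using one_minus_power_bounds(1)[of x] is_law_nonneg[OF w(1)] x
    by (intro sum_le_of_sums[OF sums]) (auto simp: mult.assoc intro!: mult_left_mono)
  ultimately show False by simp
qed

lemma excess_two_point:
  assumes w: "is_law w" "excess w \<noteq> \<top>" and z: "\<And>k. k \<ge> 3 \<Longrightarrow> w k = 0"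
  shows "enn2real (excess w) = w 2"
proof -
  have "(\<lambda>k. w k * real (k - 1)) = (\<lambda>k. if k = 2 then w 2 else 0)"
  proof
    fix k :: nat
    consider "k = 0" | "k = 1" | "k = 2" | "k \<ge> 3" by linarith
    then show "w k * real (k - 1) = (if k = 2 then w 2 else 0)" using z by cases auto
  qed
  then have "(\<lambda>k. if k = 2 then w 2 else 0) sums enn2real (excess w)"
    using excess_sums[OF w] by simp
  moreover have "(\<lambda>k. if k = (2::nat) then w 2 else 0) sums w 2" by (rule sums_single)
  ultimately show ?thesis using sums_unique2 by blast
qed

text \<open>If x < 1 is a fixed point and y the value of the first generating function at x, then
  comparison with the tangents at 1 gives 1 - x \<le> b (1 - y) \<le> b a (1 - x), where a and b are
  the means. As a b \<le> 1, these are equalities. So both generating functions are affine, the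
  means are u 2 and v 2, and their product is 1, which forces both to be 1.\<close>

lemma ext_prob_subcritical:
  assumes laws: "is_law u" "is_law v" and le: "excess u * excess v \<le> 1" and ne: "\<not> (u 2 = 1 \<and> v 2 = 1)"
  shows "ext_prob u v = 1"
proof (rule ccontr)
  assume ne1: "ext_prob u v \<noteq> 1"
  define x where "x = ext_prob u v"
  define y where "y = gen u x"
  have x: "0 \<le> x" "x < 1" "gen v y = x"
    using ext_prob_bounds[OF laws] ext_prob_fix[OF laws] ne1 by (auto simp: x_def y_def)
  have y: "0 \<le> y" "y \<le> 1" using x by (auto simp: y_def intro!: gen_nonneg gen_le_1 laws)
  have y1: "y < 1" using x y gen_1[OF laws(2)] by (cases "y = 1") auto
  have "excess v \<noteq> 0" using gen_eq_1_of_excess_0[OF laws(2)] x by auto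
  have "excess u \<noteq> 0" using gen_eq_1_of_excess_0[OF laws(1)] y1 by (auto simp: y_def)
  have fu: "excess u \<noteq> \<top>" using le \<open>excess v \<noteq> 0\<close> by (auto simp: ennreal_top_mult top_unique)
  have fv: "excess v \<noteq> \<top>" using le \<open>excess u \<noteq> 0\<close> by (auto simp: ennreal_mult_top top_unique)
  define a b where "a = enn2real (excess u)" and "b = enn2real (excess v)"
  have ab0: "a > 0" "b > 0" using fu fv \<open>excess u \<noteq> 0\<close> \<open>excess v \<noteq> 0\<close>
    by (auto simp: a_def b_def enn2real_positive_iff less_top zero_less_iff_neq_zero)
  have ab: "a * b \<le> 1"
  proof -
    have "ennreal (a * b) \<le> 1" using le fu fv ab0 by (simp add: a_def b_def ennreal_mult less_top)
    then show ?thesis by simp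
  qed
  have 1: "1 - x \<le> b * (1 - y)" using one_minus_gen_le[OF laws(2) fv y] x by (simp add: b_def)
  have 2: "1 - y \<le> a * (1 - x)" using one_minus_gen_le[OF laws(1) fu, of x] x by (simp add: a_def y_def)
  have 3: "b * (1 - y) \<le> b * (a * (1 - x))" using 2 ab0 by (intro mult_left_mono) auto
  have 4: "b * (a * (1 - x)) \<le> 1 - x" using mult_right_mono[OF ab, of "1 - x"] x by (simp add: mult_ac)
  have e1: "1 - x = b * (1 - y)" and e2: "b * (1 - y) = b * (a * (1 - x))" and e3: "b * (a * (1 - x)) = 1 - x"
    using 1 3 4 by linarith+
  have e2': "1 - y = a * (1 - x)" using e2 ab0 by simp
  have z: "\<And>k. k \<ge> 3 \<Longrightarrow> u k = 0" "\<And>k. k \<ge> 3 \<Longrightarrow> v k = 0"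
    using one_minus_gen_eq[OF laws(1) fu, of x] one_minus_gen_eq[OF laws(2) fv, of y] x y y1 e1 e2'
    by (auto simp: a_def b_def y_def)
  have "a = u 2" "b = v 2" using excess_two_point laws fu fv z by (auto simp: a_def b_def)
  moreover have "b * a = 1" using e3 x mult_cancel_right[of "b * a" "1 - x" 1] by (simp add: mult.assoc)
  moreover have "u 2 \<le> 1" "v 2 \<le> 1" using is_law_le_1 laws by auto
  ultimately have "u 2 = 1 \<and> v 2 = 1"
    using ab0 mult_le_one[of "v 2" "u 2"] mult_left_le[of "u 2" "v 2"] mult_left_le[of "v 2" "u 2"]
    by (smt (verit) mult.commute)
  then show False using ne by simp
qed

lemma excess_truncate:
  assumes laws: "is_law u" "is_law v" and gt: "excess u * excess v > 1"
  obtains n where "(\<Sum>k<n. u k * real (k - 1)) * (\<Sum>k<n. v k * real (k - 1)) > 1"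
proof -
  have lim: "(\<lambda>n. ennreal (\<Sum>k<n. w k * real (k - 1))) \<longlonglongrightarrow> excess w" if "is_law w" for w
    using summable_LIMSEQ[OF summableI, of "\<lambda>k. ennreal (w k * real (k - 1))"] is_law_nonneg[OF that]
    by (simp add: excess_def sum_ennreal)
  have "(\<lambda>n. ennreal (\<Sum>k<n. u k * real (k - 1)) * ennreal (\<Sum>k<n. v k * real (k - 1)))
      \<longlonglongrightarrow> excess u * excess v"
    using gt by (intro tendsto_mult_ennreal lim laws) auto
  from order_tendstoD(1)[OF this gt]
  obtain n where "1 < ennreal (\<Sum>k<n. u k * real (k - 1)) * ennreal (\<Sum>k<n. v k * real (k - 1))"
    using eventually_happens by fastforce
  then have "1 < ennreal ((\<Sum>k<n. u k * real (k - 1)) * (\<Sum>k<n. v k * real (k - 1)))"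
    by (subst ennreal_mult) (auto intro!: sum_nonneg simp: is_law_nonneg laws)
  then show ?thesis using that[of n] by (simp add: ennreal_less_iff flip: ennreal_1)
qed

text \<open>Close to 1 the composed generating function lies below the diagonal because its slope
  there exceeds 1, and by convexity it stays below down to the extinction probability. Points
  \<theta> just above the latter are the supersolutions that the upper bounds need.\<close>

lemma ext_prob_supercritical:
  assumes laws: "is_law u" "is_law v" and gt: "excess u * excess v > 1"
  shows "ext_prob u v < 1"
    and "\<delta> > 0 \<Longrightarrow> \<exists>\<theta>. ext_prob u v < \<theta> \<and> \<theta> < 1 \<and> \<theta> < ext_prob u v + \<delta> \<and> gen v (gen u \<theta>) < \<theta>"
proof -
  obtain n where n: "(\<Sum>k<n. u k * real (k - 1)) * (\<Sum>k<n. v k * real (k - 1)) > 1"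
    using excess_truncate[OF assms] .
  define a b where "a = (\<Sum>k<n. u k * real (k - 1))" and "b = (\<Sum>k<n. v k * real (k - 1))"
  have ab: "a * b > 1" "a \<ge> 0" "b \<ge> 0"
    using n laws by (auto simp: a_def b_def is_law_nonneg intro!: sum_nonneg)
  have "((\<lambda>x. b * gen u x ^ n * (a * x ^ n)) \<longlongrightarrow> b * gen u 1 ^ n * (a * 1 ^ n)) (at 1 within {0..1})"
    using gen_cont[OF laws(1)] by (intro tendsto_intros) (auto simp: continuous_on_def)
  then have "((\<lambda>x. b * gen u x ^ n * (a * x ^ n)) \<longlongrightarrow> a * b) (at 1 within {0..1})"
    by (simp add: gen_1[OF laws(1)] mult.commute)
  from order_tendstoD(1)[OF this ab(1)]
  have "\<forall>\<^sub>F x in at (1::real) within {0..1}. 1 < b * gen u x ^ n * (a * x ^ n)" .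
  then obtain d where d: "d > 0" "\<And>x. x \<in> {0..1} \<Longrightarrow> x \<noteq> 1 \<Longrightarrow> dist x 1 < d \<Longrightarrow> 1 < b * gen u x ^ n * (a * x ^ n)"
    unfolding eventually_at by blast
  define x where "x = max 0 (1 - d / 2)"
  have x: "0 \<le> x" "x < 1" "dist x 1 < d" using d(1) by (auto simp: x_def dist_real_def)
  have gu: "0 \<le> gen u x" "gen u x \<le> 1" using x laws by (auto intro!: gen_nonneg gen_le_1)
  have "1 - x < b * gen u x ^ n * (a * x ^ n) * (1 - x)"
    using d(2)[of x] x by simp
  also have "\<dots> = b * gen u x ^ n * (a * x ^ n * (1 - x))" by simp
  also have "\<dots> \<le> b * gen u x ^ n * (1 - gen u x)"
    using one_minus_gen_ge[OF laws(1), of x n] x ab gu by (intro mult_left_mono) (auto simp: a_def)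
  also have "\<dots> \<le> 1 - gen v (gen u x)"
    using one_minus_gen_ge[OF laws(2) gu, of n] by (simp add: b_def)
  finally have hx: "gen v (gen u x) < x" by simp
  have le: "ext_prob u v \<le> x" using ext_prob_least[OF laws] x hx by simp
  have ne: "ext_prob u v \<noteq> x" using ext_prob_fix[OF laws] hx by auto
  have lt: "ext_prob u v < x" using le ne by simp
  show "ext_prob u v < 1" using le x by simp
  assume \<delta>: "\<delta> > 0"
  \<comment> \<open>Move a fraction s of the way from the fixed point towards x. Convexity keeps the
    value below the diagonal.\<close>
  define s where "s = min 1 (\<delta> / 2)"
  have s: "0 < s" "s \<le> 1" "s < \<delta>" using \<delta> by (auto simp: s_def)
  define \<theta> where "\<theta> = (1 - s) * ext_prob u v + s * x"
  have eq: "\<theta> = ext_prob u v + s * (x - ext_prob u v)" by (simp add: \<theta>_def algebra_simps)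
  have d1: "0 < s * (x - ext_prob u v)" using s lt by simp
  have d2: "s * (x - ext_prob u v) \<le> s" using s x ext_prob_bounds[OF laws] by (intro mult_left_le) auto
  have d3: "s * (x - ext_prob u v) \<le> x - ext_prob u v" using s lt by (simp add: mult_left_le_one_le)
  have "gen v (gen u \<theta>) \<le> (1 - s) * gen v (gen u (ext_prob u v)) + s * gen v (gen u x)"
    unfolding \<theta>_def using s x ext_prob_bounds[OF laws] by (intro gen_comp_convex laws) auto
  also have "\<dots> < \<theta>" using s hx by (simp add: ext_prob_fix[OF laws] \<theta>_def)
  finally have "gen v (gen u \<theta>) < \<theta>" .
  then show "\<exists>\<theta>. ext_prob u v < \<theta> \<and> \<theta> < 1 \<and> \<theta> < ext_prob u v + \<delta> \<and> gen v (gen u \<theta>) < \<theta>"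
    using eq d1 d2 d3 s x by (intro exI[of _ \<theta>] conjI; linarith)
qed

subsection \<open>The size-biased laws\<close>

text \<open>The law of the degree of the vertex at a uniformly chosen half-edge, in the limit. A
  function rather than a \<open>pmf\<close>, as limits of proportions are taken pointwise.\<close>

definition sb :: "nat pmf \<Rightarrow> nat \<Rightarrow> real" where
  "sb p k = real k * pmf p k / pmf_mean p"

lemma pmf_mean_pos:
  assumes "set_pmf p \<subseteq> {1..}" "integrable (measure_pmf p) real"
  shows "pmf_mean p \<ge> 1"
proof -
  have "measure_pmf.expectation p (\<lambda>_. 1) \<le> pmf_mean p"
    by (rule integral_mono_AE) (use assms in \<open>auto simp: AE_measure_pmf_iff\<close>)
  then show ?thesis by simp
qed

lemma expectation_nat_pmf_sums:
  fixes f :: "nat \<Rightarrow> real"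
  assumes "integrable (measure_pmf p) f"
  shows "(\<lambda>k. pmf p k * f k) sums measure_pmf.expectation p f"
proof -
  have "integrable (count_space UNIV) (\<lambda>k. pmf p k * f k)"
    using assms by (subst (asm) measure_pmf_eq_density) (simp add: integrable_density)
  moreover have "measure_pmf.expectation p f = integral\<^sup>L (count_space UNIV) (\<lambda>k. pmf p k * f k)"
    by (subst measure_pmf_eq_density) (simp add: integral_density)
  ultimately show ?thesis by (simp add: sums_integral_count_space_nat)
qed

context
  fixes p :: "nat pmf"
  assumes supp: "set_pmf p \<subseteq> {1..}" and int: "integrable (measure_pmf p) real"
begin

lemma pmf_size_biased_eq: "pmf (size_biased p) k = sb p k"
  unfolding sb_def using pmf_mean_pos[OF supp int] by (intro pmf_size_biased[OF int]) simp

lemma is_law_sb: "is_law (sb p)"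
proof -
  have eq: "pmf (size_biased p) = sb p" using pmf_size_biased_eq by (simp add: fun_eq_iff)
  have "(\<lambda>k. pmf (size_biased p) k * 1) sums measure_pmf.expectation (size_biased p) (\<lambda>_. 1)"
    by (rule expectation_nat_pmf_sums) simp
  then have "sb p sums 1" unfolding eq by simp
  then show ?thesis using pmf_nonneg[of "size_biased p"] by (simp add: is_law_def eq)
qed

lemma pgf_size_biased_minus_one:
  assumes "0 \<le> z" "z \<le> 1"
  shows "pgf (size_biased_minus_one p) z = gen (sb p) z"
proof -
  have "(\<lambda>k. pmf (size_biased p) k * z ^ (k - 1)) sums measure_pmf.expectation (size_biased p) (\<lambda>k. z ^ (k - 1))"
    using assms by (intro expectation_nat_pmf_sums measure_pmf.integrable_const_bound[where B = 1])
      (auto intro!: power_le_one)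
  then show ?thesis
    by (simp add: pgf_def size_biased_minus_one_def gen_def pmf_size_biased_eq sums_iff)
qed

lemma ennreal_mean_size_biased_minus_one: "ennreal_mean (size_biased_minus_one p) = excess (sb p)"
proof -
  have "ennreal_mean (size_biased_minus_one p) = (\<integral>\<^sup>+ k. ennreal (real (k - 1)) \<partial>measure_pmf (size_biased p))"
    by (simp add: ennreal_mean_def size_biased_minus_one_def nn_integral_map_pmf)
  also have "\<dots> = (\<integral>\<^sup>+ k. ennreal (pmf (size_biased p) k) * ennreal (real (k - 1)) \<partial>count_space UNIV)"
    by (rule nn_integral_measure_pmf)
  also have "\<dots> = (\<Sum>k. ennreal (pmf (size_biased p) k) * ennreal (real (k - 1)))"
    by (rule nn_integral_count_space_nat)
  also have "\<dots> = excess (sb p)"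
    unfolding excess_def by (simp add: pmf_size_biased_eq ennreal_mult is_law_nonneg[OF is_law_sb])
  finally show ?thesis .
qed

lemma pgf_sums:
  assumes "0 \<le> z" "z \<le> 1"
  shows "(\<lambda>k. pmf p k * z ^ k) sums pgf p z"
  unfolding pgf_def using assms
  by (intro expectation_nat_pmf_sums measure_pmf.integrable_const_bound[where B = 1]) (auto intro!: power_le_one)

lemma pmf_0: "pmf p 0 = 0"
  using supp by (auto simp: pmf_eq_0_set_pmf)

lemma pgf_less_1:
  assumes "0 \<le> z" "z < 1"
  shows "pgf p z < 1"
proof -
  have "(\<lambda>k. pmf p k * 1) sums measure_pmf.expectation p (\<lambda>_. 1)"
    by (rule expectation_nat_pmf_sums) simp
  then have s: "(\<lambda>k. z * pmf p k) sums (z * 1)" by (intro sums_mult) simp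
  have "pgf p z \<le> z * 1"
  proof (rule sums_le[OF _ pgf_sums s])
    fix k show "pmf p k * z ^ k \<le> z * pmf p k"
      using power_decreasing[of 1 k z] assms pmf_0 by (cases k) (auto intro: mult_left_mono simp: mult.commute[of z])
  qed (use assms in auto)
  then show ?thesis using assms by simp
qed

text \<open>Size-biasing multiplies each weight on the positive integers by a positive number, so it
  does not change the support.\<close>

lemma sb_2_eq_1:
  assumes "sb p 2 = 1"
  shows "pmf p 2 = 1"
proof -
  have z: "pmf p k = 0" if "k \<noteq> 2" for k
  proof (cases "k = 0")
    case False
    have "(\<Sum>i\<in>{2, k}. sb p i) \<le> 1"
      using sum_le_suminf[OF is_law_summable[OF is_law_sb], of "{2, k}"] is_law_suminf[OF is_law_sb]
        is_law_nonneg[OF is_law_sb] by auto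
    then have "sb p k = 0" using that assms is_law_nonneg[OF is_law_sb, of k] by simp
    then show ?thesis using False pmf_mean_pos[OF supp int] by (simp add: sb_def)
  qed (simp add: pmf_0)
  have "(\<lambda>k. pmf p k * 1) sums measure_pmf.expectation p (\<lambda>_. 1)"
    by (rule expectation_nat_pmf_sums) simp
  moreover have "pmf p = (\<lambda>k. if k = 2 then pmf p 2 else 0)" using z by auto
  ultimately have "(\<lambda>k. if k = 2 then pmf p 2 else 0) sums 1" by simp
  from sums_unique2[OF this sums_single[of 2 "\<lambda>_. pmf p 2"]] show ?thesis by simp
qed

end

lemma eta_left_eq:
  assumes "set_pmf p \<subseteq> {1..}" "integrable (measure_pmf p) real"
    and "set_pmf q \<subseteq> {1..}" "integrable (measure_pmf q) real"
  shows "eta_left p q = ext_prob (sb p) (sb q)"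
proof -
  note l = is_law_sb[OF assms(1,2)] is_law_sb[OF assms(3,4)]
  have "(0 \<le> x \<and> x \<le> 1 \<and> x = pgf (size_biased_minus_one q) (pgf (size_biased_minus_one p) x)) =
     (0 \<le> x \<and> x \<le> 1 \<and> x = gen (sb q) (gen (sb p) x))" for x
    using gen_nonneg[OF l(1), of x] gen_le_1[OF l(1), of x]
    by (auto simp: pgf_size_biased_minus_one[OF assms(1,2)] pgf_size_biased_minus_one[OF assms(3,4)])
  then show ?thesis unfolding eta_left_def ext_prob_eq_Least[OF l] by simp
qed

lemma eta_right_eq:
  assumes "set_pmf p \<subseteq> {1..}" "integrable (measure_pmf p) real"
    and "set_pmf q \<subseteq> {1..}" "integrable (measure_pmf q) real"
  shows "eta_right p q = gen (sb p) (ext_prob (sb p) (sb q))"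
  using ext_prob_bounds[OF is_law_sb[OF assms(1,2)] is_law_sb[OF assms(3,4)]]
  by (simp add: eta_right_def eta_left_eq[OF assms] pgf_size_biased_minus_one[OF assms(1,2)])

section \<open>Sequences of configurations with converging degree statistics\<close>

text \<open>Pointwise convergence of proportions to a law leaves no mass at infinity, so the
  averages of bounded functions of the degree converge as well.\<close>

lemma law_average_tendsto:
  fixes S :: "nat \<Rightarrow> 'a set" and d :: "nat \<Rightarrow> 'a \<Rightarrow> nat"
  assumes u: "is_law u" and fin: "\<And>n. finite (S n)" and ne: "\<forall>\<^sub>F n in sequentially. S n \<noteq> {}"
    and lim: "\<And>k. (\<lambda>n. uprob (S n) (\<lambda>x. d n x = k)) \<longlonglongrightarrow> u k"
    and b: "\<And>k. 0 \<le> b k" "\<And>k. b k \<le> 1"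
  shows "(\<lambda>n. avg (S n) (\<lambda>x. b (d n x))) \<longlonglongrightarrow> (\<Sum>k. u k * b k)"
proof (rule LIMSEQ_I)
  fix e :: real assume e: "e > 0"
  have "(\<lambda>m. \<Sum>k<m. u k) \<longlonglongrightarrow> 1" using u by (simp add: is_law_def sums_def)
  from order_tendstoD(1)[OF this, of "1 - e / 4"] e
  obtain m where m: "1 - e / 4 < (\<Sum>k<m. u k)" using eventually_happens by fastforce
  have sm: "summable (\<lambda>k. u k * b k)" by (rule is_law_summable_mult[OF u b])
  have tail: "(\<Sum>k. u k * b k) - (\<Sum>k<m. u k * b k) \<in> {0..e / 4}"
  proof -
    have "(\<Sum>k. u k * b k) - (\<Sum>k<m. u k * b k) = (\<Sum>k. u (k + m) * b (k + m))"
      using suminf_minus_initial_segment[OF sm, of m] by simp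
    moreover have "0 \<le> (\<Sum>k. u (k + m) * b (k + m))"
      using sm b is_law_nonneg[OF u] by (intro suminf_nonneg) (auto simp: summable_iff_shift[of "\<lambda>k. u k * b k"])
    moreover have "(\<Sum>k. u (k + m) * b (k + m)) \<le> (\<Sum>k. u (k + m))"
      using sm is_law_summable[OF u] b is_law_nonneg[OF u]
      by (intro suminf_le) (auto simp: summable_iff_shift[of "\<lambda>k. u k * b k"] summable_iff_shift[of u] mult_left_le)
    moreover have "(\<Sum>k. u (k + m)) = 1 - (\<Sum>k<m. u k)"
      using suminf_minus_initial_segment[OF is_law_summable[OF u], of m] is_law_suminf[OF u] by simp
    ultimately show ?thesis using m by auto
  qed
  have e4: "e / 4 > 0" using e by simp
  have l1: "(\<lambda>n. \<Sum>k<m. uprob (S n) (\<lambda>x. d n x = k) * b k) \<longlonglongrightarrow> (\<Sum>k<m. u k * b k)"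
    by (intro tendsto_intros lim)
  have l2: "(\<lambda>n. \<Sum>k<m. uprob (S n) (\<lambda>x. d n x = k)) \<longlonglongrightarrow> (\<Sum>k<m. u k)"
    by (intro tendsto_intros lim)
  have "\<forall>\<^sub>F n in sequentially. norm (avg (S n) (\<lambda>x. b (d n x)) - (\<Sum>k. u k * b k)) < e"
    using tendstoD[OF l1 e4] order_tendstoD(1)[OF l2 m] ne
  proof eventually_elim
    case (elim n)
    let ?p = "\<lambda>k. uprob (S n) (\<lambda>x. d n x = k)"
    have c: "real (card (S n)) > 0" using elim fin[of n] by (simp add: card_gt_0_iff)
    have part: "(\<Sum>k<m. ?p k * g k) = avg (S n) (\<lambda>x. if d n x < m then g (d n x) else 0)" for g :: "nat \<Rightarrow> real"
    proof -
      have "(\<Sum>k<m. ?p k * g k) = (\<Sum>k<m. avg (S n) (\<lambda>x. g k * of_bool (d n x = k)))"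
        using fin by (simp add: avg_cmult avg_of_bool mult.commute)
      also have "\<dots> = avg (S n) (\<lambda>x. \<Sum>k<m. g k * of_bool (d n x = k))" by (rule avg_sum[symmetric])
      also have "(\<lambda>x. \<Sum>k<m. g k * of_bool (d n x = k)) = (\<lambda>x. if d n x < m then g (d n x) else 0)"
        by (auto simp: fun_eq_iff)
      finally show ?thesis .
    qed
    have one: "avg (S n) (\<lambda>x. 1) = 1" using elim fin by (intro avg_const) auto
    have "avg (S n) (\<lambda>x. b (d n x)) - (\<Sum>k<m. ?p k * b k)
        = avg (S n) (\<lambda>x. b (d n x) - (if d n x < m then b (d n x) else 0))"
      unfolding part avg_diff by simp
    also have "\<dots> \<le> avg (S n) (\<lambda>x. 1 - (if d n x < m then 1 else 0))"
      using b by (intro avg_mono) auto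
    also have "\<dots> = 1 - (\<Sum>k<m. ?p k)" using part[of "\<lambda>_. 1"] one by (simp add: avg_diff)
    finally have 1: "avg (S n) (\<lambda>x. b (d n x)) - (\<Sum>k<m. ?p k * b k) \<le> e / 4" using elim by simp
    have "0 \<le> avg (S n) (\<lambda>x. b (d n x) - (if d n x < m then b (d n x) else 0))"
      using b by (intro avg_nonneg) auto
    then have 2: "0 \<le> avg (S n) (\<lambda>x. b (d n x)) - (\<Sum>k<m. ?p k * b k)"
      unfolding part avg_diff by simp
    have 3: "\<bar>(\<Sum>k<m. ?p k * b k) - (\<Sum>k<m. u k * b k)\<bar> < e / 4" using elim(1) by (simp add: dist_real_def)
    have 4: "0 \<le> (\<Sum>k. u k * b k) - (\<Sum>k<m. u k * b k)" "(\<Sum>k. u k * b k) - (\<Sum>k<m. u k * b k) \<le> e / 4"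
      using tail by auto
    show ?case unfolding real_norm_def using 1 2 3 4 by linarith
  qed
  then show "\<exists>no. \<forall>n\<ge>no. norm (avg (S n) (\<lambda>x. b (d n x)) - (\<Sum>k. u k * b k)) < e"
    by (simp add: eventually_sequentially)
qed

text \<open>For the average over the partner that is revealed. The J half-edges already used and the
  r active ones cost at most \<eta> in each proportion; another \<eta> allows for the proportions
  not being at their limits yet.\<close>

lemma average_lower_bound:
  fixes \<phi> m v :: "_ \<Rightarrow> real"
  assumes fin: "finite S" and sub: "S' \<subseteq> S" "R \<subseteq> S'" and cR: "card R = r" and J: "card S \<le> card S' + J"
    and m: "\<And>k. 0 \<le> m k" "\<And>k. m k \<le> 1"
    and le: "\<And>y. y \<in> S' - R \<Longrightarrow> d y \<in> {1..D} \<Longrightarrow> m (d y) \<le> \<phi> y" and \<phi>: "\<And>y. 0 \<le> \<phi> y"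
    and v: "\<And>k. k \<in> {1..D} \<Longrightarrow> v k - \<eta> \<le> uprob S (\<lambda>y. d y = k)"
    and \<eta>: "real (J + r) \<le> \<eta> * real (card S)" and pos: "card S' > 0"
  shows "(\<Sum>k=1..D. v k * m k) - 2 * real D * \<eta> \<le> (\<Sum>y\<in>S' - R. \<phi> y) / real (card S')"
proof -
  have finS: "finite S'" using fin sub(1) by (rule rev_finite_subset)
  then have finR: "finite R" using sub(2) by (rule rev_finite_subset)
  have cS: "card S' \<le> card S" using fin sub by (intro card_mono)
  have cnt: "real (card {y \<in> S. d y = k}) - real (J + r) \<le> real (card {y \<in> S' - R. d y = k})" for k
  proof -
    have "{y \<in> S. d y = k} \<subseteq> {y \<in> S' - R. d y = k} \<union> (S - S') \<union> R" by auto
    then have "card {y \<in> S. d y = k} \<le> card ({y \<in> S' - R. d y = k} \<union> (S - S') \<union> R)"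
      using fin finS finR by (intro card_mono) auto
    also have "\<dots> \<le> card {y \<in> S' - R. d y = k} + card (S - S') + card R"
      by (meson add_le_mono1 card_Un_le order_trans)
    also have "card (S - S') \<le> J" using J sub finS by (simp add: card_Diff_subset)
    finally show ?thesis using cR by linarith
  qed
  have "(\<Sum>k=1..D. v k * m k) - 2 * real D * \<eta> = (\<Sum>k=1..D. v k * m k - 2 * \<eta>)"
    by (simp add: sum_subtractf)
  also have "\<dots> \<le> (\<Sum>k=1..D. m k * real (card {y \<in> S' - R. d y = k}) / real (card S))"
  proof (rule sum_mono)
    fix k assume k: "k \<in> {1..D}"
    have cp: "real (card S) > 0" using pos cS by simp
    have eta0: "0 \<le> \<eta>" using \<eta> cp by (smt (verit) of_nat_0_le_iff zero_le_mult_iff mult_neg_pos)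
    have "v k - 2 * \<eta> \<le> uprob S (\<lambda>y. d y = k) - real (J + r) / real (card S)"
    proof -
      have "real (J + r) / real (card S) \<le> \<eta>" using \<eta> cp by (simp add: divide_le_eq)
      then show ?thesis using v[OF k] by linarith
    qed
    also have "\<dots> = (real (card {y \<in> S. d y = k}) - real (J + r)) / real (card S)"
      by (simp add: uprob_def diff_divide_distrib)
    also have "\<dots> \<le> real (card {y \<in> S' - R. d y = k}) / real (card S)"
      using cnt[of k] by (intro divide_right_mono) auto
    finally have "m k * (v k - 2 * \<eta>) \<le> m k * (real (card {y \<in> S' - R. d y = k}) / real (card S))"
      using m by (intro mult_left_mono) auto
    moreover have "v k * m k - 2 * \<eta> \<le> m k * (v k - 2 * \<eta>)"
      using m[of k] eta0 by (simp add: algebra_simps mult_left_le)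
    ultimately show "v k * m k - 2 * \<eta> \<le> m k * real (card {y \<in> S' - R. d y = k}) / real (card S)" by simp
  qed
  also have "\<dots> = (\<Sum>k=1..D. m k * real (card {y \<in> S' - R. d y = k})) / real (card S)"
    by (simp add: sum_divide_distrib)
  also have "\<dots> \<le> (\<Sum>k=1..D. m k * real (card {y \<in> S' - R. d y = k})) / real (card S')"
    using pos cS m by (intro divide_left_mono sum_nonneg) auto
  also have "\<dots> \<le> (\<Sum>y\<in>S' - R. \<phi> y) / real (card S')"
  proof (rule divide_right_mono)
    have "(\<Sum>k=1..D. m k * real (card {y \<in> S' - R. d y = k}))
        = (\<Sum>k=1..D. \<Sum>y\<in>{y \<in> S' - R. d y = k}. m (d y))"
      by (intro sum.cong) auto
    also have "\<dots> \<le> (\<Sum>k=1..D. \<Sum>y\<in>{y \<in> S' - R. d y = k}. \<phi> y)"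
      using le by (intro sum_mono) auto
    also have "\<dots> = (\<Sum>y\<in>(\<Union>k\<in>{1..D}. {y \<in> S' - R. d y = k}). \<phi> y)"
      using finS by (intro sum.UNION_disjoint[symmetric]) auto
    also have "\<dots> \<le> (\<Sum>y\<in>S' - R. \<phi> y)"
      using finS \<phi> by (intro sum_mono2) auto
    finally show "(\<Sum>k=1..D. m k * real (card {y \<in> S' - R. d y = k})) \<le> (\<Sum>y\<in>S' - R. \<phi> y)" .
  qed simp
  finally show ?thesis .
qed

text \<open>The sets A n and B n of half-edges are matched; u and v are the limits of the degree
  proportions among half-edges, so they correspond to size-biased degree laws.\<close>

locale config_sequence =
  fixes A :: "nat \<Rightarrow> 'a set" and B :: "nat \<Rightarrow> 'b set" and \<alpha> :: "'a \<Rightarrow> 'v" and \<beta> :: "'b \<Rightarrow> 'w"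
    and u v :: "nat \<Rightarrow> real"
  assumes finA: "finite (A n)" and finB: "finite (B n)" and cAB: "card (A n) = card (B n)"
    and card_lim: "filterlim (\<lambda>n. card (A n)) at_top sequentially"
    and laws: "is_law u" "is_law v"
    and u_lim: "(\<lambda>n. uprob (A n) (\<lambda>x. card (fib (A n) \<alpha> x) = k)) \<longlonglongrightarrow> u k"
    and v_lim: "(\<lambda>n. uprob (B n) (\<lambda>y. card (fib (B n) \<beta> y) = k)) \<longlonglongrightarrow> v k"
begin

abbreviation "\<rho> \<equiv> ext_prob u v"
abbreviation "MM n \<equiv> matchings (A n) (B n)"

lemma finM: "finite (MM n)"
  using finA finB by (rule finite_matchings_of_finite)

lemma MM_ne: "MM n \<noteq> {}"
  using finA finB cAB by (rule matchings_ne)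

lemma eventually_card: "\<forall>\<^sub>F n in sequentially. c \<le> real (card (A n))"
proof -
  have "\<forall>\<^sub>F n in sequentially. nat \<lceil>c\<rceil> \<le> card (A n)" using card_lim unfolding filterlim_at_top by blast
  then show ?thesis by eventually_elim (simp add: nat_ceiling_le_eq)
qed

lemma eventually_ne: "\<forall>\<^sub>F n in sequentially. A n \<noteq> {}" "\<forall>\<^sub>F n in sequentially. B n \<noteq> {}"
proof -
  show "\<forall>\<^sub>F n in sequentially. A n \<noteq> {}"
    by (rule eventually_mono[OF eventually_card[of 1]]) auto
  have "B n \<noteq> {}" if "1 \<le> real (card (A n))" for n using that unfolding cAB by auto
  then show "\<forall>\<^sub>F n in sequentially. B n \<noteq> {}"
    by (rule eventually_mono[OF eventually_card[of 1]])
qed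

lemma card_fib_pos: "x \<in> A n \<Longrightarrow> card (fib (A n) \<alpha> x) > 0" "y \<in> B n \<Longrightarrow> card (fib (B n) \<beta> y) > 0"
  using finA finB by (auto simp: card_gt_0_iff fib_def)

lemma uv_0: "u 0 = 0" "v 0 = 0"
proof -
  have "uprob (A n) (\<lambda>x. card (fib (A n) \<alpha> x) = 0) = 0" "uprob (B n) (\<lambda>x. card (fib (B n) \<beta> x) = 0) = 0" for n
    using card_fib_pos by (auto intro!: uprob_const_False)
  then show "u 0 = 0" "v 0 = 0" using u_lim[of 0] v_lim[of 0] by (simp_all add: LIMSEQ_const_iff)
qed

lemma avg_left_tendsto:
  "(\<And>k. 0 \<le> b k) \<Longrightarrow> (\<And>k. b k \<le> 1) \<Longrightarrow>
    (\<lambda>n. avg (A n) (\<lambda>x. b (card (fib (A n) \<alpha> x)))) \<longlonglongrightarrow> (\<Sum>k. u k * b k)"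
  by (rule law_average_tendsto[OF laws(1) finA eventually_ne(1) u_lim])

lemma avg_right_tendsto:
  "(\<And>k. 0 \<le> b k) \<Longrightarrow> (\<And>k. b k \<le> 1) \<Longrightarrow>
    (\<lambda>n. avg (B n) (\<lambda>x. b (card (fib (B n) \<beta> x)))) \<longlonglongrightarrow> (\<Sum>k. v k * b k)"
  by (rule law_average_tendsto[OF laws(2) finB eventually_ne(2) v_lim])

subsection \<open>Lower bound for the probability of a small component\<close>

abbreviation "stops_at K J n l r c \<equiv> (\<forall>A' L B' R.
  explorable (A n) \<alpha> A' L \<longrightarrow> explorable (B n) \<beta> B' R \<longrightarrow> card A' = card B' \<longrightarrow>
  card (A n) \<le> card A' + J \<longrightarrow> card L = l \<longrightarrow> card R = r \<longrightarrow>
  c \<le> uprob (matchings A' B') (\<lambda>f. card (explored A' \<alpha> \<beta> f L R) \<le> K))"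

text \<open>Explorations from l left and r right active half-edges die out within a bounded number
  of steps with asymptotic probability at least c. The estimate is uniform in the state, and the
  bound K does not depend on the number J of half-edges used before; both are needed to iterate
  it.\<close>

definition stops :: "nat \<Rightarrow> nat \<Rightarrow> real \<Rightarrow> bool" where
  "stops l r c \<longleftrightarrow> (\<forall>\<delta>>0. \<exists>K. \<forall>J. \<forall>\<^sub>F n in sequentially. stops_at K J n l r (c - \<delta>))"

lemma stops_limit:
  assumes "\<And>\<epsilon>. \<epsilon> > 0 \<Longrightarrow> \<exists>c'. c - \<epsilon> \<le> c' \<and> stops l r c'"
  shows "stops l r c"
  unfolding stops_def
proof (intro allI impI)
  fix \<delta> :: real assume d: "\<delta> > 0"
  obtain c' where c': "c - \<delta> / 2 \<le> c'" "stops l r c'" using assms[of "\<delta> / 2"] d by auto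
  from c'(2) d obtain K where K: "\<forall>J. \<forall>\<^sub>F n in sequentially. stops_at K J n l r (c' - \<delta> / 2)"
    unfolding stops_def using half_gt_zero by blast
  show "\<exists>K. \<forall>J. \<forall>\<^sub>F n in sequentially. stops_at K J n l r (c - \<delta>)"
  proof (intro exI[of _ K] allI)
    fix J
    from K[rule_format, of J] show "\<forall>\<^sub>F n in sequentially. stops_at K J n l r (c - \<delta>)"
      by (rule eventually_mono) (use c'(1) in \<open>fastforce\<close>)
  qed
qed

lemma stops_0: "stops 0 0 1"
  unfolding stops_def
proof (intro allI impI exI[of _ 0] always_eventually)
  fix \<delta> :: real and J n A' L B' R
  assume "\<delta> > 0" and *: "explorable (A n) \<alpha> A' L" "explorable (B n) \<beta> B' R" "card A' = card B'"
    "card L = 0" "card R = 0"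
  have fin: "finite A'" "finite B'"
        using * finite_subset[OF _ finA[of n]] finite_subset[OF _ finB[of n]] by (auto simp: explorable_def)
  then have "finite L" "finite R"
    using * finite_subset[OF _ fin(1)] finite_subset[OF _ fin(2)] by (auto simp: explorable_def)
  then have "L = {}" "R = {}" using * by auto
  then have "uprob (matchings A' B') (\<lambda>f. card (explored A' \<alpha> \<beta> f L R) \<le> 0) = 1"
    using fin matchings_ne[OF fin *(3)]
    by (intro uprob_const_True finite_matchings_of_finite) (auto simp: explored_def)
  then show "1 - \<delta> \<le> uprob (matchings A' B') (\<lambda>f. card (explored A' \<alpha> \<beta> f L R) \<le> 0)"
    using \<open>\<delta> > 0\<close> by simp
qed

lemma stops_nonpos: "c \<le> 0 \<Longrightarrow> stops l r c"
  unfolding stops_def by (auto intro!: exI[of _ 0] always_eventually order_trans[OF _ uprob_nonneg])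

lemma stops_uniform:
  fixes D :: nat
  assumes "\<And>k. k \<in> {1..D} \<Longrightarrow> stops (l k) (r k) (c k)" and d: "\<delta> > 0"
  obtains K where "\<And>J. \<forall>\<^sub>F n in sequentially. \<forall>k\<in>{1..D}. stops_at K J n (l k) (r k) (c k - \<delta>)"
proof -
  have "\<forall>k\<in>{1..D}. \<exists>K. \<forall>J. \<forall>\<^sub>F n in sequentially. stops_at K J n (l k) (r k) (c k - \<delta>)"
    using assms unfolding stops_def by simp
  then obtain K where K: "\<forall>k\<in>{1..D}. \<forall>J. \<forall>\<^sub>F n in sequentially. stops_at (K k) J n (l k) (r k) (c k - \<delta>)"
    unfolding bchoice_iff by blast
  define K' where "K' = (\<Sum>k=1..D. K k)"
  have K': "K k \<le> K'" if "k \<in> {1..D}" for k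
    unfolding K'_def by (rule member_le_sum) (use that in auto)
  show ?thesis
  proof (rule that[of K'])
    fix J
    have "\<forall>\<^sub>F n in sequentially. \<forall>k\<in>{1..D}. stops_at (K k) J n (l k) (r k) (c k - \<delta>)"
      using K by (intro eventually_ball_finite) auto
    then show "\<forall>\<^sub>F n in sequentially. \<forall>k\<in>{1..D}. stops_at K' J n (l k) (r k) (c k - \<delta>)"
    proof (rule eventually_mono, intro ballI allI impI)
      fix n k A' L B' R
      assume H: "\<forall>k\<in>{1..D}. stops_at (K k) J n (l k) (r k) (c k - \<delta>)"
      and k: "k \<in> {1..D}" and *: "explorable (A n) \<alpha> A' L" "explorable (B n) \<beta> B' R" "card A' = card B'"
       "card (A n) \<le> card A' + J" "card L = l k" "card R = r k"
      have fin: "finite A'" "finite B'"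
        using * finite_subset[OF _ finA[of n]] finite_subset[OF _ finB[of n]] by (auto simp: explorable_def)
      have "c k - \<delta> \<le> uprob (matchings A' B') (\<lambda>f. card (explored A' \<alpha> \<beta> f L R) \<le> K k)"
        using H k * by blast
      also have "\<dots> \<le> uprob (matchings A' B') (\<lambda>f. card (explored A' \<alpha> \<beta> f L R) \<le> K')"
        using K'[OF k] fin by (intro uprob_mono finite_matchings_of_finite) auto
      finally show "c k - \<delta> \<le> uprob (matchings A' B') (\<lambda>f. card (explored A' \<alpha> \<beta> f L R) \<le> K')" .
    qed
  qed
qed

lemma combine_lower:
  fixes c w :: "nat \<Rightarrow> real"
  assumes "is_law w" "\<delta> > 0"
    and "(\<Sum>k=1..D. w k * max 0 (c k - \<delta> / 2)) - 2 * real D * (\<delta> / (4 * (real D + 1))) \<le> X"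
  shows "(\<Sum>k=1..D. w k * c k) - \<delta> \<le> X"
proof -
  have "(\<Sum>k=1..D. w k) \<le> 1"
    using sum_le_suminf[OF is_law_summable[OF assms(1)], of "{1..D}"] is_law_suminf[OF assms(1)]
      is_law_nonneg[OF assms(1)] by auto
  then have "(\<Sum>k=1..D. w k) * (\<delta> / 2) \<le> 1 * (\<delta> / 2)" using assms(2) by (intro mult_right_mono) auto
  moreover have "(\<Sum>k=1..D. w k * (c k - \<delta> / 2)) \<le> (\<Sum>k=1..D. w k * max 0 (c k - \<delta> / 2))"
    using is_law_nonneg[OF assms(1)] by (intro sum_mono mult_left_mono) auto
  moreover have "(\<Sum>k=1..D. w k * (c k - \<delta> / 2)) = (\<Sum>k=1..D. w k * c k) - (\<Sum>k=1..D. w k) * (\<delta> / 2)"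
    by (simp add: algebra_simps sum_subtractf sum_distrib_left)
  moreover have "2 * real D * (\<delta> / (4 * (real D + 1))) \<le> \<delta> / 2"
    using assms(2) by (simp add: field_simps)
  ultimately show ?thesis using assms(3) by linarith
qed

text \<open>Reveal the partner of one active half-edge. It belongs to a vertex of degree k with
  probability close to \<open>v k\<close>, and k - 1 further half-edges become active.\<close>

lemma stops_left:
  assumes st: "\<And>k. k \<in> {1..D} \<Longrightarrow> stops l (r + (k - 1)) (c k)" and c: "\<And>k. c k \<le> 1"
  shows "stops (Suc l) r (\<Sum>k=1..D. v k * c k)"
  unfolding stops_def
proof (intro allI impI)
  fix \<delta> :: real assume d: "\<delta> > 0"
  then have d2: "\<delta> / 2 > 0" by simp
  obtain K where K: "\<And>J. \<forall>\<^sub>F n in sequentially. \<forall>k\<in>{1..D}. stops_at K J n l (r + (k - 1)) (c k - \<delta> / 2)"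
    using stops_uniform[of D "\<lambda>_. l" "\<lambda>k. r + (k - 1)" c, OF st d2] by blast
  \<comment> \<open>Chosen such that the total error \<open>2 * D * \<eta>\<close> in
    \<open>average_lower_bound\<close> is at most \<open>\<delta> / 2\<close>.\<close>
  define \<eta> where "\<eta> = \<delta> / (4 * (real D + 1))"
  have eta: "\<eta> > 0" using d by (simp add: \<eta>_def)
  show "\<exists>K. \<forall>J. \<forall>\<^sub>F n in sequentially. stops_at K J n (Suc l) r ((\<Sum>k=1..D. v k * c k) - \<delta>)"
  \<comment> \<open>The estimate for the next state is used with one more half-edge removed, that is
    with \<open>Suc J\<close>.\<close>
  proof (intro exI[of _ "Suc K"] allI)
    fix J
    have "\<forall>\<^sub>F n in sequentially. \<forall>k\<in>{1..D}. v k - \<eta> < uprob (B n) (\<lambda>y. card (fib (B n) \<beta> y) = k)"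
      using eta by (intro eventually_ball_finite ballI order_tendstoD(1)[OF v_lim]) auto
    moreover note K[of "Suc J"] eventually_card[of "real (J + r) / \<eta>"]
    ultimately show "\<forall>\<^sub>F n in sequentially. stops_at (Suc K) J n (Suc l) r ((\<Sum>k=1..D. v k * c k) - \<delta>)"
    proof eventually_elim
      case (elim n)
      show ?case
      proof (intro allI impI)
        fix A' L B' R
        assume *: "explorable (A n) \<alpha> A' L" "explorable (B n) \<beta> B' R" "card A' = card B'"
          "card (A n) \<le> card A' + J" "card L = Suc l" "card R = r"
        have sub: "A' \<subseteq> A n" "B' \<subseteq> B n" "L \<subseteq> A'" "R \<subseteq> B'" using * by (auto simp: explorable_def)
        have fin: "finite A'" "finite B'" using finite_subset[OF sub(1) finA] finite_subset[OF sub(2) finB] by auto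
        obtain x where x: "x \<in> L" using *(5) by fastforce
        have xA: "x \<in> A'" using x sub by auto
        have fL: "finite L" using finite_subset[OF sub(3) fin(1)] .
        let ?\<phi> = "\<lambda>y. uprob (matchings (A' - {x}) (B' - {y}))
          (\<lambda>f. card (explored (A' - {x}) \<alpha> \<beta> f (L - {x}) (R \<union> fib B' \<beta> y - {y})) \<le> K)"
        have "(\<Sum>k=1..D. v k * max 0 (c k - \<delta> / 2)) - 2 * real D * \<eta> \<le> (\<Sum>y\<in>B' - R. ?\<phi> y) / real (card B')"
        proof (rule average_lower_bound[OF finB[of n] sub(2,4) *(6), of J _ "\<lambda>y. card (fib (B n) \<beta> y)"])
          show "card (B n) \<le> card B' + J" using * cAB[of n] by simp
          show "0 \<le> max 0 (c k - \<delta> / 2)" "max 0 (c k - \<delta> / 2) \<le> 1" for k using c[of k] d by auto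
          show "v k - \<eta> \<le> uprob (B n) (\<lambda>y. card (fib (B n) \<beta> y) = k)" if "k \<in> {1..D}" for k
            using elim(1) that by (auto intro: less_imp_le)
          show "real (J + r) \<le> \<eta> * real (card (B n))" using elim(3) eta cAB[of n] by (simp add: field_simps)
          show "0 < card B'" using xA fin * by (metis card_gt_0_iff empty_iff)
          fix y assume y: "y \<in> B' - R" and k: "card (fib (B n) \<beta> y) \<in> {1..D}"
          have "c (card (fib (B n) \<beta> y)) - \<delta> / 2 \<le> ?\<phi> y"
          proof (rule elim(2)[rule_format, OF k])
            show "explorable (A n) \<alpha> (A' - {x}) (L - {x})" using *(1) x by (rule explorable_remove)
            show "explorable (B n) \<beta> (B' - {y}) (R \<union> fib B' \<beta> y - {y})" using *(2) y by (rule explorable_discover)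
            show "card (A' - {x}) = card (B' - {y})" using xA y fin * by simp
            show "card (A n) \<le> card (A' - {x}) + Suc J" using xA fin * by simp
            show "card (L - {x}) = l" using x fL * by simp
            show "card (R \<union> fib B' \<beta> y - {y}) = r + (card (fib (B n) \<beta> y) - 1)"
              using card_discover[OF finB *(2) y] *(6) by simp
          qed
          then show "max 0 (c (card (fib (B n) \<beta> y)) - \<delta> / 2) \<le> ?\<phi> y" by simp
        qed simp
        also have "\<dots> \<le> uprob (matchings A' B') (\<lambda>f. card (explored A' \<alpha> \<beta> f L R) \<le> Suc K)"
          by (rule explored_small_step_left[OF finA finB *(1-3) x])
        finally show "(\<Sum>k=1..D. v k * c k) - \<delta> \<le> uprob (matchings A' B') (\<lambda>f. card (explored A' \<alpha> \<beta> f L R) \<le> Suc K)"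
          unfolding \<eta>_def by (rule combine_lower[OF laws(2) d])
      qed
    qed
  qed
qed

lemma stops_right:
  assumes st: "\<And>k. k \<in> {1..D} \<Longrightarrow> stops (l + (k - 1)) r (c k)" and c: "\<And>k. c k \<le> 1"
  shows "stops l (Suc r) (\<Sum>k=1..D. u k * c k)"
  unfolding stops_def
proof (intro allI impI)
  fix \<delta> :: real assume d: "\<delta> > 0"
  then have d2: "\<delta> / 2 > 0" by simp
  obtain K where K: "\<And>J. \<forall>\<^sub>F n in sequentially. \<forall>k\<in>{1..D}. stops_at K J n (l + (k - 1)) r (c k - \<delta> / 2)"
    using stops_uniform[of D "\<lambda>k. l + (k - 1)" "\<lambda>_. r" c, OF st d2] by blast
  define \<eta> where "\<eta> = \<delta> / (4 * (real D + 1))"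
  have eta: "\<eta> > 0" using d by (simp add: \<eta>_def)
  show "\<exists>K. \<forall>J. \<forall>\<^sub>F n in sequentially. stops_at K J n l (Suc r) ((\<Sum>k=1..D. u k * c k) - \<delta>)"
  proof (intro exI[of _ "Suc K"] allI)
    fix J
    have "\<forall>\<^sub>F n in sequentially. \<forall>k\<in>{1..D}. u k - \<eta> < uprob (A n) (\<lambda>y. card (fib (A n) \<alpha> y) = k)"
      using eta by (intro eventually_ball_finite ballI order_tendstoD(1)[OF u_lim]) auto
    moreover note K[of "Suc J"] eventually_card[of "real (J + l) / \<eta>"]
    ultimately show "\<forall>\<^sub>F n in sequentially. stops_at (Suc K) J n l (Suc r) ((\<Sum>k=1..D. u k * c k) - \<delta>)"
    proof eventually_elim
      case (elim n)
      show ?case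
      proof (intro allI impI)
        fix A' L B' R
        assume *: "explorable (A n) \<alpha> A' L" "explorable (B n) \<beta> B' R" "card A' = card B'"
          "card (A n) \<le> card A' + J" "card L = l" "card R = Suc r"
        have sub: "A' \<subseteq> A n" "B' \<subseteq> B n" "L \<subseteq> A'" "R \<subseteq> B'" using * by (auto simp: explorable_def)
        have fin: "finite A'" "finite B'" using finite_subset[OF sub(1) finA] finite_subset[OF sub(2) finB] by auto
        obtain y where y: "y \<in> R" using *(6) by fastforce
        have yB: "y \<in> B'" using y sub by auto
        have fR: "finite R" using finite_subset[OF sub(4) fin(2)] .
        let ?\<phi> = "\<lambda>x. uprob (matchings (A' - {x}) (B' - {y}))
          (\<lambda>f. card (explored (A' - {x}) \<alpha> \<beta> f (L \<union> fib A' \<alpha> x - {x}) (R - {y})) \<le> K)"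
        have "(\<Sum>k=1..D. u k * max 0 (c k - \<delta> / 2)) - 2 * real D * \<eta> \<le> (\<Sum>x\<in>A' - L. ?\<phi> x) / real (card A')"
        proof (rule average_lower_bound[OF finA[of n] sub(1,3) *(5,4), of _ "\<lambda>x. card (fib (A n) \<alpha> x)"])
          show "0 \<le> max 0 (c k - \<delta> / 2)" "max 0 (c k - \<delta> / 2) \<le> 1" for k using c[of k] d by auto
          show "u k - \<eta> \<le> uprob (A n) (\<lambda>x. card (fib (A n) \<alpha> x) = k)" if "k \<in> {1..D}" for k
            using elim(1) that by (auto intro: less_imp_le)
          show "real (J + l) \<le> \<eta> * real (card (A n))" using elim(3) eta by (simp add: field_simps)
          show "0 < card A'" using yB fin * by (metis card_gt_0_iff empty_iff)
          fix x assume x: "x \<in> A' - L" and k: "card (fib (A n) \<alpha> x) \<in> {1..D}"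
          have "c (card (fib (A n) \<alpha> x)) - \<delta> / 2 \<le> ?\<phi> x"
          proof (rule elim(2)[rule_format, OF k])
            show "explorable (A n) \<alpha> (A' - {x}) (L \<union> fib A' \<alpha> x - {x})" using *(1) x by (rule explorable_discover)
            show "explorable (B n) \<beta> (B' - {y}) (R - {y})" using *(2) y by (rule explorable_remove)
            show "card (A' - {x}) = card (B' - {y})" using yB x fin * by simp
            show "card (A n) \<le> card (A' - {x}) + Suc J" using x fin * by simp
            show "card (R - {y}) = r" using y fR * by simp
            show "card (L \<union> fib A' \<alpha> x - {x}) = l + (card (fib (A n) \<alpha> x) - 1)"
              using card_discover[OF finA *(1) x] *(5) by simp
          qed
          then show "max 0 (c (card (fib (A n) \<alpha> x)) - \<delta> / 2) \<le> ?\<phi> x" by simp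
        qed simp
        also have "\<dots> \<le> uprob (matchings A' B') (\<lambda>f. card (explored A' \<alpha> \<beta> f L R) \<le> Suc K)"
          by (rule explored_small_step_right[OF finA finB *(1-3) y])
        finally show "(\<Sum>k=1..D. u k * c k) - \<delta> \<le> uprob (matchings A' B') (\<lambda>f. card (explored A' \<alpha> \<beta> f L R) \<le> Suc K)"
          unfolding \<eta>_def by (rule combine_lower[OF laws(1) d])
      qed
    qed
  qed
qed

lemma gen_partial_sums:
  assumes w: "is_law w" "w 0 = 0" and z: "0 \<le> z" "z \<le> 1" and c: "0 \<le> c" "c \<le> 1" and e: "\<epsilon> > 0"
  obtains D where "gen w z * c - \<epsilon> \<le> (\<Sum>k=1..D. w k * (z ^ (k - 1) * c))"
proof -
  have "(\<lambda>n. \<Sum>k<n. w k * z ^ (k - 1)) \<longlonglongrightarrow> gen w z"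
    using summable_LIMSEQ[OF gen_summable[OF w(1) z]] by (simp add: gen_def)
  from order_tendstoD(1)[OF this, of "gen w z - \<epsilon>"] e
  obtain n where n: "gen w z - \<epsilon> < (\<Sum>k<n. w k * z ^ (k - 1))" using eventually_happens by fastforce
  have "(\<Sum>k<n. w k * z ^ (k - 1)) \<le> (\<Sum>k\<in>insert 0 {1..n}. w k * z ^ (k - 1))"
    using w z is_law_nonneg[OF w(1)] by (intro sum_mono2) auto
  then have "gen w z - \<epsilon> \<le> (\<Sum>k=1..n. w k * z ^ (k - 1))" using n w by simp
  then have "(gen w z - \<epsilon>) * c \<le> (\<Sum>k=1..n. w k * z ^ (k - 1)) * c" using c by (intro mult_right_mono)
  moreover have "gen w z * c - \<epsilon> \<le> (gen w z - \<epsilon>) * c" using c e by (simp add: algebra_simps mult_left_le)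
  moreover have "(\<Sum>k=1..n. w k * z ^ (k - 1)) * c = (\<Sum>k=1..n. w k * (z ^ (k - 1) * c))"
    by (simp add: sum_distrib_right mult.assoc)
  ultimately show ?thesis using that[of n] by linarith
qed

text \<open>Each additional active half-edge multiplies the probability of dying out by the
  probability for its own descendants. The two claims alternate: an active right half-edge is
  replaced by left ones, whose factors are known for t rounds, and an active left half-edge by right
  ones, which leads to t + 1 rounds.\<close>

lemma stops_iter:
  "(\<forall>l r c. 0 \<le> c \<longrightarrow> c \<le> 1 \<longrightarrow> stops l r c \<longrightarrow> stops (Suc l) r (ext_iter u v t * c)) \<and>
   (\<forall>l r c. 0 \<le> c \<longrightarrow> c \<le> 1 \<longrightarrow> stops l r c \<longrightarrow> stops l (Suc r) (gen u (ext_iter u v t) * c))"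
proof (induction t)
  have right: "stops l (Suc r) (gen u z * c)"
    if c: "0 \<le> c" "c \<le> 1" and st: "stops l r c" and z: "0 \<le> z" "z \<le> 1"
      and left: "\<And>l r c. 0 \<le> c \<Longrightarrow> c \<le> 1 \<Longrightarrow> stops l r c \<Longrightarrow> stops (Suc l) r (z * c)" for l r c z
  proof (rule stops_limit)
    fix \<epsilon> :: real assume e: "\<epsilon> > 0"
    have pow: "stops (l + j) r (z ^ j * c)" for j
    proof (induction j)
      case (Suc j)
      have "z ^ j * c \<le> 1" using z c by (simp add: mult_le_one power_le_one)
      then show ?case using left[of "z ^ j * c" "l + j" r] Suc z c by (simp add: mult.assoc)
    qed (use st in simp)
    obtain D where D: "gen u z * c - \<epsilon> \<le> (\<Sum>k=1..D. u k * (z ^ (k - 1) * c))"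
      using gen_partial_sums[OF laws(1) uv_0(1) z c e] .
    have "stops l (Suc r) (\<Sum>k=1..D. u k * (z ^ (k - 1) * c))"
      using z c by (intro stops_right pow) (auto simp: mult_le_one power_le_one)
    then show "\<exists>c'. gen u z * c - \<epsilon> \<le> c' \<and> stops l (Suc r) c'" using D by blast
  qed
  have left: "stops (Suc l) r (gen v z * c)"
    if c: "0 \<le> c" "c \<le> 1" and st: "stops l r c" and z: "0 \<le> z" "z \<le> 1"
      and right: "\<And>l r c. 0 \<le> c \<Longrightarrow> c \<le> 1 \<Longrightarrow> stops l r c \<Longrightarrow> stops l (Suc r) (z * c)" for l r c z
  proof (rule stops_limit)
    fix \<epsilon> :: real assume e: "\<epsilon> > 0"
    have pow: "stops l (r + j) (z ^ j * c)" for j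
    proof (induction j)
      case (Suc j)
      have "z ^ j * c \<le> 1" using z c by (simp add: mult_le_one power_le_one)
      then show ?case using right[of "z ^ j * c" l "r + j"] Suc z c by (simp add: mult.assoc)
    qed (use st in simp)
    obtain D where D: "gen v z * c - \<epsilon> \<le> (\<Sum>k=1..D. v k * (z ^ (k - 1) * c))"
      using gen_partial_sums[OF laws(2) uv_0(2) z c e] .
    have "stops (Suc l) r (\<Sum>k=1..D. v k * (z ^ (k - 1) * c))"
      using z c by (intro stops_left pow) (auto simp: mult_le_one power_le_one)
    then show "\<exists>c'. gen v z * c - \<epsilon> \<le> c' \<and> stops (Suc l) r c'" using D by blast
  qed
  {
    case 0
    have "stops (Suc l) r (ext_iter u v 0 * c)" for l r c by (simp add: stops_nonpos)
    then show ?case using right[of _ _ _ "ext_iter u v 0"] by simp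
  next
    case (Suc t)
    note b = ext_iter_bounds[OF laws, of t]
    have "0 \<le> gen u (ext_iter u v t)" "gen u (ext_iter u v t) \<le> 1"
      using b laws by (auto intro!: gen_nonneg gen_le_1)
    then have L: "stops (Suc l) r (ext_iter u v (Suc t) * c)" if "0 \<le> c" "c \<le> 1" "stops l r c" for l r c
      using left[of c l r "gen u (ext_iter u v t)"] Suc that by simp
    then show ?case using right[of _ _ _ "ext_iter u v (Suc t)"] ext_iter_bounds[OF laws, of "Suc t"] by blast
  }
qed

text \<open>The bound with t rounds holds for every t, and the iterates increase to the extinction
  probability.\<close>

lemma stops_ext_prob: "stops k 0 (\<rho> ^ k)"
proof (rule stops_limit)
  fix \<epsilon> :: real assume e: "\<epsilon> > 0"
  have st: "stops k 0 (ext_iter u v t ^ k)" for t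
  proof (induction k)
    case (Suc k)
    have "ext_iter u v t ^ k \<le> 1" "0 \<le> ext_iter u v t ^ k"
      using ext_iter_bounds[OF laws, of t] by (auto intro: power_le_one)
    then show ?case using stops_iter[of t] Suc by auto
  qed (simp add: stops_0)
  have "(\<lambda>t. ext_iter u v t ^ k) \<longlonglongrightarrow> \<rho> ^ k" by (intro tendsto_intros ext_iter_tendsto laws)
  from order_tendstoD(1)[OF this, of "\<rho> ^ k - \<epsilon>"] e
  obtain t where "\<rho> ^ k - \<epsilon> < ext_iter u v t ^ k" using eventually_happens by fastforce
  then show "\<exists>c'. \<rho> ^ k - \<epsilon> \<le> c' \<and> stops k 0 c'" using st by (intro exI[of _ "ext_iter u v t ^ k"]) auto
qed

lemma small_lower:
  assumes "\<delta> > 0"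
  obtains K where "\<forall>\<^sub>F n in sequentially. \<forall>L. explorable (A n) \<alpha> (A n) L \<longrightarrow> card L = k \<longrightarrow>
    \<rho> ^ k - \<delta> \<le> uprob (MM n) (\<lambda>f. card (explored (A n) \<alpha> \<beta> f L {}) \<le> K)"
proof -
  obtain K where K: "\<forall>J. \<forall>\<^sub>F n in sequentially. stops_at K J n k 0 (\<rho> ^ k - \<delta>)"
    using stops_ext_prob[of k] assms unfolding stops_def by blast
  show ?thesis
  proof (rule that[of K])
    show "\<forall>\<^sub>F n in sequentially. \<forall>L. explorable (A n) \<alpha> (A n) L \<longrightarrow> card L = k \<longrightarrow>
      \<rho> ^ k - \<delta> \<le> uprob (MM n) (\<lambda>f. card (explored (A n) \<alpha> \<beta> f L {}) \<le> K)"
      using K[rule_format, of 0]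
    proof eventually_elim
      case (elim n)
      have "explorable (B n) \<beta> (B n) {}" by (rule explorable_self) auto
      then show ?case using elim cAB[of n] by auto
    qed
  qed
qed

end

lemma explored_Un: "explored A \<alpha> \<beta> f (L \<union> L') {} = explored A \<alpha> \<beta> f L {} \<union> explored A \<alpha> \<beta> f L' {}"
  by (simp add: explored_def Image_Un)

context config_sequence
begin

subsection \<open>Upper bound for the probability of a small component\<close>

text \<open>A supersolution with room to spare. Of each term \<open>2 * \<epsilon>\<close>, one
  \<epsilon> absorbs the difference between the proportions at n and their limits, the other one the
  half-edges that have been used.\<close>

definition slack :: "real \<Rightarrow> real \<Rightarrow> bool" where
  "slack \<theta> \<epsilon> \<longleftrightarrow> 0 < \<epsilon> \<and> 0 \<le> \<theta> \<and> \<theta> \<le> 1 \<and> gen u \<theta> + 2 * \<epsilon> \<le> 1 \<and> gen v (gen u \<theta> + 2 * \<epsilon>) + 2 * \<epsilon> \<le> \<theta>"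

lemma slack_exists:
  assumes th: "0 \<le> \<theta>" "\<theta> \<le> 1" and lt: "gen v (gen u \<theta>) < \<theta>"
  obtains \<epsilon> where "slack \<theta> \<epsilon>"
proof -
  define y where "y = gen u \<theta>"
  have y: "0 \<le> y" "y \<le> 1" using th laws by (auto simp: y_def intro!: gen_nonneg gen_le_1)
  have y1: "y < 1" using y lt th gen_1[OF laws(2)] by (cases "y = 1") (auto simp: y_def)
  define d where "d = (\<theta> - gen v y) / 2"
  have d: "d > 0" using lt by (simp add: d_def y_def)
  obtain r where r: "r > 0" "\<And>y'. y' \<in> {0..1} \<Longrightarrow> dist y' y < r \<Longrightarrow> dist (gen v y') (gen v y) < d"
    using gen_cont[OF laws(2)] y d unfolding continuous_on_iff by (metis atLeastAtMost_iff)
  define \<epsilon> where "\<epsilon> = min (d / 2) (min (r / 4) ((1 - y) / 2))"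
  have e: "\<epsilon> > 0" "2 * \<epsilon> \<le> d" "2 * \<epsilon> < r" "2 * \<epsilon> \<le> 1 - y"
  proof -
    have "\<epsilon> \<le> d / 2" "\<epsilon> \<le> r / 4" "\<epsilon> \<le> (1 - y) / 2" by (auto simp: \<epsilon>_def min_def)
    then show "2 * \<epsilon> \<le> d" "2 * \<epsilon> < r" "2 * \<epsilon> \<le> 1 - y" using r(1) by (simp_all add: field_simps)
    show "\<epsilon> > 0" using d r(1) y1 by (simp add: \<epsilon>_def)
  qed
  have "dist (gen v (y + 2 * \<epsilon>)) (gen v y) < d" using e y by (intro r(2)) (auto simp: dist_real_def)
  then have "gen v (y + 2 * \<epsilon>) < gen v y + d" by (auto simp: dist_real_def)
  then have "gen v (y + 2 * \<epsilon>) + 2 * \<epsilon> \<le> \<theta>" using e by (simp add: d_def field_simps)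
  then have "slack \<theta> \<epsilon>" using e th by (simp add: slack_def y_def)
  then show ?thesis by (rule that)
qed

text \<open>The vertex labels \<open>\<alpha>'\<close> may depend on n and need not be the given
  ones, because the bound is also used after some half-edges have been cut off their
  vertices.\<close>

lemma small_upper:
  fixes \<alpha>' :: "nat \<Rightarrow> 'a \<Rightarrow> 'x"
  assumes sl: "slack \<theta> \<epsilon>" and d: "\<delta> > 0"
    and stat: "\<forall>\<^sub>F n in sequentially. avg (A n) (\<lambda>x. \<theta> ^ (card (fib (A n) (\<alpha>' n) x) - 1)) \<le> gen u \<theta> + \<epsilon>"
  shows "\<forall>\<^sub>F n in sequentially. \<forall>L. explorable (A n) (\<alpha>' n) (A n) L \<longrightarrow>
    uprob (MM n) (\<lambda>f. card (explored (A n) (\<alpha>' n) \<beta> f L {}) \<le> K) \<le> \<theta> ^ card L + \<delta>"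
proof -
  have e: "\<epsilon> > 0" and th: "0 \<le> \<theta>" "\<theta> \<le> 1" using sl by (auto simp: slack_def)
  define \<theta>r where "\<theta>r = gen u \<theta> + 2 * \<epsilon>"
  have thr: "0 \<le> \<theta>r" "\<theta>r \<le> 1" "gen v \<theta>r + 2 * \<epsilon> \<le> \<theta>"
    using sl gen_nonneg[OF laws(1), of \<theta>] by (auto simp: slack_def \<theta>r_def)
  have "(\<lambda>n. avg (B n) (\<lambda>y. \<theta>r ^ (card (fib (B n) \<beta> y) - 1))) \<longlonglongrightarrow> gen v \<theta>r"
    unfolding gen_def by (rule avg_right_tendsto) (use thr in \<open>auto intro: power_le_one\<close>)
  then have "\<forall>\<^sub>F n in sequentially. avg (B n) (\<lambda>y. \<theta>r ^ (card (fib (B n) \<beta> y) - 1)) < gen v \<theta>r + \<epsilon>"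
    using e by (intro order_tendstoD) auto
  then show ?thesis
    using stat eventually_card[of "real K + real K / \<epsilon> + real K * real K / \<delta> + 1"]
  proof eventually_elim
    case (elim n)
    define h where "h = card (A n)"
    have hpos: "real K / \<epsilon> \<ge> 0" "real K * real K / \<delta> \<ge> 0" using e d by auto
    have h: "real h \<ge> real K + 1" using elim(3) hpos unfolding h_def by linarith
    have cA: "real (card (A n)) > 0" using h by (simp add: h_def)
    have h1: "real (h - K) = real h - real K" "h - K > 0" using h by (auto simp: of_nat_diff)
    have "real K / \<epsilon> \<le> real h" using elim(3) hpos unfolding h_def by linarith
    then have eh: "real K \<le> \<epsilon> * real h" using e by (simp add: field_simps)
    have "real K * real K / \<delta> \<le> real (h - K)" using elim(3) hpos h1 unfolding h_def by linarith
    then have err: "real K * real K / real (h - K) \<le> \<delta>" using d h1 by (simp add: field_simps)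
    have SB: "(\<Sum>y\<in>B n. \<theta>r ^ (card (fib (B n) \<beta> y) - 1)) \<le> \<theta> * real (h - K)"
    proof -
      have "(\<Sum>y\<in>B n. \<theta>r ^ (card (fib (B n) \<beta> y) - 1)) \<le> (gen v \<theta>r + \<epsilon>) * real h"
        using elim(1) cA by (simp add: avg_def h_def flip: cAB) (simp add: divide_less_eq)
      also have "\<dots> \<le> (\<theta> - \<epsilon>) * real h" using thr by (intro mult_right_mono) auto
      also have "\<dots> \<le> \<theta> * real h - \<theta> * real K"
        using eh mult_right_mono[OF th(2), of "real K"] by (simp add: algebra_simps)
      finally show ?thesis by (simp add: h1 algebra_simps)
    qed
    have SA: "(\<Sum>x\<in>A n. \<theta> ^ (card (fib (A n) (\<alpha>' n) x) - 1)) \<le> \<theta>r * real (h - K)"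
    proof -
      have "(\<Sum>x\<in>A n. \<theta> ^ (card (fib (A n) (\<alpha>' n) x) - 1)) \<le> (gen u \<theta> + \<epsilon>) * real h"
        using elim(2) cA by (simp add: avg_def h_def divide_le_eq)
      also have "\<dots> = \<theta>r * real h - \<epsilon> * real h" by (simp add: \<theta>r_def algebra_simps)
      also have "\<dots> \<le> \<theta>r * real h - \<theta>r * real K"
        using eh mult_right_mono[OF thr(2), of "real K"] by simp
      finally show ?thesis by (simp add: h1 algebra_simps)
    qed
    show ?case
    proof (intro allI impI)
      fix L assume L: "explorable (A n) (\<alpha>' n) (A n) L"
      have "uprob (MM n) (\<lambda>f. card (explored (A n) (\<alpha>' n) \<beta> f L {}) \<le> K)
        \<le> \<theta> ^ card L * \<theta>r ^ card ({} :: 'b set) + real K * real K / real (h - K)"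
      proof (rule explored_small_le[OF finA finB th thr(1,2) h1(2) SB SA L])
        show "explorable (B n) \<beta> (B n) {}" by (rule explorable_self) auto
        show "h - K + K \<le> card (A n)" using h by (simp add: h_def)
      qed (use cAB in auto)
      then show "uprob (MM n) (\<lambda>f. card (explored (A n) (\<alpha>' n) \<beta> f L {}) \<le> K) \<le> \<theta> ^ card L + \<delta>"
        using err by simp
    qed
  qed
qed

definition supercritical :: bool where
  "supercritical \<longleftrightarrow> (\<forall>\<delta>>0. \<exists>\<theta>. \<rho> < \<theta> \<and> \<theta> < 1 \<and> \<theta> < \<rho> + \<delta> \<and> gen v (gen u \<theta>) < \<theta>)"

text \<open>The situations in which explorations have a matching upper bound: it is trivial if
  \<rho> = 1, and it comes from supersolutions near \<rho> otherwise.\<close>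

definition regular :: bool where
  "regular \<longleftrightarrow> \<rho> = 1 \<or> supercritical"

lemma \<rho>_bounds: "0 \<le> \<rho>" "\<rho> \<le> 1"
  using ext_prob_bounds[OF laws] by auto

lemma power_above_\<rho>:
  assumes "\<delta> > 0"
  obtains d where "d > 0" "\<And>\<theta>. \<rho> < \<theta> \<Longrightarrow> \<theta> < \<rho> + d \<Longrightarrow> \<theta> ^ k \<le> \<rho> ^ k + \<delta>"
proof -
  have "isCont (\<lambda>z. z ^ k) \<rho>" by (intro continuous_intros)
  then obtain d where d: "d > 0" "\<And>z. dist z \<rho> < d \<Longrightarrow> dist (z ^ k) (\<rho> ^ k) < \<delta>"
    using assms unfolding continuous_at_eps_delta by metis
  show ?thesis
  proof (rule that[OF d(1)])
    fix \<theta> assume "\<rho> < \<theta>" "\<theta> < \<rho> + d"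
    then have "dist (\<theta> ^ k) (\<rho> ^ k) < \<delta>" by (intro d(2)) (auto simp: dist_real_def)
    then show "\<theta> ^ k \<le> \<rho> ^ k + \<delta>" by (auto simp: dist_real_def)
  qed
qed

lemma stat_left:
  assumes "0 \<le> \<theta>" "\<theta> \<le> 1" "\<epsilon> > 0"
  shows "\<forall>\<^sub>F n in sequentially. avg (A n) (\<lambda>x. \<theta> ^ (card (fib (A n) \<alpha> x) - 1)) \<le> gen u \<theta> + \<epsilon>"
proof -
  have "(\<lambda>n. avg (A n) (\<lambda>x. \<theta> ^ (card (fib (A n) \<alpha> x) - 1))) \<longlonglongrightarrow> gen u \<theta>"
    unfolding gen_def by (rule avg_left_tendsto) (use assms in \<open>auto intro: power_le_one\<close>)
  from order_tendstoD(2)[OF this, of "gen u \<theta> + \<epsilon>"] assms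
  show ?thesis by (auto elim!: eventually_mono)
qed

lemma small_upper_ext:
  assumes reg: regular and d: "\<delta> > 0"
  shows "\<forall>\<^sub>F n in sequentially. \<forall>L. explorable (A n) \<alpha> (A n) L \<longrightarrow> card L = k \<longrightarrow>
    uprob (MM n) (\<lambda>f. card (explored (A n) \<alpha> \<beta> f L {}) \<le> K) \<le> \<rho> ^ k + \<delta>"
proof (cases "\<rho> = 1")
  case True
  have "uprob (MM n) (\<lambda>f. card (explored (A n) \<alpha> \<beta> f L {}) \<le> K) \<le> \<rho> ^ k + \<delta>" for n L
  proof -
    have "uprob (MM n) (\<lambda>f. card (explored (A n) \<alpha> \<beta> f L {}) \<le> K) \<le> 1" by (rule uprob_le_1)
    also have "1 \<le> \<rho> ^ k + \<delta>" using True d by simp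
    finally show ?thesis .
  qed
  then show ?thesis by simp
next
  case False
  obtain d' where d': "d' > 0" "\<And>\<theta>. \<rho> < \<theta> \<Longrightarrow> \<theta> < \<rho> + d' \<Longrightarrow> \<theta> ^ k \<le> \<rho> ^ k + \<delta> / 2"
    using power_above_\<rho>[of "\<delta> / 2" k] d by auto
  obtain \<theta> where th: "\<rho> < \<theta>" "\<theta> < 1" "\<theta> < \<rho> + d'" "gen v (gen u \<theta>) < \<theta>"
    using reg d'(1) False unfolding regular_def supercritical_def by blast
  have th0: "0 \<le> \<theta>" "\<theta> \<le> 1" using th \<rho>_bounds by auto
  obtain \<epsilon> where sl: "slack \<theta> \<epsilon>" using slack_exists[OF th0 th(4)] .
  have "\<forall>\<^sub>F n in sequentially. \<forall>L. explorable (A n) \<alpha> (A n) L \<longrightarrow>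
    uprob (MM n) (\<lambda>f. card (explored (A n) \<alpha> \<beta> f L {}) \<le> K) \<le> \<theta> ^ card L + \<delta> / 2"
    using small_upper[OF sl _ stat_left[OF th0], of "\<delta> / 2" K] sl d by (auto simp: slack_def)
  then show ?thesis
  proof eventually_elim
    case (elim n)
    then show ?case using d'(2)[OF th(1,3)] by (auto; smt (verit) field_sum_of_halves)
  qed
qed

subsection \<open>Concentration of the number of half-edges in small components\<close>

definition small :: "nat \<Rightarrow> nat \<Rightarrow> ('a \<Rightarrow> 'b) \<Rightarrow> 'a \<Rightarrow> bool" where
  "small n K f x \<longleftrightarrow> card (explored (A n) \<alpha> \<beta> f {x} {}) \<le> K"

lemma explored_fib:
  assumes "x \<in> S"
  shows "explored S \<alpha> \<beta> f (fib S \<alpha> x) {} = explored S \<alpha> \<beta> f {x} {}"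
proof
  have "fib S \<alpha> x \<subseteq> explored S \<alpha> \<beta> f {x} {}"
  proof
    fix x' assume "x' \<in> fib S \<alpha> x"
    then have x': "x' \<in> S" "\<alpha> x = \<alpha> x'" by (auto simp: fib_def)
    have "x \<in> explored S \<alpha> \<beta> f {x} {}" using explored_start(1)[of "{x}"] by blast
    then show "x' \<in> explored S \<alpha> \<beta> f {x} {}" by (rule explored_link) (use assms x' in auto)
  qed
  then show "explored S \<alpha> \<beta> f (fib S \<alpha> x) {} \<subseteq> explored S \<alpha> \<beta> f {x} {}"
    using explored_link[of _ S \<alpha> \<beta> f "{x}" "{}"] by (intro explored_least) auto
  show "explored S \<alpha> \<beta> f {x} {} \<subseteq> explored S \<alpha> \<beta> f (fib S \<alpha> x) {}"
    using assms by (intro explored_mono) (auto simp: fib_def)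
qed

lemma explorable_fib: "x \<in> A n \<Longrightarrow> explorable (A n) \<alpha> (A n) (fib (A n) \<alpha> x)"
  by (rule explorable_self) (auto simp: fib_def)

lemma explorable_fib2: "explorable (A n) \<alpha> (A n) (fib (A n) \<alpha> x \<union> fib (A n) \<alpha> x')"
  by (rule explorable_self) (auto simp: fib_def)

lemma small_prob_lower:
  assumes "\<delta> > 0"
  obtains K0 where "\<And>K. K \<ge> K0 \<Longrightarrow> \<forall>\<^sub>F n in sequentially. \<forall>x\<in>A n. card (fib (A n) \<alpha> x) = k \<longrightarrow>
    \<rho> ^ k - \<delta> \<le> uprob (MM n) (\<lambda>f. small n K f x)"
proof -
  obtain K0 where K0: "\<forall>\<^sub>F n in sequentially. \<forall>L. explorable (A n) \<alpha> (A n) L \<longrightarrow> card L = k \<longrightarrow>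
    \<rho> ^ k - \<delta> \<le> uprob (MM n) (\<lambda>f. card (explored (A n) \<alpha> \<beta> f L {}) \<le> K0)"
    using small_lower[OF assms] .
  show ?thesis
  proof (rule that[of K0])
    fix K assume K: "K0 \<le> K"
    show "\<forall>\<^sub>F n in sequentially. \<forall>x\<in>A n. card (fib (A n) \<alpha> x) = k \<longrightarrow>
      \<rho> ^ k - \<delta> \<le> uprob (MM n) (\<lambda>f. small n K f x)"
      using K0
    proof eventually_elim
      case (elim n)
      show ?case
      proof (intro ballI impI)
        fix x assume x: "x \<in> A n" "card (fib (A n) \<alpha> x) = k"
        have "\<rho> ^ k - \<delta> \<le> uprob (MM n) (\<lambda>f. card (explored (A n) \<alpha> \<beta> f (fib (A n) \<alpha> x) {}) \<le> K0)"
          using elim explorable_fib[OF x(1)] x(2) by blast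
        also have "\<dots> \<le> uprob (MM n) (\<lambda>f. small n K f x)"
          using K x by (intro uprob_mono finM) (auto simp: small_def explored_fib)
        finally show "\<rho> ^ k - \<delta> \<le> uprob (MM n) (\<lambda>f. small n K f x)" .
      qed
    qed
  qed
qed

text \<open>Explore from both vertices at once. This gives asymptotically the product of the two
  probabilities, but only as an upper bound, which suffices for a variance.\<close>

lemma both_small_upper:
  assumes reg: regular and d: "\<delta> > 0"
  shows "\<forall>\<^sub>F n in sequentially. \<forall>x\<in>A n. \<forall>x'\<in>A n. card (fib (A n) \<alpha> x) = k \<longrightarrow> card (fib (A n) \<alpha> x') = k' \<longrightarrow>
    \<alpha> x \<noteq> \<alpha> x' \<longrightarrow> uprob (MM n) (\<lambda>f. small n K f x \<and> small n K f x') \<le> \<rho> ^ (k + k') + \<delta>"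
  using small_upper_ext[OF reg d, of "k + k'" "2 * K"]
proof eventually_elim
  case (elim n)
  show ?case
  proof (intro ballI impI)
    fix x x' assume x: "x \<in> A n" "x' \<in> A n" "card (fib (A n) \<alpha> x) = k" "card (fib (A n) \<alpha> x') = k'" "\<alpha> x \<noteq> \<alpha> x'"
    let ?L = "fib (A n) \<alpha> x \<union> fib (A n) \<alpha> x'"
    have fin: "finite (fib (A n) \<alpha> z)" for z using finA[of n] by (simp add: fib_def)
    have "card ?L = k + k'" using x fin by (subst card_Un_disjoint) (auto simp: fib_def)
    then have "uprob (MM n) (\<lambda>f. card (explored (A n) \<alpha> \<beta> f ?L {}) \<le> 2 * K) \<le> \<rho> ^ (k + k') + \<delta>"
      using elim explorable_fib2 by blast
    moreover have "uprob (MM n) (\<lambda>f. small n K f x \<and> small n K f x')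
        \<le> uprob (MM n) (\<lambda>f. card (explored (A n) \<alpha> \<beta> f ?L {}) \<le> 2 * K)"
    proof (rule uprob_mono[OF finM])
      fix f assume s: "small n K f x \<and> small n K f x'"
      have "explored (A n) \<alpha> \<beta> f ?L {} = explored (A n) \<alpha> \<beta> f {x} {} \<union> explored (A n) \<alpha> \<beta> f {x'} {}"
        by (simp only: explored_Un explored_fib[OF x(1)] explored_fib[OF x(2)])
      then have "card (explored (A n) \<alpha> \<beta> f ?L {})
          \<le> card (explored (A n) \<alpha> \<beta> f {x} {}) + card (explored (A n) \<alpha> \<beta> f {x'} {})"
        by (simp add: card_Un_le)
      then show "card (explored (A n) \<alpha> \<beta> f ?L {}) \<le> 2 * K" using s by (simp add: small_def)
    qed
    ultimately show "uprob (MM n) (\<lambda>f. small n K f x \<and> small n K f x') \<le> \<rho> ^ (k + k') + \<delta>" by simp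
  qed
qed

lemma degree_tail:
  assumes "\<epsilon> > 0"
  obtains D where "\<forall>\<^sub>F n in sequentially. uprob (A n) (\<lambda>x. D \<le> card (fib (A n) \<alpha> x)) \<le> \<epsilon>"
proof -
  have "(\<lambda>m. \<Sum>k<m. u k) \<longlonglongrightarrow> 1" using laws(1) by (simp add: is_law_def sums_def)
  from order_tendstoD(1)[OF this, of "1 - \<epsilon>"] assms
  obtain D where D: "1 - \<epsilon> < (\<Sum>k<D. u k)" using eventually_happens by fastforce
  have eq: "(\<Sum>k. u k * of_bool (D \<le> k)) = 1 - (\<Sum>k<D. u k)"
  proof -
    have "summable (\<lambda>k. u k * of_bool (D \<le> k))" by (rule is_law_summable_mult[OF laws(1)]) auto
    from suminf_split_initial_segment[OF this, of D]
    have "(\<Sum>k. u k * of_bool (D \<le> k)) = (\<Sum>k. u (k + D))" by simp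
    also have "\<dots> = 1 - (\<Sum>k<D. u k)"
      using suminf_minus_initial_segment[OF is_law_summable[OF laws(1)], of D] is_law_suminf[OF laws(1)] by simp
    finally show ?thesis .
  qed
  have "(\<lambda>n. avg (A n) (\<lambda>x. of_bool (D \<le> card (fib (A n) \<alpha> x)))) \<longlonglongrightarrow> (\<Sum>k. u k * of_bool (D \<le> k))"
    by (rule avg_left_tendsto) auto
  then have "(\<lambda>n. uprob (A n) (\<lambda>x. D \<le> card (fib (A n) \<alpha> x))) \<longlonglongrightarrow> 1 - (\<Sum>k<D. u k)"
    using finA by (simp add: eq avg_of_bool)
  from order_tendstoD(2)[OF this, of \<epsilon>] D
  show ?thesis by (intro that[of D]) (auto elim!: eventually_mono)
qed

text \<open>The half-edges in small components, weighted by a function of the degree. The weight 1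
  counts edges and the weight 1 / k counts vertices.\<close>

definition small_weight :: "(nat \<Rightarrow> real) \<Rightarrow> nat \<Rightarrow> nat \<Rightarrow> ('a \<Rightarrow> 'b) \<Rightarrow> real" where
  "small_weight w n K f = avg (A n) (\<lambda>x. w (card (fib (A n) \<alpha> x)) * of_bool (small n K f x))"

lemma square_avg:
  "(avg S g)\<^sup>2 = (\<Sum>x\<in>S. \<Sum>x'\<in>S. g x * g x') / (real (card S))\<^sup>2"
  by (simp add: avg_def power_divide power2_eq_square sum_product)

text \<open>Expand the square. For half-edges of different vertices with degrees below D, the
  covariance is at most \<open>3 * \<epsilon>\<close>, by the upper bound for both and the lower
  bounds for each of them. All other pairs are a proportion of at most
  \<open>3 * \<epsilon>\<close>.\<close>

lemma small_variance:
  assumes reg: regular and e: "\<epsilon> > 0" and w: "\<And>k. 0 \<le> w k" "\<And>k. w k \<le> 1"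
  obtains K0 where "\<And>K. K \<ge> K0 \<Longrightarrow> \<forall>\<^sub>F n in sequentially. avg (MM n) (\<lambda>f.
    (avg (A n) (\<lambda>x. w (card (fib (A n) \<alpha> x)) * (of_bool (small n K f x) - \<rho> ^ card (fib (A n) \<alpha> x))))\<^sup>2) \<le> 6 * \<epsilon>"
proof -
  obtain D where D: "\<forall>\<^sub>F n in sequentially. uprob (A n) (\<lambda>x. D \<le> card (fib (A n) \<alpha> x)) \<le> \<epsilon>"
    using degree_tail[OF e] .
  have "\<forall>k. \<exists>K0. \<forall>K\<ge>K0. \<forall>\<^sub>F n in sequentially. \<forall>x\<in>A n. card (fib (A n) \<alpha> x) = k \<longrightarrow>
    \<rho> ^ k - \<epsilon> \<le> uprob (MM n) (\<lambda>f. small n K f x)"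
  proof
    fix k show "\<exists>K0. \<forall>K\<ge>K0. \<forall>\<^sub>F n in sequentially. \<forall>x\<in>A n. card (fib (A n) \<alpha> x) = k \<longrightarrow>
      \<rho> ^ k - \<epsilon> \<le> uprob (MM n) (\<lambda>f. small n K f x)"
      by (rule small_prob_lower[OF e, of k]) blast
  qed
  from choice[OF this] obtain K0 where K0: "\<And>k K. K \<ge> K0 k \<Longrightarrow> \<forall>\<^sub>F n in sequentially. \<forall>x\<in>A n. card (fib (A n) \<alpha> x) = k \<longrightarrow>
    \<rho> ^ k - \<epsilon> \<le> uprob (MM n) (\<lambda>f. small n K f x)" by blast
  define K1 where "K1 = (\<Sum>k<D. K0 k)"
  have K1: "K0 k \<le> K1" if "k < D" for k unfolding K1_def by (rule member_le_sum) (use that in auto)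
  show ?thesis
  proof (rule that[of K1])
    fix K assume K: "K1 \<le> K"
    have "\<forall>\<^sub>F n in sequentially. \<forall>k\<in>{..<D}. \<forall>x\<in>A n. card (fib (A n) \<alpha> x) = k \<longrightarrow>
      \<rho> ^ k - \<epsilon> \<le> uprob (MM n) (\<lambda>f. small n K f x)"
      using K K1 by (intro eventually_ball_finite ballI K0) (auto intro: order_trans)
    moreover have "\<forall>\<^sub>F n in sequentially. \<forall>k\<in>{..<D}. \<forall>k'\<in>{..<D}. \<forall>x\<in>A n. \<forall>x'\<in>A n.
      card (fib (A n) \<alpha> x) = k \<longrightarrow> card (fib (A n) \<alpha> x') = k' \<longrightarrow>
      \<alpha> x \<noteq> \<alpha> x' \<longrightarrow> uprob (MM n) (\<lambda>f. small n K f x \<and> small n K f x') \<le> \<rho> ^ (k + k') + \<epsilon>"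
      by (intro eventually_ball_finite ballI both_small_upper[OF reg e]) auto
    moreover note D eventually_card[of "real D / \<epsilon> + 1"]
    ultimately show "\<forall>\<^sub>F n in sequentially. avg (MM n) (\<lambda>f.
      (avg (A n) (\<lambda>x. w (card (fib (A n) \<alpha> x)) * (of_bool (small n K f x) - \<rho> ^ card (fib (A n) \<alpha> x))))\<^sup>2) \<le> 6 * \<epsilon>"
    proof eventually_elim
      case (elim n)
      define dg where "dg x = card (fib (A n) \<alpha> x)" for x
      define s where "s f x = (of_bool (small n K f x) :: real)" for f x
      define c where "c = real (card (A n))"
      have De: "real D / \<epsilon> \<ge> 0" using e by simp
      have c: "c > 0" "real D / \<epsilon> \<le> c" using elim(4) De unfolding c_def by linarith+
      have Dc: "real D / c \<le> \<epsilon>" using c e by (simp add: field_simps)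
      have r: "0 \<le> \<rho> ^ k" "\<rho> ^ k \<le> 1" for k using \<rho>_bounds by (auto intro: power_le_one)
      have lo: "\<rho> ^ dg x - \<epsilon> \<le> avg (MM n) (\<lambda>f. s f x)" if "x \<in> A n" "dg x < D" for x
        using elim(1) that finM[of n] by (auto simp: dg_def s_def avg_of_bool)
      have hi: "avg (MM n) (\<lambda>f. s f x * s f x') \<le> \<rho> ^ dg x * \<rho> ^ dg x' + \<epsilon>"
        if "x \<in> A n" "dg x < D" "x' \<in> A n" "dg x' < D" "\<alpha> x \<noteq> \<alpha> x'" for x x'
      proof -
        have "(\<lambda>f. s f x * s f x') = (\<lambda>f. of_bool (small n K f x \<and> small n K f x'))"
          by (auto simp: s_def fun_eq_iff)
        then show ?thesis using elim(2) that finM[of n] by (auto simp: dg_def avg_of_bool power_add)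
      qed
      define cov where "cov x x' = avg (MM n) (\<lambda>f. (s f x - \<rho> ^ dg x) * (s f x' - \<rho> ^ dg x'))" for x x'
      have cov1: "cov x x' \<le> 1" for x x'
      proof -
        have "(s f x - \<rho> ^ dg x) * (s f x' - \<rho> ^ dg x') \<le> 1" for f
        proof -
          have "\<bar>s f z - \<rho> ^ dg z\<bar> \<le> 1" for z using r[of "dg z"] by (auto simp: s_def of_bool_def abs_le_iff)
          then have "\<bar>s f x - \<rho> ^ dg x\<bar> * \<bar>s f x' - \<rho> ^ dg x'\<bar> \<le> 1" by (intro mult_le_one) auto
          then show ?thesis by (simp add: abs_mult[symmetric])
        qed
        then have "cov x x' \<le> avg (MM n) (\<lambda>f. 1)" unfolding cov_def by (intro avg_mono) auto
        then show ?thesis using avg_const[OF finM MM_ne] by simp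
      qed
      have cov2: "cov x x' \<le> 3 * \<epsilon>" if x: "x \<in> A n" "dg x < D" "x' \<in> A n" "dg x' < D" "\<alpha> x \<noteq> \<alpha> x'" for x x'
      proof -
        have "cov x x' = avg (MM n) (\<lambda>f. s f x * s f x' - \<rho> ^ dg x' * s f x - \<rho> ^ dg x * s f x' + \<rho> ^ dg x * \<rho> ^ dg x')"
          unfolding cov_def by (intro arg_cong[where f = "avg (MM n)"] ext) (simp add: algebra_simps)
        also have "\<dots> = avg (MM n) (\<lambda>f. s f x * s f x') - \<rho> ^ dg x' * avg (MM n) (\<lambda>f. s f x)
            - \<rho> ^ dg x * avg (MM n) (\<lambda>f. s f x') + \<rho> ^ dg x * \<rho> ^ dg x'"
          by (simp add: avg_add avg_diff avg_cmult avg_const[OF finM MM_ne])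
        also have "\<dots> \<le> (\<rho> ^ dg x * \<rho> ^ dg x' + \<epsilon>) - \<rho> ^ dg x' * (\<rho> ^ dg x - \<epsilon>)
            - \<rho> ^ dg x * (\<rho> ^ dg x' - \<epsilon>) + \<rho> ^ dg x * \<rho> ^ dg x'"
          using hi[OF x] mult_left_mono[OF lo[OF x(1,2)] r(1)[of "dg x'"]]
            mult_left_mono[OF lo[OF x(3,4)] r(1)[of "dg x"]] by linarith
        also have "\<dots> = \<epsilon> + \<epsilon> * \<rho> ^ dg x' + \<epsilon> * \<rho> ^ dg x" by (simp add: algebra_simps)
        also have "\<dots> \<le> \<epsilon> + \<epsilon> * 1 + \<epsilon> * 1" using r e by (intro add_mono mult_left_mono) auto
        finally show ?thesis by simp
      qed
      have bound: "w (dg x) * w (dg x') * cov x x'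
          \<le> 3 * \<epsilon> + of_bool (D \<le> dg x) + of_bool (D \<le> dg x') + of_bool (dg x < D \<and> \<alpha> x' = \<alpha> x)"
        if x: "x \<in> A n" "x' \<in> A n" for x x'
      proof -
        have "w (dg x) * w (dg x') * cov x x' \<le> w (dg x) * w (dg x') * max 0 (cov x x')"
          using w by (intro mult_left_mono) auto
        also have "\<dots> \<le> 1 * max 0 (cov x x')" using w by (intro mult_right_mono mult_le_one) auto
        also have "\<dots> \<le> 3 * \<epsilon> + of_bool (D \<le> dg x) + of_bool (D \<le> dg x') + of_bool (dg x < D \<and> \<alpha> x' = \<alpha> x)"
        proof (cases "dg x < D \<and> dg x' < D \<and> \<alpha> x \<noteq> \<alpha> x'")
          case True then show ?thesis using cov2[of x x'] x e by simp
        next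
          case False
          then have "D \<le> dg x \<or> D \<le> dg x' \<or> (dg x < D \<and> \<alpha> x' = \<alpha> x)" by auto
          then have "1 \<le> of_bool (D \<le> dg x) + of_bool (D \<le> dg x') + (of_bool (dg x < D \<and> \<alpha> x' = \<alpha> x) :: real)"
            by (auto simp: of_bool_def)
          then show ?thesis using cov1[of x x'] e by linarith
        qed
        finally show ?thesis .
      qed
      have "avg (MM n) (\<lambda>f. (avg (A n) (\<lambda>x. w (dg x) * (s f x - \<rho> ^ dg x)))\<^sup>2)
         = (\<Sum>x\<in>A n. \<Sum>x'\<in>A n. w (dg x) * w (dg x') * cov x x') / c\<^sup>2"
      proof -
        have eq: "(avg (A n) (\<lambda>x. w (dg x) * (s f x - \<rho> ^ dg x)))\<^sup>2 = (1 / c\<^sup>2) * (\<Sum>x\<in>A n. \<Sum>x'\<in>A n.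
            w (dg x) * w (dg x') * ((s f x - \<rho> ^ dg x) * (s f x' - \<rho> ^ dg x')))" for f
          unfolding square_avg c_def by (simp add: mult_ac)
        show ?thesis unfolding eq avg_cmult avg_sum cov_def by simp
      qed
      also have "\<dots> \<le> (\<Sum>x\<in>A n. \<Sum>x'\<in>A n. 3 * \<epsilon> + of_bool (D \<le> dg x) + of_bool (D \<le> dg x')
          + of_bool (dg x < D \<and> \<alpha> x' = \<alpha> x)) / c\<^sup>2"
        using bound by (intro divide_right_mono sum_mono) auto
      also have "\<dots> \<le> 6 * \<epsilon>"
      proof -
        have tail: "(\<Sum>x\<in>A n. of_bool (D \<le> dg x)) \<le> \<epsilon> * c"
          using elim(3) finA[of n] c by (simp add: uprob_eq_avg dg_def c_def divide_le_eq)
        have same: "(\<Sum>x'\<in>A n. of_bool (dg x < D \<and> \<alpha> x' = \<alpha> x)) \<le> real D" for x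
        proof (cases "dg x < D")
          case True
          have "(\<Sum>x'\<in>A n. of_bool (\<alpha> x' = \<alpha> x)) = real (dg x)"
            using finA[of n] by (simp add: of_bool_def sum.If_cases dg_def fib_def Int_def)
          then show ?thesis using True by simp
        qed simp
        have "(\<Sum>x\<in>A n. \<Sum>x'\<in>A n. 3 * \<epsilon> + of_bool (D \<le> dg x) + of_bool (D \<le> dg x')
          + of_bool (dg x < D \<and> \<alpha> x' = \<alpha> x))
          = 3 * \<epsilon> * c * c + c * (\<Sum>x\<in>A n. of_bool (D \<le> dg x)) + c * (\<Sum>x\<in>A n. of_bool (D \<le> dg x))
           + (\<Sum>x\<in>A n. \<Sum>x'\<in>A n. of_bool (dg x < D \<and> \<alpha> x' = \<alpha> x))"
          by (simp only: sum.distrib sum_constant c_def sum_distrib_left) (simp add: mult_ac)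
        also have "\<dots> \<le> 3 * \<epsilon> * c * c + c * (\<epsilon> * c) + c * (\<epsilon> * c) + (\<Sum>x\<in>A n. real D)"
          using tail same c by (intro add_mono mult_left_mono sum_mono order_refl) auto
        also have "\<dots> = (5 * \<epsilon> + real D / c) * c\<^sup>2"
          using c by (simp add: c_def power2_eq_square field_simps)
        also have "\<dots> \<le> (6 * \<epsilon>) * c\<^sup>2" using Dc by (intro mult_right_mono) auto
        finally show ?thesis using c by (simp add: divide_le_eq)
      qed
      finally show ?case by (simp add: dg_def s_def)
    qed
  qed
qed

lemma small_weight_tendsto:
  assumes reg: regular and d: "\<delta> > 0" and w: "\<And>k. 0 \<le> w k" "\<And>k. w k \<le> 1"
  obtains K0 where "\<And>K. K \<ge> K0 \<Longrightarrow> \<forall>\<^sub>F n in sequentially.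
    uprob (MM n) (\<lambda>f. \<bar>small_weight w n K f - (\<Sum>k. u k * (w k * \<rho> ^ k))\<bar> \<ge> \<delta>) \<le> \<delta>"
proof -
  define \<epsilon> where "\<epsilon> = \<delta> * (\<delta> / 2)\<^sup>2 / 6"
  have e: "\<epsilon> > 0" using d by (simp add: \<epsilon>_def)
  obtain K0 where K0: "\<And>K. K \<ge> K0 \<Longrightarrow> \<forall>\<^sub>F n in sequentially. avg (MM n) (\<lambda>f.
    (avg (A n) (\<lambda>x. w (card (fib (A n) \<alpha> x)) * (of_bool (small n K f x) - \<rho> ^ card (fib (A n) \<alpha> x))))\<^sup>2) \<le> 6 * \<epsilon>"
    using small_variance[OF reg e, of w] w by blast
  show ?thesis
  proof (rule that[of K0])
    fix K assume K: "K0 \<le> K"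
    have "0 \<le> w k * \<rho> ^ k" "w k * \<rho> ^ k \<le> 1" for k
      using w[of k] \<rho>_bounds by (auto intro!: mult_le_one power_le_one)
    then have "(\<lambda>n. avg (A n) (\<lambda>x. w (card (fib (A n) \<alpha> x)) * \<rho> ^ card (fib (A n) \<alpha> x))) \<longlonglongrightarrow> (\<Sum>k. u k * (w k * \<rho> ^ k))"
      by (intro avg_left_tendsto)
    from tendstoD[OF this, of "\<delta> / 2"] d
    have "\<forall>\<^sub>F n in sequentially. dist (avg (A n) (\<lambda>x. w (card (fib (A n) \<alpha> x)) * \<rho> ^ card (fib (A n) \<alpha> x)))
        (\<Sum>k. u k * (w k * \<rho> ^ k)) < \<delta> / 2" by simp
    then show "\<forall>\<^sub>F n in sequentially.
      uprob (MM n) (\<lambda>f. \<bar>small_weight w n K f - (\<Sum>k. u k * (w k * \<rho> ^ k))\<bar> \<ge> \<delta>) \<le> \<delta>"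
      using K0[OF K]
    proof eventually_elim
      case (elim n)
      define \<tau> where "\<tau> = avg (A n) (\<lambda>x. w (card (fib (A n) \<alpha> x)) * \<rho> ^ card (fib (A n) \<alpha> x))"
      have eq: "small_weight w n K f - \<tau>
        = avg (A n) (\<lambda>x. w (card (fib (A n) \<alpha> x)) * (of_bool (small n K f x) - \<rho> ^ card (fib (A n) \<alpha> x)))" for f
        by (simp add: small_weight_def \<tau>_def algebra_simps flip: avg_diff)
      have "uprob (MM n) (\<lambda>f. \<bar>small_weight w n K f - (\<Sum>k. u k * (w k * \<rho> ^ k))\<bar> \<ge> \<delta>)
        \<le> uprob (MM n) (\<lambda>f. (small_weight w n K f - \<tau>)\<^sup>2 \<ge> (\<delta> / 2)\<^sup>2)"
      proof (rule uprob_mono[OF finM])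
        fix f assume "\<bar>small_weight w n K f - (\<Sum>k. u k * (w k * \<rho> ^ k))\<bar> \<ge> \<delta>"
        then have "\<bar>small_weight w n K f - \<tau>\<bar> \<ge> \<delta> / 2" using elim(1) unfolding \<tau>_def dist_real_def by linarith
        then have "(\<delta> / 2)\<^sup>2 \<le> \<bar>small_weight w n K f - \<tau>\<bar>\<^sup>2" using d by (intro power_mono) auto
        then show "(small_weight w n K f - \<tau>)\<^sup>2 \<ge> (\<delta> / 2)\<^sup>2" by simp
      qed
      also have "\<dots> \<le> avg (MM n) (\<lambda>f. (small_weight w n K f - \<tau>)\<^sup>2) / (\<delta> / 2)\<^sup>2"
        using d by (intro uprob_markov finM) auto
      also have "\<dots> \<le> 6 * \<epsilon> / (\<delta> / 2)\<^sup>2"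
        using elim(2) unfolding eq by (intro divide_right_mono) auto
      also have "\<dots> = \<delta>" using d by (simp add: \<epsilon>_def)
      finally show ?case .
    qed
  qed
qed

end

section \<open>Sprinkling\<close>

lemma linked_sym: "sym (linked A \<alpha> \<beta> f)"
  by (auto simp: linked_def sym_def)

abbreviation comp_of :: "'a set \<Rightarrow> ('a \<Rightarrow> 'v) \<Rightarrow> ('b \<Rightarrow> 'w) \<Rightarrow> ('a \<Rightarrow> 'b) \<Rightarrow> 'a \<Rightarrow> 'a set" where
  "comp_of A \<alpha> \<beta> f x \<equiv> explored A \<alpha> \<beta> f {x} {}"

lemma comp_of_eq: "comp_of A \<alpha> \<beta> f x = (linked A \<alpha> \<beta> f)\<^sup>* `` {x}"
  by (simp add: explored_def)

lemma rtrancl_class_eq: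
  assumes "sym r" "y \<in> r\<^sup>* `` {x}"
  shows "r\<^sup>* `` {y} = r\<^sup>* `` {x}"
proof -
  have xy: "(x, y) \<in> r\<^sup>*" using assms(2) by (rule Image_singleton_iff[THEN iffD1])
  moreover have "(y, x) \<in> r\<^sup>*" using sym_rtrancl[OF assms(1)] xy by (rule symD)
  ultimately show ?thesis by (auto intro: rtrancl_trans)
qed

lemma comp_of_self: "x \<in> comp_of A \<alpha> \<beta> f x"
  using explored_start(1)[of "{x}" A \<alpha> \<beta> f "{}"] by simp

lemma comp_of_cong: "y \<in> comp_of A \<alpha> \<beta> f x \<Longrightarrow> comp_of A \<alpha> \<beta> f y = comp_of A \<alpha> \<beta> f x"
  unfolding comp_of_eq by (rule rtrancl_class_eq[OF linked_sym])

lemma comp_of_disjoint: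
  "comp_of A \<alpha> \<beta> f x \<noteq> comp_of A \<alpha> \<beta> f y \<Longrightarrow> comp_of A \<alpha> \<beta> f x \<inter> comp_of A \<alpha> \<beta> f y = {}"
  using comp_of_cong by (metis disjoint_iff)

lemma comp_of_subset: "x \<in> A \<Longrightarrow> comp_of A \<alpha> \<beta> f x \<subseteq> A"
  by (rule explored_subset) auto

text \<open>Makes each half-edge of F a vertex of its own.\<close>

definition split_label :: "'a set \<Rightarrow> ('a \<Rightarrow> 'v) \<Rightarrow> 'a \<Rightarrow> 'v + 'a" where
  "split_label F \<alpha> x = (if x \<in> F then Inr x else Inl (\<alpha> x))"

text \<open>Right half-edges connected by a vertex on either side, where the half-edges of F have
  been cut off. Since F enters only through its complement, the resulting classes are determined by
  f outside F (\<open>big_classes_cong\<close>), while the values on F remain random.\<close>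

definition right_linked ::
  "'a set \<Rightarrow> 'b set \<Rightarrow> ('a \<Rightarrow> 'v) \<Rightarrow> ('b \<Rightarrow> 'w) \<Rightarrow> 'a set \<Rightarrow> ('a \<Rightarrow> 'b) \<Rightarrow> ('b \<times> 'b) set" where
  "right_linked A B \<alpha> \<beta> F f = {(y, y'). y \<in> B \<and> y' \<in> B \<and>
     (\<beta> y = \<beta> y' \<or> (\<exists>x\<in>A - F. \<exists>x'\<in>A - F. f x = y \<and> f x' = y' \<and> \<alpha> x = \<alpha> x'))}"

definition right_class ::
  "'a set \<Rightarrow> 'b set \<Rightarrow> ('a \<Rightarrow> 'v) \<Rightarrow> ('b \<Rightarrow> 'w) \<Rightarrow> 'a set \<Rightarrow> ('a \<Rightarrow> 'b) \<Rightarrow> 'b \<Rightarrow> 'b set" where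
  "right_class A B \<alpha> \<beta> F f y = (right_linked A B \<alpha> \<beta> F f)\<^sup>* `` {y}"

definition big_classes ::
  "'a set \<Rightarrow> 'b set \<Rightarrow> ('a \<Rightarrow> 'v) \<Rightarrow> ('b \<Rightarrow> 'w) \<Rightarrow> 'a set \<Rightarrow> nat \<Rightarrow> ('a \<Rightarrow> 'b) \<Rightarrow> 'b set set" where
  "big_classes A B \<alpha> \<beta> F K f = {C \<in> right_class A B \<alpha> \<beta> F f ` B. K \<le> card C}"

lemma right_linked_cong: "(\<And>x. x \<in> A - F \<Longrightarrow> f x = g x) \<Longrightarrow> right_linked A B \<alpha> \<beta> F f = right_linked A B \<alpha> \<beta> F g"
  by (auto simp: right_linked_def)

lemma big_classes_cong:
  "(\<And>x. x \<in> A - F \<Longrightarrow> f x = g x) \<Longrightarrow> big_classes A B \<alpha> \<beta> F K f = big_classes A B \<alpha> \<beta> F K g"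
  using right_linked_cong[of A F f g B \<alpha> \<beta>] by (simp add: big_classes_def right_class_def)

lemma right_linked_sym: "sym (right_linked A B \<alpha> \<beta> F f)"
proof (rule symI)
  fix y y' assume "(y, y') \<in> right_linked A B \<alpha> \<beta> F f"
  then show "(y', y) \<in> right_linked A B \<alpha> \<beta> F f" unfolding right_linked_def by (simp; metis)
qed

lemma right_class_self: "y \<in> right_class A B \<alpha> \<beta> F f y"
  by (simp add: right_class_def)

lemma right_class_cong: "y \<in> right_class A B \<alpha> \<beta> F f y' \<Longrightarrow> right_class A B \<alpha> \<beta> F f y = right_class A B \<alpha> \<beta> F f y'"
  unfolding right_class_def by (rule rtrancl_class_eq[OF right_linked_sym])

lemma right_class_subset:
  assumes "y \<in> B" shows "right_class A B \<alpha> \<beta> F f y \<subseteq> B"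
proof
  fix y' assume "y' \<in> right_class A B \<alpha> \<beta> F f y"
  then have "(y, y') \<in> (right_linked A B \<alpha> \<beta> F f)\<^sup>*" by (simp add: right_class_def)
  then show "y' \<in> B" by (induction rule: rtrancl_induct) (use assms in \<open>auto simp: right_linked_def\<close>)
qed

lemma right_class_sound:
  assumes f: "f \<in> matchings A B" and z: "z \<in> A"
  shows "right_class A B \<alpha> \<beta> F f (f z) \<subseteq> f ` comp_of A \<alpha> \<beta> f z"
proof
  fix y assume "y \<in> right_class A B \<alpha> \<beta> F f (f z)"
  then have "(f z, y) \<in> (right_linked A B \<alpha> \<beta> F f)\<^sup>*" by (simp add: right_class_def)
  then show "y \<in> f ` comp_of A \<alpha> \<beta> f z"
  proof (induction rule: rtrancl_induct)
    case base then show ?case using comp_of_self by (rule imageI)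
  next
    case (step y y')
    then obtain x where x: "x \<in> comp_of A \<alpha> \<beta> f z" "y = f x" by auto
    have xA: "x \<in> A" using x comp_of_subset[OF z] by blast
    have "y' \<in> B" using step(2) by (auto simp: right_linked_def)
    then obtain x' where x': "x' \<in> A" "y' = f x'" using matchings_image[OF f] by auto
    have "\<alpha> x = \<alpha> x' \<or> \<beta> (f x) = \<beta> (f x')"
      using step(2) x x' xA inj_onD[OF matchings_inj[OF f]] by (auto simp: right_linked_def)
    then have "x' \<in> comp_of A \<alpha> \<beta> f z" using explored_link[OF x(1) xA x'(1)] by blast
    then show ?case using x' by auto
  qed
qed

text \<open>The estimates for explorations are about components of left half-edges. They bound the
  probability that the class of a right half-edge is small through this comparison.\<close>

lemma split_comp_le_right_class:
  assumes f: "f \<in> matchings A B" and z: "z \<in> A" and fin: "finite B"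
  shows "card (comp_of A (split_label F \<alpha>) \<beta> f z) \<le> card (right_class A B \<alpha> \<beta> F f (f z))"
proof -
  have sub: "comp_of A (split_label F \<alpha>) \<beta> f z \<subseteq> A" by (rule comp_of_subset[OF z])
  have "comp_of A (split_label F \<alpha>) \<beta> f z \<subseteq> {x \<in> A. f x \<in> right_class A B \<alpha> \<beta> F f (f z)}"
  proof (rule explored_least)
    show "{z} \<subseteq> {x \<in> A. f x \<in> right_class A B \<alpha> \<beta> F f (f z)}" using z right_class_self by simp
    fix x x' assume x: "x \<in> {x \<in> A. f x \<in> right_class A B \<alpha> \<beta> F f (f z)}" "x' \<in> A"
      and l: "split_label F \<alpha> x = split_label F \<alpha> x' \<or> \<beta> (f x) = \<beta> (f x')"
    have "x = x' \<or> (f x, f x') \<in> right_linked A B \<alpha> \<beta> F f"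
      using l x matchings_mem[OF f] by (auto simp: right_linked_def split_label_def split: if_splits)
    then show "x' \<in> {x \<in> A. f x \<in> right_class A B \<alpha> \<beta> F f (f z)}"
      using x unfolding right_class_def by (auto intro: rtrancl_into_rtrancl)
  qed simp
  then have "f ` comp_of A (split_label F \<alpha>) \<beta> f z \<subseteq> right_class A B \<alpha> \<beta> F f (f z)" by auto
  moreover have "finite (right_class A B \<alpha> \<beta> F f (f z))"
    using right_class_subset[OF matchings_mem[OF f z]] fin by (rule finite_subset)
  ultimately have "card (f ` comp_of A (split_label F \<alpha>) \<beta> f z) \<le> card (right_class A B \<alpha> \<beta> F f (f z))"
    by (intro card_mono)
  moreover have "inj_on f (comp_of A (split_label F \<alpha>) \<beta> f z)"
    using matchings_inj[OF f] sub by (rule inj_on_subset)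
  ultimately show ?thesis by (simp add: card_image)
qed

lemma in_Union_big_classes:
  assumes "y \<in> B"
  shows "y \<in> \<Union>(big_classes A B \<alpha> \<beta> F K f) \<longleftrightarrow> K \<le> card (right_class A B \<alpha> \<beta> F f y)"
proof
  assume "y \<in> \<Union>(big_classes A B \<alpha> \<beta> F K f)"
  then obtain y' where "y \<in> right_class A B \<alpha> \<beta> F f y'" "K \<le> card (right_class A B \<alpha> \<beta> F f y')"
    by (auto simp: big_classes_def)
  then show "K \<le> card (right_class A B \<alpha> \<beta> F f y)" using right_class_cong by metis
next
  assume "K \<le> card (right_class A B \<alpha> \<beta> F f y)"
  then show "y \<in> \<Union>(big_classes A B \<alpha> \<beta> F K f)"
    using assms right_class_self[of y A B \<alpha> \<beta> F f] by (auto simp: big_classes_def)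
qed

lemma big_classes_eq:
  assumes "C \<in> big_classes A B \<alpha> \<beta> F K f" "y \<in> C"
  shows "C = right_class A B \<alpha> \<beta> F f y"
proof -
  obtain y0 where "C = right_class A B \<alpha> \<beta> F f y0" using assms(1) by (auto simp: big_classes_def)
  then show ?thesis using right_class_cong[of y A B \<alpha> \<beta> F f y0] assms(2) by simp
qed

lemma card_big_classes:
  assumes fin: "finite B" and K: "K > 0"
  shows "finite (big_classes A B \<alpha> \<beta> F K f)" "card (big_classes A B \<alpha> \<beta> F K f) \<le> card B div K"
proof -
  let ?C = "big_classes A B \<alpha> \<beta> F K f"
  show finC: "finite ?C" using fin by (simp add: big_classes_def)
  have sub: "C \<subseteq> B" if "C \<in> ?C" for C using that right_class_subset[of _ B A \<alpha> \<beta> F f] unfolding big_classes_def by blast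
  have disj: "C \<inter> C' = {}" if "C \<in> ?C" "C' \<in> ?C" "C \<noteq> C'" for C C'
  proof (rule ccontr)
    assume "C \<inter> C' \<noteq> {}"
    then obtain y where "y \<in> C" "y \<in> C'" by auto
    then show False using that big_classes_eq by metis
  qed
  have "card ?C * K = (\<Sum>C\<in>?C. K)" by simp
  also have "\<dots> \<le> (\<Sum>C\<in>?C. card C)" by (rule sum_mono) (simp add: big_classes_def)
  also have "\<dots> = card (\<Union>?C)"
    using sub disj fin by (intro card_Union_disjoint[symmetric]) (auto simp: pairwise_def disjnt_def intro: finite_subset)
  also have "\<dots> \<le> card B" using sub fin by (intro card_mono) auto
  finally show "card ?C \<le> card B div K" using K by (simp add: less_eq_div_iff_mult_less_eq)
qed

text \<open>For x in G the half-edge \<open>s x\<close> belongs to the same vertex as x but is not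
  cut, so x joins the class of \<open>f (s x)\<close>, known before F is matched, to that of its
  random partner \<open>f x\<close>. The event says that some division of the big classes into two
  groups is not bridged, although one group meets many of the half-edges \<open>s x\<close> and the
  other one many of the partners of F.\<close>

definition separated ::
  "'a set \<Rightarrow> 'b set \<Rightarrow> ('a \<Rightarrow> 'v) \<Rightarrow> ('b \<Rightarrow> 'w) \<Rightarrow> 'a set \<Rightarrow> 'a set \<Rightarrow> ('a \<Rightarrow> 'a) \<Rightarrow> nat \<Rightarrow> real \<Rightarrow> ('a \<Rightarrow> 'b) \<Rightarrow> bool" where
  "separated A B \<alpha> \<beta> F G s K a f \<longleftrightarrow> (\<exists>\<S>\<subseteq>big_classes A B \<alpha> \<beta> F K f.
     a \<le> real (card {x \<in> G. f (s x) \<in> \<Union>\<S>}) \<and>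
     a \<le> real (card {y \<in> f ` F. y \<in> \<Union>(big_classes A B \<alpha> \<beta> F K f - \<S>)}) \<and>
     (\<forall>x\<in>G. f (s x) \<in> \<Union>\<S> \<longrightarrow> f x \<notin> \<Union>(big_classes A B \<alpha> \<beta> F K f - \<S>)))"

text \<open>Condition on f outside F. For a fixed division of the big classes, a set of at least a
  elements of F has to avoid a set of at least a partners, which has probability at most
  \<open>exp (- a\<^sup>2 / card F)\<close>. There are at most \<open>card B div K\<close> classes
  of size K or more, hence the number of divisions.\<close>

lemma separated_unlikely:
  assumes fin: "finite A" "finite B" and c: "card A = card B" and F: "F \<subseteq> A" "F \<noteq> {}"
    and G: "G \<subseteq> F" and s: "\<And>x. x \<in> G \<Longrightarrow> s x \<in> A - F" and K: "K > 0" and a: "a \<ge> 0"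
  shows "uprob (matchings A B) (separated A B \<alpha> \<beta> F G s K a)
    \<le> 2 ^ (card B div K) * exp (- a\<^sup>2 / real (card F))"
proof (rule uprob_matchings_conditional[OF fin c, of "A - F"])
  fix f0 assume f0: "f0 \<in> matchings A B"
  have AF: "A - (A - F) = F" using F by auto
  have BF: "B - f0 ` (A - F) = f0 ` F"
    using matchings_image[OF f0] F inj_onD[OF matchings_inj[OF f0]] by auto
  let ?BC = "big_classes A B \<alpha> \<beta> F K f0"
  let ?ext = "\<lambda>g x. if x \<in> A - F then f0 x else g x"
  let ?S = "\<lambda>\<S>. {x \<in> G. f0 (s x) \<in> \<Union>\<S>}"
  let ?T = "\<lambda>\<S>. {y \<in> f0 ` F. y \<in> \<Union>(?BC - \<S>)}"
  let ?Q = "\<lambda>\<S> g. a \<le> real (card (?S \<S>)) \<and> a \<le> real (card (?T \<S>)) \<and> g ` ?S \<S> \<inter> ?T \<S> = {}"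
  have finF: "finite F" using F(1) fin(1) by (rule finite_subset)
  have finM: "finite (matchings F (f0 ` F))" using finF by (intro finite_matchings_of_finite) auto
  have cF: "card F = card (f0 ` F)" using matchings_inj[OF f0] F by (metis card_image inj_on_subset)
  have "uprob (matchings F (f0 ` F)) (\<lambda>g. separated A B \<alpha> \<beta> F G s K a (?ext g))
    \<le> uprob (matchings F (f0 ` F)) (\<lambda>g. \<exists>\<S>\<in>Pow ?BC. ?Q \<S> g)"
  proof (rule uprob_mono[OF finM])
    fix g assume g: "g \<in> matchings F (f0 ` F)" and sep: "separated A B \<alpha> \<beta> F G s K a (?ext g)"
    have bc: "big_classes A B \<alpha> \<beta> F K (?ext g) = ?BC" by (rule big_classes_cong) simp
    have im: "?ext g ` F = f0 ` F" using matchings_image[OF g] by auto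
    obtain \<S> where S: "\<S> \<subseteq> ?BC" "a \<le> real (card {x \<in> G. ?ext g (s x) \<in> \<Union>\<S>})"
      "a \<le> real (card {y \<in> f0 ` F. y \<in> \<Union>(?BC - \<S>)})"
      "\<And>x. x \<in> G \<Longrightarrow> ?ext g (s x) \<in> \<Union>\<S> \<Longrightarrow> ?ext g x \<notin> \<Union>(?BC - \<S>)"
      using sep unfolding separated_def bc im by blast
    have e: "{x \<in> G. ?ext g (s x) \<in> \<Union>\<S>} = ?S \<S>" using s by auto
    have "g x \<notin> \<Union>(?BC - \<S>)" if "x \<in> ?S \<S>" for x
      using S(4)[of x] that s[of x] G by auto
    then have "?Q \<S> g" using S(2,3) unfolding e by auto
    then show "\<exists>\<S>\<in>Pow ?BC. ?Q \<S> g" using S(1) by blast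
  qed
  also have "\<dots> \<le> (\<Sum>\<S>\<in>Pow ?BC. uprob (matchings F (f0 ` F)) (?Q \<S>))"
    using card_big_classes(1)[OF fin(2) K] by (intro uprob_Bex_le finM) auto
  also have "\<dots> \<le> (\<Sum>\<S>\<in>Pow ?BC. exp (- a\<^sup>2 / real (card F)))"
  proof (rule sum_mono)
    fix \<S> assume "\<S> \<in> Pow ?BC"
    show "uprob (matchings F (f0 ` F)) (?Q \<S>) \<le> exp (- a\<^sup>2 / real (card F))"
    proof (cases "a \<le> real (card (?S \<S>)) \<and> a \<le> real (card (?T \<S>))")
      case True
      have "uprob (matchings F (f0 ` F)) (?Q \<S>) \<le> uprob (matchings F (f0 ` F)) (\<lambda>g. g ` ?S \<S> \<inter> ?T \<S> = {})"
        by (rule uprob_mono[OF finM]) auto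
      also have "\<dots> \<le> exp (- real (card (?S \<S>)) * real (card (?T \<S>)) / real (card F))"
        using finF cF G by (intro uprob_matchings_avoid) auto
      also have "\<dots> \<le> exp (- a\<^sup>2 / real (card F))"
        using True a unfolding power2_eq_square
        by (simp add: divide_right_mono mult_mono)
      finally show ?thesis .
    next
      case False
      then have "uprob (matchings F (f0 ` F)) (?Q \<S>) = 0" by (intro uprob_const_False) auto
      then show ?thesis by simp
    qed
  qed
  also have "\<dots> = 2 ^ card ?BC * exp (- a\<^sup>2 / real (card F))"
    using card_Pow[OF card_big_classes(1)[OF fin(2) K]] by simp
  also have "\<dots> \<le> 2 ^ (card B div K) * exp (- a\<^sup>2 / real (card F))"
    using card_big_classes(2)[OF fin(2) K] by (intro mult_right_mono power_increasing) auto
  finally show "uprob (matchings (A - (A - F)) (B - f0 ` (A - F))) (\<lambda>g. separated A B \<alpha> \<beta> F G s K a (?ext g))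
    \<le> 2 ^ (card B div K) * exp (- a\<^sup>2 / real (card F))"
    unfolding AF BF .
qed auto

text \<open>If no class were dominant, every single class would carry less than a of both weights.
  Add the classes one by one. Both weights of the union stay below 2 a at each step, so the
  complement carries more than a of both and the dichotomy brings the union back below a, up to the
  end, contradicting the total of 3 a.\<close>

lemma dominant_class:
  fixes l r :: "'p \<Rightarrow> real"
  assumes fin: "finite P" and nn: "\<And>p. 0 \<le> l p" "\<And>p. 0 \<le> r p" and a: "a > 0"
    and L: "3 * a \<le> sum l P" and R: "3 * a \<le> sum r P"
    and dich: "\<And>U. U \<subseteq> P \<Longrightarrow> sum l U < a \<or> sum r (P - U) < a"
  shows "\<exists>p\<in>P. sum l (P - {p}) < a \<and> sum r (P - {p}) < a"
proof (rule ccontr)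
  assume no: "\<not> ?thesis"
  have rem: "sum g (P - U) = sum g P - sum g U" if "U \<subseteq> P" for U and g :: "'p \<Rightarrow> real"
    using fin that by (simp add: sum_diff)
  have dich': "sum l (P - U) < a \<or> sum r U < a" if "U \<subseteq> P" for U
    using dich[of "P - U"] that by (simp add: double_diff)
  have single: "l p < a \<and> r p < a" if p: "p \<in> P" for p
  proof (rule ccontr)
    assume "\<not> (l p < a \<and> r p < a)"
    moreover have "sum l (P - {p}) = sum l P - l p" "sum r (P - {p}) = sum r P - r p"
      using rem[of "{p}"] p by auto
    moreover have "l p < a \<or> sum r (P - {p}) < a" "sum l (P - {p}) < a \<or> r p < a"
      using dich[of "{p}"] dich'[of "{p}"] p by auto
    ultimately have "sum l (P - {p}) < a \<and> sum r (P - {p}) < a" using L R a by linarith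
    then show False using no p by blast
  qed
  have "sum l U < a \<and> sum r U < a" if "U \<subseteq> P" for U
  proof -
    have "finite U" using that fin by (rule finite_subset)
    then show ?thesis using that
    proof induction
      case (insert p U)
      then have IH: "sum l U < a" "sum r U < a" by auto
      have e: "sum l (insert p U) = l p + sum l U" "sum r (insert p U) = r p + sum r U"
        using insert by auto
      have lt: "sum l (insert p U) < 2 * a" "sum r (insert p U) < 2 * a"
        using IH e single[of p] insert by auto
      show ?case
        using dich[OF insert.prems] dich'[OF insert.prems] rem[OF insert.prems, of l] rem[OF insert.prems, of r]
          lt L R by linarith
    qed (use a in auto)
  qed
  then show False using L a by fastforce
qed

text \<open>The cut half-edges that meet a big class through the uncut half-edge \<open>s x\<close>
  of their vertex; \<open>right_big\<close> below contains those that meet one through their own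
  partner.\<close>

definition left_big ::
  "'a set \<Rightarrow> 'b set \<Rightarrow> ('a \<Rightarrow> 'v) \<Rightarrow> ('b \<Rightarrow> 'w) \<Rightarrow> 'a set \<Rightarrow> 'a set \<Rightarrow> ('a \<Rightarrow> 'a) \<Rightarrow> nat \<Rightarrow> ('a \<Rightarrow> 'b) \<Rightarrow> 'a set" where
  "left_big A B \<alpha> \<beta> F G s K f = {x \<in> G. K \<le> card (right_class A B \<alpha> \<beta> F f (f (s x)))}"

definition right_big ::
  "'a set \<Rightarrow> 'b set \<Rightarrow> ('a \<Rightarrow> 'v) \<Rightarrow> ('b \<Rightarrow> 'w) \<Rightarrow> 'a set \<Rightarrow> nat \<Rightarrow> ('a \<Rightarrow> 'b) \<Rightarrow> 'a set" where
  "right_big A B \<alpha> \<beta> F K f = {x \<in> F. K \<le> card (right_class A B \<alpha> \<beta> F f (f x))}"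

text \<open>Group the big classes according to the components of the multigraph that contain them.
  For no union U of components is the corresponding division bridged, since both ends of a bridge
  lie in the same component. So the absence of separations gives the dichotomy of
  \<open>dominant_class\<close> for the components, with the numbers of left big and right big
  half-edges as weights.\<close>

lemma giant_of_not_separated:
  assumes fin: "finite A" "finite B" and f: "f \<in> matchings A B" and F: "F \<subseteq> A"
    and G: "G \<subseteq> F" and s: "\<And>x. x \<in> G \<Longrightarrow> s x \<in> A - F \<and> \<alpha> (s x) = \<alpha> x" and a: "a > 0"
    and ns: "\<not> separated A B \<alpha> \<beta> F G s K a f"
    and L: "3 * a \<le> real (card (left_big A B \<alpha> \<beta> F G s K f))"
    and R: "3 * a \<le> real (card (right_big A B \<alpha> \<beta> F K f))"
  shows "\<exists>z\<in>A. real (card (left_big A B \<alpha> \<beta> F G s K f - comp_of A \<alpha> \<beta> f z)) < a \<and>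
    real (card (right_big A B \<alpha> \<beta> F K f - comp_of A \<alpha> \<beta> f z)) < a"
proof -
  define LB where "LB = left_big A B \<alpha> \<beta> F G s K f"
  define RB where "RB = right_big A B \<alpha> \<beta> F K f"
  define BC where "BC = big_classes A B \<alpha> \<beta> F K f"
  define cp where "cp = comp_of A \<alpha> \<beta> f"
  define P where "P = cp ` A"
  have LBA: "LB \<subseteq> A" and RBA: "RB \<subseteq> A" using F G by (auto simp: LB_def RB_def left_big_def right_big_def)
  have finP: "finite P" using fin by (simp add: P_def)
  have finLB: "finite LB" "finite RB" using LBA RBA fin(1) finite_subset by auto
  have cpA: "cp z \<subseteq> A" if "z \<in> A" for z unfolding cp_def by (rule comp_of_subset[OF that])
  have self: "z \<in> cp z" for z unfolding cp_def by (rule comp_of_self)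
  have cong: "cp z' = cp z" if "z' \<in> cp z" for z z' using that unfolding cp_def by (rule comp_of_cong)
  have disj: "disjoint P"
    unfolding P_def disjoint_def using cong by (metis disjoint_iff imageE)
  have cov: "X \<subseteq> \<Union>P" if "X \<subseteq> A" for X using that self by (auto simp: P_def)
  have sumc: "(\<Sum>C\<in>U. real (card (X \<inter> C))) = real (card (X \<inter> \<Union>U))" if "U \<subseteq> P" "X \<subseteq> A" for X U
  proof -
    have "card (\<Union>C\<in>U. X \<inter> C) = (\<Sum>C\<in>U. card (X \<inter> C))"
    proof (rule card_UN_disjoint)
      show "finite U" using that(1) finP by (rule finite_subset)
      show "\<forall>C\<in>U. finite (X \<inter> C)" using that fin(1) by (auto intro: finite_subset)
      show "\<forall>i\<in>U. \<forall>j\<in>U. i \<noteq> j \<longrightarrow> X \<inter> i \<inter> (X \<inter> j) = {}"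
        using disj that(1) unfolding disjoint_def by blast
    qed
    moreover have "(\<Union>C\<in>U. X \<inter> C) = X \<inter> \<Union>U" by auto
    ultimately show ?thesis by (simp flip: of_nat_sum)
  qed
  have tot: "X \<inter> \<Union>P = X" if "X \<subseteq> A" for X using cov[OF that] by auto
  have cls: "right_class A B \<alpha> \<beta> F f (f x) \<subseteq> f ` cp x" if "x \<in> A" for x
    unfolding cp_def using f that by (rule right_class_sound)
  have inBC: "f x \<in> \<Union>BC \<longleftrightarrow> K \<le> card (right_class A B \<alpha> \<beta> F f (f x))" if "x \<in> A" for x
    unfolding BC_def by (rule in_Union_big_classes[OF matchings_mem[OF f that]])
  have BC_eq: "C = right_class A B \<alpha> \<beta> F f y" if "C \<in> BC" "y \<in> C" for C y
    using that big_classes_eq unfolding BC_def by metis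
  have scp: "cp (s x) = cp x" if "x \<in> G" for x
  proof (rule cong)
    have "x \<in> A" using that F G by auto
    moreover have "x \<in> cp x" by (rule self)
    ultimately show "s x \<in> cp x"
      unfolding cp_def using s[OF that] explored_link[of x A \<alpha> \<beta> f "{x}" "{}" "s x"] by auto
  qed
  have dich: "(\<Sum>C\<in>U. real (card (LB \<inter> C))) < a \<or> (\<Sum>C\<in>P - U. real (card (RB \<inter> C))) < a" if U: "U \<subseteq> P" for U
  proof -
    define \<S> where "\<S> = {C \<in> BC. C \<subseteq> f ` \<Union>U}"
    have cpU: "cp x \<subseteq> \<Union>U \<longleftrightarrow> x \<in> \<Union>U" if "x \<in> A" for x
    proof
      assume "x \<in> \<Union>U"
      then obtain z where "cp z \<in> U" "x \<in> cp z" using U by (auto simp: P_def)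
      then show "cp x \<subseteq> \<Union>U" using cong by auto
    qed (use self in auto)
    have UA: "\<Union>U \<subseteq> A" using U cpA by (auto simp: P_def)
    have memU: "x \<in> \<Union>U" if "x \<in> A" "f x \<in> f ` \<Union>U" for x
      using that UA inj_onD[OF matchings_inj[OF f]] by blast
    have S1: "f x \<in> \<Union>\<S> \<longleftrightarrow> f x \<in> \<Union>BC \<and> x \<in> \<Union>U" if x: "x \<in> A" for x
    proof
      assume "f x \<in> \<Union>\<S>"
      then have "f x \<in> \<Union>BC" "f x \<in> f ` \<Union>U" by (auto simp: \<S>_def)
      then show "f x \<in> \<Union>BC \<and> x \<in> \<Union>U" using memU[OF x] by blast
    next
      assume *: "f x \<in> \<Union>BC \<and> x \<in> \<Union>U"
      then obtain C where C: "C \<in> BC" "f x \<in> C" by auto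
      have "C \<subseteq> f ` cp x" using BC_eq[OF C] cls[OF x] by simp
      then have "C \<subseteq> f ` \<Union>U" using cpU[OF x] * by (meson image_mono order_trans)
      then show "f x \<in> \<Union>\<S>" using C by (auto simp: \<S>_def)
    qed
    have S2: "f x \<in> \<Union>(BC - \<S>) \<longleftrightarrow> f x \<in> \<Union>BC \<and> x \<notin> \<Union>U" if x: "x \<in> A" for x
    proof -
      have "f x \<in> \<Union>(BC - \<S>) \<longleftrightarrow> f x \<in> \<Union>BC \<and> f x \<notin> \<Union>\<S>"
      proof
        assume "f x \<in> \<Union>(BC - \<S>)"
        then obtain C where C: "C \<in> BC" "C \<notin> \<S>" "f x \<in> C" by auto
        have "C' = C" if "C' \<in> \<S>" "f x \<in> C'" for C'
          using that BC_eq[OF C(1,3)] BC_eq[of C' "f x"] by (auto simp: \<S>_def)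
        then show "f x \<in> \<Union>BC \<and> f x \<notin> \<Union>\<S>" using C by auto
      qed auto
      then show ?thesis using S1[OF x] by auto
    qed
    have nolink: "\<forall>x\<in>G. f (s x) \<in> \<Union>\<S> \<longrightarrow> f x \<notin> \<Union>(BC - \<S>)"
    proof (intro ballI impI)
      fix x assume x: "x \<in> G" "f (s x) \<in> \<Union>\<S>"
      have xA: "x \<in> A" "s x \<in> A" using x F G s by auto
      have "cp (s x) \<subseteq> \<Union>U" using S1[OF xA(2)] x cpU[OF xA(2)] by blast
      then have "x \<in> \<Union>U" using scp[OF x(1)] self[of x] by auto
      then show "f x \<notin> \<Union>(BC - \<S>)" using S2[OF xA(1)] by blast
    qed
    have "real (card {x \<in> G. f (s x) \<in> \<Union>\<S>}) < a \<or> real (card {y \<in> f ` F. y \<in> \<Union>(BC - \<S>)}) < a"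
    proof (rule ccontr)
      assume "\<not> ?thesis"
      then have "separated A B \<alpha> \<beta> F G s K a f"
        unfolding separated_def BC_def[symmetric] using nolink
        by (intro exI[of _ \<S>]) (auto simp: \<S>_def not_less)
      then show False using ns by contradiction
    qed
    then show ?thesis
    proof
      assume lt: "real (card {x \<in> G. f (s x) \<in> \<Union>\<S>}) < a"
      have "LB \<inter> \<Union>U \<subseteq> {x \<in> G. f (s x) \<in> \<Union>\<S>}"
      proof
        fix x assume x: "x \<in> LB \<inter> \<Union>U"
        then have xG: "x \<in> G" and big: "K \<le> card (right_class A B \<alpha> \<beta> F f (f (s x)))"
          by (auto simp: LB_def left_big_def)
        have xA: "x \<in> A" "s x \<in> A" using xG F G s by auto
        have "cp x \<subseteq> \<Union>U" using cpU[OF xA(1)] x by blast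
        then have "s x \<in> \<Union>U" using scp[OF xG] self[of "s x"] by auto
        then show "x \<in> {x \<in> G. f (s x) \<in> \<Union>\<S>}" using S1[OF xA(2)] inBC[OF xA(2)] big xG by blast
      qed
      moreover have "finite {x \<in> G. f (s x) \<in> \<Union>\<S>}" using G F fin(1) by (auto intro: finite_subset)
      ultimately have "card (LB \<inter> \<Union>U) \<le> card {x \<in> G. f (s x) \<in> \<Union>\<S>}" by (intro card_mono)
      then show ?thesis using lt sumc[OF U LBA] by linarith
    next
      assume lt: "real (card {y \<in> f ` F. y \<in> \<Union>(BC - \<S>)}) < a"
      have PU: "\<Union>(P - U) \<inter> \<Union>U = {}"
      proof (rule equals0I)
        fix x assume "x \<in> \<Union>(P - U) \<inter> \<Union>U"
        then obtain C1 C2 where C: "C1 \<in> P - U" "C2 \<in> U" "x \<in> C1" "x \<in> C2" by auto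
        then have "C1 \<inter> C2 = {}" using U by (intro disjointD[OF disj]) auto
        then show False using C by auto
      qed
      have "f ` (RB \<inter> \<Union>(P - U)) \<subseteq> {y \<in> f ` F. y \<in> \<Union>(BC - \<S>)}"
      proof
        fix y assume "y \<in> f ` (RB \<inter> \<Union>(P - U))"
        then obtain x where x: "y = f x" "x \<in> RB" "x \<in> \<Union>(P - U)" by blast
        have xF: "x \<in> F" "K \<le> card (right_class A B \<alpha> \<beta> F f (f x))" using x(2) by (auto simp: RB_def right_big_def)
        have xA: "x \<in> A" using xF F by auto
        have "x \<notin> \<Union>U" using x(3) PU by blast
        then have "f x \<in> \<Union>(BC - \<S>)" using S2[OF xA] inBC[OF xA] xF by blast
        then show "y \<in> {y \<in> f ` F. y \<in> \<Union>(BC - \<S>)}" using x xF by blast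
      qed
      moreover have "finite {y \<in> f ` F. y \<in> \<Union>(BC - \<S>)}" using F fin(1) by (auto intro: finite_subset)
      ultimately have "card (f ` (RB \<inter> \<Union>(P - U))) \<le> card {y \<in> f ` F. y \<in> \<Union>(BC - \<S>)}" by (intro card_mono)
      moreover have "card (f ` (RB \<inter> \<Union>(P - U))) = card (RB \<inter> \<Union>(P - U))"
        using matchings_inj[OF f] RBA by (intro card_image) (auto intro: inj_on_subset)
      ultimately show ?thesis using lt sumc[of "P - U" RB] RBA by auto
    qed
  qed
  have "\<exists>C\<in>P. (\<Sum>C'\<in>P - {C}. real (card (LB \<inter> C'))) < a \<and> (\<Sum>C'\<in>P - {C}. real (card (RB \<inter> C'))) < a"
  proof (rule dominant_class[OF finP _ _ a _ _ dich])
    show "3 * a \<le> (\<Sum>C\<in>P. real (card (LB \<inter> C)))" using sumc[of P LB] LBA tot[OF LBA] L by (simp add: LB_def)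
    show "3 * a \<le> (\<Sum>C\<in>P. real (card (RB \<inter> C)))" using sumc[of P RB] RBA tot[OF RBA] R by (simp add: RB_def)
  qed auto
  then obtain z where z: "z \<in> A" "(\<Sum>C'\<in>P - {cp z}. real (card (LB \<inter> C'))) < a"
    "(\<Sum>C'\<in>P - {cp z}. real (card (RB \<inter> C'))) < a" by (auto simp: P_def)
  have le: "real (card (X - cp z)) \<le> (\<Sum>C'\<in>P - {cp z}. real (card (X \<inter> C')))" if "X \<subseteq> A" for X
  proof -
    have "X - cp z \<subseteq> X \<inter> \<Union>(P - {cp z})" using cov[OF that] by auto
    then have "card (X - cp z) \<le> card (X \<inter> \<Union>(P - {cp z}))"
      using that fin(1) by (intro card_mono) (auto intro: finite_subset)
    then show ?thesis using sumc[of "P - {cp z}" X] that by auto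
  qed
  show ?thesis
    using z le[OF LBA] le[OF RBA] by (intro bexI[of _ z]) (auto simp: LB_def RB_def cp_def)
qed

text \<open>If m' points satisfy S, then at least \<open>m' choose r\<close> subsets of r elements
  consist of such points. Markov's inequality then reduces the claim to a bound for r points at
  once.\<close>

lemma uprob_many_le:
  assumes fin: "finite M" "finite F0" and rm: "r < m'" and q0: "0 \<le> q"
    and q: "\<And>X. X \<subseteq> F0 \<Longrightarrow> card X = r \<Longrightarrow> uprob M (\<lambda>f. \<forall>x\<in>X. S f x) \<le> q"
  shows "uprob M (\<lambda>f. m' \<le> card {x \<in> F0. S f x}) \<le> q * (real (card F0) / real (m' - r)) ^ r"
proof -
  let ?m = "card F0"
  let ?R = "{X. X \<subseteq> F0 \<and> card X = r}"
  have finR: "finite ?R" using fin(2) by simp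
  have pos: "real (m' choose r) > 0" using rm by (simp add: zero_less_binomial)
  have cnt: "real (card {X \<in> ?R. \<forall>x\<in>X. S f x}) = real (card {x \<in> F0. S f x} choose r)" for f
  proof -
    have "{X \<in> ?R. \<forall>x\<in>X. S f x} = {X. X \<subseteq> {x \<in> F0. S f x} \<and> card X = r}" by auto
    then show ?thesis using fin(2) by (simp add: n_subsets)
  qed
  have "uprob M (\<lambda>f. m' \<le> card {x \<in> F0. S f x}) \<le> uprob M (\<lambda>f. real (card {X \<in> ?R. \<forall>x\<in>X. S f x}) \<ge> real (m' choose r))"
    unfolding cnt by (rule uprob_mono[OF fin(1)]) (simp add: binomial_right_mono)
  also have "\<dots> \<le> avg M (\<lambda>f. real (card {X \<in> ?R. \<forall>x\<in>X. S f x})) / real (m' choose r)"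
    by (rule uprob_markov[OF fin(1) pos]) simp
  also have "avg M (\<lambda>f. real (card {X \<in> ?R. \<forall>x\<in>X. S f x})) = (\<Sum>X\<in>?R. uprob M (\<lambda>f. \<forall>x\<in>X. S f x))"
    by (rule avg_card[OF fin(1) finR])
  also have "\<dots> \<le> (\<Sum>X\<in>?R. q)" using q by (intro sum_mono) auto
  also have "\<dots> = real (?m choose r) * q" using fin(2) by (simp add: n_subsets)
  finally have 1: "uprob M (\<lambda>f. m' \<le> card {x \<in> F0. S f x}) \<le> real (?m choose r) * q / real (m' choose r)"
    by (simp add: divide_right_mono)
  show ?thesis
  proof (cases "m' \<le> ?m")
    case False
    then have "card {x \<in> F0. S f x} < m'" for f
      using card_mono[OF fin(2), of "{x \<in> F0. S f x}"] by (auto simp: not_le)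
    then have "uprob M (\<lambda>f. m' \<le> card {x \<in> F0. S f x}) = 0" by (intro uprob_const_False) (simp add: not_le)
    moreover have "0 \<le> q * (real ?m / real (m' - r)) ^ r" using q0 by simp
    ultimately show ?thesis by simp
  next
    case True
    have chs: "real (n choose r) * c ^ r = (\<Prod>i = 0..<r. real (n - i) / real (r - i) * c)"
      if "r \<le> n" for n and c :: real
      by (subst binomial_altdef_of_nat[OF that])
         (simp only: prod.distrib prod_constant card_atLeastLessThan diff_zero)
    have "real (?m choose r) * real (m' - r) ^ r \<le> real (m' choose r) * real ?m ^ r"
    proof -
      have "real (?m choose r) * real (m' - r) ^ r = (\<Prod>i = 0..<r. real (?m - i) / real (r - i) * real (m' - r))"
        using rm True by (intro chs) simp
      also have "\<dots> \<le> (\<Prod>i = 0..<r. real (m' - i) / real (r - i) * real ?m)"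
      proof (intro prod_mono conjI)
        fix i assume i: "i \<in> {0..<r}"
        have "real (?m - i) * real (m' - r) \<le> real ?m * real (m' - i)"
          using i rm by (intro mult_mono) auto
        then show "real (?m - i) / real (r - i) * real (m' - r) \<le> real (m' - i) / real (r - i) * real ?m"
          by (simp add: divide_right_mono mult.commute)
      qed simp
      also have "\<dots> = real (m' choose r) * real ?m ^ r"
        using rm by (intro chs[symmetric]) simp
      finally show ?thesis .
    qed
    then have "real (?m choose r) / real (m' choose r) \<le> real ?m ^ r / real (m' - r) ^ r"
      using pos rm by (simp add: divide_le_eq le_divide_eq mult.commute)
    then have "q * (real (?m choose r) / real (m' choose r)) \<le> q * (real ?m / real (m' - r)) ^ r"
      unfolding power_divide by (rule mult_left_mono[OF _ q0])
    then show ?thesis using 1 by (simp add: mult.commute)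
  qed
qed

text \<open>Of two half-edges that are not connected, at least one lies outside the component that
  contains almost all left big and right big half-edges.\<close>

lemma disconnected_pairs_le:
  assumes fin: "finite A" "finite B" and f: "f \<in> matchings A B" and F: "F \<subseteq> A"
    and G: "G \<subseteq> F" and s: "\<And>x. x \<in> G \<Longrightarrow> s x \<in> A - F \<and> \<alpha> (s x) = \<alpha> x" and a: "a > 0"
    and ns: "\<not> separated A B \<alpha> \<beta> F G s K a f"
    and L: "3 * a \<le> real (card (left_big A B \<alpha> \<beta> F G s K f))"
    and R: "3 * a \<le> real (card (right_big A B \<alpha> \<beta> F K f))"
  shows "real (card {(x, x') \<in> F \<times> F. Bg x \<and> Bg x' \<and> x' \<notin> comp_of A \<alpha> \<beta> f x}) \<le> 2 * real (card F) *
    (2 * a + real (card {x \<in> F. Bg x \<and> x \<notin> left_big A B \<alpha> \<beta> F G s K f \<and> x \<notin> right_big A B \<alpha> \<beta> F K f}))"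
proof -
  define LB where "LB = left_big A B \<alpha> \<beta> F G s K f"
  define RB where "RB = right_big A B \<alpha> \<beta> F K f"
  obtain z where z: "real (card (LB - comp_of A \<alpha> \<beta> f z)) < a" "real (card (RB - comp_of A \<alpha> \<beta> f z)) < a"
    using giant_of_not_separated[OF fin f F G s a ns L R] by (auto simp: LB_def RB_def)
  have finF: "finite F" using F fin(1) by (rule finite_subset)
  have sub: "LB \<subseteq> F" "RB \<subseteq> F" using G by (auto simp: LB_def RB_def left_big_def right_big_def)
  let ?C = "comp_of A \<alpha> \<beta> f z"
  let ?X = "{x \<in> F. Bg x \<and> x \<notin> ?C}"
  let ?Y = "{x \<in> F. Bg x \<and> x \<notin> LB \<and> x \<notin> RB}"
  have "card ?X \<le> card ((LB - ?C) \<union> (RB - ?C) \<union> ?Y)"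
    using finF sub by (intro card_mono) (auto intro: finite_subset)
  also have "\<dots> \<le> card (LB - ?C) + card (RB - ?C) + card ?Y"
    by (meson add_le_mono1 card_Un_le order_trans)
  finally have X: "real (card ?X) \<le> 2 * a + real (card ?Y)" using z by linarith
  have "{(x, x') \<in> F \<times> F. Bg x \<and> Bg x' \<and> x' \<notin> comp_of A \<alpha> \<beta> f x} \<subseteq> ?X \<times> F \<union> F \<times> ?X"
    using comp_of_cong[of _ A \<alpha> \<beta> f z] by auto
  then have "card {(x, x') \<in> F \<times> F. Bg x \<and> Bg x' \<and> x' \<notin> comp_of A \<alpha> \<beta> f x} \<le> card (?X \<times> F \<union> F \<times> ?X)"
    using finF by (intro card_mono) auto
  also have "\<dots> \<le> card (?X \<times> F) + card (F \<times> ?X)" by (rule card_Un_le)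
  also have "\<dots> = 2 * card F * card ?X" by (simp add: card_cartesian_product)
  finally have "real (card {(x, x') \<in> F \<times> F. Bg x \<and> Bg x' \<and> x' \<notin> comp_of A \<alpha> \<beta> f x}) \<le> 2 * real (card F) * real (card ?X)"
    by (metis (mono_tags, lifting) of_nat_le_iff of_nat_mult of_nat_numeral)
  also have "\<dots> \<le> 2 * real (card F) * (2 * a + real (card ?Y))" using X by (intro mult_left_mono) auto
  finally show ?thesis by (simp add: LB_def RB_def)
qed

lemma comp_of_precompose:
  assumes \<sigma>: "bij_betw \<sigma> A A" and lab: "\<And>x x'. x \<in> A \<Longrightarrow> x' \<in> A \<Longrightarrow> \<alpha> (\<sigma> x) = \<alpha> (\<sigma> x') \<longleftrightarrow> \<alpha> x = \<alpha> x'"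
    and x: "x \<in> A"
  shows "\<sigma> ` comp_of A \<alpha> \<beta> (restrict (f \<circ> \<sigma>) A) x = comp_of A \<alpha> \<beta> f (\<sigma> x)"
proof
  let ?g = "restrict (f \<circ> \<sigma>) A"
  have sA: "\<sigma> y \<in> A" if "y \<in> A" for y using \<sigma> that by (rule bij_betw_apply)
  have "comp_of A \<alpha> \<beta> ?g x \<subseteq> {y \<in> A. \<sigma> y \<in> comp_of A \<alpha> \<beta> f (\<sigma> x)}"
  proof (rule explored_least)
    show "{x} \<subseteq> {y \<in> A. \<sigma> y \<in> comp_of A \<alpha> \<beta> f (\<sigma> x)}" using x comp_of_self by auto
    fix y y' assume y: "y \<in> {y \<in> A. \<sigma> y \<in> comp_of A \<alpha> \<beta> f (\<sigma> x)}" "y' \<in> A"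
      and l: "\<alpha> y = \<alpha> y' \<or> \<beta> (?g y) = \<beta> (?g y')"
    have "\<alpha> (\<sigma> y) = \<alpha> (\<sigma> y') \<or> \<beta> (f (\<sigma> y)) = \<beta> (f (\<sigma> y'))" using l y lab by auto
    then show "y' \<in> {y \<in> A. \<sigma> y \<in> comp_of A \<alpha> \<beta> f (\<sigma> x)}"
      using y sA explored_link[of "\<sigma> y" A \<alpha> \<beta> f "{\<sigma> x}" "{}" "\<sigma> y'"] by auto
  qed simp
  then show "\<sigma> ` comp_of A \<alpha> \<beta> ?g x \<subseteq> comp_of A \<alpha> \<beta> f (\<sigma> x)" by auto
  have sub: "comp_of A \<alpha> \<beta> ?g x \<subseteq> A" by (rule comp_of_subset[OF x])
  show "comp_of A \<alpha> \<beta> f (\<sigma> x) \<subseteq> \<sigma> ` comp_of A \<alpha> \<beta> ?g x"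
  proof (rule explored_least)
    show "{\<sigma> x} \<subseteq> \<sigma> ` comp_of A \<alpha> \<beta> ?g x"
      using imageI[OF comp_of_self[of x A \<alpha> \<beta> ?g], of \<sigma>] by blast
    fix z z' assume z: "z \<in> \<sigma> ` comp_of A \<alpha> \<beta> ?g x" "z' \<in> A" and l: "\<alpha> z = \<alpha> z' \<or> \<beta> (f z) = \<beta> (f z')"
    obtain y where y: "z = \<sigma> y" "y \<in> comp_of A \<alpha> \<beta> ?g x" using z by auto
    obtain y' where y': "z' = \<sigma> y'" "y' \<in> A" using z(2) \<sigma> by (auto simp: bij_betw_def)
    have yA: "y \<in> A" using y sub by auto
    have "y' \<in> comp_of A \<alpha> \<beta> ?g x"
      using explored_link[OF y(2) yA y'(2)] l lab[OF yA y'(2)] y y' yA by auto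
    then show "z' \<in> \<sigma> ` comp_of A \<alpha> \<beta> ?g x" using y' by auto
  qed simp
qed

section \<open>Two half-edges in big components are connected\<close>

lemma card_fib_half_edges: "x \<in> half_edges N d \<Longrightarrow> card (fib (half_edges N d) fst x) = d (fst x)"
proof -
  assume "x \<in> half_edges N d"
  then have "fib (half_edges N d) fst x = {fst x} \<times> {1..d (fst x)}" by (auto simp: fib_def half_edges_def)
  then show ?thesis by (simp add: card_cartesian_product)
qed

lemma card_half_edges_over:
  assumes "W \<subseteq> {1..N}"
  shows "card {x \<in> half_edges N d. fst x \<in> W} = (\<Sum>w\<in>W. d w)"
proof -
  have "{x \<in> half_edges N d. fst x \<in> W} = (SIGMA w:W. {1..d w})" using assms by (auto simp: half_edges_def)
  moreover have "finite W" using assms by (rule finite_subset) simp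
  ultimately show ?thesis by simp
qed

lemma card_half_edges_degree: "card {x \<in> half_edges N d. d (fst x) = k} = k * card {w \<in> {1..N}. d w = k}"
proof -
  have "{x \<in> half_edges N d. d (fst x) = k} = {x \<in> half_edges N d. fst x \<in> {w \<in> {1..N}. d w = k}}"
    by (auto simp: half_edges_def)
  also have "card \<dots> = (\<Sum>w\<in>{w \<in> {1..N}. d w = k}. d w)" by (rule card_half_edges_over) auto
  also have "\<dots> = (\<Sum>w\<in>{w \<in> {1..N}. d w = k}. k)" by (rule sum.cong) auto
  finally show ?thesis by simp
qed

locale bcm_sequence =
  config_sequence "\<lambda>n. half_edges (N n) (dl n)" "\<lambda>n. half_edges (M n) (dr n)"
    "fst :: nat \<times> nat \<Rightarrow> nat" "fst :: nat \<times> nat \<Rightarrow> nat" u v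
  for N M :: "nat \<Rightarrow> nat" and dl dr :: "nat \<Rightarrow> nat \<Rightarrow> nat" and u v :: "nat \<Rightarrow> real"
begin

abbreviation "A n \<equiv> half_edges (N n) (dl n)"
abbreviation "B n \<equiv> half_edges (M n) (dr n)"
abbreviation "ecomp n f x \<equiv> comp_of (A n) (fst :: nat \<times> nat \<Rightarrow> nat) (fst :: nat \<times> nat \<Rightarrow> nat) f x"

definition vdeg :: "nat \<Rightarrow> nat \<Rightarrow> nat set" where
  "vdeg n k = {w \<in> {1..N n}. dl n w = k}"

lemma card_fib_A: "x \<in> A n \<Longrightarrow> card (fib (A n) fst x) = dl n (fst x)"
  by (rule card_fib_half_edges)

lemma card_degree_half_edges: "card {x \<in> A n. dl n (fst x) = k} = k * card (vdeg n k)"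
  unfolding vdeg_def by (rule card_half_edges_degree)

lemma many_of_degree:
  assumes "u k > 0"
  shows "\<forall>\<^sub>F n in sequentially. u k / (2 * real k) * real (card (A n)) \<le> real (card (vdeg n k))"
proof -
  have k: "k \<noteq> 0" using assms uv_0 by (cases k) auto
  have "\<forall>\<^sub>F n in sequentially. u k / 2 < uprob (A n) (\<lambda>x. card (fib (A n) fst x) = k)"
    using assms by (intro order_tendstoD(1)[OF u_lim]) simp
  then show ?thesis using eventually_card[of 1]
  proof eventually_elim
    case (elim n)
    have "{x \<in> A n. card (fib (A n) fst x) = k} = {x \<in> A n. dl n (fst x) = k}"
      using card_fib_A[of _ n] by auto
    then have "u k / 2 < real (k * card (vdeg n k)) / real (card (A n))"
      using elim(1) by (simp only: uprob_def card_degree_half_edges)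
    then have "u k / 2 * real (card (A n)) < real k * real (card (vdeg n k))"
      using elim(2) by (simp add: less_divide_eq)
    then show ?case using k by (simp add: field_simps)
  qed
qed

text \<open>Every vertex is represented by its first half-edge.\<close>

definition apart :: "nat \<Rightarrow> nat \<Rightarrow> nat \<Rightarrow> nat \<Rightarrow> (nat \<times> nat \<Rightarrow> nat \<times> nat) \<Rightarrow> bool" where
  "apart n K w w' f \<longleftrightarrow> \<not> small n K f (w, 1) \<and> \<not> small n K f (w', 1) \<and> (w', 1) \<notin> ecomp n f (w, 1)"

text \<open>Exchanging two vertices of the same degree is a relabelling of the half-edges, under
  which the matching is invariant in law.\<close>

lemma apart_transpose:
  assumes w: "w1 \<in> vdeg n j" "w2 \<in> vdeg n j" and dpos: "\<And>w. w \<in> {1..N n} \<Longrightarrow> dl n w > 0"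
    and v: "v1 \<in> {1..N n}" "v2 \<in> {1..N n}"
  shows "uprob (MM n) (apart n K v1 v2)
    \<le> uprob (MM n) (apart n K (Transposition.transpose w1 w2 v1) (Transposition.transpose w1 w2 v2))"
proof -
  define \<tau> where "\<tau> = Transposition.transpose w1 w2"
  define \<sigma> where "\<sigma> x = (\<tau> (fst x), snd x)" for x :: "nat \<times> nat"
  have dt: "dl n (\<tau> x) = dl n x" "\<tau> x \<in> {1..N n} \<longleftrightarrow> x \<in> {1..N n}" for x
    using w by (auto simp: \<tau>_def Transposition.transpose_def vdeg_def)
  have inv: "\<sigma> (\<sigma> x) = x" for x by (simp add: \<sigma>_def \<tau>_def)
  have sA: "\<sigma> x \<in> A n" if "x \<in> A n" for x
    using that dt[of "fst x"] by (cases x) (auto simp: \<sigma>_def half_edges_def)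
  have bij: "bij_betw \<sigma> (A n) (A n)"
    by (rule bij_betw_byWitness[where f' = \<sigma>]) (use inv sA in auto)
  have lab: "fst (\<sigma> x) = fst (\<sigma> x') \<longleftrightarrow> fst x = fst x'" for x x'
  proof -
    have "\<tau> (\<tau> z) = z" for z by (simp add: \<tau>_def)
    then show ?thesis unfolding \<sigma>_def fst_conv by metis
  qed
  have inv_into: "inv_into (A n) \<sigma> x = \<sigma> x" if "x \<in> A n" for x
    using inv_into_f_eq[OF bij_betw_imp_inj_on[OF bij], of "\<sigma> x" x] sA[OF that] inv by simp
  have "uprob (MM n) (apart n K v1 v2) \<le> uprob (MM n) (\<lambda>f. apart n K v1 v2 (restrict (f \<circ> inv_into (A n) \<sigma>) (A n)))"
    by (rule uprob_matchings_precompose[OF finA finB bij])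
  also have "\<dots> = uprob (MM n) (apart n K (\<tau> v1) (\<tau> v2))"
  proof (rule uprob_cong)
    fix f :: "nat \<times> nat \<Rightarrow> nat \<times> nat"
    have r: "restrict (f \<circ> inv_into (A n) \<sigma>) (A n) = restrict (f \<circ> \<sigma>) (A n)"
      by (auto simp: restrict_def fun_eq_iff inv_into)
    let ?g = "restrict (f \<circ> \<sigma>) (A n)"
    have v1: "(v1, 1) \<in> A n" "(v2, 1) \<in> A n" using v dpos[of v1] dpos[of v2] by (auto simp: half_edges_def)
    have im: "\<sigma> ` ecomp n ?g x = ecomp n f (\<sigma> x)" if "x \<in> A n" for x
      using comp_of_precompose[OF bij _ that, of fst fst f] lab by blast
    have inj: "inj \<sigma>" by (rule inj_on_inverseI[where g = \<sigma>]) (rule inv)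
    have crd: "card (ecomp n ?g x) = card (ecomp n f (\<sigma> x))" if "x \<in> A n" for x
      using im[OF that, symmetric] card_image[of \<sigma>] inj by (metis inj_on_subset subset_UNIV)
    have mem: "y \<in> ecomp n ?g x \<longleftrightarrow> \<sigma> y \<in> ecomp n f (\<sigma> x)" if "x \<in> A n" for x y
      using im[OF that, symmetric] inj by (simp add: inj_image_mem_iff)
    have s1: "\<sigma> (v1, 1) = (\<tau> v1, 1)" "\<sigma> (v2, 1) = (\<tau> v2, 1)" by (auto simp: \<sigma>_def)
    show "apart n K v1 v2 (restrict (f \<circ> inv_into (A n) \<sigma>) (A n)) = apart n K (\<tau> v1) (\<tau> v2) f"
      unfolding r apart_def small_def using crd[OF v1(1)] crd[OF v1(2)] mem[OF v1(1)] s1 by simp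
  qed
  finally show ?thesis by (simp add: \<tau>_def)
qed

lemma apart_symmetric:
  assumes w: "v1 \<in> vdeg n k" "w1 \<in> vdeg n k" "v2 \<in> vdeg n l" "w2 \<in> vdeg n l" "v1 \<noteq> v2" "w1 \<noteq> w2"
    and dpos: "\<And>w. w \<in> {1..N n} \<Longrightarrow> dl n w > 0"
  shows "uprob (MM n) (apart n K v1 v2) \<le> uprob (MM n) (apart n K w1 w2)"
proof -
  define v3 where "v3 = Transposition.transpose v1 w1 v2"
  have v3: "v3 \<in> vdeg n l" "v3 \<noteq> w1" using w by (auto simp: v3_def Transposition.transpose_def vdeg_def)
  have V: "v1 \<in> {1..N n}" "v2 \<in> {1..N n}" "w1 \<in> {1..N n}" "v3 \<in> {1..N n}" using w v3 by (auto simp: vdeg_def)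
  have "uprob (MM n) (apart n K v1 v2) \<le> uprob (MM n) (apart n K w1 v3)"
    using apart_transpose[OF w(1,2) dpos V(1,2), of K] by (simp add: v3_def)
  also have "\<dots> \<le> uprob (MM n) (apart n K (Transposition.transpose v3 w2 w1) (Transposition.transpose v3 w2 v3))"
    by (rule apart_transpose[OF v3(1) w(4) dpos V(3,4)])
  also have "Transposition.transpose v3 w2 w1 = w1" using v3 w by (simp add: Transposition.transpose_def)
  finally show ?thesis by simp
qed

subsection \<open>Cutting some half-edges\<close>

text \<open>The half-edges to be cut off: the first one at each vertex of Z. Only those at vertices
  of degree at least 2 have a \<open>sibling\<close>; they form \<open>cut2\<close> below.\<close>

definition cut :: "nat set \<Rightarrow> (nat \<times> nat) set" where
  "cut Z = (\<lambda>w. (w, 1)) ` Z"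

definition cut2 :: "nat \<Rightarrow> nat set \<Rightarrow> (nat \<times> nat) set" where
  "cut2 n Z = (\<lambda>w. (w, 1)) ` {w \<in> Z. dl n w \<ge> 2}"

definition sibling :: "nat \<times> nat \<Rightarrow> nat \<times> nat" where
  "sibling x = (fst x, 2)"

abbreviation "cut_label Z \<equiv> split_label (cut Z) (fst :: nat \<times> nat \<Rightarrow> nat)"
abbreviation "cut_explored n Z \<equiv> explored (A n) (cut_label Z) (fst :: nat \<times> nat \<Rightarrow> nat)"
abbreviation "cut_class n Z \<equiv> right_class (A n) (B n) fst fst (cut Z)"
abbreviation "cut_left n Z \<equiv> left_big (A n) (B n) fst fst (cut Z) (cut2 n Z) sibling"
abbreviation "cut_right n Z \<equiv> right_big (A n) (B n) fst fst (cut Z)"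
abbreviation "cut_separated n Z \<equiv> separated (A n) (B n) fst fst (cut Z) (cut2 n Z) sibling"

context
  fixes n :: nat and Z :: "nat set"
  assumes Z: "Z \<subseteq> {1..N n}" and dpos: "\<And>w. w \<in> {1..N n} \<Longrightarrow> dl n w > 0"
begin

lemma cut_subset: "cut Z \<subseteq> A n"
  using Z dpos by (fastforce simp: cut_def half_edges_def)

lemma cut2_subset: "cut2 n Z \<subseteq> cut Z"
  by (auto simp: cut_def cut2_def)

lemma sibling_cut2: "x \<in> cut2 n Z \<Longrightarrow> sibling x \<in> A n - cut Z \<and> fst (sibling x) = fst x"
  using Z by (auto simp: cut_def cut2_def sibling_def half_edges_def)

lemma card_cut: "card (cut Z) = card Z"
  unfolding cut_def by (rule card_image) (auto simp: inj_on_def)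

lemma split_label_eq:
  "split_label (cut Z) (fst :: nat \<times> nat \<Rightarrow> nat) x = split_label (cut Z) fst x' \<longleftrightarrow>
    x = x' \<or> (x \<notin> cut Z \<and> x' \<notin> cut Z \<and> fst x = fst x')"
  by (auto simp: split_label_def)

text \<open>Cutting affects only the half-edges at Z, at most \<open>D * card Z\<close> in
  number.\<close>

lemma split_stat:
  assumes th: "0 \<le> \<theta>" "\<theta> \<le> 1" and D: "\<And>w. w \<in> Z \<Longrightarrow> dl n w \<le> D"
    and small: "real D * real (card Z) \<le> \<epsilon> * real (card (A n))" and ne: "A n \<noteq> {}"
  shows "avg (A n) (\<lambda>x. \<theta> ^ (card (fib (A n) (cut_label Z) x) - 1))
    \<le> avg (A n) (\<lambda>x. \<theta> ^ (card (fib (A n) fst x) - 1)) + \<epsilon>"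
proof -
  have "avg (A n) (\<lambda>x. \<theta> ^ (card (fib (A n) (cut_label Z) x) - 1))
    \<le> avg (A n) (\<lambda>x. \<theta> ^ (card (fib (A n) fst x) - 1) + of_bool (fst x \<in> Z))"
  proof (rule avg_mono)
    fix x assume x: "x \<in> A n"
    show "\<theta> ^ (card (fib (A n) (cut_label Z) x) - 1)
      \<le> \<theta> ^ (card (fib (A n) fst x) - 1) + of_bool (fst x \<in> Z)"
    proof (cases "fst x \<in> Z")
      case True
      have "\<theta> ^ (card (fib (A n) (cut_label Z) x) - 1) \<le> 1" using th by (rule power_le_one)
      moreover have "0 \<le> \<theta> ^ (card (fib (A n) fst x) - 1)" using th by simp
      ultimately show ?thesis using True by simp
    next
      case False
      then have "fib (A n) (cut_label Z) x = fib (A n) fst x"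
        unfolding fib_def split_label_eq by (auto simp: cut_def)
      then show ?thesis using False by simp
    qed
  qed
  also have "\<dots> = avg (A n) (\<lambda>x. \<theta> ^ (card (fib (A n) fst x) - 1)) + uprob (A n) (\<lambda>x. fst x \<in> Z)"
    using finA[of n] by (simp only: avg_add avg_of_bool)
  also have "uprob (A n) (\<lambda>x. fst x \<in> Z) \<le> \<epsilon>"
  proof -
    have "card {x \<in> A n. fst x \<in> Z} = (\<Sum>w\<in>Z. dl n w)" by (rule card_half_edges_over[OF Z])
    also have "\<dots> \<le> (\<Sum>w\<in>Z. D)" using D by (rule sum_mono)
    finally have "card {x \<in> A n. fst x \<in> Z} \<le> D * card Z" by (simp add: mult.commute)
    then have "real (card {x \<in> A n. fst x \<in> Z}) \<le> real D * real (card Z)"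
      by (metis of_nat_le_iff of_nat_mult)
    then have "real (card {x \<in> A n. fst x \<in> Z}) \<le> \<epsilon> * real (card (A n))" using small by linarith
    moreover have "real (card (A n)) > 0" using finA[of n] ne by (simp add: card_gt_0_iff)
    ultimately show ?thesis by (simp add: uprob_def divide_le_eq)
  qed
  finally show ?thesis by simp
qed

lemma explorable_cut: "X \<subseteq> cut Z \<Longrightarrow> explorable (A n) (cut_label Z) (A n) X"
  using cut_subset by (intro explorable_self) (auto simp: fib_def split_label_eq)

lemma explorable_siblings:
  assumes "W \<subseteq> Z"
  shows "explorable (A n) (cut_label Z) (A n) (SIGMA w:W. {2..dl n w})"
proof (rule explorable_self)
  show "(SIGMA w:W. {2..dl n w}) \<subseteq> A n" using assms Z by (auto simp: half_edges_def)
  fix x assume x: "x \<in> (SIGMA w:W. {2..dl n w})"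
  then have "x \<notin> cut Z" by (auto simp: cut_def)
  then show "fib (A n) (cut_label Z) x \<subseteq> (SIGMA w:W. {2..dl n w})"
    using x assms unfolding fib_def split_label_eq by (auto simp: cut_def half_edges_def image_iff; fastforce)
qed

lemma explorable_vertex:
  assumes "w \<in> Z"
  shows "explorable (A n) (cut_label Z) (A n) ({w} \<times> {1..dl n w})"
proof (rule explorable_self)
  show "{w} \<times> {1..dl n w} \<subseteq> A n" using assms Z by (auto simp: half_edges_def)
  fix x assume x: "x \<in> {w} \<times> {1..dl n w}"
  then show "fib (A n) (cut_label Z) x \<subseteq> {w} \<times> {1..dl n w}"
    unfolding fib_def split_label_eq by (auto simp: half_edges_def)
qed

lemma siblings_explored:
  assumes w: "w \<in> Z" "dl n w \<ge> 2"
  shows "{w} \<times> {2..dl n w} \<subseteq> comp_of (A n) (cut_label Z) fst f (w, 2)"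
proof
  fix x assume x: "x \<in> {w} \<times> {2..dl n w}"
  have "(w, 2) \<in> A n" "x \<in> A n" using w x Z by (auto simp: half_edges_def)
  moreover have "split_label (cut Z) fst (w, 2) = split_label (cut Z) fst x"
    unfolding split_label_eq using x by (auto simp: cut_def)
  ultimately show "x \<in> comp_of (A n) (cut_label Z) fst f (w, 2)"
    by (intro explored_link[OF comp_of_self]) auto
qed

lemma card_explored_siblings:
  assumes f: "f \<in> MM n" and W: "W \<subseteq> Z" "\<And>w. w \<in> W \<Longrightarrow> dl n w \<ge> 2"
    and few: "\<And>w. w \<in> W \<Longrightarrow> card (cut_class n Z f (f (w, 2))) < K"
  shows "card (cut_explored n Z f (SIGMA w:W. {2..dl n w}) {}) \<le> card W * K"
proof -
  let ?E = "\<lambda>L. cut_explored n Z f L {}"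
  have finW: "finite W" using W(1) Z finite_subset by (meson finite_atLeastAtMost order_trans)
  have mem: "(w, 2) \<in> A n" if "w \<in> W" for w using W(1) W(2)[OF that] that Z by (auto simp: half_edges_def)
  have "(SIGMA w:W. {2..dl n w}) \<subseteq> (\<Union>w\<in>W. ?E {(w, 2)})"
    using siblings_explored W by fastforce
  moreover have "x' \<in> (\<Union>w\<in>W. ?E {(w, 2)})"
    if "x \<in> (\<Union>w\<in>W. ?E {(w, 2)})" "x \<in> A n" "x' \<in> A n"
      "split_label (cut Z) fst x = split_label (cut Z) fst x' \<or> fst (f x) = fst (f x')" for x x'
    using that explored_link[of x "A n" "split_label (cut Z) fst" fst f _ "{}" x'] by blast
  ultimately have "?E (SIGMA w:W. {2..dl n w}) \<subseteq> (\<Union>w\<in>W. ?E {(w, 2)})"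
    by (intro explored_least) auto
  moreover have "finite (\<Union>w\<in>W. ?E {(w, 2)})"
    using finW mem finA[of n] by (auto intro!: finite_explored)
  ultimately have "card (?E (SIGMA w:W. {2..dl n w})) \<le> card (\<Union>w\<in>W. ?E {(w, 2)})" by (intro card_mono)
  also have "\<dots> \<le> (\<Sum>w\<in>W. card (?E {(w, 2)}))" using finW by (rule card_UN_le)
  also have "\<dots> \<le> (\<Sum>w\<in>W. K)"
  proof (rule sum_mono)
    fix w assume w: "w \<in> W"
    show "card (?E {(w, 2)}) \<le> K"
      using split_comp_le_right_class[OF f mem[OF w] finB, of "cut Z" fst fst] few[OF w] by linarith
  qed
  finally show ?thesis by simp
qed

lemma card_explored_cut:
  assumes f: "f \<in> MM n" and X: "X \<subseteq> cut Z"
    and few: "\<And>x. x \<in> X \<Longrightarrow> card (cut_class n Z f (f x)) < K"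
  shows "card (cut_explored n Z f X {}) \<le> card X * K"
proof -
  let ?E = "\<lambda>L. cut_explored n Z f L {}"
  have mem: "x \<in> A n" if "x \<in> X" for x using that X cut_subset by auto
  have finX: "finite X" using X cut_subset finA[of n] by (meson finite_subset)
  have "?E X = (\<Union>x\<in>X. ?E {x})" using explored_Union[of "A n" _ _ f "\<lambda>x. {x}" X] by simp
  also have "card \<dots> \<le> (\<Sum>x\<in>X. card (?E {x}))" using finX by (rule card_UN_le)
  also have "\<dots> \<le> (\<Sum>x\<in>X. K)"
  proof (rule sum_mono)
    fix x assume x: "x \<in> X"
    show "card (?E {x}) \<le> K"
      using split_comp_le_right_class[OF f mem[OF x] finB, of "cut Z" fst fst] few[OF x] by linarith
  qed
  finally show ?thesis by simp
qed

text \<open>A cut half-edge that meets no big class, neither through its sibling nor through its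
  partner, belongs to a vertex from which little can be reached even when all its half-edges, now
  separate, are explored. Its probability therefore has the upper bound
  \<open>\<theta> ^ dl n w\<close> with the full degree.\<close>

lemma card_explored_vertex:
  assumes f: "f \<in> MM n" and w: "w \<in> Z"
    and nl: "(w, 1) \<notin> cut_left n Z K f"
    and nr: "(w, 1) \<notin> cut_right n Z K f"
  shows "card (cut_explored n Z f ({w} \<times> {1..dl n w}) {}) \<le> 2 * K"
proof -
  let ?E = "\<lambda>L. cut_explored n Z f L {}"
  have d1: "dl n w \<ge> 1" using w Z dpos by force
  have split: "{w} \<times> {1..dl n w} = {(w, 1)} \<union> (SIGMA w:{w}. {2..dl n w})" using d1 by auto
  have 1: "card (?E {(w, 1)}) \<le> 1 * K"
  proof -
    have "card (?E {(w, 1)}) \<le> card {(w, 1::nat)} * K"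
      using nr w by (intro card_explored_cut[OF f]) (auto simp: right_big_def cut_def not_le)
    then show ?thesis by simp
  qed
  have 2: "card (?E (SIGMA w:{w}. {2..dl n w})) \<le> K"
  proof (cases "dl n w \<ge> 2")
    case True
    have "card (?E (SIGMA w:{w}. {2..dl n w})) \<le> card {w} * K"
      using nl w True by (intro card_explored_siblings[OF f]) (auto simp: left_big_def cut2_def sibling_def not_le)
    then show ?thesis by simp
  next
    case False
    then have "(SIGMA w:{w}. {2..dl n w}) = {}" by auto
    then show ?thesis by (simp add: explored_def)
  qed
  have "card (?E ({w} \<times> {1..dl n w})) \<le> card (?E {(w, 1)}) + card (?E (SIGMA w:{w}. {2..dl n w}))"
    unfolding split explored_Un by (rule card_Un_le)
  then show ?thesis using 1 2 by simp
qed

text \<open>Undoing the cuts only enlarges the classes.\<close>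

lemma small_imp_not_big:
  assumes f: "f \<in> MM n" and w: "w \<in> Z" and s: "small n K2 f (w, 1)" and K: "K2 < K"
  shows "(w, 1) \<notin> cut_left n Z K f"
    and "(w, 1) \<notin> cut_right n Z K f"
proof -
  have w1: "(w, 1) \<in> A n" using cut_subset w by (auto simp: cut_def)
  have bound: "card (cut_class n Z f (f x)) < K" if x: "x \<in> A n" "fst x = w" for x
  proof -
    have "x \<in> ecomp n f (w, 1)" by (rule explored_link[OF comp_of_self w1]) (use x in auto)
    then have eq: "ecomp n f x = ecomp n f (w, 1)" by (rule comp_of_cong)
    have fin: "finite (ecomp n f x)" using finA x by (intro finite_explored) auto
    have "card (cut_class n Z f (f x)) \<le> card (f ` ecomp n f x)"
      using right_class_sound[OF f x(1), of fst fst "cut Z"] fin by (intro card_mono finite_imageI)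
    also have "\<dots> \<le> card (ecomp n f x)" using fin by (rule card_image_le)
    also have "\<dots> \<le> K2" using s by (simp add: small_def eq)
    finally show ?thesis using K by simp
  qed
  show "(w, 1) \<notin> cut_right n Z K f"
    using bound[OF w1] by (auto simp: right_big_def)
  show "(w, 1) \<notin> cut_left n Z K f"
  proof
    assume *: "(w, 1) \<in> cut_left n Z K f"
    then have "sibling (w, 1) \<in> A n" using sibling_cut2[of "(w, 1)"] by (auto simp: left_big_def)
    then show False using bound[of "sibling (w, 1)"] * by (auto simp: left_big_def sibling_def)
  qed
qed

end

end

lemma uprob_diff:
  assumes "finite S" "\<And>f. f \<in> S \<Longrightarrow> Q f \<Longrightarrow> P f"
  shows "uprob S (\<lambda>f. \<not> Q f \<and> P f) = uprob S P - uprob S Q"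
proof -
  have "{f \<in> S. P f} = {f \<in> S. \<not> Q f \<and> P f} \<union> {f \<in> S. Q f}" using assms(2) by auto
  then have "card {f \<in> S. P f} = card {f \<in> S. \<not> Q f \<and> P f} + card {f \<in> S. Q f}"
    by (simp only:) (rule card_Un_disjoint, use assms(1) in auto)
  then show ?thesis by (simp add: uprob_def add_divide_distrib)
qed

context bcm_sequence
begin

text \<open>Count the pairs of cut half-edges that lie in different components which are not small.
  On a bad event, of probability at most p1 + p2 + p3, all pairs may count; otherwise
  \<open>disconnected_pairs_le\<close> applies, and the half-edges missed by both kinds of big
  classes have probability at most e each, as the difference of the probabilities of two nested
  events. By exchangeability each pair of a vertex in Zk and one in Zl contributes the same
  probability.\<close>

lemma apart_bound:
  assumes Z: "Z \<subseteq> {1..N n}" and dpos: "\<And>w. w \<in> {1..N n} \<Longrightarrow> dl n w > 0"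
    and Zk: "Zk \<subseteq> Z" "Zk \<subseteq> vdeg n k" "card Zk = m" and Zl: "Zl \<subseteq> Z" "Zl \<subseteq> vdeg n l" "card Zl = m"
    and cZ: "card Z \<le> 3 * m" and m: "m \<ge> 2" and a: "a > 0" "a \<le> c * real m" and K: "K2 < K" and e: "e \<ge> 0"
    and p1: "uprob (MM n) (cut_separated n Z K a) \<le> p1"
    and p2: "uprob (MM n) (\<lambda>f. real (card (cut_left n Z K f)) < 3 * a) \<le> p2"
    and p3: "uprob (MM n) (\<lambda>f. real (card (cut_right n Z K f)) < 3 * a) \<le> p3"
    and both: "\<And>w. w \<in> Z \<Longrightarrow> uprob (MM n) (\<lambda>f. card (cut_explored n Z f ({w} \<times> {1..dl n w}) {}) \<le> 2 * K)
        \<le> uprob (MM n) (\<lambda>f. small n K2 f (w, 1)) + e"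
    and w: "w1 \<in> vdeg n k" "w2 \<in> vdeg n l" "w1 \<noteq> w2"
  shows "uprob (MM n) (apart n K2 w1 w2) \<le> 18 * (p1 + p2 + p3) + 24 * c + 36 * e"
proof -
  define F where "F = cut Z"
  define LB where "LB f = cut_left n Z K f" for f :: "nat \<times> nat \<Rightarrow> nat \<times> nat"
  define RB where "RB f = cut_right n Z K f" for f :: "nat \<times> nat \<Rightarrow> nat \<times> nat"
  define bad where "bad f \<longleftrightarrow> cut_separated n Z K a f
    \<or> real (card (LB f)) < 3 * a \<or> real (card (RB f)) < 3 * a" for f
  define Q where "Q p f \<longleftrightarrow> \<not> small n K2 f (fst p) \<and> \<not> small n K2 f (snd p) \<and> snd p \<notin> ecomp n f (fst p)"
    for p :: "(nat \<times> nat) \<times> (nat \<times> nat)" and f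
  define miss where "miss f x \<longleftrightarrow> \<not> small n K2 f x \<and> x \<notin> LB f \<and> x \<notin> RB f" for f x
  have FA: "F \<subseteq> A n" unfolding F_def by (rule cut_subset[OF Z dpos])
  have finF: "finite F" using FA finA by (rule finite_subset)
  have finZ: "finite Z" using Z by (rule finite_subset) simp
  have cF: "card F = card Z" unfolding F_def by (rule card_cut[OF Z dpos])
  have cF3: "real (card F) \<le> 3 * real m" using cZ cF by linarith
  have sib: "\<And>x. x \<in> cut2 n Z \<Longrightarrow> sibling x \<in> A n - F \<and> fst (sibling x) = fst x"
    unfolding F_def by (rule sibling_cut2[OF Z dpos])
  have G: "cut2 n Z \<subseteq> F" unfolding F_def by (rule cut2_subset[OF Z dpos])
  have bad_le: "uprob (MM n) bad \<le> p1 + p2 + p3"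
  proof -
    have "uprob (MM n) bad \<le> uprob (MM n) (cut_separated n Z K a)
       + uprob (MM n) (\<lambda>f. real (card (LB f)) < 3 * a \<or> real (card (RB f)) < 3 * a)"
      unfolding bad_def[abs_def] by (rule uprob_disj_le[OF finM])
    also have "uprob (MM n) (\<lambda>f. real (card (LB f)) < 3 * a \<or> real (card (RB f)) < 3 * a)
       \<le> uprob (MM n) (\<lambda>f. real (card (LB f)) < 3 * a) + uprob (MM n) (\<lambda>f. real (card (RB f)) < 3 * a)"
      by (rule uprob_disj_le[OF finM])
    finally show ?thesis using p1 p2 p3 by (simp add: LB_def RB_def)
  qed
  \<comment> \<open>The pointwise bound for the number of pairs, whose average is then compared with
    \<open>m * (m - 1)\<close> times the probability in question; \<open>m * (m - 1)\<close> is at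
    least half of \<open>m\<^sup>2\<close>, and there are at most \<open>9 * m\<^sup>2\<close> pairs
    of cut half-edges.\<close>
  have pt: "real (card {p \<in> F \<times> F. Q p f}) \<le> (real (card F))\<^sup>2 * of_bool (bad f)
      + (4 * real (card F) * a + 2 * real (card F) * real (card {x \<in> F. miss f x}))" if f: "f \<in> MM n" for f
  proof (cases "bad f")
    case True
    have "card {p \<in> F \<times> F. Q p f} \<le> card (F \<times> F)" using finF by (intro card_mono) auto
    then have "real (card {p \<in> F \<times> F. Q p f}) \<le> real (card (F \<times> F))" by (rule of_nat_mono)
    then have "real (card {p \<in> F \<times> F. Q p f}) \<le> (real (card F))\<^sup>2"
      by (simp only: card_cartesian_product power2_eq_square of_nat_mult)
    moreover have "0 \<le> 4 * real (card F) * a + 2 * real (card F) * real (card {x \<in> F. miss f x})" using a by simp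
    moreover have "(of_bool (bad f) :: real) = 1" using True by simp
    ultimately show ?thesis by (simp only: mult_1_right)
  next
    case False
    have "real (card {(x, x') \<in> F \<times> F. \<not> small n K2 f x \<and> \<not> small n K2 f x' \<and> x' \<notin> ecomp n f x}) \<le> 2 * real (card F) *
      (2 * a + real (card {x \<in> F. \<not> small n K2 f x \<and> x \<notin> LB f \<and> x \<notin> RB f}))"
      using False disconnected_pairs_le[OF finA finB f FA G sib a(1), where K = K and Bg = "\<lambda>x. \<not> small n K2 f x" and \<beta> = fst]
      by (simp add: bad_def LB_def RB_def F_def not_less)
    moreover have "{p \<in> F \<times> F. Q p f}
        = {(x, x') \<in> F \<times> F. \<not> small n K2 f x \<and> \<not> small n K2 f x' \<and> x' \<notin> ecomp n f x}"
      by (auto simp: Q_def)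
    ultimately show ?thesis using False by (simp add: miss_def algebra_simps)
  qed
  have miss_le: "uprob (MM n) (\<lambda>f. miss f x) \<le> e" if x: "x \<in> F" for x
  proof -
    obtain w where w: "w \<in> Z" "x = (w, 1)" using x by (auto simp: F_def cut_def)
    have 1: "uprob (MM n) (\<lambda>f. miss f x) = uprob (MM n) (\<lambda>f. x \<notin> LB f \<and> x \<notin> RB f) - uprob (MM n) (\<lambda>f. small n K2 f x)"
      unfolding miss_def using small_imp_not_big[OF Z dpos _ w(1) _ K] w(2)
      by (intro uprob_diff finM) (auto simp: LB_def RB_def)
    have 2: "uprob (MM n) (\<lambda>f. x \<notin> LB f \<and> x \<notin> RB f)
      \<le> uprob (MM n) (\<lambda>f. card (cut_explored n Z f ({w} \<times> {1..dl n w}) {}) \<le> 2 * K)"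
    proof (rule uprob_mono[OF finM])
      fix f assume f: "f \<in> MM n" "x \<notin> LB f \<and> x \<notin> RB f"
      show "card (cut_explored n Z f ({w} \<times> {1..dl n w}) {}) \<le> 2 * K"
        by (rule card_explored_vertex[OF Z dpos f(1) w(1)]) (use f(2) w(2) in \<open>simp_all add: LB_def RB_def\<close>)
    qed
    show ?thesis using 1 2 both[OF w(1)] unfolding w(2) by linarith
  qed
  have "avg (MM n) (\<lambda>f. real (card {p \<in> F \<times> F. Q p f})) \<le> avg (MM n) (\<lambda>f. (real (card F))\<^sup>2 * of_bool (bad f)
      + (4 * real (card F) * a + 2 * real (card F) * real (card {x \<in> F. miss f x})))"
    by (rule avg_mono) (rule pt)
  also have "\<dots> = (real (card F))\<^sup>2 * uprob (MM n) bad + (4 * real (card F) * a + 2 * real (card F) * (\<Sum>x\<in>F. uprob (MM n) (\<lambda>f. miss f x)))"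
    by (simp only: avg_add avg_cmult avg_of_bool[OF finM] avg_const[OF finM MM_ne] avg_card[OF finM finF])
  also have "\<dots> \<le> (real (card F))\<^sup>2 * (p1 + p2 + p3) + (4 * real (card F) * (c * real m) + 2 * real (card F) * (real (card F) * e))"
    using bad_le miss_le a sum_bounded_above[of F "\<lambda>x. uprob (MM n) (\<lambda>f. miss f x)" e]
    by (intro add_mono mult_left_mono) auto
  also have "\<dots> \<le> (3 * real m)\<^sup>2 * (p1 + p2 + p3) + (4 * (3 * real m) * (c * real m) + 2 * (3 * real m) * (3 * real m * e))"
  proof -
    have P: "0 \<le> p1 + p2 + p3" using bad_le uprob_nonneg order_trans by blast
    have cm: "0 \<le> c * real m" using a by linarith
    have "0 \<le> c" using cm m by (simp add: zero_le_mult_iff)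
    then show ?thesis using cF3 P cm e
      by (intro add_mono mult_right_mono power_mono mult_mono mult_nonneg_nonneg) auto
  qed
  also have "\<dots> = (real m)\<^sup>2 * (9 * (p1 + p2 + p3) + 12 * c + 18 * e)" by (simp add: power2_eq_square algebra_simps)
  finally have up: "avg (MM n) (\<lambda>f. real (card {p \<in> F \<times> F. Q p f})) \<le> (real m)\<^sup>2 * (9 * (p1 + p2 + p3) + 12 * c + 18 * e)" .
  define P where "P = uprob (MM n) (apart n K2 w1 w2)"
  define pairs where "pairs = (SIGMA w:Zk. Zl - {w})"
  define em where "em = (\<lambda>(w, w'). ((w :: nat, 1 :: nat), (w' :: nat, 1 :: nat)))"
  have finZk: "finite Zk" "finite Zl" using Zk(1) Zl(1) finZ finite_subset by auto
  have sub: "em ` pairs \<subseteq> F \<times> F" using Zk(1) Zl(1) by (auto simp: em_def pairs_def F_def cut_def)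
  have cp: "real m * (real m - 1) \<le> real (card pairs)"
  proof -
    have "m - 1 \<le> card (Zl - {w})" for w using Zl(3) finZk(2) by (simp add: card_Diff_singleton_if)
    then have "(\<Sum>w\<in>Zk. m - 1) \<le> (\<Sum>w\<in>Zk. card (Zl - {w}))" by (intro sum_mono)
    also have "\<dots> = card pairs" unfolding pairs_def using finZk by (simp add: card_SigmaI)
    finally have "m * (m - 1) \<le> card pairs" using Zk(3) by simp
    then have "real (m * (m - 1)) \<le> real (card pairs)" by linarith
    then show ?thesis using m by (simp add: of_nat_diff)
  qed
  have inj: "inj_on em pairs" by (auto simp: inj_on_def em_def)
  have Pe: "P \<le> uprob (MM n) (Q (em p))" if p: "p \<in> pairs" for p
  proof -
    obtain w w' where ww: "p = (w, w')" "w \<in> Zk" "w' \<in> Zl" "w \<noteq> w'" using p by (auto simp: pairs_def)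
    have "P \<le> uprob (MM n) (apart n K2 w w')"
      unfolding P_def by (rule apart_symmetric) (use ww w Zk Zl dpos in auto)
    also have "apart n K2 w w' = Q (em p)" by (auto simp: fun_eq_iff apart_def Q_def ww(1) em_def)
    finally show ?thesis .
  qed
  have "real m * (real m - 1) * P \<le> real (card pairs) * P"
    using cp by (rule mult_right_mono) (simp add: P_def)
  also have "\<dots> \<le> (\<Sum>p\<in>pairs. uprob (MM n) (Q (em p)))" using Pe by (intro sum_bounded_below) auto
  also have "\<dots> = (\<Sum>p\<in>em ` pairs. uprob (MM n) (Q p))" using inj by (simp add: sum.reindex)
  also have "\<dots> \<le> (\<Sum>p\<in>F \<times> F. uprob (MM n) (Q p))" using finF sub by (intro sum_mono2) auto
  also have "\<dots> = avg (MM n) (\<lambda>f. real (card {p \<in> F \<times> F. Q p f}))"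
    using finF by (intro avg_card[symmetric] finM) auto
  also note up
  finally have "real m * (real m - 1) * P \<le> (real m)\<^sup>2 * (9 * (p1 + p2 + p3) + 12 * c + 18 * e)" .
  moreover have "(real m)\<^sup>2 * (P / 2) \<le> real m * (real m - 1) * P"
  proof -
    have "real m * (real m / 2) \<le> real m * (real m - 1)" using m by (intro mult_left_mono) auto
    then have "real m * (real m / 2) * P \<le> real m * (real m - 1) * P" by (rule mult_right_mono) (simp add: P_def)
    then show ?thesis by (simp add: power2_eq_square)
  qed
  ultimately have "(real m)\<^sup>2 * (P / 2) \<le> (real m)\<^sup>2 * (9 * (p1 + p2 + p3) + 12 * c + 18 * e)" by linarith
  then have "P / 2 \<le> 9 * (p1 + p2 + p3) + 12 * c + 18 * e" using m by simp
  then show ?thesis by (simp add: P_def)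
qed

text \<open>Apply \<open>uprob_many_le\<close> to the vertices of W that see a small class, of which
  there would be more than \<open>\<phi> * m + r\<close>. If q is about \<open>\<theta> ^ r\<close>
  with \<theta> < \<phi>, the bound tends to 0 as r grows.\<close>

lemma few_big_unlikely:
  assumes fin: "finite W" and cW: "card W = m" and sub: "\<And>f. f \<in> MM n \<Longrightarrow> (\<lambda>w. (w, 1)) ` {w \<in> W. \<not> S f w} \<subseteq> LB f"
    and finLB: "\<And>f. finite (LB f)" and q0: "q \<ge> 0" and \<phi>: "0 < \<phi>" "\<phi> < 1" and c: "0 < c" "c \<le> (1 - \<phi>) / 6"
    and large: "real r + 1 \<le> (1 - \<phi>) / 2 * real m"
    and q: "\<And>X. X \<subseteq> W \<Longrightarrow> card X = r \<Longrightarrow> uprob (MM n) (\<lambda>f. \<forall>w\<in>X. S f w) \<le> q"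
  shows "uprob (MM n) (\<lambda>f. real (card (LB f :: (nat \<times> nat) set)) < 3 * (c * real m)) \<le> q * (1 / \<phi>) ^ r"
proof -
  define m' where "m' = nat \<lceil>(1 - 3 * c) * real m\<rceil>"
  have "(1 + \<phi>) / 2 \<le> 1 - 3 * c" using c(2) by (simp add: field_simps)
  then have "(1 + \<phi>) / 2 * real m \<le> (1 - 3 * c) * real m" by (rule mult_right_mono) simp
  moreover have "(1 - 3 * c) * real m \<le> real m'" unfolding m'_def by (rule real_nat_ceiling_ge)
  moreover have "(1 + \<phi>) / 2 * real m = \<phi> * real m + (1 - \<phi>) / 2 * real m" by (simp add: field_simps)
  ultimately have m': "\<phi> * real m + real r + 1 \<le> real m'" using large by linarith
  have pm: "0 < (1 - \<phi>) / 2 * real m" using large by linarith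
  then have mpos: "real m > 0" using \<phi> by (simp add: zero_less_mult_iff)
  have pp: "0 < \<phi> * real m" using \<phi> mpos by simp
  then have rm: "r < m'" using m' by linarith
  have "uprob (MM n) (\<lambda>f. real (card (LB f)) < 3 * (c * real m)) \<le> uprob (MM n) (\<lambda>f. m' \<le> card {w \<in> W. S f w})"
  proof (rule uprob_mono[OF finM])
    fix f assume f: "f \<in> MM n" and lt: "real (card (LB f)) < 3 * (c * real m)"
    have "card {w \<in> W. \<not> S f w} = card ((\<lambda>w. (w, 1::nat)) ` {w \<in> W. \<not> S f w})"
      by (rule card_image[symmetric]) (auto simp: inj_on_def)
    also have "\<dots> \<le> card (LB f)" using sub[OF f] finLB by (intro card_mono)
    finally have "real (card {w \<in> W. \<not> S f w}) < 3 * (c * real m)" using lt by linarith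
    moreover have "card W = card {w \<in> W. S f w} + card {w \<in> W. \<not> S f w}"
      using fin by (subst card_Un_disjoint[symmetric]) (auto intro: arg_cong[where f = card])
    ultimately have "(1 - 3 * c) * real m \<le> real (card {w \<in> W. S f w})" using cW by (simp add: algebra_simps)
    then show "m' \<le> card {w \<in> W. S f w}" unfolding m'_def by (simp add: nat_ceiling_le_eq)
  qed
  also have "\<dots> \<le> q * (real (card W) / real (m' - r)) ^ r"
    by (rule uprob_many_le[OF finM fin rm q0 q])
  also have "\<dots> \<le> q * (1 / \<phi>) ^ r"
  proof (intro mult_left_mono power_mono q0)
    have "\<phi> * real m \<le> real (m' - r)" using m' rm by (simp add: of_nat_diff)
    then show "real (card W) / real (m' - r) \<le> 1 / \<phi>" using \<phi> rm cW by (simp add: field_simps)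
  qed simp
  finally show ?thesis .
qed

text \<open>The entropy \<open>h / K\<close> of the divisions is at most half of the exponent
  \<open>(c * m)\<^sup>2 / z\<close>, which is of order \<open>c\<^sup>2 * \<epsilon> * h\<close>; x
  is a lower bound for what is left of the exponent.\<close>

lemma separation_numeric:
  fixes c \<epsilon> \<delta> :: real
  assumes "0 < c" "0 < \<epsilon>" "0 < \<delta>" and K: "12 / (c\<^sup>2 * \<epsilon>) \<le> real K" "K > 0"
    and m: "\<epsilon> * real h / 2 \<le> real m" "m > 0" and z: "0 < z" "z \<le> 3 * m"
    and h: "12 / (c\<^sup>2 * \<epsilon> * \<delta>) \<le> real h"
  shows "2 ^ (h div K) * exp (- (c * real m)\<^sup>2 / real z) \<le> \<delta>"
proof -
  define x where "x = c\<^sup>2 * \<epsilon> * real h / 12"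
  have ce: "c\<^sup>2 * \<epsilon> > 0" using assms by simp
  have "(2::real) ^ (h div K) \<le> exp 1 ^ (h div K)"
    using exp_ge_add_one_self[of 1] by (intro power_mono) auto
  also have "\<dots> = exp (real (h div K))" by (simp flip: exp_of_nat_mult)
  also have "\<dots> \<le> exp (real h / real K)"
    using div_times_less_eq_dividend[of h K] K(2) by (simp add: le_divide_eq flip: of_nat_mult)
  also have "real h / real K \<le> x"
  proof -
    have "12 \<le> real K * (c\<^sup>2 * \<epsilon>)" using K ce by (simp add: divide_le_eq)
    then have "real h * 12 \<le> real h * (real K * (c\<^sup>2 * \<epsilon>))" by (rule mult_left_mono) simp
    then show ?thesis using K(2) by (simp add: x_def field_simps)
  qed
  finally have 1: "(2::real) ^ (h div K) \<le> exp x" by simp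
  have "2 * x \<le> c\<^sup>2 * real m / 3"
    using mult_left_mono[OF m(1), of "c\<^sup>2"] by (simp add: x_def field_simps)
  also have "\<dots> = (c * real m)\<^sup>2 / (3 * real m)" using m(2) by (simp add: power2_eq_square)
  also have "\<dots> \<le> (c * real m)\<^sup>2 / real z" using z m(2) by (intro divide_left_mono) auto
  finally have "exp (- (c * real m)\<^sup>2 / real z) \<le> exp (- (2 * x))" by simp
  with 1 have "2 ^ (h div K) * exp (- (c * real m)\<^sup>2 / real z) \<le> exp x * exp (- (2 * x))"
    by (intro mult_mono) auto
  also have "\<dots> = exp (- x)" by (simp flip: exp_add)
  also have "\<dots> \<le> \<delta>"
  proof -
    have "12 \<le> real h * (c\<^sup>2 * \<epsilon> * \<delta>)" using h ce assms(3) by (simp add: divide_le_eq)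
    then have "1 \<le> x * \<delta>" by (simp add: x_def field_simps)
    also have "\<dots> \<le> exp x * \<delta>" using exp_ge_add_one_self[of x] assms(3) by (intro mult_right_mono) linarith+
    finally show ?thesis by (simp add: exp_minus field_simps)
  qed
  finally show ?thesis .
qed

lemma supercritical_regular: "supercritical \<Longrightarrow> regular"
  by (simp add: regular_def)

text \<open>Cut the first half-edge at m vertices of each of the degrees k, l and k0, where m is
  about \<open>\<epsilon> * h\<close>. Those of degrees k and l are the ones to be compared. Those
  of degree k0 \<ge> 2 guarantee enough left big and right big half-edges. The parameters are fixed
  in the order \<theta>, c and r, \<epsilon>, K2, K, and finally n.\<close>

lemma apart_unlikely:
  assumes dpos: "\<And>n w. w \<in> {1..N n} \<Longrightarrow> dl n w > 0" and super: supercritical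
    and k0: "k0 \<ge> 2" "u k0 > 0" and uk: "u k > 0" and ul: "u l > 0" and \<delta>: "\<delta> > 0"
  obtains K0 where "\<And>K2. K2 \<ge> K0 \<Longrightarrow> \<forall>\<^sub>F n in sequentially. \<forall>w1\<in>vdeg n k. \<forall>w2\<in>vdeg n l. w1 \<noteq> w2 \<longrightarrow>
    uprob (MM n) (apart n K2 w1 w2) \<le> \<delta>"
proof -
  define J where "J = {k, l, k0}"
  have uJ: "u j > 0" "j > 0" if "j \<in> J" for j
  proof -
    show "u j > 0" using that uk ul k0 by (auto simp: J_def)
    then show "j > 0" using uv_0(1) by (cases j) auto
  qed
  \<comment> \<open>The total error at the end is \<open>222 * \<delta>2\<close>.\<close>
  define \<delta>2 where "\<delta>2 = \<delta> / 400"
  have d2: "\<delta>2 > 0" using \<delta> by (simp add: \<delta>2_def)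
  have d2': "\<delta> = 400 * \<delta>2" by (simp add: \<delta>2_def)
  have "\<forall>j. \<exists>d>0. \<forall>\<theta>. \<rho> < \<theta> \<longrightarrow> \<theta> < \<rho> + d \<longrightarrow> \<theta> ^ j \<le> \<rho> ^ j + \<delta>2"
  proof
    fix j show "\<exists>d>0. \<forall>\<theta>. \<rho> < \<theta> \<longrightarrow> \<theta> < \<rho> + d \<longrightarrow> \<theta> ^ j \<le> \<rho> ^ j + \<delta>2"
      by (rule power_above_\<rho>[OF d2, of j]) blast
  qed
  from choice[OF this] obtain dd where dd: "\<And>j. dd j > 0"
    "\<And>j \<theta>. \<rho> < \<theta> \<Longrightarrow> \<theta> < \<rho> + dd j \<Longrightarrow> \<theta> ^ j \<le> \<rho> ^ j + \<delta>2" by blast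
  define d where "d = min (dd k) (min (dd l) (dd k0))"
  have "d > 0" using dd(1) by (simp add: d_def)
  then obtain \<theta> where th: "\<rho> < \<theta>" "\<theta> < 1" "\<theta> < \<rho> + d" "gen v (gen u \<theta>) < \<theta>"
    using super unfolding supercritical_def by blast
  have th0: "0 \<le> \<theta>" "\<theta> \<le> 1" using th \<rho>_bounds by auto
  have thj: "\<theta> ^ j \<le> \<rho> ^ j + \<delta>2" if "j \<in> J" for j
    using that dd(2)[OF th(1), of j] th(3) by (auto simp: J_def d_def)
  obtain \<epsilon>0 where sl: "slack \<theta> \<epsilon>0" using slack_exists[OF th0 th(4)] .
  have e0: "\<epsilon>0 > 0" using sl by (simp add: slack_def)
  then have e02: "\<epsilon>0 / 2 > 0" by simp
  \<comment> \<open>Any number strictly between \<theta> and 1 would do.\<close>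
  define \<phi> where "\<phi> = (1 + \<theta>) / 2"
  have ph: "0 < \<phi>" "\<phi> < 1" "\<theta> < \<phi>" using th th0 by (auto simp: \<phi>_def)
  define c where "c = min ((1 - \<phi>) / 6) \<delta>2"
  have c: "0 < c" "c \<le> (1 - \<phi>) / 6" "c \<le> \<delta>2"
  proof -
    show "0 < c" using ph d2 by (simp add: c_def)
    show "c \<le> (1 - \<phi>) / 6" unfolding c_def by (rule min.cobounded1)
    show "c \<le> \<delta>2" unfolding c_def by (rule min.cobounded2)
  qed
  have "\<theta> / \<phi> < 1" using ph by simp
  then obtain r where r: "(\<theta> / \<phi>) ^ r < \<delta>2" using real_arch_pow_inv[OF d2] by blast
  define \<delta>' where "\<delta>' = min \<delta>2 (\<delta>2 * \<phi> ^ r)"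
  have d': "\<delta>' > 0" "\<delta>' \<le> \<delta>2" "\<delta>' \<le> \<delta>2 * \<phi> ^ r" using d2 ph by (auto simp: \<delta>'_def)
  define q where "q = \<theta> ^ r + \<delta>'"
  have q0: "q \<ge> 0" using th0 d' by (simp add: q_def)
  have q_le: "q * (1 / \<phi>) ^ r \<le> 2 * \<delta>2"
  proof -
    have "q * (1 / \<phi>) ^ r = (\<theta> / \<phi>) ^ r + \<delta>' / \<phi> ^ r" by (simp add: q_def power_divide add_divide_distrib)
    also have "\<delta>' / \<phi> ^ r \<le> \<delta>2" using d'(3) ph by (simp add: divide_le_eq)
    finally show ?thesis using r by linarith
  qed
  have "\<forall>j. \<exists>K0. \<forall>K\<ge>K0. \<forall>\<^sub>F n in sequentially. \<forall>x\<in>A n. card (fib (A n) fst x) = j \<longrightarrow>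
    \<rho> ^ j - \<delta>2 \<le> uprob (MM n) (\<lambda>f. small n K f x)"
  proof
    fix j show "\<exists>K0. \<forall>K\<ge>K0. \<forall>\<^sub>F n in sequentially. \<forall>x\<in>A n. card (fib (A n) fst x) = j \<longrightarrow>
      \<rho> ^ j - \<delta>2 \<le> uprob (MM n) (\<lambda>f. small n K f x)"
      by (rule small_prob_lower[OF d2, of j]) blast
  qed
  from choice[OF this] obtain Kl where Kl: "\<And>j K. K \<ge> Kl j \<Longrightarrow> \<forall>\<^sub>F n in sequentially. \<forall>x\<in>A n. card (fib (A n) fst x) = j \<longrightarrow>
    \<rho> ^ j - \<delta>2 \<le> uprob (MM n) (\<lambda>f. small n K f x)" by blast
  define K0 where "K0 = max (Kl k) (max (Kl l) (Kl k0))"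
  define D where "D = k + l + k0"
  have DJ: "j \<le> D" if "j \<in> J" for j using that by (auto simp: J_def D_def)
  have D0: "D > 0" using k0 by (simp add: D_def)
  \<comment> \<open>Cutting so few half-edges changes the degree statistics by at most half of the
    slack, and there are enough vertices of each of the three degrees.\<close>
  define \<epsilon> where "\<epsilon> = min (\<epsilon>0 / (6 * real D)) (Min ((\<lambda>j. u j / (2 * real j)) ` J))"
  have finJ: "finite J" "J \<noteq> {}" by (auto simp: J_def)
  have eps: "\<epsilon> > 0" using e0 D0 uJ finJ by (auto simp: \<epsilon>_def)
  have eps1: "6 * real D * \<epsilon> \<le> \<epsilon>0"
  proof -
    have "\<epsilon> \<le> \<epsilon>0 / (6 * real D)" by (simp add: \<epsilon>_def)
    then show ?thesis using D0 by (simp add: field_simps)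
  qed
  have eps2: "\<epsilon> \<le> u j / (2 * real j)" if "j \<in> J" for j
    using that finJ by (auto simp: \<epsilon>_def min_le_iff_disj)
  define m where "m n = nat \<lfloor>\<epsilon> * real (card (A n))\<rfloor>" for n
  have m_le: "real (m n) \<le> \<epsilon> * real (card (A n))" for n
    using eps by (simp add: m_def)
  define Zf where "Zf n j = (SOME X. X \<subseteq> vdeg n j \<and> card X = m n)" for n j
  define Z where "Z n = Zf n k \<union> Zf n l \<union> Zf n k0" for n
  define good where "good n \<longleftrightarrow> (\<forall>j\<in>J. Zf n j \<subseteq> vdeg n j \<and> card (Zf n j) = m n) \<and> A n \<noteq> {}" for n
  have ev_good: "\<forall>\<^sub>F n in sequentially. good n"
  proof -
    have "\<forall>\<^sub>F n in sequentially. \<forall>j\<in>J. u j / (2 * real j) * real (card (A n)) \<le> real (card (vdeg n j))"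
      using uJ(1) finJ by (intro eventually_ball_finite ballI many_of_degree) auto
    then show ?thesis using eventually_ne(1)
    proof eventually_elim
      case (elim n)
      have "Zf n j \<subseteq> vdeg n j \<and> card (Zf n j) = m n" if j: "j \<in> J" for j
      proof -
        have "\<epsilon> * real (card (A n)) \<le> u j / (2 * real j) * real (card (A n))"
          using eps2[OF j] by (rule mult_right_mono) simp
        then have "real (m n) \<le> real (card (vdeg n j))" using m_le[of n] elim(1) j by fastforce
        then have "m n \<le> card (vdeg n j)" by simp
        then obtain X where "X \<subseteq> vdeg n j" "card X = m n" using obtain_subset_with_card_n by metis
        then have "\<exists>X. X \<subseteq> vdeg n j \<and> card X = m n" by blast
        from someI_ex[OF this] show ?thesis by (simp add: Zf_def)
      qed
      then show ?case using elim(2) by (simp add: good_def)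
    qed
  qed
  have goodZ: "Z n \<subseteq> {1..N n}" "\<And>w. w \<in> Z n \<Longrightarrow> dl n w \<in> J" "card (Z n) \<le> 3 * m n"
    "\<And>w. w \<in> Z n \<Longrightarrow> dl n w \<le> D" if g: "good n" for n
  proof -
    have Zs: "Zf n j \<subseteq> vdeg n j" "card (Zf n j) = m n" if "j \<in> J" for j using g that by (auto simp: good_def)
    have JJ: "k \<in> J" "l \<in> J" "k0 \<in> J" by (auto simp: J_def)
    show "Z n \<subseteq> {1..N n}" using Zs(1)[OF JJ(1)] Zs(1)[OF JJ(2)] Zs(1)[OF JJ(3)] by (auto simp: Z_def vdeg_def)
    show dJ: "\<And>w. w \<in> Z n \<Longrightarrow> dl n w \<in> J"
      using Zs(1)[OF JJ(1)] Zs(1)[OF JJ(2)] Zs(1)[OF JJ(3)] JJ by (auto simp: Z_def vdeg_def)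
    then show "\<And>w. w \<in> Z n \<Longrightarrow> dl n w \<le> D" using DJ by blast
    have "card (Z n) \<le> card (Zf n k) + card (Zf n l) + card (Zf n k0)"
      unfolding Z_def by (meson add_le_mono1 card_Un_le order_trans)
    then show "card (Z n) \<le> 3 * m n" using Zs(2) JJ by simp
  qed
  have stat: "\<forall>\<^sub>F n in sequentially. avg (A n) (\<lambda>x. \<theta> ^ (card (fib (A n) (cut_label (Z n)) x) - 1)) \<le> gen u \<theta> + \<epsilon>0"
    using ev_good stat_left[OF th0 e02]
  proof eventually_elim
    case (elim n)
    have ne: "A n \<noteq> {}" using elim(1) by (simp add: good_def)
    have "real D * real (card (Z n)) \<le> real D * (3 * (\<epsilon> * real (card (A n))))"
      using goodZ(3)[OF elim(1)] m_le[of n] by (intro mult_left_mono) auto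
    also have "\<dots> = 6 * real D * \<epsilon> * (real (card (A n)) / 2)" by simp
    also have "\<dots> \<le> \<epsilon>0 * (real (card (A n)) / 2)" using eps1 by (rule mult_right_mono) simp
    finally have "real D * real (card (Z n)) \<le> \<epsilon>0 / 2 * real (card (A n))" by simp
    from split_stat[OF goodZ(1)[OF elim(1)] dpos th0 goodZ(4)[OF elim(1)] this ne]
    show ?case using elim(2) e0 by simp
  qed
  show ?thesis
  proof (rule that[of K0])
    fix K2 assume K2: "K0 \<le> K2"
    \<comment> \<open>K exceeds K2, so that small components meet no big class, and is large enough
      for the union bound over the divisions of the big classes.\<close>
    define K where "K = max (K2 + 1) (nat \<lceil>12 / (c\<^sup>2 * \<epsilon>)\<rceil>)"
    have K: "K2 < K" "12 / (c\<^sup>2 * \<epsilon>) \<le> real K" "K > 0"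
      by (auto simp: K_def intro: order_trans[OF real_nat_ceiling_ge])
    define hmin where "hmin = max (max (4 / \<epsilon>) (2 * (real r + 1) * 2 / ((1 - \<phi>) * \<epsilon>))) (12 / (c\<^sup>2 * \<epsilon> * \<delta>2))"
    have low: "\<forall>\<^sub>F n in sequentially. \<forall>j\<in>J. \<forall>x\<in>A n. card (fib (A n) fst x) = j \<longrightarrow>
        \<rho> ^ j - \<delta>2 \<le> uprob (MM n) (\<lambda>f. small n K2 f x)"
      using finJ K2 by (intro eventually_ball_finite ballI Kl) (auto simp: J_def K0_def)
    show "\<forall>\<^sub>F n in sequentially. \<forall>w1\<in>vdeg n k. \<forall>w2\<in>vdeg n l. w1 \<noteq> w2 \<longrightarrow>
      uprob (MM n) (apart n K2 w1 w2) \<le> \<delta>"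
      using ev_good low small_upper[OF sl d'(1) stat, of "2 * K"] small_upper[OF sl d'(1) stat, of "r * K"]
        eventually_card[of hmin]
    proof eventually_elim
      case (elim n)
      note Zn = goodZ[OF elim(1)]
      let ?m = "m n" and ?h = "card (A n)"
      have h: "4 / \<epsilon> \<le> real ?h" "2 * (real r + 1) * 2 / ((1 - \<phi>) * \<epsilon>) \<le> real ?h" "12 / (c\<^sup>2 * \<epsilon> * \<delta>2) \<le> real ?h"
        using elim(5) by (auto simp: hmin_def)
      have eh: "4 \<le> \<epsilon> * real ?h" using h(1) eps by (simp add: divide_le_eq mult.commute)
      have m1: "\<epsilon> * real ?h - 1 \<le> real ?m"
      proof -
        have "0 \<le> \<lfloor>\<epsilon> * real ?h\<rfloor>" using eh by simp
        then have "real ?m = real_of_int \<lfloor>\<epsilon> * real ?h\<rfloor>" by (simp add: m_def)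
        then show ?thesis by linarith
      qed
      have m2: "\<epsilon> * real ?h / 2 \<le> real ?m" "?m \<ge> 2" using m1 eh by linarith+
      have large: "real r + 1 \<le> (1 - \<phi>) / 2 * real ?m"
      proof -
        have pe: "(1 - \<phi>) * \<epsilon> > 0" using ph eps by simp
        have "2 * (real r + 1) * 2 \<le> real ?h * ((1 - \<phi>) * \<epsilon>)" using h(2) pe by (simp add: divide_le_eq)
        then have "real r + 1 \<le> (1 - \<phi>) / 2 * (\<epsilon> * real ?h / 2)" by (simp add: field_simps)
        also have "\<dots> \<le> (1 - \<phi>) / 2 * real ?m" using m2(1) ph by (intro mult_left_mono) auto
        finally show ?thesis .
      qed
      have JJ: "k \<in> J" "l \<in> J" "k0 \<in> J" by (auto simp: J_def)
      have Zs: "Zf n j \<subseteq> vdeg n j" "card (Zf n j) = ?m" if "j \<in> J" for j using elim(1) that by (auto simp: good_def)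
      have subZ: "Zf n k \<subseteq> Z n" "Zf n l \<subseteq> Z n" "Zf n k0 \<subseteq> Z n" by (auto simp: Z_def)
      have finZ: "finite (Z n)" using Zn(1) by (rule finite_subset) simp
      have finW: "finite (Zf n k0)" using subZ(3) finZ by (rule finite_subset)
      have ne: "Z n \<noteq> {}" using subZ(1) Zs(2)[OF JJ(1)] m2(2) by fastforce
      have cutne: "cut (Z n) \<noteq> {}" using ne by (simp add: cut_def)
      have cpos: "0 < card (Z n)" using ne finZ by (simp add: card_gt_0_iff)
      have kd: "dl n w = k0" if "w \<in> Zf n k0" for w using Zs(1)[OF JJ(3)] that by (auto simp: vdeg_def)
      let ?LB = "cut_left n (Z n) K"
      let ?RB = "cut_right n (Z n) K"
      let ?sm = "\<lambda>f x. card (cut_class n (Z n) f (f x)) < K"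
      have finLR: "finite (?LB f)" "finite (?RB f)" for f
        using finZ by (auto simp: left_big_def right_big_def cut_def cut2_def)
      have p1: "uprob (MM n) (cut_separated n (Z n) K (c * real ?m)) \<le> \<delta>2"
      proof -
        have "uprob (MM n) (cut_separated n (Z n) K (c * real ?m))
          \<le> 2 ^ (card (B n) div K) * exp (- (c * real ?m)\<^sup>2 / real (card (cut (Z n))))"
          using sibling_cut2[OF Zn(1) dpos] c
          by (intro separated_unlikely finA finB cAB cut_subset[OF Zn(1) dpos] cutne cut2_subset[OF Zn(1) dpos] K(3)) auto
        also have "\<dots> \<le> \<delta>2"
          unfolding cAB[symmetric] using m2 Zn(3) cpos card_cut[OF Zn(1) dpos]
          by (intro separation_numeric[OF c(1) eps d2 K(2,3) _ _ _ _ h(3)]) linarith+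
        finally show ?thesis .
      qed
      have p2: "uprob (MM n) (\<lambda>f. real (card (?LB f)) < 3 * (c * real ?m)) \<le> q * (1 / \<phi>) ^ r"
      proof (rule few_big_unlikely[OF finW Zs(2)[OF JJ(3)] _ finLR(1) q0 ph(1,2) c(1,2) large, where S = "\<lambda>f w. ?sm f (w, 2)"])
        show "(\<lambda>w. (w, 1)) ` {w \<in> Zf n k0. \<not> ?sm f (w, 2)} \<subseteq> ?LB f" for f
          using subZ(3) kd k0 by (auto simp: left_big_def cut2_def sibling_def)
        fix X assume X: "X \<subseteq> Zf n k0" "card X = r"
        have XZ: "X \<subseteq> Z n" using X subZ by auto
        have "uprob (MM n) (\<lambda>f. \<forall>w\<in>X. ?sm f (w, 2)) \<le> uprob (MM n) (\<lambda>f.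
          card (cut_explored n (Z n) f (SIGMA w:X. {2..dl n w}) {}) \<le> r * K)"
        proof (rule uprob_mono[OF finM])
          fix f assume f: "f \<in> MM n" "\<forall>w\<in>X. ?sm f (w, 2)"
          have "card (cut_explored n (Z n) f (SIGMA w:X. {2..dl n w}) {}) \<le> card X * K"
            by (rule card_explored_siblings[OF Zn(1) dpos f(1) XZ]) (use f X kd k0 in auto)
          then show "card (cut_explored n (Z n) f (SIGMA w:X. {2..dl n w}) {}) \<le> r * K"
            using X by simp
        qed
        also have "\<dots> \<le> \<theta> ^ card (SIGMA w:X. {2..dl n w}) + \<delta>'"
          using elim(4) explorable_siblings[OF Zn(1) dpos XZ] by blast
        also have "card (SIGMA w:X. {2..dl n w}) = r * (k0 - 1)"
        proof -
          have "finite X" using X(1) finW by (rule finite_subset)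
          then have "card (SIGMA w:X. {2..dl n w}) = (\<Sum>w\<in>X. card {2..dl n w})" by simp
          also have "\<dots> = (\<Sum>w\<in>X. k0 - 1)" using X kd by (intro sum.cong) auto
          finally show ?thesis using X by simp
        qed
        also have "\<theta> ^ (r * (k0 - 1)) + \<delta>' \<le> q"
          unfolding q_def using th0 k0 by (intro add_right_mono power_decreasing) auto
        finally show "uprob (MM n) (\<lambda>f. \<forall>w\<in>X. ?sm f (w, 2)) \<le> q" .
      qed
      have p3: "uprob (MM n) (\<lambda>f. real (card (?RB f)) < 3 * (c * real ?m)) \<le> q * (1 / \<phi>) ^ r"
      proof (rule few_big_unlikely[OF finW Zs(2)[OF JJ(3)] _ finLR(2) q0 ph(1,2) c(1,2) large, where S = "\<lambda>f w. ?sm f (w, 1)"])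
        show "(\<lambda>w. (w, 1)) ` {w \<in> Zf n k0. \<not> ?sm f (w, 1)} \<subseteq> ?RB f" for f
          using subZ(3) by (auto simp: right_big_def cut_def)
        fix X assume X: "X \<subseteq> Zf n k0" "card X = r"
        have cX: "cut X \<subseteq> cut (Z n)" using X subZ by (auto simp: cut_def)
        have ccX: "card (cut X) = r" using X unfolding cut_def by (subst card_image) (auto simp: inj_on_def)
        have "uprob (MM n) (\<lambda>f. \<forall>w\<in>X. ?sm f (w, 1)) \<le> uprob (MM n) (\<lambda>f.
          card (cut_explored n (Z n) f (cut X) {}) \<le> r * K)"
        proof (rule uprob_mono[OF finM])
          fix f assume f: "f \<in> MM n" "\<forall>w\<in>X. ?sm f (w, 1)"
          have "card (cut_explored n (Z n) f (cut X) {}) \<le> card (cut X) * K"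
            by (rule card_explored_cut[OF Zn(1) dpos f(1) cX]) (use f in \<open>auto simp: cut_def\<close>)
          then show "card (cut_explored n (Z n) f (cut X) {}) \<le> r * K"
            using ccX by simp
        qed
        also have "\<dots> \<le> \<theta> ^ card (cut X) + \<delta>'"
          using elim(4) explorable_cut[OF Zn(1) dpos cX] by blast
        finally show "uprob (MM n) (\<lambda>f. \<forall>w\<in>X. ?sm f (w, 1)) \<le> q" by (simp add: ccX q_def)
      qed
      have both: "uprob (MM n) (\<lambda>f. card (cut_explored n (Z n) f ({w} \<times> {1..dl n w}) {}) \<le> 2 * K)
        \<le> uprob (MM n) (\<lambda>f. small n K2 f (w, 1)) + 3 * \<delta>2" if w: "w \<in> Z n" for w
      proof -
        have j: "dl n w \<in> J" using Zn(2) w by blast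
        have wA: "(w, 1) \<in> A n" using cut_subset[OF Zn(1) dpos] w by (auto simp: cut_def)
        have "uprob (MM n) (\<lambda>f. card (cut_explored n (Z n) f ({w} \<times> {1..dl n w}) {}) \<le> 2 * K)
          \<le> \<theta> ^ card ({w} \<times> {1..dl n w}) + \<delta>'"
          using elim(3) explorable_vertex[OF Zn(1) dpos w] by blast
        also have "\<dots> \<le> \<rho> ^ dl n w + \<delta>2 + \<delta>2" using thj[OF j] d'(2) by (simp add: card_cartesian_product)
        also have "\<rho> ^ dl n w \<le> uprob (MM n) (\<lambda>f. small n K2 f (w, 1)) + \<delta>2"
          using elim(2) j wA card_fib_A[OF wA] by fastforce
        finally show ?thesis by simp
      qed
      show ?case
      proof (intro ballI impI)
        fix w1 w2 assume w: "w1 \<in> vdeg n k" "w2 \<in> vdeg n l" "w1 \<noteq> w2"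
        have "uprob (MM n) (apart n K2 w1 w2)
          \<le> 18 * (\<delta>2 + q * (1 / \<phi>) ^ r + q * (1 / \<phi>) ^ r) + 24 * c + 36 * (3 * \<delta>2)"
        proof (rule apart_bound[OF Zn(1) dpos subZ(1) Zs(1)[OF JJ(1)] Zs(2)[OF JJ(1)]
              subZ(2) Zs(1)[OF JJ(2)] Zs(2)[OF JJ(2)] Zn(3) m2(2) _ _ K(1) _ p1 p2 p3 both w])
          show "0 < c * real ?m" using c m2(2) by simp
          show "0 \<le> 3 * \<delta>2" using d2 by simp
        qed auto
        also have "\<dots> \<le> 18 * (\<delta>2 + 2 * \<delta>2 + 2 * \<delta>2) + 24 * \<delta>2 + 36 * (3 * \<delta>2)"
          using q_le c(3) by (intro add_mono mult_left_mono order_refl) auto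
        also have "\<dots> \<le> \<delta>" using d2 by (simp add: d2')
        finally show "uprob (MM n) (apart n K2 w1 w2) \<le> \<delta>" .
      qed
    qed
  qed
qed

end

section \<open>The giant component\<close>

context bcm_sequence
begin

lemma ecomp_vertex:
  assumes "x \<in> A n" "x' \<in> A n" "fst x = fst x'"
  shows "ecomp n f x = ecomp n f x'"
  by (rule sym, rule comp_of_cong, rule explored_link[OF comp_of_self assms(1,2)]) (simp add: assms)

lemma apart_iff:
  assumes dpos: "\<And>w. w \<in> {1..N n} \<Longrightarrow> dl n w > 0" and x: "x \<in> A n" "x' \<in> A n"
  shows "(\<not> small n K f x \<and> \<not> small n K f x' \<and> x' \<notin> ecomp n f x) = apart n K (fst x) (fst x') f"
proof -
  have y: "(fst x, 1) \<in> A n" "(fst x', 1) \<in> A n"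
    using x dpos[of "fst x"] dpos[of "fst x'"] by (auto simp: half_edges_def)
  have e: "ecomp n f x = ecomp n f (fst x, 1)" "ecomp n f x' = ecomp n f (fst x', 1)"
    by (rule ecomp_vertex[OF x(1) y(1)], simp) (rule ecomp_vertex[OF x(2) y(2)], simp)
  have "x' \<in> ecomp n f x \<longleftrightarrow> (fst x', 1) \<in> ecomp n f x"
  proof
    assume "x' \<in> ecomp n f x"
    then show "(fst x', 1) \<in> ecomp n f x" by (rule explored_link) (use x y in auto)
  next
    assume "(fst x', 1) \<in> ecomp n f x"
    then show "x' \<in> ecomp n f x" by (rule explored_link) (use x y in auto)
  qed
  then show ?thesis unfolding apart_def small_def e by simp
qed

definition apart_pairs :: "nat \<Rightarrow> nat \<Rightarrow> (nat \<times> nat \<Rightarrow> nat \<times> nat) \<Rightarrow> ((nat \<times> nat) \<times> (nat \<times> nat)) set" where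
  "apart_pairs n K f = {p \<in> A n \<times> A n. apart n K (fst (fst p)) (fst (snd p)) f}"

text \<open>Degrees at least D, and degrees below D of limiting probability 0, concern few
  half-edges. For the finitely many others the previous lemma applies.\<close>

lemma few_apart_pairs:
  assumes dpos: "\<And>n w. w \<in> {1..N n} \<Longrightarrow> dl n w > 0" and super: supercritical
    and k0: "k0 \<ge> 2" "u k0 > 0" and \<delta>: "\<delta> > 0"
  obtains K0 where "\<And>K. K \<ge> K0 \<Longrightarrow> \<forall>\<^sub>F n in sequentially.
    avg (MM n) (\<lambda>f. real (card (apart_pairs n K f))) \<le> \<delta> * (real (card (A n)))\<^sup>2"
proof -
  define \<epsilon> where "\<epsilon> = \<delta> / 8"
  have e: "\<epsilon> > 0" and de: "\<delta> = 8 * \<epsilon>" using \<delta> by (auto simp: \<epsilon>_def)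
  obtain D where D: "\<forall>\<^sub>F n in sequentially. uprob (A n) (\<lambda>x. D \<le> card (fib (A n) fst x)) \<le> \<epsilon>"
    using degree_tail[OF e] .
  define J where "J = {j \<in> {..<D}. u j > 0}"
  define J0 where "J0 = {j \<in> {..<D}. \<not> u j > 0}"
  have finJ: "finite J" "finite J0" by (auto simp: J_def J0_def)
  have u0: "u j = 0" if "j \<in> J0" for j using that is_law_nonneg[OF laws(1), of j] by (auto simp: J0_def)
  have "\<forall>p. \<exists>K0. p \<in> J \<times> J \<longrightarrow> (\<forall>K2\<ge>K0. \<forall>\<^sub>F n in sequentially. \<forall>w1\<in>vdeg n (fst p). \<forall>w2\<in>vdeg n (snd p).
    w1 \<noteq> w2 \<longrightarrow> uprob (MM n) (apart n K2 w1 w2) \<le> \<epsilon>)"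
  proof
    fix p show "\<exists>K0. p \<in> J \<times> J \<longrightarrow> (\<forall>K2\<ge>K0. \<forall>\<^sub>F n in sequentially. \<forall>w1\<in>vdeg n (fst p). \<forall>w2\<in>vdeg n (snd p).
      w1 \<noteq> w2 \<longrightarrow> uprob (MM n) (apart n K2 w1 w2) \<le> \<epsilon>)"
    proof (cases "p \<in> J \<times> J")
      case True
      then have pu: "u (fst p) > 0" "u (snd p) > 0" by (auto simp: J_def)
      obtain K0 where "\<And>K2. K2 \<ge> K0 \<Longrightarrow> \<forall>\<^sub>F n in sequentially. \<forall>w1\<in>vdeg n (fst p). \<forall>w2\<in>vdeg n (snd p).
        w1 \<noteq> w2 \<longrightarrow> uprob (MM n) (apart n K2 w1 w2) \<le> \<epsilon>"
        by (rule apart_unlikely[OF dpos super k0 pu e], assumption) (rule that, blast)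
      then show ?thesis by blast
    qed auto
  qed
  from choice[OF this] obtain Kp where Kp: "\<And>p K2. p \<in> J \<times> J \<Longrightarrow> Kp p \<le> K2 \<Longrightarrow>
    \<forall>\<^sub>F n in sequentially. \<forall>w1\<in>vdeg n (fst p). \<forall>w2\<in>vdeg n (snd p). w1 \<noteq> w2 \<longrightarrow>
      uprob (MM n) (apart n K2 w1 w2) \<le> \<epsilon>" by blast
  define K0 where "K0 = sum Kp (J \<times> J)"
  have K0: "Kp p \<le> K0" if "p \<in> J \<times> J" for p
    unfolding K0_def by (rule member_le_sum) (use that finJ in auto)
  have J0ev: "\<forall>\<^sub>F n in sequentially. (\<Sum>j\<in>J0. uprob (A n) (\<lambda>x. card (fib (A n) fst x) = j)) < \<epsilon>"
  proof -
    have "(\<lambda>n. \<Sum>j\<in>J0. uprob (A n) (\<lambda>x. card (fib (A n) fst x) = j)) \<longlonglongrightarrow> (\<Sum>j\<in>J0. u j)"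
      by (intro tendsto_sum u_lim)
    then show ?thesis using e u0 by (intro order_tendstoD(2)) auto
  qed
  show ?thesis
  proof (rule that[of K0])
    fix K assume K: "K0 \<le> K"
    have "\<forall>\<^sub>F n in sequentially. \<forall>p\<in>J \<times> J. \<forall>w1\<in>vdeg n (fst p). \<forall>w2\<in>vdeg n (snd p). w1 \<noteq> w2 \<longrightarrow>
      uprob (MM n) (apart n K w1 w2) \<le> \<epsilon>"
      using K K0 finJ by (intro eventually_ball_finite ballI Kp) (auto intro: order_trans)
    then show "\<forall>\<^sub>F n in sequentially. avg (MM n) (\<lambda>f. real (card (apart_pairs n K f))) \<le> \<delta> * (real (card (A n)))\<^sup>2"
      using D J0ev eventually_card[of 1]
    proof eventually_elim
      case (elim n)
      define h where "h = real (card (A n))"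
      have h: "h > 0" using elim(4) by (simp add: h_def)
      define rare where "rare x \<longleftrightarrow> D \<le> dl n (fst x) \<or> dl n (fst x) \<in> J0" for x :: "nat \<times> nat"
      have rare: "(\<Sum>x\<in>A n. of_bool (rare x)) \<le> 2 * \<epsilon> * h"
      proof -
        have "uprob (A n) rare \<le> uprob (A n) (\<lambda>x. D \<le> card (fib (A n) fst x)) + uprob (A n) (\<lambda>x. \<exists>j\<in>J0. card (fib (A n) fst x) = j)"
          using uprob_disj_le[OF finA[of n], of "\<lambda>x. D \<le> card (fib (A n) fst x)" "\<lambda>x. \<exists>j\<in>J0. card (fib (A n) fst x) = j"]
          by (subst uprob_cong[of "A n" rare "\<lambda>x. D \<le> card (fib (A n) fst x) \<or> (\<exists>j\<in>J0. card (fib (A n) fst x) = j)"])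
             (auto simp: rare_def card_fib_A)
        also have "\<dots> \<le> \<epsilon> + \<epsilon>"
          using elim(2,3) uprob_Bex_le[OF finA[of n] finJ(2), of "\<lambda>j x. card (fib (A n) fst x) = j"] by (intro add_mono) auto
        finally have "uprob (A n) rare \<le> 2 * \<epsilon>" by simp
        then show ?thesis using h finA[of n] by (simp add: uprob_eq_avg h_def divide_le_eq)
      qed
      let ?P = "\<lambda>p. uprob (MM n) (apart n K (fst (fst p)) (fst (snd p)))"
      have bound: "?P (x, x') \<le> \<epsilon> + of_bool (rare x) + of_bool (rare x')" if x: "x \<in> A n" "x' \<in> A n" for x x'
      proof (cases "rare x \<or> rare x'")
        case True
        have "?P (x, x') \<le> 1" by simp
        also have "1 \<le> \<epsilon> + of_bool (rare x) + of_bool (rare x')" using True e by (auto simp: of_bool_def)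
        finally show ?thesis .
      next
        case False
        have mem: "fst x \<in> vdeg n (dl n (fst x))" "fst x' \<in> vdeg n (dl n (fst x'))"
          using x by (auto simp: vdeg_def half_edges_def)
        have JJ: "(dl n (fst x), dl n (fst x')) \<in> J \<times> J" using False by (auto simp: rare_def J_def J0_def)
        show ?thesis
        proof (cases "fst x = fst x'")
          case True
          have "?P (x, x') = 0" using True by (intro uprob_const_False) (simp add: apart_def comp_of_self)
          then show ?thesis using e by simp
        next
          case neq: False
          have "?P (x, x') \<le> \<epsilon>" using bspec[OF elim(1) JJ] mem neq by auto
          then show ?thesis using False by simp
        qed
      qed
      have "avg (MM n) (\<lambda>f. real (card (apart_pairs n K f))) = (\<Sum>p\<in>A n \<times> A n. ?P p)"
        unfolding apart_pairs_def using finA by (intro avg_card finM) auto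
      also have "\<dots> = (\<Sum>x\<in>A n. \<Sum>x'\<in>A n. ?P (x, x'))" by (simp add: sum.cartesian_product split_def)
      also have "\<dots> \<le> (\<Sum>x\<in>A n. \<Sum>x'\<in>A n. \<epsilon> + of_bool (rare x) + of_bool (rare x'))"
        using bound by (intro sum_mono)
      also have "\<dots> = \<epsilon> * h * h + h * (\<Sum>x\<in>A n. of_bool (rare x)) + h * (\<Sum>x\<in>A n. of_bool (rare x))"
        by (simp only: sum.distrib sum_constant h_def sum_distrib_left) (simp add: mult_ac)
      also have "\<dots> \<le> \<epsilon> * h * h + h * (2 * \<epsilon> * h) + h * (2 * \<epsilon> * h)"
        using rare h by (intro add_mono mult_left_mono order_refl) auto
      also have "\<dots> = 5 * (\<epsilon> * h\<^sup>2)" by (simp add: power2_eq_square algebra_simps)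
      also have "\<dots> \<le> \<delta> * h\<^sup>2" using e by (simp add: de)
      finally show ?case by (simp add: h_def)
    qed
  qed
qed

text \<open>The limit of the proportion of half-edges in small components.\<close>

definition small_mass :: real where
  "small_mass = (\<Sum>k. u k * \<rho> ^ k)"

lemma small_mass_eq: "small_mass = \<rho> * gen u \<rho>"
proof -
  have "small_mass = (\<Sum>k. \<rho> * (u k * \<rho> ^ (k - 1)))"
    unfolding small_mass_def
  proof (rule suminf_cong)
    fix k show "u k * \<rho> ^ k = \<rho> * (u k * \<rho> ^ (k - 1))" using uv_0(1) by (cases k) auto
  qed
  also have "\<dots> = \<rho> * gen u \<rho>"
    unfolding gen_def using \<rho>_bounds by (intro suminf_mult gen_summable laws)
  finally show ?thesis .
qed

lemma supercritical_lt_1: "supercritical \<Longrightarrow> \<rho> < 1"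
  unfolding supercritical_def using zero_less_one by (meson less_trans)

definition big_set :: "nat \<Rightarrow> nat \<Rightarrow> (nat \<times> nat \<Rightarrow> nat \<times> nat) \<Rightarrow> (nat \<times> nat) set" where
  "big_set n K f = {x \<in> A n. \<not> small n K f x}"

lemma small_weight_one: "small_weight (\<lambda>_. 1) n K f = 1 - real (card (big_set n K f)) / real (card (A n))"
  if "A n \<noteq> {}"
proof -
  have "small_weight (\<lambda>_. 1) n K f = uprob (A n) (small n K f)"
    unfolding small_weight_def using finA[of n] by (simp add: avg_of_bool)
  also have "\<dots> = 1 - uprob (A n) (\<lambda>x. \<not> small n K f x)"
    using uprob_not[OF finA that, of "small n K f"] by simp
  finally show ?thesis by (simp add: uprob_def big_set_def)
qed

text \<open>If no component contained almost all of the more than \<omega> h half-edges outside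
  small components, each of these would be apart from more than \<delta> h others. Markov's
  inequality for the number of such pairs makes this unlikely.\<close>

lemma giant_exists:
  assumes dpos: "\<And>n w. w \<in> {1..N n} \<Longrightarrow> dl n w > 0" and super: supercritical
    and k0: "k0 \<ge> 2" "u k0 > 0" and \<delta>: "\<delta> > 0"
  obtains K0 where "\<And>K. K \<ge> K0 \<Longrightarrow> \<forall>\<^sub>F n in sequentially. uprob (MM n) (\<lambda>f.
    \<not> (\<exists>z\<in>big_set n K f. real (card (big_set n K f - ecomp n f z)) \<le> \<delta> * real (card (A n)))) \<le> \<delta>"
proof -
  have "small_mass < 1"
    using supercritical_lt_1[OF super] \<rho>_bounds gen_le_1[OF laws(1) \<rho>_bounds] gen_nonneg[OF laws(1) \<rho>_bounds]
    by (auto simp: small_mass_eq intro!: mult_left_le order.strict_trans1[OF _ supercritical_lt_1[OF super]])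
  define \<omega> where "\<omega> = min ((1 - small_mass) / 2) (\<delta> / 2)"
  have om: "\<omega> > 0" "\<omega> \<le> (1 - small_mass) / 2" "\<omega> \<le> \<delta> / 2"
  proof -
    show "\<omega> > 0" using \<open>small_mass < 1\<close> \<delta> by (simp add: \<omega>_def)
    show "\<omega> \<le> (1 - small_mass) / 2" unfolding \<omega>_def by (rule min.cobounded1)
    show "\<omega> \<le> \<delta> / 2" unfolding \<omega>_def by (rule min.cobounded2)
  qed
  have om2: "small_mass + 2 * \<omega> \<le> 1" using om(2) by (simp add: field_simps)
  obtain K1 where K1: "\<And>K. K \<ge> K1 \<Longrightarrow> \<forall>\<^sub>F n in sequentially.
    uprob (MM n) (\<lambda>f. \<bar>small_weight (\<lambda>_. 1) n K f - (\<Sum>k. u k * (1 * \<rho> ^ k))\<bar> \<ge> \<omega>) \<le> \<omega>"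
    using small_weight_tendsto[OF supercritical_regular[OF super] om(1), of "\<lambda>_. 1"] by auto
  define \<delta>' where "\<delta>' = \<delta> * \<omega> * (\<delta> / 2)"
  have d': "\<delta>' > 0" using \<delta> om by (simp add: \<delta>'_def)
  obtain K2 where K2: "\<And>K. K \<ge> K2 \<Longrightarrow> \<forall>\<^sub>F n in sequentially.
    avg (MM n) (\<lambda>f. real (card (apart_pairs n K f))) \<le> \<delta>' * (real (card (A n)))\<^sup>2"
    using few_apart_pairs[OF dpos super k0 d'] by blast
  show ?thesis
  proof (rule that[of "max K1 K2"])
    fix K assume "max K1 K2 \<le> K"
    then have K: "K1 \<le> K" "K2 \<le> K" by auto
    show "\<forall>\<^sub>F n in sequentially. uprob (MM n) (\<lambda>f.
      \<not> (\<exists>z\<in>big_set n K f. real (card (big_set n K f - ecomp n f z)) \<le> \<delta> * real (card (A n)))) \<le> \<delta>"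
      using K1[OF K(1)] K2[OF K(2)] eventually_card[of 1]
    proof eventually_elim
      case (elim n)
      define h where "h = real (card (A n))"
      have h: "h > 0" using elim(3) by (simp add: h_def)
      have ne: "A n \<noteq> {}" using elim(3) by auto
      let ?E1 = "\<lambda>f. \<bar>small_weight (\<lambda>_. 1) n K f - (\<Sum>k. u k * (1 * \<rho> ^ k))\<bar> \<ge> \<omega>"
      let ?E2 = "\<lambda>f. real (card (apart_pairs n K f)) \<ge> \<delta> * \<omega> * h\<^sup>2"
      have "uprob (MM n) (\<lambda>f. \<not> (\<exists>z\<in>big_set n K f. real (card (big_set n K f - ecomp n f z)) \<le> \<delta> * real (card (A n))))
        \<le> uprob (MM n) (\<lambda>f. ?E1 f \<or> ?E2 f)"
      proof (rule uprob_mono[OF finM], rule ccontr)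
        fix f assume no: "\<not> (\<exists>z\<in>big_set n K f. real (card (big_set n K f - ecomp n f z)) \<le> \<delta> * real (card (A n)))"
          and "\<not> (?E1 f \<or> ?E2 f)"
        then have E: "small_weight (\<lambda>_. 1) n K f < small_mass + \<omega>" "real (card (apart_pairs n K f)) < \<delta> * \<omega> * h\<^sup>2"
          by (auto simp: small_mass_def abs_less_iff not_le)
        let ?W = "big_set n K f"
        have WA: "?W \<subseteq> A n" by (auto simp: big_set_def)
        have finW: "finite ?W" using WA finA by (rule finite_subset)
        have "1 - real (card ?W) / h < 1 - \<omega>"
          using E(1) om2 unfolding small_weight_one[OF ne] h_def by linarith
        then have w: "\<omega> * h < real (card ?W)" using h by (simp add: field_simps)
        have eq: "apart_pairs n K f = (SIGMA x:?W. ?W - ecomp n f x)"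
        proof -
          have "p \<in> apart_pairs n K f \<longleftrightarrow> p \<in> (SIGMA x:?W. ?W - ecomp n f x)" for p
            using apart_iff[where n = n and x = "fst p" and x' = "snd p" and K = K and f = f, OF dpos]
            by (cases p) (auto simp: apart_pairs_def big_set_def)
          then show ?thesis by blast
        qed
        have "card (apart_pairs n K f) = (\<Sum>x\<in>?W. card (?W - ecomp n f x))"
          unfolding eq using finW by (intro card_SigmaI) auto
        then have "real (card (apart_pairs n K f)) = (\<Sum>x\<in>?W. real (card (?W - ecomp n f x)))" by simp
        also have "\<dots> \<ge> real (card ?W) * (\<delta> * h)"
          using no WA by (intro sum_bounded_below) (force simp: h_def)
        finally have "real (card ?W) * (\<delta> * h) < \<delta> * \<omega> * h\<^sup>2" using E(2) by linarith
        moreover have "\<omega> * h * (\<delta> * h) \<le> real (card ?W) * (\<delta> * h)" using w \<delta> h by (intro mult_right_mono) auto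
        ultimately show False by (simp add: power2_eq_square mult_ac)
      qed
      also have "\<dots> \<le> uprob (MM n) ?E1 + uprob (MM n) ?E2" by (rule uprob_disj_le[OF finM])
      also have "\<dots> \<le> \<delta> / 2 + \<delta> / 2"
      proof (rule add_mono)
        show "uprob (MM n) ?E1 \<le> \<delta> / 2" using elim(1) om(3) by linarith
        have dw: "\<delta> * \<omega> * h\<^sup>2 > 0" using \<delta> om h by simp
        have "uprob (MM n) ?E2 \<le> avg (MM n) (\<lambda>f. real (card (apart_pairs n K f))) / (\<delta> * \<omega> * h\<^sup>2)"
          by (rule uprob_markov[OF finM dw]) simp
        also have "\<dots> \<le> \<delta>' * h\<^sup>2 / (\<delta> * \<omega> * h\<^sup>2)"
          using elim(2) dw by (intro divide_right_mono) (auto simp: h_def)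
        also have "\<dots> = \<delta> / 2" using \<delta> om h by (simp add: \<delta>'_def)
        finally show "uprob (MM n) ?E2 \<le> \<delta> / 2" .
      qed
      finally show ?case by simp
    qed
  qed
qed

end

section \<open>Components of the multigraph\<close>

definition vertices_of :: "('a \<Rightarrow> 'b) \<Rightarrow> ('a \<Rightarrow> 'v) \<Rightarrow> ('b \<Rightarrow> 'w) \<Rightarrow> 'a set \<Rightarrow> ('v + 'w) set" where
  "vertices_of f \<alpha> \<beta> E = Inl ` \<alpha> ` E \<union> Inr ` \<beta> ` f ` E"

context
  fixes N M :: nat and dl dr :: "nat \<Rightarrow> nat" and f :: "nat \<times> nat \<Rightarrow> nat \<times> nat"
  assumes dlp: "\<And>w. w \<in> {1..N} \<Longrightarrow> dl w > 0" and drp: "\<And>a. a \<in> {1..M} \<Longrightarrow> dr a > 0"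
    and f: "f \<in> matchings (half_edges N dl) (half_edges M dr)"
begin

abbreviation (input) "AA \<equiv> half_edges N dl"
abbreviation (input) "GG \<equiv> bcm_graph N M dl f"
abbreviation (input) "SS \<equiv> with_proj (mk_symmetric GG)"
abbreviation (input) "CC x \<equiv> comp_of AA (fst :: nat \<times> nat \<Rightarrow> nat) (fst :: nat \<times> nat \<Rightarrow> nat) f x"
abbreviation (input) "VV \<equiv> vertices_of f (fst :: nat \<times> nat \<Rightarrow> nat) (fst :: nat \<times> nat \<Rightarrow> nat)"

lemma verts_GG: "verts SS = Inl ` {1..N} \<union> Inr ` {1..M}"
  by (simp add: bcm_graph_def)

lemma arcs_ends_SS: "(a, b) \<in> arcs_ends SS \<longleftrightarrow>
    (\<exists>e\<in>AA. (a = Inl (fst e) \<and> b = Inr (fst (f e))) \<or> (a = Inr (fst (f e)) \<and> b = Inl (fst e)))"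
  by (auto simp: arcs_ends_conv parcs_mk_symmetric bcm_graph_def)

lemma ends_in_verts: "e \<in> AA \<Longrightarrow> Inl (fst e) \<in> verts SS" "e \<in> AA \<Longrightarrow> Inr (fst (f e)) \<in> verts SS"
  using matchings_mem[OF f, of e] unfolding verts_GG by (auto simp: half_edges_def)

lemma reach_step: "(a, b) \<in> arcs_ends SS \<Longrightarrow> reachable SS a b"
proof -
  assume ab: "(a, b) \<in> arcs_ends SS"
  then obtain e where e: "e \<in> AA"
    "(a = Inl (fst e) \<and> b = Inr (fst (f e))) \<or> (a = Inr (fst (f e)) \<and> b = Inl (fst e))"
    unfolding arcs_ends_SS by blast
  have "a \<in> verts SS" "b \<in> verts SS" using e(2) ends_in_verts[OF e(1)] by metis+
  then show ?thesis unfolding reachable_def by (intro rtrancl_on_into_rtrancl_on[OF rtrancl_on_refl] ab)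
qed

lemma reach_trans: "reachable SS a b \<Longrightarrow> reachable SS b c \<Longrightarrow> reachable SS a c"
  unfolding reachable_def by (rule rtrancl_on_trans)

lemma reach_left_right: "e \<in> AA \<Longrightarrow> reachable SS (Inl (fst e)) (Inr (fst (f e)))"
  and reach_right_left: "e \<in> AA \<Longrightarrow> reachable SS (Inr (fst (f e))) (Inl (fst e))"
  by (rule reach_step, unfold arcs_ends_SS, blast)+

lemma reach_comp_left:
  assumes "x \<in> AA" "y \<in> CC x"
  shows "reachable SS (Inl (fst x)) (Inl (fst y))"
proof -
  have "(x, y) \<in> (linked AA fst fst f)\<^sup>*" using assms(2) by (simp add: comp_of_eq)
  then show ?thesis
  proof (induction rule: rtrancl_induct)
    case base
    then show ?case unfolding reachable_def using ends_in_verts(1)[OF assms(1)] by (rule rtrancl_on_refl)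
  next
    case (step y z)
    have yz: "y \<in> AA" "z \<in> AA" "fst y = fst z \<or> fst (f y) = fst (f z)" using step(2) by (auto simp: linked_def)
    have "reachable SS (Inl (fst y)) (Inl (fst z)) \<or> fst y = fst z"
      using yz reach_left_right[OF yz(1)] reach_right_left[OF yz(2)] reach_trans by metis
    then show ?case using step(3) reach_trans by auto
  qed
qed

lemma reach_comp:
  assumes "x \<in> AA" "a \<in> VV (CC x)" "b \<in> VV (CC x)"
  shows "reachable SS a b"
proof -
  have sub: "CC x \<subseteq> AA" by (rule comp_of_subset[OF assms(1)])
  have to: "\<exists>y\<in>CC x. reachable SS c (Inl (fst y)) \<and> reachable SS (Inl (fst y)) c" if c: "c \<in> VV (CC x)" for c
  proof -
    obtain y where y: "y \<in> CC x" "c = Inl (fst y) \<or> c = Inr (fst (f y))"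
      using c unfolding vertices_of_def by blast
    have yA: "y \<in> AA" using y sub by auto
    have "reachable SS (Inl (fst y)) (Inl (fst y))" by (rule reach_comp_left[OF yA comp_of_self])
    then show ?thesis using y reach_left_right[OF yA] reach_right_left[OF yA] by blast
  qed
  obtain y where y: "y \<in> CC x" "reachable SS a (Inl (fst y))" using to[OF assms(2)] by blast
  obtain z where z: "z \<in> CC x" "reachable SS (Inl (fst z)) b" using to[OF assms(3)] by blast
  have "z \<in> CC y" using z(1) comp_of_cong[OF y(1)] by simp
  then have "reachable SS (Inl (fst y)) (Inl (fst z))" using y(1) sub by (intro reach_comp_left) auto
  then show ?thesis using y(2) z(2) reach_trans by blast
qed

lemma reach_closed:
  assumes "x \<in> AA" "reachable SS a b" "a \<in> VV (CC x)"
  shows "b \<in> VV (CC x)"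
proof -
  have sub: "CC x \<subseteq> AA" by (rule comp_of_subset[OF assms(1)])
  show ?thesis
    using assms(2) unfolding reachable_def
  proof (induction rule: rtrancl_on_induct)
    case base show ?case by (rule assms(3))
  next
    case (step y z)
    obtain e where e: "e \<in> AA" "(y = Inl (fst e) \<and> z = Inr (fst (f e))) \<or> (y = Inr (fst (f e)) \<and> z = Inl (fst e))"
      using step(2) unfolding arcs_ends_SS by blast
    have "\<exists>d\<in>CC x. fst d = fst e \<or> fst (f d) = fst (f e)" using step e by (auto simp: vertices_of_def)
    then obtain d where d: "d \<in> CC x" "fst d = fst e \<or> fst (f d) = fst (f e)" by blast
    have "e \<in> CC x" by (rule explored_link[OF d(1) _ e(1) d(2)]) (use d(1) sub in auto)
    then show ?case using e(2) by (auto simp: vertices_of_def)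
  qed
qed

text \<open>All degrees are positive, so each vertex is incident to an edge and there are no
  isolated vertices to be treated separately.\<close>

lemma components_bcm_graph: "components GG = (\<lambda>x. VV (CC x)) ` AA"
proof
  show "(\<lambda>x. VV (CC x)) ` AA \<subseteq> components GG"
  proof
    fix S assume "S \<in> (\<lambda>x. VV (CC x)) ` AA"
    then obtain x where x: "x \<in> AA" "S = VV (CC x)" by auto
    have "S \<noteq> {}" using comp_of_self[of x AA fst fst f] unfolding x(2) vertices_of_def by blast
    then show "S \<in> components GG"
      unfolding components_def pre_digraph.sccs_verts_def using reach_comp[OF x(1)] reach_closed[OF x(1)] x(2) by blast
  qed
  show "components GG \<subseteq> (\<lambda>x. VV (CC x)) ` AA"
  proof
    fix S assume "S \<in> components GG"
    then have S: "S \<noteq> {}" "\<And>a b. a \<in> S \<Longrightarrow> b \<in> S \<Longrightarrow> reachable SS a b"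
      "\<And>a b. a \<in> S \<Longrightarrow> b \<notin> S \<Longrightarrow> \<not> reachable SS a b \<or> \<not> reachable SS b a"
      unfolding components_def pre_digraph.sccs_verts_def by blast+
    obtain a where a: "a \<in> S" using S(1) by auto
    have "a \<in> verts SS" using S(2)[OF a a] unfolding reachable_def by (rule in_rtrancl_on_in_F)
    then have "\<exists>x\<in>AA. a \<in> VV {x}"
      unfolding verts_GG
    proof
      assume "a \<in> Inl ` {1..N}"
      then obtain w where "a = Inl w" "w \<in> {1..N}" by auto
      then show ?thesis using dlp[of w] by (intro bexI[of _ "(w, 1)"]) (auto simp: vertices_of_def half_edges_def)
    next
      assume "a \<in> Inr ` {1..M}"
      then obtain w where w: "a = Inr w" "w \<in> {1..M}" by auto
      then have "(w, 1) \<in> f ` AA" using drp[of w] matchings_image[OF f] by (auto simp: half_edges_def)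
      then obtain x where "x \<in> AA" "f x = (w, 1)" by force
      then show ?thesis using w by (intro bexI[of _ x]) (auto simp: vertices_of_def)
    qed
    then obtain x where x: "x \<in> AA" "a \<in> VV {x}" by auto
    have ax: "a \<in> VV (CC x)" using x(2) comp_of_self[of x AA fst fst f] by (auto simp: vertices_of_def)
    have "S = VV (CC x)"
    proof
      show "S \<subseteq> VV (CC x)" using S(2)[OF a] reach_closed[OF x(1) _ ax] by blast
      show "VV (CC x) \<subseteq> S" using S(3)[OF a] reach_comp[OF x(1) ax] reach_comp[OF x(1) _ ax] by blast
    qed
    then show "S \<in> (\<lambda>x. VV (CC x)) ` AA" using x(1) by blast
  qed
qed

lemma component_edges_bcm_graph:
  assumes "x \<in> AA"
  shows "component_edges GG (VV (CC x)) = CC x"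
proof -
  have sub: "CC x \<subseteq> AA" by (rule comp_of_subset[OF assms])
  have "e \<in> CC x" if e: "e \<in> AA" "Inl (fst e) \<in> VV (CC x)" for e
  proof -
    obtain d where d: "d \<in> CC x" "fst d = fst e" using e(2) by (auto simp: vertices_of_def)
    show ?thesis by (rule explored_link[OF d(1) _ e(1)]) (use d sub in auto)
  qed
  then show ?thesis
    using sub unfolding component_edges_def induce_subgraph_def
    by (auto simp: bcm_graph_def vertices_of_def)
qed

lemma left_part_vertices:
  assumes "x \<in> AA"
  shows "VV (CC x) \<inter> left_part N = Inl ` fst ` CC x"
    and "VV (CC x) \<inter> left_part_deg N dl k = Inl ` {w \<in> fst ` CC x. dl w = k}"
  using comp_of_subset[OF assms, of fst fst f]
  by (auto simp: vertices_of_def left_part_def left_part_deg_def half_edges_def)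

lemma card_vertices_le: "card (VV (CC x)) \<le> 2 * card (CC x)" if "x \<in> AA"
proof -
  have fin: "finite (CC x)"
    using comp_of_subset[OF that, of fst fst f] by (rule finite_subset) (auto simp: half_edges_def)
  have "card (VV (CC x)) \<le> card (Inl ` fst ` CC x :: (nat + nat) set) + card (Inr ` fst ` f ` CC x :: (nat + nat) set)"
    unfolding vertices_of_def by (rule card_Un_le)
  also have "\<dots> \<le> card (CC x) + card (CC x)"
    using fin by (intro add_mono order_trans[OF card_image_le] finite_imageI card_image_le order_refl) auto
  finally show ?thesis by simp
qed

end

section \<open>From half-edges to vertices\<close>

locale bcm_model = bcm_sequence N M dl dr u v
  for N M :: "nat \<Rightarrow> nat" and dl dr :: "nat \<Rightarrow> nat \<Rightarrow> nat" and u v :: "nat \<Rightarrow> real" +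
  fixes \<mu> :: real
  assumes N_pos: "\<And>n. N n > 0" and N_lim: "filterlim N at_top sequentially"
    and dl_pos: "\<And>n w. w \<in> {1..N n} \<Longrightarrow> dl n w > 0" and dr_pos: "\<And>n a. a \<in> {1..M n} \<Longrightarrow> dr n a > 0"
    and mean_lim: "(\<lambda>n. real (card (A n)) / real (N n)) \<longlonglongrightarrow> \<mu>"
begin

abbreviation "bgraph n f \<equiv> bcm_graph (N n) (M n) (dl n) f"
abbreviation "WW f \<equiv> vertices_of f (fst :: nat \<times> nat \<Rightarrow> nat) (fst :: nat \<times> nat \<Rightarrow> nat)"
abbreviation "ratio n \<equiv> real (card (A n)) / real (N n)"

lemma A_nonempty: "A n \<noteq> {}"
proof -
  have "(1, 1) \<in> A n" using N_pos[of n] dl_pos[of 1 n] by (auto simp: half_edges_def)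
  then show ?thesis by blast
qed

lemma card_A_pos: "real (card (A n)) > 0"
  using A_nonempty[of n] finA[of n] by (simp add: card_gt_0_iff)

lemma first_half_edge: "w \<in> {1..N n} \<Longrightarrow> (w, 1) \<in> A n"
  using dl_pos[of w n] by (auto simp: half_edges_def)

lemma eventually_N: "\<forall>\<^sub>F n in sequentially. c \<le> real (N n)"
proof -
  have "\<forall>\<^sub>F n in sequentially. nat \<lceil>c\<rceil> \<le> N n" using N_lim unfolding filterlim_at_top by blast
  then show ?thesis by eventually_elim (simp add: nat_ceiling_le_eq)
qed

lemma ratio_pos: "ratio n > 0"
  using card_A_pos[of n] N_pos[of n] by simp

lemma mean_nonneg: "\<mu> \<ge> 0"
  by (rule LIMSEQ_le_const[OF mean_lim]) (auto intro: less_imp_le[OF ratio_pos])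

lemma eventually_ratio: "\<forall>\<^sub>F n in sequentially. ratio n \<le> \<mu> + 1"
  using order_tendstoD(2)[OF mean_lim, of "\<mu> + 1"] by (auto elim!: eventually_mono)

lemma small_comp_cong: "y \<in> ecomp n f x \<Longrightarrow> small n K f y = small n K f x"
  using comp_of_cong[of y "A n" fst fst f x] by (simp add: small_def)

lemma small_vertex: "x \<in> A n \<Longrightarrow> small n K f x = small n K f (fst x, 1)"
proof -
  assume x: "x \<in> A n"
  then have "(fst x, 1) \<in> A n" by (intro first_half_edge) (auto simp: half_edges_def)
  then have "ecomp n f x = ecomp n f (fst x, 1)" using x by (intro ecomp_vertex) auto
  then show ?thesis by (simp add: small_def)
qed

lemma ecomp_big: "z \<in> big_set n K f \<Longrightarrow> ecomp n f z \<subseteq> big_set n K f"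
proof
  fix y assume z: "z \<in> big_set n K f" and y: "y \<in> ecomp n f z"
  have "y \<in> A n" using comp_of_subset[of z "A n" fst fst f] y z by (auto simp: big_set_def)
  then show "y \<in> big_set n K f" using small_comp_cong[OF y, of K] z by (simp add: big_set_def)
qed

lemma sum_vertices:
  fixes g :: "nat \<Rightarrow> real"
  shows "(\<Sum>x\<in>A n. 1 / real (dl n (fst x)) * g (fst x)) = (\<Sum>w\<in>{1..N n}. g w)"
proof -
  have "(\<Sum>x\<in>A n. 1 / real (dl n (fst x)) * g (fst x))
      = (\<Sum>w\<in>{1..N n}. \<Sum>i\<in>{1..dl n w}. 1 / real (dl n w) * g w)"
    unfolding half_edges_def by (subst sum.Sigma) (auto simp: split_def)
  also have "\<dots> = (\<Sum>w\<in>{1..N n}. g w)"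
    by (rule sum.cong) (use dl_pos[of _ n] in auto)
  finally show ?thesis .
qed

text \<open>A vertex of degree k is represented by k half-edges, so this weight counts the vertices
  whose degree satisfies P.\<close>

definition inv_weight :: "(nat \<Rightarrow> bool) \<Rightarrow> nat \<Rightarrow> real" where
  "inv_weight P k = (if k = 0 then 0 else of_bool (P k) / real k)"

lemma inv_weight_bounds: "0 \<le> inv_weight P k" "inv_weight P k \<le> 1"
  by (auto simp: inv_weight_def)

lemma card_small_vertices:
  "real (card {w \<in> {1..N n}. P (dl n w) \<and> small n K f (w, 1)})
    = real (card (A n)) * small_weight (inv_weight P) n K f"
proof -
  have "real (card (A n)) * small_weight (inv_weight P) n K f
      = (\<Sum>x\<in>A n. inv_weight P (card (fib (A n) fst x)) * of_bool (small n K f x))"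
    using card_A_pos[of n] by (simp add: small_weight_def avg_def)
  also have "\<dots> = (\<Sum>x\<in>A n. 1 / real (dl n (fst x)) * of_bool (P (dl n (fst x)) \<and> small n K f (fst x, 1)))"
  proof (rule sum.cong)
    fix x assume x: "x \<in> A n"
    have "dl n (fst x) > 0" using x dl_pos[of "fst x" n] by (auto simp: half_edges_def)
    then show "inv_weight P (card (fib (A n) fst x)) * of_bool (small n K f x)
        = 1 / real (dl n (fst x)) * of_bool (P (dl n (fst x)) \<and> small n K f (fst x, 1))"
      unfolding card_fib_A[OF x] small_vertex[OF x] by (simp add: inv_weight_def)
  qed simp
  also have "\<dots> = (\<Sum>w\<in>{1..N n}. of_bool (P (dl n w) \<and> small n K f (w, 1)))"
    by (rule sum_vertices)
  also have "\<dots> = real (card {w \<in> {1..N n}. P (dl n w) \<and> small n K f (w, 1)})"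
    by (simp add: of_bool_def sum.If_cases Int_def)
  finally show ?thesis by simp
qed

text \<open>A left vertex outside small components that the giant component misses is charged to its
  first half-edge, which is one of the few half-edges in
  \<open>big_set n K f - ecomp n f z\<close>.\<close>

lemma card_giant_vertices:
  assumes z: "z \<in> big_set n K f" and near: "real (card (big_set n K f - ecomp n f z)) \<le> \<delta> * real (card (A n))"
  shows "\<bar>real (card {w \<in> fst ` ecomp n f z. P (dl n w)})
      - (real (card {w \<in> {1..N n}. P (dl n w)}) - real (card (A n)) * small_weight (inv_weight P) n K f)\<bar> \<le> \<delta> * real (card (A n))"
proof -
  define V where "V = real (card {w \<in> {1..N n}. P (dl n w)})"
  let ?X = "{w \<in> fst ` ecomp n f z. P (dl n w)}"
  let ?Y = "{w \<in> {1..N n}. P (dl n w) \<and> \<not> small n K f (w, 1)}"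
  let ?S = "{w \<in> {1..N n}. P (dl n w) \<and> small n K f (w, 1)}"
  have zA: "z \<in> A n" using z by (auto simp: big_set_def)
  have "{w \<in> {1..N n}. P (dl n w)} = ?Y \<union> ?S" by auto
  then have "card {w \<in> {1..N n}. P (dl n w)} = card ?Y + card ?S"
    by (simp only:) (rule card_Un_disjoint, auto)
  then have Y: "real (card ?Y) = V - real (card (A n)) * small_weight (inv_weight P) n K f"
    using card_small_vertices[of n P K f] by (simp add: V_def)
  have XY: "?X \<subseteq> ?Y"
  proof
    fix w assume "w \<in> ?X"
    then obtain x where x: "x \<in> ecomp n f z" "w = fst x" "P (dl n w)" by auto
    have xb: "x \<in> A n" "\<not> small n K f x" using ecomp_big[OF z] x(1) by (auto simp: big_set_def)
    then show "w \<in> ?Y" using x small_vertex[OF xb(1)] by (auto simp: half_edges_def)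
  qed
  have "(\<lambda>w. (w, 1::nat)) ` (?Y - ?X) \<subseteq> big_set n K f - ecomp n f z"
  proof
    fix y assume "y \<in> (\<lambda>w. (w, 1::nat)) ` (?Y - ?X)"
    then obtain w where w: "y = (w, 1)" "w \<in> ?Y" "w \<notin> ?X" by auto
    have "(w, 1) \<notin> ecomp n f z" using w(2,3) by (auto intro: image_eqI[of w fst "(w, 1)"])
    then show "y \<in> big_set n K f - ecomp n f z" using w first_half_edge[of w n] by (auto simp: big_set_def)
  qed
  moreover have "finite (big_set n K f - ecomp n f z)" using finA[of n] by (simp add: big_set_def)
  ultimately have "card ((\<lambda>w. (w, 1::nat)) ` (?Y - ?X)) \<le> card (big_set n K f - ecomp n f z)" by (intro card_mono)
  moreover have "card ((\<lambda>w. (w, 1::nat)) ` (?Y - ?X)) = card (?Y - ?X)" by (intro card_image) (auto simp: inj_on_def)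
  moreover have "card (?Y - ?X) = card ?Y - card ?X"
    using XY finite_subset[OF XY] by (intro card_Diff_subset) auto
  moreover have "card ?X \<le> card ?Y" using XY by (intro card_mono) auto
  ultimately show ?thesis using Y near unfolding V_def by linarith
qed

lemma card_giant_edges:
  assumes z: "z \<in> big_set n K f" and near: "real (card (big_set n K f - ecomp n f z)) \<le> \<delta> * real (card (A n))"
  shows "\<bar>real (card (ecomp n f z)) - real (card (A n)) * (1 - small_weight (\<lambda>_. 1) n K f)\<bar> \<le> \<delta> * real (card (A n))"
proof -
  have W: "real (card (A n)) * (1 - small_weight (\<lambda>_. 1) n K f) = real (card (big_set n K f))"
    using card_A_pos[of n] by (simp add: small_weight_one[OF A_nonempty])
  have fin: "finite (big_set n K f)" using finA[of n] by (simp add: big_set_def)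
  have sub: "ecomp n f z \<subseteq> big_set n K f" by (rule ecomp_big[OF z])
  have "card (big_set n K f - ecomp n f z) = card (big_set n K f) - card (ecomp n f z)"
    using sub finite_subset[OF sub fin] by (intro card_Diff_subset) auto
  moreover have "card (ecomp n f z) \<le> card (big_set n K f)" using sub fin by (intro card_mono)
  ultimately show ?thesis using W near by linarith
qed

lemma card_other_component:
  assumes z: "z \<in> big_set n K f" and near: "real (card (big_set n K f - ecomp n f z)) \<le> \<delta> * real (card (A n))"
    and f: "f \<in> MM n" and x: "x \<in> A n" "ecomp n f x \<noteq> ecomp n f z" and \<delta>: "\<delta> \<ge> 0"
  shows "real (card (WW f (ecomp n f x))) \<le> 2 * real K + 2 * \<delta> * real (card (A n))"
proof -
  have "real (card (ecomp n f x)) \<le> real K + \<delta> * real (card (A n))"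
  proof (cases "small n K f x")
    case True
    then have "real (card (ecomp n f x)) \<le> real K" by (simp add: small_def)
    then show ?thesis using \<delta> by (simp add: add_increasing2)
  next
    case False
    then have "ecomp n f x \<subseteq> big_set n K f" using x(1) by (intro ecomp_big) (simp add: big_set_def)
    then have "ecomp n f x \<subseteq> big_set n K f - ecomp n f z" using comp_of_disjoint[OF x(2)] by blast
    then have "card (ecomp n f x) \<le> card (big_set n K f - ecomp n f z)"
      using finA[of n] by (intro card_mono) (auto simp: big_set_def)
    then show ?thesis using near by linarith
  qed
  then show ?thesis using card_vertices_le[OF dl_pos dr_pos f x(1)] by linarith
qed

lemma components_graph: "f \<in> MM n \<Longrightarrow> components (bgraph n f) = (\<lambda>x. WW f (ecomp n f x)) ` A n"
  by (rule components_bcm_graph[of "N n" "dl n" "M n" "dr n"]) (use dl_pos[of _ n] dr_pos[of _ n] in auto)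

text \<open>Multiplied by the mean degree, the limiting proportion of left vertices that lie in
  small components and whose degree satisfies P.\<close>

definition small_vertex_mass :: "(nat \<Rightarrow> bool) \<Rightarrow> real" where
  "small_vertex_mass P = (\<Sum>k. u k * (inv_weight P k * \<rho> ^ k))"

text \<open>The typical event. The third condition is the instance of the fourth for the trivial
  property, which identifies the largest component by its number of vertices.\<close>

definition good :: "(nat \<Rightarrow> bool) \<Rightarrow> real \<Rightarrow> nat \<Rightarrow> nat \<Rightarrow> (nat \<times> nat \<Rightarrow> nat \<times> nat) \<Rightarrow> bool" where
  "good P \<delta> K n f \<longleftrightarrow> (\<exists>z\<in>big_set n K f. real (card (big_set n K f - ecomp n f z)) \<le> \<delta> * real (card (A n))) \<and>
    \<bar>small_weight (\<lambda>_. 1) n K f - small_mass\<bar> < \<delta> \<and>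
    \<bar>small_weight (inv_weight (\<lambda>_. True)) n K f - small_vertex_mass (\<lambda>_. True)\<bar> < \<delta> \<and>
    \<bar>small_weight (inv_weight P) n K f - small_vertex_mass P\<bar> < \<delta>"

lemma good_likely:
  assumes super: supercritical and k0: "k0 \<ge> 2" "u k0 > 0" and \<delta>: "\<delta> > 0"
  obtains K where "\<forall>\<^sub>F n in sequentially. uprob (MM n) (\<lambda>f. \<not> good P \<delta> K n f) \<le> \<delta>"
proof -
  define \<epsilon> where "\<epsilon> = \<delta> / 4"
  have e: "\<epsilon> > 0" and de: "\<delta> = 4 * \<epsilon>" using \<delta> by (auto simp: \<epsilon>_def)
  note reg = supercritical_regular[OF super]
  obtain K1 where K1: "\<And>K. K \<ge> K1 \<Longrightarrow> \<forall>\<^sub>F n in sequentially. uprob (MM n) (\<lambda>f.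
    \<not> (\<exists>z\<in>big_set n K f. real (card (big_set n K f - ecomp n f z)) \<le> \<epsilon> * real (card (A n)))) \<le> \<epsilon>"
    by (rule giant_exists[OF dl_pos super k0 e], assumption) (rule that, blast)
  obtain K2 where K2: "\<And>K. K \<ge> K2 \<Longrightarrow> \<forall>\<^sub>F n in sequentially.
    uprob (MM n) (\<lambda>f. \<bar>small_weight (\<lambda>_. 1) n K f - (\<Sum>k. u k * (1 * \<rho> ^ k))\<bar> \<ge> \<epsilon>) \<le> \<epsilon>"
    using small_weight_tendsto[OF reg e, of "\<lambda>_. 1"] by auto
  obtain K3 where K3: "\<And>K. K \<ge> K3 \<Longrightarrow> \<forall>\<^sub>F n in sequentially.
    uprob (MM n) (\<lambda>f. \<bar>small_weight (inv_weight (\<lambda>_. True)) n K f - small_vertex_mass (\<lambda>_. True)\<bar> \<ge> \<epsilon>) \<le> \<epsilon>"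
    using small_weight_tendsto[OF reg e, of "inv_weight (\<lambda>_. True)", OF inv_weight_bounds] unfolding small_vertex_mass_def by blast
  obtain K4 where K4: "\<And>K. K \<ge> K4 \<Longrightarrow> \<forall>\<^sub>F n in sequentially.
    uprob (MM n) (\<lambda>f. \<bar>small_weight (inv_weight P) n K f - small_vertex_mass P\<bar> \<ge> \<epsilon>) \<le> \<epsilon>"
    using small_weight_tendsto[OF reg e, of "inv_weight P", OF inv_weight_bounds] unfolding small_vertex_mass_def by blast
  define K where "K = max (max K1 K2) (max K3 K4)"
  have K: "K1 \<le> K" "K2 \<le> K" "K3 \<le> K" "K4 \<le> K" by (auto simp: K_def)
  show ?thesis
  proof (rule that[of K])
    show "\<forall>\<^sub>F n in sequentially. uprob (MM n) (\<lambda>f. \<not> good P \<delta> K n f) \<le> \<delta>"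
      using K1[OF K(1)] K2[OF K(2)] K3[OF K(3)] K4[OF K(4)]
    proof eventually_elim
      case (elim n)
      let ?E1 = "\<lambda>f. \<not> (\<exists>z\<in>big_set n K f. real (card (big_set n K f - ecomp n f z)) \<le> \<epsilon> * real (card (A n)))"
      let ?E2 = "\<lambda>f. \<bar>small_weight (\<lambda>_. 1) n K f - (\<Sum>k. u k * (1 * \<rho> ^ k))\<bar> \<ge> \<epsilon>"
      let ?E3 = "\<lambda>f. \<bar>small_weight (inv_weight (\<lambda>_. True)) n K f - small_vertex_mass (\<lambda>_. True)\<bar> \<ge> \<epsilon>"
      let ?E4 = "\<lambda>f. \<bar>small_weight (inv_weight P) n K f - small_vertex_mass P\<bar> \<ge> \<epsilon>"
      have "uprob (MM n) (\<lambda>f. \<not> good P \<delta> K n f) \<le> uprob (MM n) (\<lambda>f. (?E1 f \<or> ?E2 f) \<or> (?E3 f \<or> ?E4 f))"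
      proof (rule uprob_mono[OF finM], rule ccontr)
        fix f assume ng: "\<not> good P \<delta> K n f" and "\<not> ((?E1 f \<or> ?E2 f) \<or> (?E3 f \<or> ?E4 f))"
        then have E: "\<not> ?E1 f" "\<not> ?E2 f" "\<not> ?E3 f" "\<not> ?E4 f" by blast+
        obtain z where z: "z \<in> big_set n K f" "real (card (big_set n K f - ecomp n f z)) \<le> \<epsilon> * real (card (A n))"
          using E(1) by blast
        have "\<epsilon> * real (card (A n)) \<le> \<delta> * real (card (A n))" using e unfolding de by (intro mult_right_mono) auto
        then have "real (card (big_set n K f - ecomp n f z)) \<le> \<delta> * real (card (A n))" using z(2) by linarith
        then have "good P \<delta> K n f"
          unfolding good_def using E(2-4) z(1) e by (auto simp: de small_mass_def not_le)
        then show False using ng by contradiction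
      qed
      also have "\<dots> \<le> uprob (MM n) (\<lambda>f. ?E1 f \<or> ?E2 f) + uprob (MM n) (\<lambda>f. ?E3 f \<or> ?E4 f)"
        by (rule uprob_disj_le[OF finM])
      also have "\<dots> \<le> (uprob (MM n) ?E1 + uprob (MM n) ?E2) + (uprob (MM n) ?E3 + uprob (MM n) ?E4)"
        by (intro add_mono uprob_disj_le[OF finM])
      also have "\<dots> \<le> (\<epsilon> + \<epsilon>) + (\<epsilon> + \<epsilon>)" using elim by (intro add_mono)
      finally show ?case by (simp add: de)
    qed
  qed
qed

text \<open>The component with almost all edges outside small components has too many left vertices
  to be beaten: every other component has at most \<open>K + \<delta> * h\<close> edges, hence at
  most twice as many vertices.\<close>

lemma good_largest:
  assumes g: "good P \<delta> K n f" and f: "f \<in> MM n" and \<delta>: "\<delta> > 0"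
    and big: "2 * real K + 4 * \<delta> * real (card (A n)) < real (N n) - real (card (A n)) * small_vertex_mass (\<lambda>_. True)"
    and C1: "largest_component (bgraph n f) C1"
  obtains z where "z \<in> big_set n K f" "real (card (big_set n K f - ecomp n f z)) \<le> \<delta> * real (card (A n))"
    "C1 = WW f (ecomp n f z)"
    "\<And>C2. second_largest_component (bgraph n f) C1 C2 \<Longrightarrow> real (card C2) \<le> 2 * real K + 2 * \<delta> * real (card (A n))"
proof -
  define h where "h = real (card (A n))"
  have h: "h > 0" using card_A_pos by (simp add: h_def)
  obtain z where z: "z \<in> big_set n K f" "real (card (big_set n K f - ecomp n f z)) \<le> \<delta> * h"
    using g by (auto simp: good_def h_def)
  have zA: "z \<in> A n" using z by (auto simp: big_set_def)
  note comps = components_graph[OF f]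
  obtain x where x: "x \<in> A n" "C1 = WW f (ecomp n f x)"
    using C1 unfolding largest_component_def by (auto simp: comps)
  have allw: "{w \<in> {1..N n}. True} = {1..N n}" "{w \<in> fst ` ecomp n f z. True} = fst ` ecomp n f z" by auto
  have "\<bar>real (card (fst ` ecomp n f z)) - (real (N n) - h * small_weight (inv_weight (\<lambda>_. True)) n K f)\<bar> \<le> \<delta> * h"
    using card_giant_vertices[OF z(1) z(2)[unfolded h_def], of "\<lambda>_. True"] unfolding allw by (simp add: h_def)
  moreover have "h * small_weight (inv_weight (\<lambda>_. True)) n K f \<le> h * (small_vertex_mass (\<lambda>_. True) + \<delta>)"
    using g h by (intro mult_left_mono) (auto simp: good_def)
  ultimately have "2 * real K + 2 * \<delta> * h < real (card (fst ` ecomp n f z))"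
    using big by (simp add: h_def[symmetric] algebra_simps abs_le_iff)
  also have "card (fst ` ecomp n f z) = card (WW f (ecomp n f z) \<inter> left_part (N n))"
    by (subst left_part_vertices(1)[OF dl_pos dr_pos f zA]) (auto simp: card_image inj_on_def)
  also have "card (WW f (ecomp n f z) \<inter> left_part (N n)) \<le> card (WW f (ecomp n f z))"
  proof (rule card_mono)
    have "finite (ecomp n f z)" using zA finA[of n] by (intro finite_explored) auto
    then show "finite (WW f (ecomp n f z))" by (simp add: vertices_of_def)
  qed simp
  also have "card (WW f (ecomp n f z)) \<le> card C1"
    using C1 zA unfolding largest_component_def by (auto simp: comps)
  finally have lt: "2 * real K + 2 * \<delta> * h < real (card C1)" by simp
  have other: "real (card (WW f (ecomp n f y))) \<le> 2 * real K + 2 * \<delta> * h" if "y \<in> A n" "ecomp n f y \<noteq> ecomp n f z" for y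
    using card_other_component[OF z(1) z(2)[unfolded h_def] f that] \<delta> by (simp add: h_def)
  have xz: "ecomp n f x = ecomp n f z" using other[OF x(1)] lt x(2) by fastforce
  show ?thesis
  proof (rule that[OF z(1)])
    show "real (card (big_set n K f - ecomp n f z)) \<le> \<delta> * real (card (A n))" using z(2) by (simp add: h_def)
    show C1z: "C1 = WW f (ecomp n f z)" using x(2) xz by simp
    fix C2 assume C2: "second_largest_component (bgraph n f) C1 C2"
    show "real (card C2) \<le> 2 * real K + 2 * \<delta> * real (card (A n))"
    proof (cases "components (bgraph n f) - {C1} = {}")
      case True
      then have "C2 = {}" using C2 by (simp add: second_largest_component_def)
      then show ?thesis using \<delta> by simp
    next
      case False
      then have "C2 \<in> components (bgraph n f) - {C1}" using C2 by (simp add: second_largest_component_def)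
      then obtain y where y: "y \<in> A n" "C2 = WW f (ecomp n f y)" "C2 \<noteq> C1" by (auto simp: comps)
      then have "ecomp n f y \<noteq> ecomp n f z" using C1z by auto
      then show ?thesis using other[OF y(1)] y(2) by (simp add: h_def)
    qed
  qed
qed

subsection \<open>Convergence in probability\<close>

text \<open>The exceptional event has probability at most \<delta>, which may be taken as small as
  \<epsilon> and the desired bound for the probability require.\<close>

lemma in_prob_of_good:
  assumes super: supercritical and k0: "k0 \<ge> 2" "u k0 > 0"
    and \<delta>0: "\<delta>0 > 0" and C: "C \<ge> 0"
    and approx: "\<And>\<delta> K. 0 < \<delta> \<Longrightarrow> \<delta> < \<delta>0 \<Longrightarrow> \<forall>\<^sub>F n in sequentially. \<forall>f\<in>MM n. good P \<delta> K n f \<longrightarrow> \<bar>X n f - b n\<bar> \<le> C * \<delta>"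
    and b: "b \<longlonglongrightarrow> c" and \<epsilon>: "\<epsilon> > 0"
  shows "(\<lambda>n. uprob (MM n) (\<lambda>f. \<bar>X n f - c\<bar> > \<epsilon>)) \<longlonglongrightarrow> 0"
proof (rule LIMSEQ_I)
  fix e :: real assume e: "e > 0"
  define \<delta> where "\<delta> = min (min (\<delta>0 / 2) (e / 2)) (\<epsilon> / (2 * (C + 1)))"
  have d: "\<delta> > 0" using \<delta>0 e \<epsilon> C by (simp add: \<delta>_def)
  have d3: "\<delta> \<le> \<epsilon> / (2 * (C + 1))" unfolding \<delta>_def by (rule min.cobounded2)
  have "\<delta> \<le> \<delta>0 / 2" "\<delta> \<le> e / 2"
    unfolding \<delta>_def by (rule min.coboundedI1, (rule min.cobounded1 min.cobounded2))+
  then have d1: "\<delta> < \<delta>0" and d2: "\<delta> < e" using \<delta>0 e by (auto intro: le_less_trans)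
  have Cd: "C * \<delta> \<le> \<epsilon> / 2"
  proof -
    have "C * \<delta> \<le> (C + 1) * (\<epsilon> / (2 * (C + 1)))" using C d d3 by (intro mult_mono) auto
    also have "\<dots> = \<epsilon> / 2"
    proof -
      have "C + 1 \<noteq> 0" using C by linarith
      then show ?thesis using mult_divide_mult_cancel_left[of "C + 1" \<epsilon> 2] by (simp add: mult.commute)
    qed
    finally show ?thesis .
  qed
  obtain K where K: "\<forall>\<^sub>F n in sequentially. uprob (MM n) (\<lambda>f. \<not> good P \<delta> K n f) \<le> \<delta>"
    using good_likely[OF super k0 d] by blast
  have e2: "\<epsilon> / 2 > 0" using \<epsilon> by simp
  have "\<forall>\<^sub>F n in sequentially. norm (uprob (MM n) (\<lambda>f. \<bar>X n f - c\<bar> > \<epsilon>) - 0) < e"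
    using K approx[OF d d1, of K] tendstoD[OF b e2]
  proof eventually_elim
    case (elim n)
    have "uprob (MM n) (\<lambda>f. \<bar>X n f - c\<bar> > \<epsilon>) \<le> uprob (MM n) (\<lambda>f. \<not> good P \<delta> K n f)"
    proof (rule uprob_mono[OF finM])
      fix f assume f: "f \<in> MM n" "\<bar>X n f - c\<bar> > \<epsilon>"
      show "\<not> good P \<delta> K n f"
      proof
        assume "good P \<delta> K n f"
        then have "\<bar>X n f - b n\<bar> \<le> \<epsilon> / 2" using elim(2) f(1) Cd by fastforce
        moreover have "\<bar>b n - c\<bar> < \<epsilon> / 2" using elim(3) by (simp add: dist_real_def)
        ultimately show False using f(2) by linarith
      qed
    qed
    then have "uprob (MM n) (\<lambda>f. \<bar>X n f - c\<bar> > \<epsilon>) < e" using elim(1) d2 by linarith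
    then show ?case by simp
  qed
  then show "\<exists>no. \<forall>n\<ge>no. norm (uprob (MM n) (\<lambda>f. \<bar>X n f - c\<bar> > \<epsilon>) - 0) < e"
    by (simp add: eventually_sequentially)
qed

context
  fixes C1 :: "nat \<Rightarrow> bip_multigraph \<Rightarrow> (nat + nat) set" and C2 :: "nat \<Rightarrow> bip_multigraph \<Rightarrow> (nat + nat) set" and k0
  assumes super: supercritical and k0: "k0 \<ge> 2" "u k0 > 0"
    and mass: "\<mu> * small_vertex_mass (\<lambda>_. True) < 1"
    and C1: "\<And>n f. f \<in> MM n \<Longrightarrow> largest_component (bgraph n f) (C1 n (bgraph n f))"
    and C2: "\<And>n f. f \<in> MM n \<Longrightarrow> second_largest_component (bgraph n f) (C1 n (bgraph n f)) (C2 n (bgraph n f))"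
begin

text \<open>The limiting proportion of left vertices in the giant component, and a bound on \<delta>
  for which the giant component is recognizably larger than all others.\<close>

definition "gap = 1 - \<mu> * small_vertex_mass (\<lambda>_. True)"

definition "\<delta>max = gap / (16 * (\<mu> + 1))"

lemma gap_pos: "gap > 0" "\<delta>max > 0"
  using mass mean_nonneg by (auto simp: gap_def \<delta>max_def)

text \<open>Each of the two terms on the left is eventually below a quarter of
  \<open>gap * N n\<close>, while the right-hand side exceeds three quarters of it.\<close>

lemma eventually_big_enough:
  assumes \<delta>: "0 < \<delta>" "\<delta> < \<delta>max"
  shows "\<forall>\<^sub>F n in sequentially. 2 * real K + 4 * \<delta> * real (card (A n))
    < real (N n) - real (card (A n)) * small_vertex_mass (\<lambda>_. True)"
proof -
  have "(\<lambda>n. 1 - ratio n * small_vertex_mass (\<lambda>_. True)) \<longlonglongrightarrow> gap"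
    unfolding gap_def by (intro tendsto_intros mean_lim)
  then have "\<forall>\<^sub>F n in sequentially. 1 - ratio n * small_vertex_mass (\<lambda>_. True) > 3 * gap / 4"
    using gap_pos by (intro order_tendstoD) auto
  then show ?thesis using eventually_ratio eventually_N[of "8 * real K / gap + 1"]
  proof eventually_elim
    case (elim n)
    have Np: "real (N n) > 0" using N_pos by simp
    have "\<delta> * (16 * (\<mu> + 1)) \<le> gap" using \<delta>(2) mean_nonneg by (simp add: \<delta>max_def less_divide_eq)
    moreover have "\<delta> * (16 * ratio n) \<le> \<delta> * (16 * (\<mu> + 1))"
      using elim(2) \<delta>(1) by (intro mult_left_mono) auto
    moreover have "4 * (\<delta> * x) \<le> gap / 4" if "\<delta> * (16 * x) \<le> gap" for x using that by simp
    ultimately have 1: "4 * (\<delta> * ratio n) \<le> gap / 4" by (meson order_trans)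
    have "8 * real K / gap < real (N n)" using elim(3) by linarith
    then have 2: "2 * real K < gap / 4 * real (N n)" using gap_pos by (simp add: field_simps)
    have "4 * \<delta> * real (card (A n)) = 4 * (\<delta> * ratio n) * real (N n)" using Np by simp
    also have "\<dots> \<le> gap / 4 * real (N n)" using 1 Np by (intro mult_right_mono) auto
    finally have 3: "4 * \<delta> * real (card (A n)) \<le> gap / 4 * real (N n)" .
    have "3 * gap / 4 * real (N n) < (1 - ratio n * small_vertex_mass (\<lambda>_. True)) * real (N n)"
      using elim(1) Np by (intro mult_strict_right_mono)
    also have "\<dots> = real (N n) - real (card (A n)) * small_vertex_mass (\<lambda>_. True)"
      using Np by (simp add: algebra_simps)
    finally have 4: "3 * gap / 4 * real (N n) < real (N n) - real (card (A n)) * small_vertex_mass (\<lambda>_. True)" .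
    have "gap / 4 * real (N n) + gap / 4 * real (N n) \<le> 3 * gap / 4 * real (N n)"
      using gap_pos Np by simp
    then show ?case using 2 3 4 by linarith
  qed
qed

text \<open>The property P is trivial for the number of all left vertices and equality with k for
  those of degree k. Accordingly, L n is the left part or its vertices of degree k.\<close>

lemma giant_left_degree:
  assumes \<epsilon>: "\<epsilon> > 0" and lim: "(\<lambda>n. real (card {w \<in> {1..N n}. P (dl n w)}) / real (N n)) \<longlonglongrightarrow> V"
    and part: "\<And>n f x. f \<in> MM n \<Longrightarrow> x \<in> A n \<Longrightarrow> WW f (ecomp n f x) \<inter> L n = Inl ` {w \<in> fst ` ecomp n f x. P (dl n w)}"
  shows "(\<lambda>n. uprob (MM n) (\<lambda>f. \<bar>real (card (C1 n (bgraph n f) \<inter> L n)) / real (N n)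
    - (V - \<mu> * small_vertex_mass P)\<bar> > \<epsilon>)) \<longlonglongrightarrow> 0"
proof (rule in_prob_of_good[OF super k0 gap_pos(2) _ _ _ \<epsilon>, where P = P and C = "2 * (\<mu> + 1)"
      and b = "\<lambda>n. real (card {w \<in> {1..N n}. P (dl n w)}) / real (N n) - ratio n * small_vertex_mass P"])
  show "0 \<le> 2 * (\<mu> + 1)" using mean_nonneg by simp
  show "(\<lambda>n. real (card {w \<in> {1..N n}. P (dl n w)}) / real (N n) - ratio n * small_vertex_mass P)
    \<longlonglongrightarrow> V - \<mu> * small_vertex_mass P"
    by (intro tendsto_intros lim mean_lim)
  fix \<delta> K assume \<delta>: "0 < \<delta>" "\<delta> < \<delta>max"
  show "\<forall>\<^sub>F n in sequentially. \<forall>f\<in>MM n. good P \<delta> K n f \<longrightarrow>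
    \<bar>real (card (C1 n (bgraph n f) \<inter> L n)) / real (N n)
      - (real (card {w \<in> {1..N n}. P (dl n w)}) / real (N n) - ratio n * small_vertex_mass P)\<bar> \<le> 2 * (\<mu> + 1) * \<delta>"
    using eventually_big_enough[OF \<delta>, of K] eventually_ratio
  proof eventually_elim
    case (elim n)
    show ?case
    proof (intro ballI impI)
      fix f assume f: "f \<in> MM n" and g: "good P \<delta> K n f"
      define h where "h = real (card (A n))"
      have Np: "real (N n) > 0" using N_pos by simp
      obtain z where z: "z \<in> big_set n K f" "real (card (big_set n K f - ecomp n f z)) \<le> \<delta> * real (card (A n))"
        "C1 n (bgraph n f) = WW f (ecomp n f z)"
        by (rule good_largest[OF g f \<delta>(1) elim(1) C1[OF f]]) (rule that)
      have zA: "z \<in> A n" using z by (auto simp: big_set_def)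
      let ?V = "real (card {w \<in> {1..N n}. P (dl n w)})"
      have "card (C1 n (bgraph n f) \<inter> L n) = card {w \<in> fst ` ecomp n f z. P (dl n w)}"
        unfolding z(3) part[OF f zA] by (rule card_image) (auto simp: inj_on_def)
      then have 1: "\<bar>real (card (C1 n (bgraph n f) \<inter> L n)) - (?V - h * small_weight (inv_weight P) n K f)\<bar> \<le> \<delta> * h"
        using card_giant_vertices[OF z(1,2), of P] by (simp add: h_def)
      have "\<bar>h * small_weight (inv_weight P) n K f - h * small_vertex_mass P\<bar> = h * \<bar>small_weight (inv_weight P) n K f - small_vertex_mass P\<bar>"
        by (simp add: h_def abs_mult flip: right_diff_distrib)
      also have "\<dots> \<le> h * \<delta>" using g by (intro mult_left_mono) (auto simp: good_def h_def)
      finally have 2: "\<bar>h * small_weight (inv_weight P) n K f - h * small_vertex_mass P\<bar> \<le> \<delta> * h" by (simp add: mult.commute)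
      have "\<bar>real (card (C1 n (bgraph n f) \<inter> L n)) - (?V - h * small_vertex_mass P)\<bar> \<le> 2 * (\<delta> * h)"
        using 1 2 by linarith
      then have "\<bar>real (card (C1 n (bgraph n f) \<inter> L n)) - (?V - h * small_vertex_mass P)\<bar> / real (N n) \<le> 2 * (\<delta> * h) / real (N n)"
        using Np by (intro divide_right_mono) auto
      also have "2 * (\<delta> * h) / real (N n) = 2 * \<delta> * ratio n" by (simp add: h_def)
      also have "\<dots> \<le> 2 * \<delta> * (\<mu> + 1)" using elim(2) \<delta> by (intro mult_left_mono) auto
      also have "\<bar>real (card (C1 n (bgraph n f) \<inter> L n)) - (?V - h * small_vertex_mass P)\<bar> / real (N n)
        = \<bar>real (card (C1 n (bgraph n f) \<inter> L n)) / real (N n) - (?V / real (N n) - ratio n * small_vertex_mass P)\<bar>"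
        using Np by (subst abs_div_pos) (simp_all add: h_def diff_divide_distrib)
      finally show "\<bar>real (card (C1 n (bgraph n f) \<inter> L n)) / real (N n)
        - (?V / real (N n) - ratio n * small_vertex_mass P)\<bar> \<le> 2 * (\<mu> + 1) * \<delta>" by (simp add: mult_ac)
    qed
  qed
qed

lemma giant_edges:
  assumes \<epsilon>: "\<epsilon> > 0"
  shows "(\<lambda>n. uprob (MM n) (\<lambda>f. \<bar>real (card (component_edges (bgraph n f) (C1 n (bgraph n f)))) / real (N n)
    - \<mu> * (1 - small_mass)\<bar> > \<epsilon>)) \<longlonglongrightarrow> 0"
proof (rule in_prob_of_good[OF super k0 gap_pos(2) _ _ _ \<epsilon>, where P = "\<lambda>_. True" and C = "2 * (\<mu> + 1)"
      and b = "\<lambda>n. ratio n * (1 - small_mass)"])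
  show "0 \<le> 2 * (\<mu> + 1)" using mean_nonneg by simp
  show "(\<lambda>n. ratio n * (1 - small_mass)) \<longlonglongrightarrow> \<mu> * (1 - small_mass)" by (intro tendsto_intros mean_lim)
  fix \<delta> K assume \<delta>: "0 < \<delta>" "\<delta> < \<delta>max"
  show "\<forall>\<^sub>F n in sequentially. \<forall>f\<in>MM n. good (\<lambda>_. True) \<delta> K n f \<longrightarrow>
    \<bar>real (card (component_edges (bgraph n f) (C1 n (bgraph n f)))) / real (N n) - ratio n * (1 - small_mass)\<bar> \<le> 2 * (\<mu> + 1) * \<delta>"
    using eventually_big_enough[OF \<delta>, of K] eventually_ratio
  proof eventually_elim
    case (elim n)
    show ?case
    proof (intro ballI impI)
      fix f assume f: "f \<in> MM n" and g: "good (\<lambda>_. True) \<delta> K n f"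
      define h where "h = real (card (A n))"
      have Np: "real (N n) > 0" using N_pos by simp
      obtain z where z: "z \<in> big_set n K f" "real (card (big_set n K f - ecomp n f z)) \<le> \<delta> * real (card (A n))"
        "C1 n (bgraph n f) = WW f (ecomp n f z)"
        by (rule good_largest[OF g f \<delta>(1) elim(1) C1[OF f]]) (rule that)
      have zA: "z \<in> A n" using z by (auto simp: big_set_def)
      have ce: "component_edges (bgraph n f) (C1 n (bgraph n f)) = ecomp n f z"
        unfolding z(3) by (rule component_edges_bcm_graph[OF dl_pos dr_pos f zA])
      have 1: "\<bar>real (card (ecomp n f z)) - h * (1 - small_weight (\<lambda>_. 1) n K f)\<bar> \<le> \<delta> * h"
        using card_giant_edges[OF z(1,2)] by (simp add: h_def)
      have "\<bar>h * (1 - small_weight (\<lambda>_. 1) n K f) - h * (1 - small_mass)\<bar> = h * \<bar>small_weight (\<lambda>_. 1) n K f - small_mass\<bar>"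
        by (simp add: h_def abs_mult abs_minus_commute flip: right_diff_distrib)
      also have "\<dots> \<le> h * \<delta>" using g by (intro mult_left_mono) (auto simp: good_def h_def)
      finally have 2: "\<bar>h * (1 - small_weight (\<lambda>_. 1) n K f) - h * (1 - small_mass)\<bar> \<le> \<delta> * h" by (simp add: mult.commute)
      have "\<bar>real (card (ecomp n f z)) - h * (1 - small_mass)\<bar> \<le> 2 * (\<delta> * h)" using 1 2 by linarith
      then have "\<bar>real (card (ecomp n f z)) - h * (1 - small_mass)\<bar> / real (N n) \<le> 2 * (\<delta> * h) / real (N n)"
        using Np by (intro divide_right_mono) auto
      also have "2 * (\<delta> * h) / real (N n) = 2 * \<delta> * ratio n" by (simp add: h_def)
      also have "\<dots> \<le> 2 * \<delta> * (\<mu> + 1)" using elim(2) \<delta> by (intro mult_left_mono) auto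
      also have "\<bar>real (card (ecomp n f z)) - h * (1 - small_mass)\<bar> / real (N n)
        = \<bar>real (card (ecomp n f z)) / real (N n) - ratio n * (1 - small_mass)\<bar>"
        using Np by (subst abs_div_pos) (simp_all add: h_def diff_divide_distrib)
      finally show "\<bar>real (card (component_edges (bgraph n f) (C1 n (bgraph n f)))) / real (N n) - ratio n * (1 - small_mass)\<bar> \<le> 2 * (\<mu> + 1) * \<delta>"
        unfolding ce by (simp add: mult_ac)
    qed
  qed
qed

lemma second_component:
  assumes \<epsilon>: "\<epsilon> > 0"
  shows "(\<lambda>n. uprob (MM n) (\<lambda>f. \<bar>real (card (C2 n (bgraph n f))) / real (N n + M n) - 0\<bar> > \<epsilon>)) \<longlonglongrightarrow> 0"
proof (rule in_prob_of_good[OF super k0 gap_pos(2) _ _ _ \<epsilon>, where P = "\<lambda>_. True" and C = "2 * (\<mu> + 2)" and b = "\<lambda>n. 0"])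
  show "0 \<le> 2 * (\<mu> + 2)" using mean_nonneg by simp
  fix \<delta> K assume \<delta>: "0 < \<delta>" "\<delta> < \<delta>max"
  show "\<forall>\<^sub>F n in sequentially. \<forall>f\<in>MM n. good (\<lambda>_. True) \<delta> K n f \<longrightarrow>
    \<bar>real (card (C2 n (bgraph n f))) / real (N n + M n) - 0\<bar> \<le> 2 * (\<mu> + 2) * \<delta>"
    using eventually_big_enough[OF \<delta>, of K] eventually_ratio eventually_N[of "real K / \<delta>"]
  proof eventually_elim
    case (elim n)
    show ?case
    proof (intro ballI impI)
      fix f assume f: "f \<in> MM n" and g: "good (\<lambda>_. True) \<delta> K n f"
      have Np: "real (N n) > 0" using N_pos by simp
      obtain z where "\<And>C2. second_largest_component (bgraph n f) (C1 n (bgraph n f)) C2 \<Longrightarrow>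
          real (card C2) \<le> 2 * real K + 2 * \<delta> * real (card (A n))"
        by (rule good_largest[OF g f \<delta>(1) elim(1) C1[OF f]]) (rule that)
      from this[OF C2[OF f]] have 1: "real (card (C2 n (bgraph n f))) \<le> 2 * real K + 2 * \<delta> * real (card (A n))" .
      have 2: "real K \<le> \<delta> * real (N n)" using elim(3) \<delta>(1) by (simp add: divide_le_eq mult.commute)
      have "real (card (A n)) \<le> (\<mu> + 1) * real (N n)" using elim(2) Np by (simp add: divide_le_eq)
      then have "2 * \<delta> * real (card (A n)) \<le> 2 * \<delta> * ((\<mu> + 1) * real (N n))" using \<delta>(1) by (intro mult_left_mono) auto
      then have "real (card (C2 n (bgraph n f))) \<le> 2 * (\<delta> * real (N n)) + 2 * \<delta> * ((\<mu> + 1) * real (N n))" using 1 2 by linarith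
      also have "\<dots> = 2 * (\<mu> + 2) * \<delta> * real (N n)" by (simp add: algebra_simps)
      also have "\<dots> \<le> 2 * (\<mu> + 2) * \<delta> * real (N n + M n)" using \<delta>(1) mean_nonneg by (intro mult_left_mono) auto
      finally show "\<bar>real (card (C2 n (bgraph n f))) / real (N n + M n) - 0\<bar> \<le> 2 * (\<mu> + 2) * \<delta>"
        using Np by (simp add: divide_le_eq)
    qed
  qed
qed simp

end

text \<open>If \<rho> = 1, only a proportion \<delta> of the half-edges lies outside small
  components, so no component has more than \<open>K + \<delta> * h\<close> edges.\<close>

lemma no_giant:
  assumes one: "\<rho> = 1" and \<epsilon>: "\<epsilon> > 0"
    and C1: "\<And>n f. f \<in> MM n \<Longrightarrow> largest_component (bgraph n f) (C1 n (bgraph n f))"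
  shows "(\<lambda>n. uprob (MM n) (\<lambda>f. \<bar>real (card (C1 n (bgraph n f))) / real (N n + M n) - 0\<bar> > \<epsilon>)) \<longlonglongrightarrow> 0"
proof (rule LIMSEQ_I)
  fix e :: real assume e: "e > 0"
  have reg: regular using one by (simp add: regular_def)
  define \<delta> where "\<delta> = min (e / 2) (\<epsilon> / (2 * (\<mu> + 2)))"
  have d: "\<delta> > 0" using e \<epsilon> mean_nonneg by (simp add: \<delta>_def)
  have "\<delta> \<le> e / 2" unfolding \<delta>_def by (rule min.cobounded1)
  then have d1: "\<delta> < e" using e by (auto intro: le_less_trans)
  have "\<delta> \<le> \<epsilon> / (2 * (\<mu> + 2))" unfolding \<delta>_def by (rule min.cobounded2)
  then have d2: "2 * (\<mu> + 2) * \<delta> \<le> \<epsilon>" using mean_nonneg by (simp add: le_divide_eq mult.commute)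
  have s1: "(\<Sum>k. u k * (1 * \<rho> ^ k)) = 1" using is_law_suminf[OF laws(1)] by (simp add: one)
  obtain K where K: "\<forall>\<^sub>F n in sequentially.
    uprob (MM n) (\<lambda>f. \<bar>small_weight (\<lambda>_. 1) n K f - 1\<bar> \<ge> \<delta>) \<le> \<delta>"
    using small_weight_tendsto[OF reg d, of "\<lambda>_. 1"] unfolding s1 by auto
  have "\<forall>\<^sub>F n in sequentially. norm (uprob (MM n) (\<lambda>f. \<bar>real (card (C1 n (bgraph n f))) / real (N n + M n) - 0\<bar> > \<epsilon>) - 0) < e"
    using K eventually_ratio eventually_N[of "real K / \<delta>"]
  proof eventually_elim
    case (elim n)
    have Np: "real (N n) > 0" using N_pos by simp
    have "uprob (MM n) (\<lambda>f. \<bar>real (card (C1 n (bgraph n f))) / real (N n + M n) - 0\<bar> > \<epsilon>)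
      \<le> uprob (MM n) (\<lambda>f. \<bar>small_weight (\<lambda>_. 1) n K f - 1\<bar> \<ge> \<delta>)"
    proof (rule uprob_mono[OF finM], rule ccontr)
      fix f assume f: "f \<in> MM n" and gt: "\<bar>real (card (C1 n (bgraph n f))) / real (N n + M n) - 0\<bar> > \<epsilon>"
        and "\<not> \<bar>small_weight (\<lambda>_. 1) n K f - 1\<bar> \<ge> \<delta>"
      then have "real (card (big_set n K f)) / real (card (A n)) < \<delta>"
        by (simp add: small_weight_one[OF A_nonempty] abs_less_iff)
      then have W: "real (card (big_set n K f)) < \<delta> * real (card (A n))"
        using card_A_pos[of n] by (simp add: divide_less_eq)
      obtain x where x: "x \<in> A n" "C1 n (bgraph n f) = WW f (ecomp n f x)"
        using C1[OF f] unfolding largest_component_def by (auto simp: components_graph[OF f])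
      have "real (card (ecomp n f x)) \<le> real K + \<delta> * real (card (A n))"
      proof (cases "small n K f x")
        case True
        then have "real (card (ecomp n f x)) \<le> real K" by (simp add: small_def)
        then show ?thesis using d by (simp add: add_increasing2)
      next
        case False
        then have "ecomp n f x \<subseteq> big_set n K f" using x(1) by (intro ecomp_big) (simp add: big_set_def)
        then have "card (ecomp n f x) \<le> card (big_set n K f)"
          using finA[of n] by (intro card_mono) (auto simp: big_set_def)
        then show ?thesis using W by linarith
      qed
      then have 1: "real (card (C1 n (bgraph n f))) \<le> 2 * real K + 2 * \<delta> * real (card (A n))"
        using card_vertices_le[OF dl_pos dr_pos f x(1)] unfolding x(2) by linarith
      have 2: "real K \<le> \<delta> * real (N n)" using elim(3) d by (simp add: divide_le_eq mult.commute)
      have "real (card (A n)) \<le> (\<mu> + 1) * real (N n)" using elim(2) Np by (simp add: divide_le_eq)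
      then have "2 * \<delta> * real (card (A n)) \<le> 2 * \<delta> * ((\<mu> + 1) * real (N n))" using d by (intro mult_left_mono) auto
      then have "real (card (C1 n (bgraph n f))) \<le> 2 * (\<delta> * real (N n)) + 2 * \<delta> * ((\<mu> + 1) * real (N n))" using 1 2 by linarith
      also have "\<dots> = 2 * (\<mu> + 2) * \<delta> * real (N n)" by (simp add: algebra_simps)
      also have "\<dots> \<le> \<epsilon> * real (N n + M n)" using d2 \<epsilon> by (intro mult_mono) auto
      finally have "real (card (C1 n (bgraph n f))) / real (N n + M n) \<le> \<epsilon>" using Np by (simp add: divide_le_eq)
      then show False using gt by simp
    qed
    then have "uprob (MM n) (\<lambda>f. \<bar>real (card (C1 n (bgraph n f))) / real (N n + M n) - 0\<bar> > \<epsilon>) < e"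
      using elim(1) d1 by linarith
    then show ?case by simp
  qed
  then show "\<exists>no. \<forall>n\<ge>no. norm (uprob (MM n) (\<lambda>f. \<bar>real (card (C1 n (bgraph n f))) / real (N n + M n) - 0\<bar> > \<epsilon>) - 0) < e"
    by (simp add: eventually_sequentially)
qed

end

section \<open>The bipartite configuration model\<close>

lemma real_law_borel: "finite_borel_measure (real_law X)"
  unfolding real_law_def finite_borel_measure_def finite_borel_measure_axioms_def
  by (auto intro!: measure_pmf.finite_measure_distr)

lemma cdf_real_law: "cdf (real_law X) x = measure_pmf.prob X {j. real j \<le> x}"
  by (simp add: cdf_def real_law_def measure_distr vimage_def)

text \<open>The distribution function of a law on the natural numbers is continuous at k - 1 / 2 and
  k + 1 / 2, and the weight of k is the difference of its values there.\<close>

lemma weak_conv_pmf: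
  assumes "weak_conv_m (\<lambda>n. real_law (X n)) (real_law Y)"
  shows "(\<lambda>n. pmf (X n) k) \<longlonglongrightarrow> pmf Y k"
proof -
  have pmf_cdf: "pmf Z k = cdf (real_law Z) (real k + 1 / 2) - cdf (real_law Z) (real k - 1 / 2)" for Z
  proof -
    have "{k} = {j. real j \<le> real k + 1 / 2} - {j. real j \<le> real k - 1 / 2}"
      by (auto simp: field_simps)
    then have "pmf Z k = measure_pmf.prob Z ({j. real j \<le> real k + 1 / 2} - {j. real j \<le> real k - 1 / 2})"
      by (metis pmf.rep_eq)
    also have "\<dots> = measure_pmf.prob Z {j. real j \<le> real k + 1 / 2} - measure_pmf.prob Z {j. real j \<le> real k - 1 / 2}"
      by (rule measure_pmf.finite_measure_Diff) auto
    finally show ?thesis by (simp add: cdf_real_law)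
  qed
  have conv: "(\<lambda>n. cdf (real_law (X n)) x) \<longlonglongrightarrow> cdf (real_law Y) x" if x: "\<And>j. real j \<noteq> x" for x
  proof -
    have "measure (real_law Y) {x} = measure_pmf.prob Y (real -` {x})"
      by (simp add: real_law_def measure_distr)
    also have "real -` {x} = {}" using x by auto
    finally have "isCont (cdf (real_law Y)) x"
      by (simp add: finite_borel_measure.isCont_cdf[OF real_law_borel])
    then show ?thesis using assms by (simp add: weak_conv_m_def weak_conv_def)
  qed
  have "real j \<noteq> real k + 1 / 2" "real j \<noteq> real k - 1 / 2" for j
  proof -
    have "real (j * 2) \<noteq> real (1 + k * 2)" "real (1 + j * 2) \<noteq> real (k * 2)"
      unfolding of_nat_eq_iff by presburger+
    then show "real j \<noteq> real k + 1 / 2" "real j \<noteq> real k - 1 / 2" by (simp_all add: field_simps)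
  qed
  then show ?thesis unfolding pmf_cdf by (intro tendsto_diff conv) auto
qed

lemma pmf_degree_law: "N > 0 \<Longrightarrow> pmf (degree_law N d) k = real (card {w \<in> {1..N}. d w = k}) / real N"
  by (simp add: degree_law_def pmf_map measure_pmf_of_set vimage_def Int_def)

lemma pmf_mean_degree_law: "N > 0 \<Longrightarrow> pmf_mean (degree_law N d) = real (card (half_edges N d)) / real N"
  by (simp add: degree_law_def half_edges_def integral_pmf_of_set)

text \<open>A vertex of degree k is met by k half-edges, which is the origin of the
  size-biasing.\<close>

lemma uprob_degree:
  assumes "N > 0" "\<And>w. w \<in> {1..N} \<Longrightarrow> d w > 0"
  shows "uprob (half_edges N d) (\<lambda>x. card (fib (half_edges N d) fst x) = k)
    = real k * pmf (degree_law N d) k / pmf_mean (degree_law N d)"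
proof -
  have "{x \<in> half_edges N d. card (fib (half_edges N d) fst x) = k} = {x \<in> half_edges N d. d (fst x) = k}"
    using card_fib_half_edges[of _ N d] by auto
  then have "uprob (half_edges N d) (\<lambda>x. card (fib (half_edges N d) fst x) = k)
      = real (k * card {w \<in> {1..N}. d w = k}) / real (card (half_edges N d))"
    by (simp only: uprob_def card_half_edges_degree)
  then show ?thesis using assms(1) by (simp add: pmf_degree_law pmf_mean_degree_law)
qed

lemma size_biased_degree_lim:
  assumes N: "\<And>n. N n > 0" and d: "\<And>n w. w \<in> {1..N n} \<Longrightarrow> d n w > 0"
    and conv: "weak_conv_m (\<lambda>n. real_law (degree_law (N n) (d n))) (real_law p)"
    and mean: "(\<lambda>n. pmf_mean (degree_law (N n) (d n))) \<longlonglongrightarrow> pmf_mean p"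
    and p: "set_pmf p \<subseteq> {1..}" "integrable (measure_pmf p) real"
  shows "(\<lambda>n. uprob (half_edges (N n) (d n)) (\<lambda>x. card (fib (half_edges (N n) (d n)) fst x) = k)) \<longlonglongrightarrow> sb p k"
proof -
  have "pmf_mean p \<noteq> 0" using pmf_mean_pos[OF p] by linarith
  then have "(\<lambda>n. real k * pmf (degree_law (N n) (d n)) k / pmf_mean (degree_law (N n) (d n))) \<longlonglongrightarrow> sb p k"
    unfolding sb_def by (intro tendsto_intros weak_conv_pmf conv mean)
  then show ?thesis using uprob_degree[OF N d] by simp
qed

lemma card_half_edges_ge:
  assumes "\<And>w. w \<in> {1..N} \<Longrightarrow> d w > 0"
  shows "N \<le> card (half_edges N d)"
proof -
  have "(\<Sum>w\<in>{1..N}. 1) \<le> (\<Sum>w\<in>{1..N}. d w)" using assms by (intro sum_mono) (simp add: Suc_le_eq)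
  then show ?thesis by (simp add: half_edges_def)
qed

lemma prob_BCM:
  assumes "(\<Sum>v\<in>{1..N}. dl v) = (\<Sum>a\<in>{1..M}. dr a)"
  shows "measure_pmf.prob (BCM N M dl dr) {G. P G}
    = uprob (matchings (half_edges N dl) (half_edges M dr)) (\<lambda>f. P (bcm_graph N M dl f))"
  using matchings_nonempty[OF assms] finite_matchings[of N dl M dr]
  by (simp add: BCM_def measure_pmf_of_set uprob_def Int_def)

lemma set_BCM:
  assumes "(\<Sum>v\<in>{1..N}. dl v) = (\<Sum>a\<in>{1..M}. dr a)" "f \<in> matchings (half_edges N dl) (half_edges M dr)"
  shows "bcm_graph N M dl f \<in> set_pmf (BCM N M dl dr)"
  using matchings_nonempty[OF assms(1)] finite_matchings[of N dl M dr] assms(2) by (simp add: BCM_def)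


theorem theorem2p11:
  fixes N M :: "nat \<Rightarrow> nat"
    and dl dr :: "nat \<Rightarrow> nat \<Rightarrow> nat"
    and p q :: "nat pmf"
    and C1 C2 :: "nat \<Rightarrow> bip_multigraph \<Rightarrow> (nat + nat) set"
  defines "B \<equiv> \<lambda>n. BCM (N n) (M n) (dl n) (dr n)"
  assumes N_pos: "\<And>n. N n > 0" and M_pos: "\<And>n. M n > 0"
    and N_lim: "filterlim N at_top sequentially" and M_lim: "filterlim M at_top sequentially"
    and dl_pos: "\<And>n v. v \<in> {1..N n} \<Longrightarrow> dl n v > 0"
    and dr_pos: "\<And>n a. a \<in> {1..M n} \<Longrightarrow> dr n a > 0"
    and deg_sum: "\<And>n. (\<Sum>v\<in>{1..N n}. dl n v) = (\<Sum>a\<in>{1..M n}. dr n a)"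
    and p_supp: "set_pmf p \<subseteq> {1..}" and q_supp: "set_pmf q \<subseteq> {1..}"
    and A: "weak_conv_m (\<lambda>n. real_law (degree_law (N n) (dl n))) (real_law p)"
    and B1: "integrable (measure_pmf p) real"
    and B2: "(\<lambda>n. pmf_mean (degree_law (N n) (dl n))) \<longlonglongrightarrow> pmf_mean p"
    and C: "weak_conv_m (\<lambda>n. real_law (degree_law (M n) (dr n))) (real_law q)"
    and D1: "integrable (measure_pmf q) real"
    and D2: "(\<lambda>n. pmf_mean (degree_law (M n) (dr n))) \<longlonglongrightarrow> pmf_mean q"
    and p2q2: "pmf p 2 + pmf q 2 < 2"
    and C1: "\<And>n G. G \<in> set_pmf (B n) \<Longrightarrow> largest_component G (C1 n G)"
    and C2: "\<And>n G. G \<in> set_pmf (B n) \<Longrightarrow> second_largest_component G (C1 n G) (C2 n G)"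
  shows
    "(ennreal_mean (size_biased_minus_one p) * ennreal_mean (size_biased_minus_one q) > 1 \<longrightarrow>
       xi_left p q > 0 \<and> eta_left p q < 1 \<and> eta_right p q < 1 \<and>
       tendsto_in_prob B (\<lambda>n G. real (card (C1 n G \<inter> left_part (N n))) / real (N n))
         (xi_left p q) \<and>
       (\<forall>k\<ge>1. tendsto_in_prob B
         (\<lambda>n G. real (card (C1 n G \<inter> left_part_deg (N n) (dl n) k)) / real (N n))
         (pmf p k * (1 - eta_left p q ^ k))) \<and>
       tendsto_in_prob B (\<lambda>n G. real (card (component_edges G (C1 n G))) / real (N n))
         (pmf_mean p * (1 - eta_left p q * eta_right p q)) \<and>
       tendsto_in_prob B (\<lambda>n G. real (card (C2 n G)) / real (N n + M n)) 0) \<and>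
     (ennreal_mean (size_biased_minus_one p) * ennreal_mean (size_biased_minus_one q) \<le> 1 \<longrightarrow>
       tendsto_in_prob B (\<lambda>n G. real (card (C1 n G)) / real (N n + M n)) 0)"
proof -
  note supp = p_supp q_supp and int = B1 D1
  have mean1: "pmf_mean p \<ge> 1" by (rule pmf_mean_pos[OF p_supp B1])
  have mean_eq: "pmf_mean (degree_law (N n) (dl n)) = real (card (half_edges (N n) (dl n))) / real (N n)" for n
    by (rule pmf_mean_degree_law[OF N_pos])
  interpret bcm_model N M dl dr "sb p" "sb q" "pmf_mean p"
  proof unfold_locales
    show "finite (half_edges (N n) (dl n))" "finite (half_edges (M n) (dr n))" for n
      by (auto simp: half_edges_def)
    show "card (half_edges (N n) (dl n)) = card (half_edges (M n) (dr n))" for n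
      using deg_sum[of n] by (simp add: half_edges_def)
    show "filterlim (\<lambda>n. card (half_edges (N n) (dl n))) at_top sequentially"
      by (rule filterlim_at_top_mono[OF N_lim]) (intro always_eventually allI card_half_edges_ge dl_pos)
    show "is_law (sb p)" "is_law (sb q)" by (rule is_law_sb[OF p_supp B1], rule is_law_sb[OF q_supp D1])
    show "(\<lambda>n. uprob (half_edges (N n) (dl n)) (\<lambda>x. card (fib (half_edges (N n) (dl n)) fst x) = k)) \<longlonglongrightarrow> sb p k" for k
      by (rule size_biased_degree_lim[OF N_pos dl_pos A B2 p_supp B1])
    show "(\<lambda>n. uprob (half_edges (M n) (dr n)) (\<lambda>x. card (fib (half_edges (M n) (dr n)) fst x) = k)) \<longlonglongrightarrow> sb q k" for k
      by (rule size_biased_degree_lim[OF M_pos dr_pos C D2 q_supp D1])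
    show "(\<lambda>n. real (card (half_edges (N n) (dl n))) / real (N n)) \<longlonglongrightarrow> pmf_mean p"
      using B2 by (simp add: mean_eq)
  qed (use N_pos N_lim dl_pos dr_pos in auto)

  have prob_B: "measure_pmf.prob (B n) {G. P G} = uprob (matchings (half_edges (N n) (dl n)) (half_edges (M n) (dr n)))
      (\<lambda>f. P (bcm_graph (N n) (M n) (dl n) f))" for n P
    unfolding B_def by (rule prob_BCM[OF deg_sum])
  have C1f: "largest_component (bcm_graph (N n) (M n) (dl n) f) (C1 n (bcm_graph (N n) (M n) (dl n) f))"
    and C2f: "second_largest_component (bcm_graph (N n) (M n) (dl n) f) (C1 n (bcm_graph (N n) (M n) (dl n) f))
      (C2 n (bcm_graph (N n) (M n) (dl n) f))"
    if "f \<in> matchings (half_edges (N n) (dl n)) (half_edges (M n) (dr n))" for n f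
    using set_BCM[OF deg_sum that] by (auto intro: C1 C2 simp: B_def)
  note laws = is_law_sb[OF p_supp B1] is_law_sb[OF q_supp D1]
  note bounds = ext_prob_bounds[OF laws]
  have eta: "eta_left p q = ext_prob (sb p) (sb q)" "eta_right p q = gen (sb p) (ext_prob (sb p) (sb q))"
    by (rule eta_left_eq[OF p_supp B1 q_supp D1], rule eta_right_eq[OF p_supp B1 q_supp D1])
  have excess_eq: "ennreal_mean (size_biased_minus_one p) = excess (sb p)" "ennreal_mean (size_biased_minus_one q) = excess (sb q)"
    by (rule ennreal_mean_size_biased_minus_one[OF p_supp B1], rule ennreal_mean_size_biased_minus_one[OF q_supp D1])
  \<comment> \<open>The factor k of the size-biased law cancels the weight 1 / k, which turns sums
    over half-edges into sums over vertices.\<close>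
  have weight: "pmf_mean p * (sb p k * (inv_weight P k * x ^ k)) = (if P k then pmf p k * x ^ k else 0)" for P k x
    using mean1 pmf_0[OF p_supp B1] by (auto simp: sb_def inv_weight_def)

  show ?thesis unfolding excess_eq
  proof (intro conjI impI)
    assume gt: "1 < excess (sb p) * excess (sb q)"
    have lt1: "ext_prob (sb p) (sb q) < 1" by (rule ext_prob_supercritical(1)[OF laws gt])
    have super: supercritical
      unfolding supercritical_def using ext_prob_supercritical(2)[OF laws gt] by blast
    \<comment> \<open>A law concentrated on degrees 0 and 1 would have excess 0.\<close>
    obtain k0 where k0: "k0 \<ge> 2" "sb p k0 > 0"
    proof (rule ccontr)
      assume none: "\<not> thesis"
      have "sb p k * real (k - 1) = 0" for k
      proof (cases "k \<ge> 2")
        case True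
        then show ?thesis using none that is_law_nonneg[OF laws(1), of k] by (metis less_eq_real_def mult_zero_left)
      qed (simp add: not_le)
      then have "excess (sb p) = 0" unfolding excess_def by (simp only: ennreal_0 suminf_zero)
      then show False using gt by simp
    qed
    have mass_of_sums: "pmf_mean p * small_vertex_mass P = s"
      if "(\<lambda>k. if P k then pmf p k * ext_prob (sb p) (sb q) ^ k else 0) sums s" for P s
    proof -
      have m: "pmf_mean p \<noteq> 0" using mean1 by linarith
      from that have "(\<lambda>k. pmf_mean p * (sb p k * (inv_weight P k * ext_prob (sb p) (sb q) ^ k))) sums (pmf_mean p * (s / pmf_mean p))"
        unfolding weight using m by simp
      then show ?thesis using m unfolding small_vertex_mass_def by (auto simp: sums_mult_iff sums_iff suminf_mult)
    qed
    have mass_all: "pmf_mean p * small_vertex_mass (\<lambda>_. True) = pgf p (ext_prob (sb p) (sb q))"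
      by (rule mass_of_sums) (use pgf_sums[OF p_supp B1 bounds] in simp)
    have mass_k: "pmf_mean p * small_vertex_mass (\<lambda>j. j = k) = pmf p k * ext_prob (sb p) (sb q) ^ k" for k
      by (rule mass_of_sums) (rule sums_single)
    have pgf1: "pgf p (ext_prob (sb p) (sb q)) < 1" by (rule pgf_less_1[OF p_supp B1 bounds(1) lt1])
    have mass: "pmf_mean p * small_vertex_mass (\<lambda>_. True) < 1" using pgf1 by (simp add: mass_all)
    note giant = super k0 mass C1f C2f
    show "0 < xi_left p q" using pgf1 by (simp add: xi_left_def eta(1))
    show "eta_left p q < 1" using lt1 by (simp add: eta(1))
    show "eta_right p q < 1"
    proof -
      have "gen (sb p) (ext_prob (sb p) (sb q)) \<noteq> 1"
        using ext_prob_fix[OF laws] gen_1[OF laws(2)] lt1 by auto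
      then show ?thesis using gen_le_1[OF laws(1) bounds] by (simp add: eta(2))
    qed
    show "tendsto_in_prob B (\<lambda>n G. real (card (C1 n G \<inter> left_part (N n))) / real (N n)) (xi_left p q)"
      unfolding tendsto_in_prob_def prob_B
    proof (intro allI impI)
      fix \<epsilon> :: real assume "\<epsilon> > 0"
      have xi: "xi_left p q = 1 - pmf_mean p * small_vertex_mass (\<lambda>_. True)" by (simp add: mass_all xi_left_def eta(1))
      have eq: "{w \<in> X. True} = X" for X :: "nat set" by simp
      show "(\<lambda>n. uprob (MM n) (\<lambda>f. \<epsilon> < \<bar>real (card (C1 n (bgraph n f) \<inter> left_part (N n))) / real (N n) - xi_left p q\<bar>)) \<longlonglongrightarrow> 0"
        unfolding xi
      proof (rule giant_left_degree[OF giant \<open>\<epsilon> > 0\<close>], unfold eq)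
        show "(\<lambda>n. real (card {1..N n}) / real (N n)) \<longlonglongrightarrow> 1"
          by (simp add: neq0_conv[THEN iffD2, OF N_pos])
        show "WW f (ecomp n f x) \<inter> left_part (N n) = Inl ` fst ` ecomp n f x"
          if "f \<in> MM n" "x \<in> A n" for n f x
          by (rule left_part_vertices(1)[OF dl_pos dr_pos that])
      qed
    qed
    show "\<forall>k\<ge>1. tendsto_in_prob B (\<lambda>n G. real (card (C1 n G \<inter> left_part_deg (N n) (dl n) k)) / real (N n))
         (pmf p k * (1 - eta_left p q ^ k))"
      unfolding tendsto_in_prob_def prob_B
    proof (intro allI impI)
      fix k :: nat and \<epsilon> :: real assume "k \<ge> 1" "\<epsilon> > 0"
      have eq: "pmf p k * (1 - eta_left p q ^ k) = pmf p k - pmf_mean p * small_vertex_mass (\<lambda>j. j = k)"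
        by (simp add: mass_k eta(1) right_diff_distrib)
      show "(\<lambda>n. uprob (MM n) (\<lambda>f. \<epsilon> < \<bar>real (card (C1 n (bgraph n f) \<inter> left_part_deg (N n) (dl n) k)) / real (N n)
          - pmf p k * (1 - eta_left p q ^ k)\<bar>)) \<longlonglongrightarrow> 0"
        unfolding eq
      proof (rule giant_left_degree[OF giant \<open>\<epsilon> > 0\<close>])
        show "(\<lambda>n. real (card {w \<in> {1..N n}. dl n w = k}) / real (N n)) \<longlonglongrightarrow> pmf p k"
          using weak_conv_pmf[OF A, of k] by (simp add: pmf_degree_law[OF N_pos])
        show "WW f (ecomp n f x) \<inter> left_part_deg (N n) (dl n) k = Inl ` {w \<in> fst ` ecomp n f x. dl n w = k}"
          if "f \<in> MM n" "x \<in> A n" for n f x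
          by (rule left_part_vertices(2)[OF dl_pos dr_pos that])
      qed
    qed
    show "tendsto_in_prob B (\<lambda>n G. real (card (component_edges G (C1 n G))) / real (N n))
         (pmf_mean p * (1 - eta_left p q * eta_right p q))"
      unfolding tendsto_in_prob_def prob_B eta using giant_edges[OF giant] by (simp only: small_mass_eq) simp
    show "tendsto_in_prob B (\<lambda>n G. real (card (C2 n G)) / real (N n + M n)) 0"
      unfolding tendsto_in_prob_def prob_B using second_component[OF giant] by blast
  next
    assume le: "excess (sb p) * excess (sb q) \<le> 1"
    have "\<not> (sb p 2 = 1 \<and> sb q 2 = 1)"
      using sb_2_eq_1[OF p_supp B1] sb_2_eq_1[OF q_supp D1] p2q2 by auto
    then have one: "ext_prob (sb p) (sb q) = 1" by (rule ext_prob_subcritical[OF laws le])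
    show "tendsto_in_prob B (\<lambda>n G. real (card (C1 n G)) / real (N n + M n)) 0"
      unfolding tendsto_in_prob_def prob_B using no_giant[OF one _ C1f] by blast
  qed
qed

end
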